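(* Let $r\ge 0$ and let $S\subseteq\{0,1,\ldots,r\}$ be a subset containing $r$. The category of filtered differential graded algebras admits a model category structure whose weak equivalences are those morphisms that are $r$-quasi-isomorphisms after applying the forgetful functor $U$ to $f\mathcal{C}$, and whose fibrations are those morphisms that, after applying $U$, are surjective on $s$-cycles $Z_s^{p,p+n}$ for all $p,n\in\mathbb{Z}$ and all $s\in S$. The generating cofibrations and generating acyclic cofibrations are given by $TI_S$ and $TJ_S$ respectively, where $T$ is the free algebra functor from $f\mathcal{C}$ to filtered differential graded algebras.
   Context: Fix a commutative unital ring $R$. $f\mathcal{C}$ is the category of filtered chain complexes: an object is an unbounded, cohomologically graded chain complex $A$ of $R$-modules (differential $d$ of degree $+1$) with subcomplexes $F_pA$, $p\in\mathbb{Z}$, such that $F_pA\subseteq F_{p+1}A\subseteq A$; a morphism is a chain map $f$ with $f(F_pA)\subseteq F_pB$ for all $p$. For $k\ge 0$ put $Z_k^{p,p+n}(A)=F_pA^n\cap d^{-1}F_{p-k}A^{n+1}$ (the $k$-cycles), $B_0^{p,p+n}(A)=F_{p-1}A^n$, and for $k\ge1$, $B_k^{p,p+n}(A)=d\,Z_{k-1}^{p+k-1,p+k-1+n-1}(A)+Z_{k-1}^{p-1,p-1+n}(A)$. The $k$-page is $E_k^{p,p+n}(A)=Z_k^{p,p+n}(A)/B_k^{p,p+n}(A)$. An $r$-quasi-isomorphism is a morphism inducing an isomorphism on $E_{r+1}$. $R_{(p)}^n$ is the filtered chain complex with a copy of $R$ in degree $n$ and $0$ elsewhere, with $F_q=0$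 for $q<p$ and $F_q=R$ for $q\ge p$. Set $\mathcal{Z}_k(p,n)=\bigl(R_{(p)}^n\xrightarrow{1}R_{(p-k)}^{n+1}\bigr)$, and for $k\ge 1$, $\mathcal{B}_k(p,n)=\mathcal{Z}_{k-1}(p+k-1,n-1)\oplus\mathcal{Z}_{k-1}(p-1,n)$, with $\varphi_k\colon\mathcal{Z}_k(p,n)\to\mathcal{B}_k(p,n)$ the diagonal $R_{(p)}^n\to R_{(p)}^n\oplus R_{(p-1)}^n$ in degree $n$ and the identity in degree $n+1$. Let $I_r=\{\varphi_{r+1}\colon\mathcal{Z}_{r+1}(p,n)\to\mathcal{B}_{r+1}(p,n)\}_{p,n\in\mathbb{Z}}$, $J_k=\{0\to\mathcal{Z}_k(p,n)\}_{p,n\in\mathbb{Z}}$, $I_S=I_r\cup\bigcup_{s\in S}J_s$, $J_S=\bigcup_{s\in S}J_s$. $f\mathcal{C}$ is symmetric monoidal: $A\otimes B$ is the usual tensor product of chain complexes (Koszul signs) with $F_p(A\otimes B)=\sum_i\operatorname{im}(F_iA\otimes F_{p-i}B\to A\otimes B)$, and unit $R_{(0)}^0$. A filtered differential graded algebra is a (not necessarily commutative) monoid in this monoidal category; morphisms are monoid morphisms. $TI_S=\{T(i): i\in I_S\}$ and similarly for $TJ_S$. *)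

theory Defs
  imports "HOL-Algebra.Module" "HOL-Algebra.AbelCoset" "HOL-Library.Equipollence"
begin

section \<open>Categories\<close>

record ('o, 'm) category =
  objs :: "'o set"
  arrs :: "'m set"
  src :: "'m \<Rightarrow> 'o"
  tgt :: "'m \<Rightarrow> 'o"
  ident :: "'o \<Rightarrow> 'm"
  cmp :: "'m \<Rightarrow> 'm \<Rightarrow> 'm"

definition hom_set :: "('o, 'm) category \<Rightarrow> 'o \<Rightarrow> 'o \<Rightarrow> 'm set" where
  "hom_set C X Y = {f \<in> arrs C. src C f = X \<and> tgt C f = Y}"

definition is_category :: "('o, 'm) category \<Rightarrow> bool" where
  "is_category C \<longleftrightarrow>
     (\<forall>f\<in>arrs C. src C f \<in> objs C \<and> tgt C f \<in> objs C) \<and>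
     (\<forall>X\<in>objs C. ident C X \<in> hom_set C X X) \<and>
     (\<forall>f\<in>arrs C. \<forall>g\<in>arrs C. src C g = tgt C f \<longrightarrow>
        cmp C g f \<in> hom_set C (src C f) (tgt C g)) \<and>
     (\<forall>f\<in>arrs C. cmp C f (ident C (src C f)) = f \<and> cmp C (ident C (tgt C f)) f = f) \<and>
     (\<forall>f\<in>arrs C. \<forall>g\<in>arrs C. \<forall>h\<in>arrs C. src C g = tgt C f \<longrightarrow> src C h = tgt C g \<longrightarrow>
        cmp C h (cmp C g f) = cmp C (cmp C h g) f)"

definition is_functor ::
  "('o, 'm) category \<Rightarrow> ('p, 'n) category \<Rightarrow> ('o \<Rightarrow> 'p) \<Rightarrow> ('m \<Rightarrow> 'n) \<Rightarrow> bool" where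
  "is_functor C D Fo Fm \<longleftrightarrow>
     (\<forall>X\<in>objs C. Fo X \<in> objs D) \<and>
     (\<forall>f\<in>arrs C. Fm f \<in> hom_set D (Fo (src C f)) (Fo (tgt C f))) \<and>
     (\<forall>X\<in>objs C. Fm (ident C X) = ident D (Fo X)) \<and>
     (\<forall>f\<in>arrs C. \<forall>g\<in>arrs C. src C g = tgt C f \<longrightarrow>
        Fm (cmp C g f) = cmp D (Fm g) (Fm f))"

definition left_adjoint ::
  "('o, 'm) category \<Rightarrow> ('p, 'n) category \<Rightarrow> ('o \<Rightarrow> 'p) \<Rightarrow> ('m \<Rightarrow> 'n) \<Rightarrow>
   ('p \<Rightarrow> 'o) \<Rightarrow> ('n \<Rightarrow> 'm) \<Rightarrow> bool" where
  "left_adjoint C D Fo Fm Go Gm \<longleftrightarrow>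
     is_functor C D Fo Fm \<and> is_functor D C Go Gm \<and>
     (\<exists>\<eta>. (\<forall>X\<in>objs C. \<eta> X \<in> hom_set C X (Go (Fo X))) \<and>
          (\<forall>f\<in>arrs C. cmp C (\<eta> (tgt C f)) f = cmp C (Gm (Fm f)) (\<eta> (src C f))) \<and>
          (\<forall>X\<in>objs C. \<forall>Y\<in>objs D. \<forall>f\<in>hom_set C X (Go Y).
             \<exists>!g. g \<in> hom_set D (Fo X) Y \<and> cmp C (Gm g) (\<eta> X) = f))"

subsection \<open>Limits and colimits\<close>

definition is_cone ::
  "('j, 'k) category \<Rightarrow> ('o, 'm) category \<Rightarrow> ('j \<Rightarrow> 'o) \<Rightarrow> ('k \<Rightarrow> 'm) \<Rightarrow> 'o \<Rightarrow> ('j \<Rightarrow> 'm) \<Rightarrow> bool"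
  where
  "is_cone J C Fo Fm X \<pi> \<longleftrightarrow> X \<in> objs C \<and> (\<forall>j\<in>objs J. \<pi> j \<in> hom_set C X (Fo j)) \<and>
     (\<forall>u\<in>arrs J. cmp C (Fm u) (\<pi> (src J u)) = \<pi> (tgt J u))"

definition is_limit ::
  "('j, 'k) category \<Rightarrow> ('o, 'm) category \<Rightarrow> ('j \<Rightarrow> 'o) \<Rightarrow> ('k \<Rightarrow> 'm) \<Rightarrow> 'o \<Rightarrow> ('j \<Rightarrow> 'm) \<Rightarrow> bool"
  where
  "is_limit J C Fo Fm X \<pi> \<longleftrightarrow> is_cone J C Fo Fm X \<pi> \<and>
     (\<forall>Y \<psi>. is_cone J C Fo Fm Y \<psi> \<longrightarrow>
        (\<exists>!h. h \<in> hom_set C Y X \<and> (\<forall>j\<in>objs J. cmp C (\<pi> j) h = \<psi> j)))"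

definition is_cocone ::
  "('j, 'k) category \<Rightarrow> ('o, 'm) category \<Rightarrow> ('j \<Rightarrow> 'o) \<Rightarrow> ('k \<Rightarrow> 'm) \<Rightarrow> 'o \<Rightarrow> ('j \<Rightarrow> 'm) \<Rightarrow> bool"
  where
  "is_cocone J C Fo Fm X \<iota> \<longleftrightarrow> X \<in> objs C \<and> (\<forall>j\<in>objs J. \<iota> j \<in> hom_set C (Fo j) X) \<and>
     (\<forall>u\<in>arrs J. cmp C (\<iota> (tgt J u)) (Fm u) = \<iota> (src J u))"

definition is_colimit ::
  "('j, 'k) category \<Rightarrow> ('o, 'm) category \<Rightarrow> ('j \<Rightarrow> 'o) \<Rightarrow> ('k \<Rightarrow> 'm) \<Rightarrow> 'o \<Rightarrow> ('j \<Rightarrow> 'm) \<Rightarrow> bool"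
  where
  "is_colimit J C Fo Fm X \<iota> \<longleftrightarrow> is_cocone J C Fo Fm X \<iota> \<and>
     (\<forall>Y \<psi>. is_cocone J C Fo Fm Y \<psi> \<longrightarrow>
        (\<exists>!h. h \<in> hom_set C X Y \<and> (\<forall>j\<in>objs J. cmp C h (\<iota> j) = \<psi> j)))"

text \<open>HOL has no type of all sets, so size is measured against types. A category, ordinal or
  cardinal is small when it lives on (a subset of) a fixed index type \<open>'i\<close>.\<close>

definition bicomplete :: "'i itself \<Rightarrow> ('o, 'm) category \<Rightarrow> bool" where
  "bicomplete _ C \<longleftrightarrow>
     (\<forall>(J :: ('i, 'i) category) Fo Fm. is_category J \<and> is_functor J C Fo Fm \<longrightarrow>
        (\<exists>X \<pi>. is_limit J C Fo Fm X \<pi>) \<and> (\<exists>X \<iota>. is_colimit J C Fo Fm X \<iota>))"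

definition is_pushout :: "('o, 'm) category \<Rightarrow> 'm \<Rightarrow> 'm \<Rightarrow> 'm \<Rightarrow> 'm \<Rightarrow> bool" where
  \<comment> \<open>\<open>f : A \<rightarrow> B\<close>, \<open>g : A \<rightarrow> C\<close>, \<open>g' : B \<rightarrow> P\<close>, \<open>f' : C \<rightarrow> P\<close>; \<open>f'\<close> is the pushout of \<open>f\<close> along \<open>g\<close>\<close>
  "is_pushout C f g g' f' \<longleftrightarrow>
     {f, g, g', f'} \<subseteq> arrs C \<and> src C f = src C g \<and> src C g' = tgt C f \<and> src C f' = tgt C g \<and>
     tgt C g' = tgt C f' \<and> cmp C g' f = cmp C f' g \<and>
     (\<forall>u\<in>arrs C. \<forall>v\<in>arrs C. src C u = tgt C f \<and> src C v = tgt C g \<and> tgt C u = tgt C v \<and>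
        cmp C u f = cmp C v g \<longrightarrow>
        (\<exists>!h. h \<in> hom_set C (tgt C g') (tgt C u) \<and> cmp C h g' = u \<and> cmp C h f' = v))"

section \<open>Transfinite composition and smallness\<close>

text \<open>An ordinal is represented by a well-order \<open>r\<close> (in the sense of the library, hence
  reflexive on its field), whose elements are the ordinals below it.\<close>

definition poset_category :: "'i rel \<Rightarrow> ('i, 'i \<times> 'i) category" where
  "poset_category r = \<lparr>objs = Field r, arrs = r, src = fst, tgt = snd,
     ident = (\<lambda>x. (x, x)), cmp = (\<lambda>v u. (fst u, snd v))\<rparr>"

definition is_successor :: "'i rel \<Rightarrow> 'i \<Rightarrow> 'i \<Rightarrow> bool" where
  "is_successor r a b \<longleftrightarrow> a \<in> underS r b \<and> underS r b \<subseteq> under r a"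

definition is_limit_elem :: "'i rel \<Rightarrow> 'i \<Rightarrow> bool" where
  "is_limit_elem r b \<longleftrightarrow> b \<in> Field r \<and> underS r b \<noteq> {} \<and> (\<nexists>a. is_successor r a b)"

definition is_limit_ordinal :: "'i rel \<Rightarrow> bool" where
  "is_limit_ordinal r \<longleftrightarrow> Field r \<noteq> {} \<and> (\<forall>a\<in>Field r. aboveS r a \<noteq> {})"

definition is_sequence ::
  "'i rel \<Rightarrow> ('o, 'm) category \<Rightarrow> ('i \<Rightarrow> 'o) \<Rightarrow> ('i \<times> 'i \<Rightarrow> 'm) \<Rightarrow> bool" where
  "is_sequence r C Xo Xm \<longleftrightarrow> Well_order r \<and> is_functor (poset_category r) C Xo Xm \<and>
     (\<forall>b. is_limit_elem r b \<longrightarrow>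
        is_colimit (poset_category (Restr r (underS r b))) C Xo Xm (Xo b) (\<lambda>a. Xm (a, b)))"

definition steps_in :: "'i rel \<Rightarrow> ('i \<times> 'i \<Rightarrow> 'm) \<Rightarrow> 'm set \<Rightarrow> bool" where
  "steps_in r Xm K \<longleftrightarrow> (\<forall>a b. is_successor r a b \<longrightarrow> Xm (a, b) \<in> K)"

definition pushouts_of :: "('o, 'm) category \<Rightarrow> 'm set \<Rightarrow> 'm set" where
  "pushouts_of C I = {f'. \<exists>f\<in>I. \<exists>g g'. is_pushout C f g g' f'}"

definition relative_cells :: "'i itself \<Rightarrow> ('o, 'm) category \<Rightarrow> 'm set \<Rightarrow> 'm set" where
  "relative_cells _ C I = {f. \<exists>(r :: 'i rel) Xo Xm Y \<iota> z.
     is_sequence r C Xo Xm \<and> steps_in r Xm (pushouts_of C I) \<and>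
     is_colimit (poset_category r) C Xo Xm Y \<iota> \<and>
     z \<in> Field r \<and> underS r z = {} \<and> f = \<iota> z}"

definition filtered_ordinal :: "'k set \<Rightarrow> 'i rel \<Rightarrow> bool" where
  "filtered_ordinal \<kappa> r \<longleftrightarrow> is_limit_ordinal r \<and>
     (\<forall>A\<subseteq>Field r. A \<lesssim> \<kappa> \<longrightarrow> (\<exists>b\<in>Field r. \<forall>a\<in>A. (a, b) \<in> r))"

text \<open>The last two conjuncts below say that the canonical map from the (filtered) colimit of the
  sets \<open>Hom(A, X\<^sub>b)\<close> to \<open>Hom(A, colim X)\<close> is surjective and injective.
  The cardinal is required to be less than that of \<open>'i\<close>, since otherwise there
  may be no filtered ordinals on \<open>'i\<close> and the condition would be void.\<close>

definition small_relative_to :: "'i itself \<Rightarrow> ('o, 'm) category \<Rightarrow> 'm set \<Rightarrow> 'o \<Rightarrow> bool" where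
  "small_relative_to _ C D A \<longleftrightarrow> (\<exists>\<kappa> :: 'i set. \<kappa> \<prec> (UNIV :: 'i set) \<and>
     (\<forall>(r :: 'i rel) Xo Xm Y \<iota>.
        is_sequence r C Xo Xm \<and> filtered_ordinal \<kappa> r \<and> steps_in r Xm D \<and>
        is_colimit (poset_category r) C Xo Xm Y \<iota> \<longrightarrow>
        (\<forall>g\<in>hom_set C A Y. \<exists>b\<in>Field r. \<exists>h\<in>hom_set C A (Xo b). g = cmp C (\<iota> b) h) \<and>
        (\<forall>b\<in>Field r. \<forall>h\<in>hom_set C A (Xo b). \<forall>h'\<in>hom_set C A (Xo b).
           cmp C (\<iota> b) h = cmp C (\<iota> b) h' \<longrightarrow>
           (\<exists>c. (b, c) \<in> r \<and> cmp C (Xm (b, c)) h = cmp C (Xm (b, c)) h'))))"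

section \<open>Model categories\<close>

definition has_lifting :: "('o, 'm) category \<Rightarrow> 'm \<Rightarrow> 'm \<Rightarrow> bool" where
  "has_lifting C i p \<longleftrightarrow>
     (\<forall>u\<in>hom_set C (src C i) (src C p). \<forall>v\<in>hom_set C (tgt C i) (tgt C p).
        cmp C p u = cmp C v i \<longrightarrow>
        (\<exists>h\<in>hom_set C (tgt C i) (src C p). cmp C h i = u \<and> cmp C p h = v))"

definition rlp :: "('o, 'm) category \<Rightarrow> 'm set \<Rightarrow> 'm set" where
  "rlp C I = {p \<in> arrs C. \<forall>i\<in>I. has_lifting C i p}"

definition is_retract :: "('o, 'm) category \<Rightarrow> 'm \<Rightarrow> 'm \<Rightarrow> bool" where
  "is_retract C f g \<longleftrightarrow> f \<in> arrs C \<and> g \<in> arrs C \<and>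
     (\<exists>s\<in>hom_set C (src C f) (src C g). \<exists>t\<in>hom_set C (src C g) (src C f).
      \<exists>s'\<in>hom_set C (tgt C f) (tgt C g). \<exists>t'\<in>hom_set C (tgt C g) (tgt C f).
        cmp C t s = ident C (src C f) \<and> cmp C t' s' = ident C (tgt C f) \<and>
        cmp C g s = cmp C s' f \<and> cmp C f t = cmp C t' g)"

definition retract_closed :: "('o, 'm) category \<Rightarrow> 'm set \<Rightarrow> bool" where
  "retract_closed C K \<longleftrightarrow> (\<forall>f g. g \<in> K \<and> is_retract C f g \<longrightarrow> f \<in> K)"

definition wide_subcategory :: "('o, 'm) category \<Rightarrow> 'm set \<Rightarrow> bool" where
  "wide_subcategory C K \<longleftrightarrow> K \<subseteq> arrs C \<and> (\<forall>X\<in>objs C. ident C X \<in> K) \<and>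
     (\<forall>f\<in>K. \<forall>g\<in>K. src C g = tgt C f \<longrightarrow> cmp C g f \<in> K)"

definition two_of_three :: "('o, 'm) category \<Rightarrow> 'm set \<Rightarrow> bool" where
  "two_of_three C W \<longleftrightarrow> (\<forall>f\<in>arrs C. \<forall>g\<in>arrs C. src C g = tgt C f \<longrightarrow>
     (f \<in> W \<and> g \<in> W \<longrightarrow> cmp C g f \<in> W) \<and>
     (f \<in> W \<and> cmp C g f \<in> W \<longrightarrow> g \<in> W) \<and>
     (g \<in> W \<and> cmp C g f \<in> W \<longrightarrow> f \<in> W))"

text \<open>Functorial factorisations \<open>f = P f \<circ> L f\<close>. A morphism \<open>f \<rightarrow> g\<close> of the arrow category
  is a pair \<open>(u, v)\<close> with \<open>v \<circ> f = g \<circ> u\<close>, and \<open>M f g u v\<close> is the induced arrow between the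
  middle objects.\<close>

definition functorial_factorization :: "('o, 'm) category \<Rightarrow> 'm set \<Rightarrow> 'm set \<Rightarrow> bool" where
  "functorial_factorization C K K' \<longleftrightarrow> (\<exists>L P M.
     (\<forall>f\<in>arrs C. L f \<in> K \<and> P f \<in> K' \<and> src C (L f) = src C f \<and> src C (P f) = tgt C (L f) \<and>
        tgt C (P f) = tgt C f \<and> cmp C (P f) (L f) = f) \<and>
     (\<forall>f\<in>arrs C. \<forall>g\<in>arrs C.
        \<forall>u\<in>hom_set C (src C f) (src C g). \<forall>v\<in>hom_set C (tgt C f) (tgt C g).
        cmp C v f = cmp C g u \<longrightarrow>
        M f g u v \<in> hom_set C (tgt C (L f)) (tgt C (L g)) \<and>
        cmp C (M f g u v) (L f) = cmp C (L g) u \<and>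
        cmp C (P g) (M f g u v) = cmp C v (P f)) \<and>
     (\<forall>f\<in>arrs C. M f f (ident C (src C f)) (ident C (tgt C f)) = ident C (tgt C (L f))) \<and>
     (\<forall>f\<in>arrs C. \<forall>g\<in>arrs C. \<forall>h\<in>arrs C.
        \<forall>u\<in>hom_set C (src C f) (src C g). \<forall>v\<in>hom_set C (tgt C f) (tgt C g).
        \<forall>u'\<in>hom_set C (src C g) (src C h). \<forall>v'\<in>hom_set C (tgt C g) (tgt C h).
        cmp C v f = cmp C g u \<and> cmp C v' g = cmp C h u' \<longrightarrow>
        M f h (cmp C u' u) (cmp C v' v) = cmp C (M g h u' v') (M f g u v)))"

definition model_category ::
  "'i itself \<Rightarrow> ('o, 'm) category \<Rightarrow> 'm set \<Rightarrow> 'm set \<Rightarrow> 'm set \<Rightarrow> bool" where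
  "model_category ty C W Cof Fib \<longleftrightarrow>
     is_category C \<and> bicomplete ty C \<and>
     wide_subcategory C W \<and> wide_subcategory C Cof \<and> wide_subcategory C Fib \<and>
     two_of_three C W \<and>
     retract_closed C W \<and> retract_closed C Cof \<and> retract_closed C Fib \<and>
     (\<forall>i\<in>Cof \<inter> W. \<forall>p\<in>Fib. has_lifting C i p) \<and>
     (\<forall>i\<in>Cof. \<forall>p\<in>Fib \<inter> W. has_lifting C i p) \<and>
     functorial_factorization C Cof (Fib \<inter> W) \<and>
     functorial_factorization C (Cof \<inter> W) Fib"

definition generated_by ::
  "'i itself \<Rightarrow> ('o, 'm) category \<Rightarrow> 'm set \<Rightarrow> 'm set \<Rightarrow> 'm set \<Rightarrow> 'm set \<Rightarrow> bool" where
  \<comment> \<open>\<open>I\<close> and \<open>J\<close> are generating cofibrations and generating acyclic cofibrations\<close>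
  "generated_by ty C W Fib I J \<longleftrightarrow> I \<subseteq> arrs C \<and> J \<subseteq> arrs C \<and>
     (\<forall>i\<in>I. small_relative_to ty C (relative_cells ty C I) (src C i)) \<and>
     (\<forall>j\<in>J. small_relative_to ty C (relative_cells ty C J) (src C j)) \<and>
     Fib = rlp C J \<and> Fib \<inter> W = rlp C I"

section \<open>Modules\<close>

definition mod_hom ::
  "('r, 'z) ring_scheme \<Rightarrow> ('r, 'a, 'x) module_scheme \<Rightarrow> ('r, 'b, 'y) module_scheme \<Rightarrow> ('a \<Rightarrow> 'b) set"
  where
  "mod_hom R M N = {f \<in> carrier M \<rightarrow> carrier N.
     (\<forall>x\<in>carrier M. \<forall>y\<in>carrier M. f (x \<oplus>\<^bsub>M\<^esub> y) = f x \<oplus>\<^bsub>N\<^esub> f y) \<and>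
     (\<forall>c\<in>carrier R. \<forall>x\<in>carrier M. f (c \<odot>\<^bsub>M\<^esub> x) = c \<odot>\<^bsub>N\<^esub> f x)}"

definition mod_iso ::
  "('r, 'z) ring_scheme \<Rightarrow> ('r, 'a, 'x) module_scheme \<Rightarrow> ('r, 'b, 'y) module_scheme \<Rightarrow> ('a \<Rightarrow> 'b) set"
  where "mod_iso R M N = {f \<in> mod_hom R M N. bij_betw f (carrier M) (carrier N)}"

definition mod_span ::
  "('r, 'z) ring_scheme \<Rightarrow> ('r, 'a, 'x) module_scheme \<Rightarrow> 'a set \<Rightarrow> 'a set" where
  "mod_span R M X = \<Inter>{N. submodule N R M \<and> X \<subseteq> N}"

text \<open>The library's module records extend ring records; the fields \<open>mult\<close> and \<open>one\<close>
  have no meaning for modules and are filled arbitrarily in the constructions below.\<close>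

definition quot_mod :: "('r, 'a) module \<Rightarrow> 'a set \<Rightarrow> ('r, 'a set) module" where
  "quot_mod M N = \<lparr>carrier = a_rcosets\<^bsub>M\<^esub> N, mult = (\<lambda>_ _. N), one = N,
     zero = N, add = (\<lambda>X Y. X <+>\<^bsub>M\<^esub> Y),
     smult = (\<lambda>c X. \<Union>x\<in>X. N +>\<^bsub>M\<^esub> (c \<odot>\<^bsub>M\<^esub> x))\<rparr>"

definition free_mod :: "'r ring \<Rightarrow> 's set \<Rightarrow> ('r, 's \<Rightarrow> 'r) module" where
  "free_mod R S = \<lparr>carrier = {x. (\<forall>s. x s \<in> carrier R) \<and> (\<forall>s. s \<notin> S \<longrightarrow> x s = \<zero>\<^bsub>R\<^esub>) \<and>
       finite {s. x s \<noteq> \<zero>\<^bsub>R\<^esub>}},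
     mult = (\<lambda>_ _ _. \<zero>\<^bsub>R\<^esub>), one = (\<lambda>_. \<zero>\<^bsub>R\<^esub>),
     zero = (\<lambda>_. \<zero>\<^bsub>R\<^esub>), add = (\<lambda>x y s. x s \<oplus>\<^bsub>R\<^esub> y s),
     smult = (\<lambda>c x s. c \<otimes>\<^bsub>R\<^esub> x s)\<rparr>"

definition free_gen :: "'r ring \<Rightarrow> 's \<Rightarrow> 's \<Rightarrow> 'r" where
  "free_gen R s = (\<lambda>t. if t = s then \<one>\<^bsub>R\<^esub> else \<zero>\<^bsub>R\<^esub>)"

definition free_lift :: "'r ring \<Rightarrow> ('r, 'c) module \<Rightarrow> ('s \<Rightarrow> 'c) \<Rightarrow> ('s \<Rightarrow> 'r) \<Rightarrow> 'c" where
  "free_lift R N g x = (\<Oplus>\<^bsub>N\<^esub>s\<in>{s. x s \<noteq> \<zero>\<^bsub>R\<^esub>}. x s \<odot>\<^bsub>N\<^esub> g s)"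

definition self_mod :: "'r ring \<Rightarrow> ('r, 'r) module" where
  "self_mod R = \<lparr>carrier = carrier R, mult = mult R, one = one R, zero = zero R, add = add R,
     smult = mult R\<rparr>"

definition zero_mod :: "'r ring \<Rightarrow> ('r, 'r) module" where
  "zero_mod R = (self_mod R)\<lparr>carrier := {\<zero>\<^bsub>R\<^esub>}\<rparr>"

definition sum_mod :: "('r, 'a) module \<Rightarrow> ('r, 'b) module \<Rightarrow> ('r, 'a \<times> 'b) module" where
  "sum_mod M N = \<lparr>carrier = carrier M \<times> carrier N,
     mult = (\<lambda>_ _. (\<zero>\<^bsub>M\<^esub>, \<zero>\<^bsub>N\<^esub>)), one = (\<zero>\<^bsub>M\<^esub>, \<zero>\<^bsub>N\<^esub>), zero = (\<zero>\<^bsub>M\<^esub>, \<zero>\<^bsub>N\<^esub>),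
     add = (\<lambda>x y. (fst x \<oplus>\<^bsub>M\<^esub> fst y, snd x \<oplus>\<^bsub>N\<^esub> snd y)),
     smult = (\<lambda>c x. (c \<odot>\<^bsub>M\<^esub> fst x, c \<odot>\<^bsub>N\<^esub> snd x))\<rparr>"

text \<open>The copy of a module along an injection \<open>e\<close> of its element type into another type.\<close>

definition copy_mod :: "('a \<Rightarrow> 'b) \<Rightarrow> ('r, 'a) module \<Rightarrow> ('r, 'b) module" where
  "copy_mod e M = \<lparr>carrier = e ` carrier M, mult = (\<lambda>x y. e (inv_into UNIV e x \<otimes>\<^bsub>M\<^esub> inv_into UNIV e y)),
     one = e \<one>\<^bsub>M\<^esub>, zero = e \<zero>\<^bsub>M\<^esub>, add = (\<lambda>x y. e (inv_into UNIV e x \<oplus>\<^bsub>M\<^esub> inv_into UNIV e y)),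
     smult = (\<lambda>c x. e (c \<odot>\<^bsub>M\<^esub> inv_into UNIV e x))\<rparr>"

section \<open>Filtered chain complexes\<close>

record ('r, 'a) fcomplex =
  md :: "int \<Rightarrow> ('r, 'a) module"
  df :: "int \<Rightarrow> 'a \<Rightarrow> 'a"
  fil :: "int \<Rightarrow> int \<Rightarrow> 'a set"  \<comment> \<open>\<open>fil A p n\<close> is \<open>F\<^sub>p A\<^sup>n\<close>\<close>

definition is_fcomplex :: "'r ring \<Rightarrow> ('r, 'a) fcomplex \<Rightarrow> bool" where
  "is_fcomplex R A \<longleftrightarrow>
     (\<forall>n. module R (md A n)) \<and>
     (\<forall>n. df A n \<in> mod_hom R (md A n) (md A (n + 1))) \<and>
     (\<forall>n. \<forall>x\<in>carrier (md A n). df A (n + 1) (df A n x) = \<zero>\<^bsub>md A (n + 1 + 1)\<^esub>) \<and>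
     (\<forall>p n. submodule (fil A p n) R (md A n)) \<and>
     (\<forall>p n. fil A p n \<subseteq> fil A (p + 1) n) \<and>
     (\<forall>p n. df A n ` fil A p n \<subseteq> fil A p (n + 1))"

definition is_fmap ::
  "'r ring \<Rightarrow> ('r, 'a) fcomplex \<Rightarrow> ('r, 'b) fcomplex \<Rightarrow> (int \<Rightarrow> 'a \<Rightarrow> 'b) \<Rightarrow> bool" where
  "is_fmap R A B f \<longleftrightarrow>
     (\<forall>n. f n \<in> mod_hom R (md A n) (md B n) \<inter> extensional (carrier (md A n))) \<and>
     (\<forall>n. \<forall>x\<in>carrier (md A n). f (n + 1) (df A n x) = df B n (f n x)) \<and>
     (\<forall>p n. f n ` fil A p n \<subseteq> fil B p n)"

text \<open>In the categories below, ring and module elements have the same type \<open>'r\<close>, which plays the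
  role of a universe.\<close>

datatype ('o, 'f) arrow = Arrow (asrc: 'o) (atgt: 'o) (afun: 'f)

definition fC :: "'r ring \<Rightarrow> (('r, 'r) fcomplex, (('r, 'r) fcomplex, int \<Rightarrow> 'r \<Rightarrow> 'r) arrow) category"
  where
  "fC R = \<lparr>objs = {A. is_fcomplex R A},
     arrs = {Arrow A B f | A B f. is_fcomplex R A \<and> is_fcomplex R B \<and> is_fmap R A B f},
     src = asrc, tgt = atgt,
     ident = (\<lambda>A. Arrow A A (\<lambda>n. \<lambda>x\<in>carrier (md A n). x)),
     cmp = (\<lambda>g f. Arrow (asrc f) (atgt g)
              (\<lambda>n. compose (carrier (md (asrc f) n)) (afun g n) (afun f n)))\<rparr>"

subsection \<open>The spectral sequence\<close>

text \<open>A position \<open>(p, p + n)\<close> of the spectral sequence is written \<open>p n\<close>, with \<open>n\<close> the degree in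
  the complex.\<close>

definition cycles :: "('r, 'a) fcomplex \<Rightarrow> nat \<Rightarrow> int \<Rightarrow> int \<Rightarrow> 'a set" where
  "cycles A k p n = {x \<in> fil A p n. df A n x \<in> fil A (p - int k) (n + 1)}"

definition boundaries :: "('r, 'a) fcomplex \<Rightarrow> nat \<Rightarrow> int \<Rightarrow> int \<Rightarrow> 'a set" where
  "boundaries A k p n = (case k of
       0 \<Rightarrow> fil A (p - 1) n
     | Suc j \<Rightarrow> (df A (n - 1) ` cycles A j (p + int j) (n - 1)) <+>\<^bsub>md A n\<^esub> cycles A j (p - 1) n)"

definition page :: "('r, 'a) fcomplex \<Rightarrow> nat \<Rightarrow> int \<Rightarrow> int \<Rightarrow> ('r, 'a set) module" where
  "page A k p n = quot_mod ((md A n)\<lparr>carrier := cycles A k p n\<rparr>) (boundaries A k p n)"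

definition page_map ::
  "('r, 'b) fcomplex \<Rightarrow> (int \<Rightarrow> 'a \<Rightarrow> 'b) \<Rightarrow> nat \<Rightarrow> int \<Rightarrow> int \<Rightarrow> 'a set \<Rightarrow> 'b set" where
  \<comment> \<open>sends the coset of \<open>x\<close> to the coset of \<open>f x\<close> in the page of the target \<open>B\<close>\<close>
  "page_map B f k p n X = boundaries B k p n <+>\<^bsub>md B n\<^esub> (f n ` X)"

definition quasi_iso :: "'r ring \<Rightarrow> nat \<Rightarrow> (('r, 'r) fcomplex, int \<Rightarrow> 'r \<Rightarrow> 'r) arrow set" where
  "quasi_iso R r = {f \<in> arrs (fC R). \<forall>p n.
     page_map (atgt f) (afun f) (r + 1) p n
       \<in> mod_iso R (page (asrc f) (r + 1) p n) (page (atgt f) (r + 1) p n)}"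

definition cycle_surjective :: "'r ring \<Rightarrow> nat set \<Rightarrow> (('r, 'r) fcomplex, int \<Rightarrow> 'r \<Rightarrow> 'r) arrow set"
  where
  "cycle_surjective R S = {f \<in> arrs (fC R). \<forall>s\<in>S. \<forall>p n.
     afun f n ` cycles (asrc f) s p n = cycles (atgt f) s p n}"

subsection \<open>The generating morphisms\<close>

definition zero_complex :: "'r ring \<Rightarrow> ('r, 'r) fcomplex" where
  "zero_complex R = \<lparr>md = (\<lambda>_. zero_mod R), df = (\<lambda>_ x. x), fil = (\<lambda>_ _. {\<zero>\<^bsub>R\<^esub>})\<rparr>"

definition R_complex :: "'r ring \<Rightarrow> int \<Rightarrow> int \<Rightarrow> ('r, 'r) fcomplex" where
  \<comment> \<open>\<open>R\<^sub>(\<^sub>p\<^sub>)\<^sup>n\<close>\<close>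
  "R_complex R p n = \<lparr>md = (\<lambda>m. if m = n then self_mod R else zero_mod R),
     df = (\<lambda>_ _. \<zero>\<^bsub>R\<^esub>),
     fil = (\<lambda>q m. if m = n \<and> p \<le> q then carrier R else {\<zero>\<^bsub>R\<^esub>})\<rparr>"

definition Z_complex :: "'r ring \<Rightarrow> nat \<Rightarrow> int \<Rightarrow> int \<Rightarrow> ('r, 'r) fcomplex" where
  "Z_complex R k p n = \<lparr>
     md = (\<lambda>m. if m = n then md (R_complex R p n) m
               else md (R_complex R (p - int k) (n + 1)) m),
     df = (\<lambda>m x. if m = n then x else \<zero>\<^bsub>R\<^esub>),
     fil = (\<lambda>q m. if m = n then fil (R_complex R p n) q m
                  else fil (R_complex R (p - int k) (n + 1)) q m)\<rparr>"

definition sum_complex ::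
  "('r, 'a) fcomplex \<Rightarrow> ('r, 'b) fcomplex \<Rightarrow> ('r, 'a \<times> 'b) fcomplex" where
  "sum_complex A B = \<lparr>md = (\<lambda>n. sum_mod (md A n) (md B n)), df = (\<lambda>n. map_prod (df A n) (df B n)),
     fil = (\<lambda>p n. fil A p n \<times> fil B p n)\<rparr>"

definition copy_complex :: "('a \<Rightarrow> 'b) \<Rightarrow> ('r, 'a) fcomplex \<Rightarrow> ('r, 'b) fcomplex" where
  "copy_complex e A = \<lparr>md = (\<lambda>n. copy_mod e (md A n)), df = (\<lambda>n x. e (df A n (inv_into UNIV e x))),
     fil = (\<lambda>p n. e ` fil A p n)\<rparr>"

text \<open>The elements of a direct sum are pairs; they are coded back into the original type (which
  is infinite in all uses), so that all complexes live in one category.\<close>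

definition pair_code :: "'a \<times> 'a \<Rightarrow> 'a" where
  "pair_code = (SOME e. inj e)"

lemma inj_pair_code:
  assumes "infinite (UNIV :: 'a set)"
  shows "inj (pair_code :: 'a \<times> 'a \<Rightarrow> 'a)"
proof -
  have "\<exists>e :: 'a \<times> 'a \<Rightarrow> 'a. inj e"
    using card_of_Times_same_infinite[OF assms] by (auto simp: card_of_ordIso[symmetric] bij_betw_def)
  then show ?thesis
    unfolding pair_code_def by (rule someI_ex)
qed

definition B_complex :: "'r ring \<Rightarrow> nat \<Rightarrow> int \<Rightarrow> int \<Rightarrow> ('r, 'r) fcomplex" where
  \<comment> \<open>for \<open>k \<ge> 1\<close>\<close>
  "B_complex R k p n = copy_complex pair_code
     (sum_complex (Z_complex R (k - 1) (p + int k - 1) (n - 1)) (Z_complex R (k - 1) (p - 1) n))"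

definition phi :: "'r ring \<Rightarrow> nat \<Rightarrow> int \<Rightarrow> int \<Rightarrow> (('r, 'r) fcomplex, int \<Rightarrow> 'r \<Rightarrow> 'r) arrow" where
  "phi R k p n = Arrow (Z_complex R k p n) (B_complex R k p n)
     (\<lambda>m. \<lambda>x\<in>carrier (md (Z_complex R k p n) m).
        pair_code (if m = n then (x, x) else (\<zero>\<^bsub>R\<^esub>, x)))"

definition zero_to_Z :: "'r ring \<Rightarrow> nat \<Rightarrow> int \<Rightarrow> int \<Rightarrow> (('r, 'r) fcomplex, int \<Rightarrow> 'r \<Rightarrow> 'r) arrow"
  where
  "zero_to_Z R k p n = Arrow (zero_complex R) (Z_complex R k p n) (\<lambda>m. \<lambda>x\<in>{\<zero>\<^bsub>R\<^esub>}. \<zero>\<^bsub>R\<^esub>)"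

definition J_gen :: "'r ring \<Rightarrow> nat set \<Rightarrow> (('r, 'r) fcomplex, int \<Rightarrow> 'r \<Rightarrow> 'r) arrow set" where
  "J_gen R S = (\<Union>s\<in>S. {zero_to_Z R s p n | p n. True})"

definition I_gen :: "'r ring \<Rightarrow> nat \<Rightarrow> nat set \<Rightarrow> (('r, 'r) fcomplex, int \<Rightarrow> 'r \<Rightarrow> 'r) arrow set" where
  "I_gen R r S = {phi R (r + 1) p n | p n. True} \<union> J_gen R S"

section \<open>The tensor product\<close>

text \<open>\<open>(A \<otimes> B)\<^sup>n\<close>, the direct sum over \<open>i\<close> of the tensor products of \<open>A\<^sup>i\<close> and \<open>B\<^sup>n\<^sup>-\<^sup>i\<close>, is presented
  by generators \<open>(i, a, b)\<close> with \<open>a \<in> A\<^sup>i\<close>, \<open>b \<in> B\<^sup>n\<^sup>-\<^sup>i\<close> and the bilinearity relations.\<close>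

definition tgens :: "('r, 'a) fcomplex \<Rightarrow> ('r, 'b) fcomplex \<Rightarrow> int \<Rightarrow> (int \<times> 'a \<times> 'b) set" where
  "tgens A B n = {(i, a, b) | i a b. a \<in> carrier (md A i) \<and> b \<in> carrier (md B (n - i))}"

definition tfree ::
  "'r ring \<Rightarrow> ('r, 'a) fcomplex \<Rightarrow> ('r, 'b) fcomplex \<Rightarrow> int \<Rightarrow> ('r, int \<times> 'a \<times> 'b \<Rightarrow> 'r) module" where
  "tfree R A B n = free_mod R (tgens A B n)"

definition trels ::
  "'r ring \<Rightarrow> ('r, 'a) fcomplex \<Rightarrow> ('r, 'b) fcomplex \<Rightarrow> int \<Rightarrow> (int \<times> 'a \<times> 'b \<Rightarrow> 'r) set" where
  "trels R A B n = (let F = tfree R A B n; g = free_gen R in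
     {g (i, a \<oplus>\<^bsub>md A i\<^esub> a', b) \<ominus>\<^bsub>F\<^esub> (g (i, a, b) \<oplus>\<^bsub>F\<^esub> g (i, a', b)) | i a a' b.
        a \<in> carrier (md A i) \<and> a' \<in> carrier (md A i) \<and> b \<in> carrier (md B (n - i))} \<union>
     {g (i, a, b \<oplus>\<^bsub>md B (n - i)\<^esub> b') \<ominus>\<^bsub>F\<^esub> (g (i, a, b) \<oplus>\<^bsub>F\<^esub> g (i, a, b')) | i a b b'.
        a \<in> carrier (md A i) \<and> b \<in> carrier (md B (n - i)) \<and> b' \<in> carrier (md B (n - i))} \<union>
     {g (i, c \<odot>\<^bsub>md A i\<^esub> a, b) \<ominus>\<^bsub>F\<^esub> (c \<odot>\<^bsub>F\<^esub> g (i, a, b)) | i a b c.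
        a \<in> carrier (md A i) \<and> b \<in> carrier (md B (n - i)) \<and> c \<in> carrier R} \<union>
     {g (i, a, c \<odot>\<^bsub>md B (n - i)\<^esub> b) \<ominus>\<^bsub>F\<^esub> (c \<odot>\<^bsub>F\<^esub> g (i, a, b)) | i a b c.
        a \<in> carrier (md A i) \<and> b \<in> carrier (md B (n - i)) \<and> c \<in> carrier R})"

type_synonym ('r, 'a, 'b) tens = "(int \<times> 'a \<times> 'b \<Rightarrow> 'r) set"

definition tmod ::
  "'r ring \<Rightarrow> ('r, 'a) fcomplex \<Rightarrow> ('r, 'b) fcomplex \<Rightarrow> int \<Rightarrow> ('r, ('r, 'a, 'b) tens) module" where
  "tmod R A B n = quot_mod (tfree R A B n) (mod_span R (tfree R A B n) (trels R A B n))"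

definition pure ::
  "'r ring \<Rightarrow> ('r, 'a) fcomplex \<Rightarrow> ('r, 'b) fcomplex \<Rightarrow> int \<Rightarrow> int \<times> 'a \<times> 'b \<Rightarrow> ('r, 'a, 'b) tens" where
  "pure R A B n s = mod_span R (tfree R A B n) (trels R A B n) +>\<^bsub>tfree R A B n\<^esub> free_gen R s"

text \<open>The linear map out of \<open>(A \<otimes> B)\<^sup>n\<close> with values \<open>g\<close> on pure tensors, for bilinear \<open>g\<close>.\<close>

definition tlift ::
  "'r ring \<Rightarrow> ('r, 'a) fcomplex \<Rightarrow> ('r, 'b) fcomplex \<Rightarrow> int \<Rightarrow> ('r, 'c) module \<Rightarrow>
   (int \<times> 'a \<times> 'b \<Rightarrow> 'c) \<Rightarrow> ('r, 'a, 'b) tens \<Rightarrow> 'c" where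
  "tlift R A B n N g = (\<lambda>X\<in>carrier (tmod R A B n). free_lift R N g (SOME x. x \<in> X))"

definition koszul_sign :: "'r ring \<Rightarrow> int \<Rightarrow> 'r" where
  "koszul_sign R i = (if even i then \<one>\<^bsub>R\<^esub> else \<ominus>\<^bsub>R\<^esub> \<one>\<^bsub>R\<^esub>)"

text \<open>In the filtration, the sum over \<open>i\<close> of the images of \<open>F\<^sub>i A \<otimes> F\<^sub>p\<^sub>-\<^sub>i B\<close> is the
  span of the pure tensors in these images.\<close>

definition tensor ::
  "'r ring \<Rightarrow> ('r, 'a) fcomplex \<Rightarrow> ('r, 'b) fcomplex \<Rightarrow> ('r, ('r, 'a, 'b) tens) fcomplex" where
  "tensor R A B = \<lparr>
     md = tmod R A B,
     df = (\<lambda>n. tlift R A B n (tmod R A B (n + 1)) (\<lambda>(i, a, b).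
            pure R A B (n + 1) (i + 1, df A i a, b) \<oplus>\<^bsub>tmod R A B (n + 1)\<^esub>
            koszul_sign R i \<odot>\<^bsub>tmod R A B (n + 1)\<^esub> pure R A B (n + 1) (i, a, df B (n - i) b))),
     fil = (\<lambda>p n. mod_span R (tmod R A B n)
            {pure R A B n (m, a, b) | i m a b. a \<in> fil A i m \<and> b \<in> fil B (p - i) (n - m)})\<rparr>"

definition tensor_map ::
  "'r ring \<Rightarrow> ('r, 'a) fcomplex \<Rightarrow> ('r, 'b) fcomplex \<Rightarrow> ('r, 'c) fcomplex \<Rightarrow> ('r, 'd) fcomplex \<Rightarrow>
   (int \<Rightarrow> 'a \<Rightarrow> 'c) \<Rightarrow> (int \<Rightarrow> 'b \<Rightarrow> 'd) \<Rightarrow> int \<Rightarrow> ('r, 'a, 'b) tens \<Rightarrow> ('r, 'c, 'd) tens" where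
  "tensor_map R A B A' B' f g n =
     tlift R A B n (tmod R A' B' n) (\<lambda>(i, a, b). pure R A' B' n (i, f i a, g (n - i) b))"

definition associator ::
  "'r ring \<Rightarrow> ('r, 'a) fcomplex \<Rightarrow> ('r, 'b) fcomplex \<Rightarrow> ('r, 'c) fcomplex \<Rightarrow> int \<Rightarrow>
   ('r, ('r, 'a, 'b) tens, 'c) tens \<Rightarrow> ('r, 'a, ('r, 'b, 'c) tens) tens" where
  "associator R A B C n =
     (let N = tmod R A (tensor R B C) n in
      tlift R (tensor R A B) C n N (\<lambda>(j, t, c).
        tlift R A B j N (\<lambda>(i, a, b).
          pure R A (tensor R B C) n (i, a, pure R B C (n - i) (j - i, b, c))) t))"

definition left_unitor ::
  "'r ring \<Rightarrow> ('r, 'a) fcomplex \<Rightarrow> int \<Rightarrow> ('r, 'r, 'a) tens \<Rightarrow> 'a" where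
  "left_unitor R A n = tlift R (R_complex R 0 0) A n (md A n)
     (\<lambda>(i, c, a). if i = 0 then c \<odot>\<^bsub>md A n\<^esub> a else \<zero>\<^bsub>md A n\<^esub>)"

definition right_unitor ::
  "'r ring \<Rightarrow> ('r, 'a) fcomplex \<Rightarrow> int \<Rightarrow> ('r, 'a, 'r) tens \<Rightarrow> 'a" where
  "right_unitor R A n = tlift R A (R_complex R 0 0) n (md A n)
     (\<lambda>(i, a, c). if i = n then c \<odot>\<^bsub>md A n\<^esub> a else \<zero>\<^bsub>md A n\<^esub>)"

section \<open>Filtered differential graded algebras\<close>

definition fmap_id :: "('r, 'a) fcomplex \<Rightarrow> int \<Rightarrow> 'a \<Rightarrow> 'a" where
  "fmap_id A n = (\<lambda>x\<in>carrier (md A n). x)"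

record ('r, 'a) fdga =
  cx :: "('r, 'a) fcomplex"
  multn :: "int \<Rightarrow> ('r, 'a, 'a) tens \<Rightarrow> 'a"
  unt :: "int \<Rightarrow> 'r \<Rightarrow> 'a"

definition is_fdga :: "'r ring \<Rightarrow> ('r, 'a) fdga \<Rightarrow> bool" where
  "is_fdga R M \<longleftrightarrow> (let A = cx M; \<mu> = multn M; \<eta> = unt M; E = R_complex R 0 0; AA = tensor R A A in
     is_fcomplex R A \<and> is_fmap R AA A \<mu> \<and> is_fmap R E A \<eta> \<and>
     (\<forall>n. \<forall>x\<in>carrier (md (tensor R AA A) n).
        \<mu> n (tensor_map R AA A A A \<mu> (fmap_id A) n x) =
        \<mu> n (tensor_map R A AA A A (fmap_id A) \<mu> n (associator R A A A n x))) \<and>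
     (\<forall>n. \<forall>x\<in>carrier (md (tensor R E A) n).
        \<mu> n (tensor_map R E A A A \<eta> (fmap_id A) n x) = left_unitor R A n x) \<and>
     (\<forall>n. \<forall>x\<in>carrier (md (tensor R A E) n).
        \<mu> n (tensor_map R A E A A (fmap_id A) \<eta> n x) = right_unitor R A n x))"

definition is_fdga_map :: "'r ring \<Rightarrow> ('r, 'a) fdga \<Rightarrow> ('r, 'a) fdga \<Rightarrow> (int \<Rightarrow> 'a \<Rightarrow> 'a) \<Rightarrow> bool" where
  "is_fdga_map R M N f \<longleftrightarrow> is_fmap R (cx M) (cx N) f \<and>
     (\<forall>n. \<forall>x\<in>carrier (md (tensor R (cx M) (cx M)) n).
        f n (multn M n x) = multn N n (tensor_map R (cx M) (cx M) (cx N) (cx N) f f n x)) \<and>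
     (\<forall>n. \<forall>c\<in>carrier (md (R_complex R 0 0) n). f n (unt M n c) = unt N n c)"

definition fDGA :: "'r ring \<Rightarrow> (('r, 'r) fdga, (('r, 'r) fdga, int \<Rightarrow> 'r \<Rightarrow> 'r) arrow) category" where
  "fDGA R = \<lparr>objs = {M. is_fdga R M},
     arrs = {Arrow M N f | M N f. is_fdga R M \<and> is_fdga R N \<and> is_fdga_map R M N f},
     src = asrc, tgt = atgt,
     ident = (\<lambda>M. Arrow M M (fmap_id (cx M))),
     cmp = (\<lambda>g f. Arrow (asrc f) (atgt g)
              (\<lambda>n. compose (carrier (md (cx (asrc f)) n)) (afun g n) (afun f n)))\<rparr>"

definition forget ::
  "(('r, 'r) fdga, int \<Rightarrow> 'r \<Rightarrow> 'r) arrow \<Rightarrow> (('r, 'r) fcomplex, int \<Rightarrow> 'r \<Rightarrow> 'r) arrow" where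
  "forget f = Arrow (cx (asrc f)) (cx (atgt f)) (afun f)"

definition is_free_algebra_functor ::
  "'r ring \<Rightarrow> (('r, 'r) fcomplex \<Rightarrow> ('r, 'r) fdga) \<Rightarrow>
   ((('r, 'r) fcomplex, int \<Rightarrow> 'r \<Rightarrow> 'r) arrow \<Rightarrow> (('r, 'r) fdga, int \<Rightarrow> 'r \<Rightarrow> 'r) arrow) \<Rightarrow> bool" where
  "is_free_algebra_functor R To Tm \<longleftrightarrow> left_adjoint (fC R) (fDGA R) To Tm cx forget"

definition fdga_weq :: "'r ring \<Rightarrow> nat \<Rightarrow> (('r, 'r) fdga, int \<Rightarrow> 'r \<Rightarrow> 'r) arrow set" where
  "fdga_weq R r = {f \<in> arrs (fDGA R). forget f \<in> quasi_iso R r}"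

definition fdga_fib :: "'r ring \<Rightarrow> nat set \<Rightarrow> (('r, 'r) fdga, int \<Rightarrow> 'r \<Rightarrow> 'r) arrow set" where
  "fdga_fib R S = {f \<in> arrs (fDGA R). forget f \<in> cycle_surjective R S}"

text \<open>\<open>'u\<close> is the type of all elements of rings and modules, \<open>'i\<close> the index type of small
  (co)limits. The condition makes \<open>'u\<close> closed under products of \<open>'i\<close>-indexed families; it is
  satisfied, for instance, by \<open>'u = 'i set\<close> for every infinite \<open>'i\<close>.\<close>

definition universe :: "'i itself \<Rightarrow> 'u itself \<Rightarrow> bool" where
  "universe _ _ \<longleftrightarrow> infinite (UNIV :: 'i set) \<and> infinite (UNIV :: 'u set) \<and>
     (UNIV :: ('i \<Rightarrow> 'u) set) \<lesssim> (UNIV :: 'u set)"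

end

theory Submission imports Defs begin

abbreviation (input) add_in ("_ +[_] _" [65, 0, 66] 65) where "x +[M] y \<equiv> x \<oplus>\<^bsub>M\<^esub> y"
abbreviation (input) minus_in ("_ -[_] _" [65, 0, 66] 65) where "x -[M] y \<equiv> x \<ominus>\<^bsub>M\<^esub> y"
abbreviation (input) smult_in ("_ *[_] _" [71, 0, 70] 70) where "c *[M] x \<equiv> c \<odot>\<^bsub>M\<^esub> x"
abbreviation (input) zero_in ("\<zero>[_]") where "\<zero>[M] \<equiv> \<zero>\<^bsub>M\<^esub>"
abbreviation (input) one_in ("\<one>[_]") where "\<one>[M] \<equiv> \<one>\<^bsub>M\<^esub>"
abbreviation (input) neg_in ("\<ominus>[_] _" [0, 81] 80) where "\<ominus>[M] x \<equiv> \<ominus>\<^bsub>M\<^esub> x"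
abbreviation (input) mult_in ("_ \<otimes>[_] _" [70, 0, 71] 70) where "x \<otimes>[M] y \<equiv> x \<otimes>\<^bsub>M\<^esub> y"
abbreviation grade where "grade A n \<equiv> carrier (md A n)"
abbreviation homD where "homD R \<equiv> hom_set (fDGA R)"
abbreviation homC where "homC R \<equiv> hom_set (fC R)"
abbreviation cmpD where "cmpD R \<equiv> cmp (fDGA R)"
abbreviation dgmap where "dgmap \<equiv> is_fdga_map"
abbreviation fcx where "fcx \<equiv> is_fcomplex"
abbreviation cmpC where "cmpC R \<equiv> cmp (fC R)"

text \<open>Fibrations, and fibrations that are weak equivalences, are the maps \<open>p : A \<rightarrow> B\<close> for which certain
  lifts of elements exist: cycles of \<open>B\<close> lift to cycles of \<open>A\<close>, and each square from \<open>\<phi>\<^sub>r\<^sub>+\<^sub>1\<close> has a filler. A map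
  with chosen lifts is an algebraic structure, so every \<open>f : X \<rightarrow> Y\<close> has an initial factorization \<open>X \<rightarrow> E \<rightarrow> Y\<close> with
  chosen lifts on \<open>E \<rightarrow> Y\<close>. It is functorial, and by pulling back along \<open>E \<rightarrow> B\<close>, initiality makes \<open>X \<rightarrow> E\<close> lift
  against all \<open>p\<close> of the class; no transfinite composition is needed. If \<open>j : X \<rightarrow> Y\<close> lifts against fibrations,
  it lifts against the projection to \<open>Y\<close> from the mapping path algebra of \<open>j\<close>, which yields a
  retraction \<open>\<rho>\<close> of \<open>j\<close> with \<open>j \<rho>\<close> filtered homotopic to the identity; so \<open>j\<close> is a weak equivalence.\<close>

section \<open>Modules\<close>

text \<open>HOL confines all algebras to the single type \<open>'u\<close>, and this shapes the
  constructions. An initial object is found inside the product over all objects of its kind, however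
  many there are: only the families generated by a few elements are kept, each is the value of a
  term, and terms can be coded in \<open>'u\<close>. Colimits, free algebras and initial
  factorizations arise in this way. Limits, pullbacks and sequential colimits use families that have
  codes directly; all are cases of one reduced product over a filter. That \<open>r\<close> belongs
  to \<open>S\<close> makes fillers against \<open>phi\<close> equivalent to an isomorphism on the
  page \<open>r + 1\<close>, since \<open>r\<close>-cycles can then be lifted. The bound
  \<open>S \<subseteq> {0..r}\<close> enters through the mapping path algebra: with paths shifted by
  \<open>r\<close>, its projection to \<open>Y\<close> is onto \<open>s\<close>-cycles for
  \<open>s \<le> r\<close>, while a path with this shift still identifies its ends on the page
  \<open>r + 1\<close>. Generators enter only at the end: squares from them are transposed to
  filtered complexes, where \<open>Z_complex\<close> represents cycles. Their smallness holds
  because a cycle in a sequential colimit of algebras is a cycle at some stage.\<close>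

lemma submodule_facts:
 assumes "module R M" "submodule N R M"
 shows "N \<subseteq> carrier M" "\<zero>[M]\<in>N" "!!x. x\<in>N==>\<ominus>[M] x\<in>N"
  "!!x y. x\<in>N==>y\<in>N==>x +[M] y\<in>N"
  "!!x y. x\<in>N==>y\<in>N==>x -[M] y\<in>N"
  "!!c x. c\<in>carrier R==>x\<in>N==>c *[M] x\<in>N"
proof -
 interpret module R M by fact
 note E = submoduleE[OF assms(2)]
 show 1: "N \<subseteq> carrier M" by (rule E)
 show 2: "!!x. x\<in>N==>\<ominus>[M] x\<in>N" by (rule E)
 show 3: "!!x y. x\<in>N==>y\<in>N==>x +[M] y\<in>N" by (rule E)
 show "!!c x. c\<in>carrier R==>x\<in>N==>c *[M] x\<in>N" by (rule E)
 show "!!x y. x\<in>N==>y\<in>N==>x -[M] y\<in>N" unfolding a_minus_def by (intro 2 3)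
 obtain x where x: "x\<in>N" using E(2) by blast
 have "x +[M] \<ominus>[M] x\<in>N" using x by (intro 2 3)
 then show "\<zero>[M]\<in>N" using x 1 by (simp add: M.r_neg subset_iff)
qed

text \<open>Closure under negatives comes from scaling by minus one. Concrete sets are shown to be
  submodules through this criterion.\<close>

lemma submodule_iff:
 assumes "module R M"
 shows "submodule N R M \<longleftrightarrow> N \<subseteq> carrier M & \<zero>[M]\<in>N & (\<forall>x\<in>N. \<forall>y\<in>N. x +[M] y\<in>N) &
  (\<forall>c\<in>carrier R. \<forall>x\<in>N. c *[M] x\<in>N)" (is "_ = ?r")
proof
 interpret module R M by fact
 assume r: ?r
 show "submodule N R M"
 proof (rule submoduleI)
  fix a assume a: "a\<in>N"
  then have "(\<ominus>[R] \<one>[R]) *[M] a\<in>N" using r by simp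
  moreover have "(\<ominus>[R] \<one>[R]) *[M] a = \<ominus>[M] a" using a r by (subst smult_l_minus) auto
  ultimately show "\<ominus>[M] a\<in>N" by simp
 qed (use r in auto)
qed (use submodule_facts[OF assms] in auto)

lemma mod_hom_zero:
 assumes "module R M" "module R N" "f\<in>mod_hom R M N"
 shows "f \<zero>[M] = \<zero>[N]"
proof -
 interpret M: module R M by fact
 interpret N: module R N by fact
 have "f (\<zero>[R] *[M] \<zero>[M]) = \<zero>[R] *[N] f \<zero>[M]" using assms(3)
  by (auto simp: mod_hom_def simp del: M.smult_l_null M.smult_r_null N.smult_l_null)
 moreover have "f \<zero>[M]\<in>carrier N" using assms(3) by (auto simp: mod_hom_def)
 ultimately show ?thesis by simp
qed

lemma mod_hom_minus:
 assumes "module R M" "module R N" "f\<in>mod_hom R M N" "x\<in>carrier M"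
 shows "f (\<ominus>[M] x) = \<ominus>[N] f x"
proof -
 interpret M: module R M by fact
 interpret N: module R N by fact
 have *: "f x\<in>carrier N" using assms(3,4) by (auto simp: mod_hom_def)
 have "f ((\<ominus>[R] \<one>[R]) *[M] x) = (\<ominus>[R] \<one>[R]) *[N] f x" using assms(3,4) by (auto simp: mod_hom_def)
 then show ?thesis using assms(4) * by (simp add: M.smult_l_minus N.smult_l_minus)
qed

lemma mod_hom_diff:
 assumes "module R M" "module R N" "f\<in>mod_hom R M N" "x\<in>carrier M" "y\<in>carrier M"
 shows "f (x -[M] y) = f x -[N] f y"
proof -
 interpret M: module R M by fact
 show ?thesis unfolding a_minus_def using mod_hom_minus[OF assms(1-3,5)] assms
  by (auto simp: mod_hom_def)
qed

lemma mod_span_submodule: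
 assumes "module R M" "X \<subseteq> carrier M"
 shows "submodule (mod_span R M X) R M"
proof -
 interpret M: module R M by fact
 \<comment> \<open>The whole module is a member of the family, so the intersection is not the empty
   one, which would be the universe.\<close>
 have "submodule (carrier M) R M" by (rule M.carrier_is_submodule)
 then show ?thesis unfolding mod_span_def submodule_iff[OF assms(1)]
  using assms(2) by (auto simp: submodule_iff[OF assms(1)])
qed

lemma mod_span_superset: "X \<subseteq> mod_span R M X"
 by (auto simp: mod_span_def)

lemma mod_span_least: "submodule N R M==>X \<subseteq> N==>mod_span R M X \<subseteq> N"
 by (auto simp: mod_span_def)

text \<open>Reduces equality of two homomorphisms to equality on generators: a span lies in the
  equalizer as soon as its generators do.\<close>

lemma submodule_equalizer:
 assumes "module R M" "module R N" "f\<in>mod_hom R M N" "g\<in>mod_hom R M N"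
 shows "submodule {x\<in>carrier M. f x = g x} R M"
proof -
 interpret M: module R M by fact
 show ?thesis unfolding submodule_iff[OF assms(1)]
  using assms(3,4) mod_hom_zero[OF assms(1-3)] mod_hom_zero[OF assms(1,2,4)]
  by (auto simp: mod_hom_def)
qed

lemma submodule_vimage:
 assumes "module R M" "module R N" "f\<in>mod_hom R M N" "submodule K R N"
 shows "submodule {x\<in>carrier M. f x\<in>K} R M"
proof -
 interpret M: module R M by fact
 show ?thesis unfolding submodule_iff[OF assms(1)]
  using assms(3) mod_hom_zero[OF assms(1-3)] submodule_facts[OF assms(2,4)]
  by (auto simp: mod_hom_def)
qed

subsection \<open>Quotients\<close>

locale quotient_module =
 fixes R :: "'r ring" and M :: "('r, 'a) module" and N
 assumes module: "module R M" and sub: "submodule N R M"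
begin

sublocale M: module R M by (rule module)

lemma abelian_subgroup: "abelian_subgroup N M"
 using sub M.abelian_group_axioms M.a_comm_group
 by (auto intro!: abelian_subgroupI2 simp: submodule_def)

sublocale N: abelian_subgroup N M by (rule abelian_subgroup)

lemma coset_eq_iff:
 assumes "x\<in>carrier M" "y\<in>carrier M"
 shows "N +>\<^bsub>M\<^esub> x = N +>\<^bsub>M\<^esub> y \<longleftrightarrow> x -[M] y\<in>N"
 using assms N.a_repr_independence' N.a_repr_independenceD N.a_rcos_module
 unfolding a_minus_def by metis

lemma coset_self: "x\<in>carrier M==>x\<in>N +>\<^bsub>M\<^esub> x"
 by (rule N.a_rcos_self)

lemma coset_memD: "x\<in>carrier M==>y\<in>N +>\<^bsub>M\<^esub> x==>y\<in>carrier M & N +>\<^bsub>M\<^esub> x = N +>\<^bsub>M\<^esub> y"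
 using N.a_repr_independence' N.a_elemrcos_carrier by blast

lemma carrier_quot: "carrier (quot_mod M N) = {N +>\<^bsub>M\<^esub> x | x. x\<in>carrier M}"
 by (auto simp: quot_mod_def A_RCOSETS_def' a_r_coset_def')

lemma quot_zero: "\<zero>[quot_mod M N] = N +>\<^bsub>M\<^esub> \<zero>[M]"
 by (simp add: quot_mod_def N.a_subset)

lemma quot_add:
 "x\<in>carrier M==>y\<in>carrier M ==>
  (N +>\<^bsub>M\<^esub> x) +[quot_mod M N] (N +>\<^bsub>M\<^esub> y) = N +>\<^bsub>M\<^esub> (x +[M] y)"
 by (simp add: quot_mod_def N.a_rcos_sum)

lemma quot_smult:
 assumes c: "c\<in>carrier R" and x: "x\<in>carrier M"
 shows "c *[quot_mod M N] (N +>\<^bsub>M\<^esub> x) = N +>\<^bsub>M\<^esub> (c *[M] x)"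
proof -
 have "N +>\<^bsub>M\<^esub> (c *[M] y) = N +>\<^bsub>M\<^esub> (c *[M] x)" if "y\<in>N +>\<^bsub>M\<^esub> x" for y
 proof -
  have y: "y\<in>carrier M" and "N +>\<^bsub>M\<^esub> y = N +>\<^bsub>M\<^esub> x" using coset_memD[OF x that] by auto
  then have "y -[M] x\<in>N" using x by (simp add: coset_eq_iff)
  then have "c *[M] (y -[M] x)\<in>N" using c submodule_facts(6)[OF module sub] by blast
  moreover have "c *[M] (y -[M] x) = c *[M] y -[M] c *[M] x"
   using c x y by (simp add: a_minus_def M.smult_r_distr M.smult_r_minus)
  ultimately have "c *[M] y -[M] c *[M] x\<in>N" by (simp only:)
  then show ?thesis by (rule coset_eq_iff[THEN iffD2, OF M.smult_closed[OF c y] M.smult_closed[OF c x]])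
 qed
 \<comment> \<open>The scalar action on a coset is defined as a union over its elements. The cosets
   in this union all coincide, so that it collapses to one of them.\<close>
 then have "(\<Union>y\<in>N +>\<^bsub>M\<^esub> x. N +>\<^bsub>M\<^esub> (c *[M] y)) = (\<Union>y\<in>N +>\<^bsub>M\<^esub> x. N +>\<^bsub>M\<^esub> (c *[M] x))"
  by (rule SUP_cong[OF refl])
 then show ?thesis using coset_self[OF x] by (auto simp only: quot_mod_def module.simps SUP_const)
qed

lemma quot_module: "module R (quot_mod M N)"
proof (rule moduleI)
 note simps = carrier_quot quot_zero quot_add quot_smult
 show "abelian_group (quot_mod M N)"
 proof (rule abelian_groupI)
  fix X assume "X\<in>carrier (quot_mod M N)"
  then obtain x where x: "x\<in>carrier M" "X = N +>\<^bsub>M\<^esub> x" by (auto simp: simps)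
  then show "\<exists>Y\<in>carrier (quot_mod M N). Y +[quot_mod M N] X = \<zero>[quot_mod M N]"
   by (intro bexI[of _ "N +>\<^bsub>M\<^esub> (\<ominus>[M] x)"]) (auto simp: simps M.l_neg)
 next
  fix X Y Z assume "X\<in>carrier (quot_mod M N)" "Y\<in>carrier (quot_mod M N)" "Z\<in>carrier (quot_mod M N)"
  then obtain x y z where "x\<in>carrier M" "y\<in>carrier M" "z\<in>carrier M"
   "X = N +>\<^bsub>M\<^esub> x" "Y = N +>\<^bsub>M\<^esub> y" "Z = N +>\<^bsub>M\<^esub> z" by (auto simp: simps)
  then show "X +[quot_mod M N] Y +[quot_mod M N] Z = X +[quot_mod M N] (Y +[quot_mod M N] Z)"
   by (simp add: simps M.a_assoc)
 next
  fix X Y assume "X\<in>carrier (quot_mod M N)" "Y\<in>carrier (quot_mod M N)"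
  then obtain x y where xy: "x\<in>carrier M" "y\<in>carrier M"
   "X = N +>\<^bsub>M\<^esub> x" "Y = N +>\<^bsub>M\<^esub> y" by (auto simp: simps)
  then show "X +[quot_mod M N] Y = Y +[quot_mod M N] X" by (simp add: simps M.a_comm)
  show "X +[quot_mod M N] Y\<in>carrier (quot_mod M N)" using xy by (auto simp: quot_add carrier_quot)
 next
  fix X assume "X\<in>carrier (quot_mod M N)"
  then obtain x where "x\<in>carrier M" "X = N +>\<^bsub>M\<^esub> x" by (auto simp: simps)
  then show "\<zero>[quot_mod M N] +[quot_mod M N] X = X" by (simp add: simps)
 next
  show "\<zero>[quot_mod M N]\<in>carrier (quot_mod M N)" unfolding carrier_quot quot_zero by blast
 qed
 show "cring R" by (rule M.R.cring_axioms)
next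
 fix a X assume a: "a\<in>carrier R" and "X\<in>carrier (quot_mod M N)"
 then obtain x where x: "x\<in>carrier M" "X = N +>\<^bsub>M\<^esub> x" unfolding carrier_quot by blast
 show "a *[quot_mod M N] X\<in>carrier (quot_mod M N)"
  unfolding x carrier_quot quot_smult[OF a x(1)] using a x by blast
 fix b assume b: "b\<in>carrier R"
 show "(a +[R] b) *[quot_mod M N] X = a *[quot_mod M N] X +[quot_mod M N] b *[quot_mod M N] X"
  using a b x by (simp add: quot_smult quot_add M.smult_l_distr)
 show "(a \<otimes>[R] b) *[quot_mod M N] X = a *[quot_mod M N] (b *[quot_mod M N] X)"
  using a b x by (simp add: quot_smult M.smult_assoc1)
next
 fix a X Y assume a: "a\<in>carrier R" and "X\<in>carrier (quot_mod M N)" "Y\<in>carrier (quot_mod M N)"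
 then obtain x y where xy: "x\<in>carrier M" "y\<in>carrier M" and XY: "X = N +>\<^bsub>M\<^esub> x" "Y = N +>\<^bsub>M\<^esub> y"
  unfolding carrier_quot by blast
 show "a *[quot_mod M N] (X +[quot_mod M N] Y) = a *[quot_mod M N] X +[quot_mod M N] a *[quot_mod M N] Y"
  unfolding XY quot_add[OF xy] quot_smult[OF a M.a_closed[OF xy]] M.smult_r_distr[OF a xy]
   quot_smult[OF a xy(1)] quot_smult[OF a xy(2)]
   quot_add[OF M.smult_closed[OF a xy(1)] M.smult_closed[OF a xy(2)]] ..
next
 fix X assume "X\<in>carrier (quot_mod M N)"
 then obtain x where "x\<in>carrier M" "X = N +>\<^bsub>M\<^esub> x" unfolding carrier_quot by blast
 then show "\<one>[R] *[quot_mod M N] X = X" by (simp add: quot_smult)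
qed

lemma coset_hom: "(%x. N +>\<^bsub>M\<^esub> x)\<in>mod_hom R M (quot_mod M N)"
proof -
 have "N +>\<^bsub>M\<^esub> x\<in>carrier (quot_mod M N)" if "x\<in>carrier M" for x
  using that unfolding carrier_quot by blast
 then show ?thesis unfolding mod_hom_def by (simp add: quot_add quot_smult)
qed

end

subsection \<open>Free modules\<close>

lemma free_module:
 assumes "cring R" shows "module R (free_mod R S)"
proof -
 interpret cring R by fact
 have fin: "finite {s. x s +[R] y s \<noteq> \<zero>[R]}"
  if "finite {s. x s \<noteq> \<zero>[R]}" "finite {s. y s \<noteq> \<zero>[R]}" for x y :: "'b => 'a"
  by (rule finite_subset[OF _ finite_UnI[OF that]]) auto
 have fin': "finite {s. c \<otimes>[R] x s \<noteq> \<zero>[R]}"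
  if "finite {s. x s \<noteq> \<zero>[R]}" "c\<in>carrier R" for c and x :: "'b => 'a"
  by (rule finite_subset[OF _ that(1)]) (use that in auto)
 have fin'': "finite {s. \<ominus>[R] x s \<noteq> \<zero>[R]}"
  if "finite {s. x s \<noteq> \<zero>[R]}" for x :: "'b => 'a"
  by (rule finite_subset[OF _ that(1)]) (use that in auto)
 show ?thesis
 proof (rule moduleI)
  show "abelian_group (free_mod R S)"
  proof (rule abelian_groupI)
   fix x assume "x\<in>carrier (free_mod R S)"
   then show "\<exists>y\<in>carrier (free_mod R S). y +[free_mod R S] x = \<zero>[free_mod R S]"
    by (intro bexI[of _ "%s. \<ominus>[R] x s"]) (auto simp: free_mod_def fin'' l_neg)
  qed (auto simp: free_mod_def fin a_ac)
 qed (auto simp: free_mod_def fin' l_distr r_distr m_assoc assms)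
qed

lemma free_gen_closed:
 assumes "cring R" "s\<in>S" shows "free_gen R s\<in>carrier (free_mod R S)"
proof -
 interpret cring R by fact
 have "finite {t. free_gen R s t \<noteq> \<zero>[R]}"
  by (rule finite_subset[of _ "{s}"]) (auto simp: free_gen_def)
 then show ?thesis using assms by (auto simp: free_mod_def free_gen_def)
qed

text \<open>Any finite set of generators containing the support may serve as index set. This lets
  the sums for \<open>x\<close>, \<open>y\<close> and their sum run over a common set.\<close>

lemma free_lift_over:
 assumes "module R N" "x\<in>carrier (free_mod R S)" "g\<in>S \<rightarrow> carrier N"
  "finite T" "{s. x s \<noteq> \<zero>[R]} \<subseteq> T" "T \<subseteq> S"
 shows "free_lift R N g x = (\<Oplus>\<^bsub>N\<^esub>s\<in>T. x s *[N] g s)"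
proof -
 interpret module R N by fact
 have "x s *[N] g s\<in>carrier N" if "s\<in>T" for s
  using assms that by (intro smult_closed) (auto simp: free_mod_def Pi_iff)
 moreover have "x s *[N] g s = \<zero>[N]" if "s\<in>T - {s. x s \<noteq> \<zero>[R]}" for s
  using assms that by (auto simp: Pi_iff subset_iff)
 ultimately show ?thesis unfolding free_lift_def
  using assms by (intro M.add.finprod_mono_neutral_cong_left[simplified]) (auto simp: finsum_def)
qed

lemma free_lift_hom:
 assumes "module R N" "g\<in>S \<rightarrow> carrier N"
 shows "free_lift R N g\<in>mod_hom R (free_mod R S) N"
proof -
 interpret module R N by fact
 let ?F = "free_mod R S"
 have supp: "finite {s. x s \<noteq> \<zero>[R]} & {s. x s \<noteq> \<zero>[R]} \<subseteq> S & (\<forall>s. x s\<in>carrier R)"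
  if "x\<in>carrier ?F" for x using that by (auto simp: free_mod_def)
 show ?thesis unfolding mod_hom_def
 proof (safe)
  fix x assume x: "x\<in>carrier ?F"
  show "free_lift R N g x\<in>carrier N" unfolding free_lift_def
   using supp[OF x] assms(2) by (intro M.finsum_closed) auto
  fix y assume y: "y\<in>carrier ?F"
  let ?T = "{s. x s \<noteq> \<zero>[R]} \<union> {s. y s \<noteq> \<zero>[R]}"
  have xy: "x +[?F] y\<in>carrier ?F"
   using module.axioms(2)[OF free_module[OF cring_axioms, of S]] x y
   by (simp add: abelian_group_def abelian_monoid.a_closed)
  have T: "finite ?T" "?T \<subseteq> S" using supp[OF x] supp[OF y] by auto
  have "free_lift R N g (x +[?F] y) = (\<Oplus>\<^bsub>N\<^esub>s\<in>?T. (x s +[R] y s) *[N] g s)"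
   by (subst free_lift_over[OF assms(1) xy assms(2) T(1) _ T(2)]) (auto simp: free_mod_def)
  also have "\<dots> = (\<Oplus>\<^bsub>N\<^esub>s\<in>?T. x s *[N] g s +[N] y s *[N] g s)"
   using supp[OF x] supp[OF y] assms(2) T
   by (intro M.finsum_cong') (auto simp: smult_l_distr Pi_iff subset_iff)
  also have "\<dots> = (\<Oplus>\<^bsub>N\<^esub>s\<in>?T. x s *[N] g s) +[N] (\<Oplus>\<^bsub>N\<^esub>s\<in>?T. y s *[N] g s)"
   using supp[OF x] supp[OF y] assms(2) T
   by (intro M.finsum_addf) (auto simp: Pi_iff subset_iff)
  also have "\<dots> = free_lift R N g x +[N] free_lift R N g y"
   by (subst (1 2) free_lift_over[OF assms(1) _ assms(2) T(1) _ T(2)]) (auto simp: x y)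
  finally show "free_lift R N g (x +[?F] y) = free_lift R N g x +[N] free_lift R N g y" .
 next
  fix c x assume c: "c\<in>carrier R" and x: "x\<in>carrier ?F"
  let ?T = "{s. x s \<noteq> \<zero>[R]}"
  have cx: "c *[?F] x\<in>carrier ?F"
   using module.smult_closed[OF free_module[OF cring_axioms, of S]] c x by simp
  have T: "finite ?T" "?T \<subseteq> S" using supp[OF x] by auto
  have "free_lift R N g (c *[?F] x) = (\<Oplus>\<^bsub>N\<^esub>s\<in>?T. (c \<otimes>[R] x s) *[N] g s)"
   by (subst free_lift_over[OF assms(1) cx assms(2) T(1) _ T(2)]) (auto simp: free_mod_def c)
  also have "\<dots> = (\<Oplus>\<^bsub>N\<^esub>s\<in>?T. c *[N] (x s *[N] g s))"
   using supp[OF x] assms(2) T c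
   by (intro M.finsum_cong') (auto simp: smult_assoc1 Pi_iff subset_iff)
  also have "\<dots> = c *[N] free_lift R N g x" unfolding free_lift_def
   using supp[OF x] assms(2) T c
   by (intro finsum_smult_ldistr[symmetric]) (auto simp: Pi_iff subset_iff)
  finally show "free_lift R N g (c *[?F] x) = c *[N] free_lift R N g x" .
 qed
qed

lemma free_lift_gen:
 assumes "module R N" "g\<in>S \<rightarrow> carrier N" "s\<in>S"
 shows "free_lift R N g (free_gen R s) = g s"
proof -
 interpret module R N by fact
 have "free_lift R N g (free_gen R s) = (\<Oplus>\<^bsub>N\<^esub>t\<in>{s}. free_gen R s t *[N] g t)"
  by (rule free_lift_over[OF assms(1) free_gen_closed[OF cring_axioms assms(3)] assms(2)])
   (use assms in \<open>auto simp: free_gen_def\<close>)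
 also have "\<dots> = g s"
 proof -
  have "free_gen R s s *[N] g s = g s" "g s\<in>carrier N"
   using assms by (auto simp: free_gen_def Pi_iff)
  then show ?thesis by simp
 qed
 finally show ?thesis .
qed

text \<open>Induction on the finite support: an element is the sum of its part at one generator
  \<open>t\<close> and of the element with the coordinate at \<open>t\<close> erased.\<close>

lemma free_mod_span:
 assumes "cring R"
 shows "mod_span R (free_mod R S) (free_gen R ` S) = carrier (free_mod R S)"
proof -
 interpret cring R by fact
 interpret F: module R "free_mod R S" by (rule free_module[OF assms])
 have gens: "free_gen R ` S \<subseteq> carrier (free_mod R S)" using free_gen_closed[OF assms] by auto
 let ?N = "mod_span R (free_mod R S) (free_gen R ` S)"
 have N: "submodule ?N R (free_mod R S)" by (rule mod_span_submodule[OF F.module_axioms gens])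
 note Nf = submodule_facts[OF F.module_axioms N]
 have "x\<in>?N" if "finite T" "x\<in>carrier (free_mod R S)" "{s. x s \<noteq> \<zero>[R]} = T" for x T
  using that
 proof (induction T arbitrary: x rule: finite_induct)
  case empty
  then have "x = \<zero>[free_mod R S]" by (auto simp: free_mod_def)
  then show ?case using Nf(2) by simp
 next
  case (insert t T)
  let ?y = "x(t := \<zero>[R])"
  have T: "{s. ?y s \<noteq> \<zero>[R]} = T" using insert.hyps insert.prems(2) by auto
  have y: "?y\<in>carrier (free_mod R S)" using insert.prems(1) insert.hyps(1) T
   by (auto simp: free_mod_def)
  have t: "t\<in>S" "x t\<in>carrier R" using insert.prems by (auto simp: free_mod_def)
  have x: "x = ?y +[free_mod R S] (x t *[free_mod R S] free_gen R t)"
   using insert.prems(1) t by (auto simp: free_mod_def free_gen_def fun_eq_iff)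
  have "?y\<in>?N" by (rule insert.IH[OF y T])
  moreover have "x t *[free_mod R S] free_gen R t\<in>?N"
   using t mod_span_superset[of "free_gen R ` S" R "free_mod R S"] by (intro Nf(6)) auto
  ultimately have "?y +[free_mod R S] (x t *[free_mod R S] free_gen R t)\<in>?N" by (rule Nf(4))
  then show ?case by (simp only: x[symmetric])
 qed
 then have "carrier (free_mod R S) \<subseteq> ?N" by (auto simp: free_mod_def)
 then show ?thesis using Nf(1) by blast
qed

subsection \<open>Tensor products\<close>

lemma (in abelian_group) diff_eq_zero_iff:
 assumes "x\<in>carrier G" "y\<in>carrier G"
 shows "x \<ominus> y = \<zero> \<longleftrightarrow> x = y"
 using assms minus_equality[of x "\<ominus> y"] by (auto simp: a_minus_def r_neg)

text \<open>Bilinearity in every pair of degrees \<open>i\<close> and \<open>n - i\<close>. After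
  the typing clause, each clause matches one family of relations in \<open>trels\<close>, so that
  these are the conditions for a linear map out of the tensor product.\<close>

definition balanced ::
 "'r ring => ('r, 'a) fcomplex => ('r, 'b) fcomplex => int => ('r, 'c) module =>
  (int \<times> 'a \<times> 'b => 'c) => bool" where
 "balanced R A B n N g \<longleftrightarrow>
   (\<forall>i. \<forall>a\<in>grade A i. \<forall>b\<in>grade B (n - i). g (i, a, b)\<in>carrier N) &
   (\<forall>i. \<forall>a\<in>grade A i. \<forall>a'\<in>grade A i. \<forall>b\<in>grade B (n - i).
    g (i, a +[md A i] a', b) = g (i, a, b) +[N] g (i, a', b)) &
   (\<forall>i. \<forall>a\<in>grade A i. \<forall>b\<in>grade B (n - i). \<forall>b'\<in>grade B (n - i).
    g (i, a, b +[md B (n - i)] b') = g (i, a, b) +[N] g (i, a, b')) &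
   (\<forall>i. \<forall>a\<in>grade A i. \<forall>b\<in>grade B (n - i). \<forall>c\<in>carrier R.
    g (i, c *[md A i] a, b) = c *[N] g (i, a, b)) &
   (\<forall>i. \<forall>a\<in>grade A i. \<forall>b\<in>grade B (n - i). \<forall>c\<in>carrier R.
    g (i, a, c *[md B (n - i)] b) = c *[N] g (i, a, b))"

text \<open>Only the graded modules are assumed, not differentials or filtrations, so that iterated
  tensor products fit without first being shown to be filtered complexes.\<close>

locale tensor_setup =
 fixes R :: "'r ring" and A :: "('r, 'a) fcomplex" and B :: "('r, 'b) fcomplex"
 assumes cring: "cring R" and modA: "!!n. module R (md A n)" and modB: "!!n. module R (md B n)"
begin

lemma A_closed:
 "a\<in>grade A i==>a'\<in>grade A i==>a +[md A i] a'\<in>grade A i"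
 "c\<in>carrier R==>a\<in>grade A i==>c *[md A i] a\<in>grade A i"
proof -
 interpret module R "md A i" by (rule modA)
 show "a\<in>grade A i==>a'\<in>grade A i==>a +[md A i] a'\<in>grade A i"
  "c\<in>carrier R==>a\<in>grade A i==>c *[md A i] a\<in>grade A i" by auto
qed

lemma B_closed:
 "a\<in>grade B i==>a'\<in>grade B i==>a +[md B i] a'\<in>grade B i"
 "c\<in>carrier R==>a\<in>grade B i==>c *[md B i] a\<in>grade B i"
proof -
 interpret module R "md B i" by (rule modB)
 show "a\<in>grade B i==>a'\<in>grade B i==>a +[md B i] a'\<in>grade B i"
  "c\<in>carrier R==>a\<in>grade B i==>c *[md B i] a\<in>grade B i" by auto
qed

lemma tfree_module: "module R (tfree R A B n)"
 unfolding tfree_def by (rule free_module[OF cring])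

lemma gen_closed:
 "a\<in>grade A i==>b\<in>grade B (n - i) ==>
  free_gen R (i, a, b)\<in>carrier (tfree R A B n)"
 unfolding tfree_def by (rule free_gen_closed[OF cring]) (auto simp: tgens_def)

lemma trels_subset: "trels R A B n \<subseteq> carrier (tfree R A B n)"
proof -
 interpret F: module R "tfree R A B n" by (rule tfree_module)
 show ?thesis unfolding trels_def Let_def
  by (auto intro!: gen_closed A_closed B_closed)
qed

abbreviation rel_span where
 "rel_span n \<equiv> mod_span R (tfree R A B n) (trels R A B n)"

lemma quot: "quotient_module R (tfree R A B n) (rel_span n)"
 by (rule quotient_module.intro[OF tfree_module mod_span_submodule[OF tfree_module trels_subset]])

lemma tmod_module: "module R (tmod R A B n)"
 unfolding tmod_def by (rule quotient_module.quot_module[OF quot])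

lemma pure_closed:
 "a\<in>grade A i==>b\<in>grade B (n - i) ==>
  pure R A B n (i, a, b)\<in>carrier (tmod R A B n)"
 unfolding tmod_def pure_def quotient_module.carrier_quot[OF quot] using gen_closed by blast

lemma pure_eqI:
 assumes "x\<in>carrier (tfree R A B n)" "y\<in>carrier (tfree R A B n)"
  "x -[tfree R A B n] y\<in>trels R A B n"
 shows "rel_span n +>\<^bsub>tfree R A B n\<^esub> x = rel_span n +>\<^bsub>tfree R A B n\<^esub> y"
 using assms mod_span_superset[of "trels R A B n"] quotient_module.coset_eq_iff[OF quot assms(1,2)]
 by blast

lemma balanced_pure: "balanced R A B n (tmod R A B n) (pure R A B n)"
proof -
 interpret F: module R "tfree R A B n" by (rule tfree_module)
 note q = quotient_module.quot_add[OF quot, symmetric] quotient_module.quot_smult[OF quot, symmetric]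
 show ?thesis unfolding balanced_def
 proof (intro conjI allI ballI)
  fix i a b assume ab: "a\<in>grade A i" "b\<in>grade B (n - i)"
  show "pure R A B n (i, a, b)\<in>carrier (tmod R A B n)" by (rule pure_closed[OF ab])
  note g = gen_closed
  { fix a' assume a': "a'\<in>grade A i"
   show "pure R A B n (i, a +[md A i] a', b) = pure R A B n (i, a, b) +[tmod R A B n] pure R A B n (i, a', b)"
    unfolding pure_def tmod_def
     quotient_module.quot_add[OF quot g[OF ab] g[OF a' ab(2)]]
    by (rule pure_eqI[OF g[OF A_closed(1)[OF ab(1) a'] ab(2)] F.a_closed[OF g[OF ab] g[OF a' ab(2)]]])
     (use ab a' in \<open>unfold trels_def Let_def, blast\<close>) }
  { fix b' assume b': "b'\<in>grade B (n - i)"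
   show "pure R A B n (i, a, b +[md B (n - i)] b') = pure R A B n (i, a, b) +[tmod R A B n] pure R A B n (i, a, b')"
    unfolding pure_def tmod_def
     quotient_module.quot_add[OF quot g[OF ab] g[OF ab(1) b']]
    by (rule pure_eqI[OF g[OF ab(1) B_closed(1)[OF ab(2) b']] F.a_closed[OF g[OF ab] g[OF ab(1) b']]])
     (use ab b' in \<open>unfold trels_def Let_def, blast\<close>) }
  fix c assume c: "c\<in>carrier R"
  show "pure R A B n (i, c *[md A i] a, b) = c *[tmod R A B n] pure R A B n (i, a, b)"
    unfolding pure_def tmod_def
     quotient_module.quot_smult[OF quot c g[OF ab]]
    by (rule pure_eqI[OF g[OF A_closed(2)[OF c ab(1)] ab(2)] F.smult_closed[OF c g[OF ab]]])
     (use ab c in \<open>unfold trels_def Let_def, blast\<close>)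
  show "pure R A B n (i, a, c *[md B (n - i)] b) = c *[tmod R A B n] pure R A B n (i, a, b)"
    unfolding pure_def tmod_def
     quotient_module.quot_smult[OF quot c g[OF ab]]
    by (rule pure_eqI[OF g[OF ab(1) B_closed(2)[OF c ab(2)]] F.smult_closed[OF c g[OF ab]]])
     (use ab c in \<open>unfold trels_def Let_def, blast\<close>)
 qed
qed

text \<open>The preimage of \<open>K\<close> in the free module is a submodule that contains the
  generators, hence it is everything.\<close>

lemma tmod_induct:
 assumes K: "submodule K R (tmod R A B n)"
  and p: "!!i a b. a\<in>grade A i==>b\<in>grade B (n - i)==>pure R A B n (i, a, b)\<in>K"
  and x: "x\<in>carrier (tmod R A B n)"
 shows "x\<in>K"
proof -
 let ?F = "tfree R A B n" and ?c = "%x. rel_span n +>\<^bsub>tfree R A B n\<^esub> x"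
 have h: "?c\<in>mod_hom R ?F (tmod R A B n)"
  unfolding tmod_def by (rule quotient_module.coset_hom[OF quot])
 have sub: "submodule {x\<in>carrier ?F. ?c x\<in>K} R ?F"
  by (rule submodule_vimage[OF tfree_module tmod_module h K])
 have "free_gen R ` tgens A B n \<subseteq> {x\<in>carrier ?F. ?c x\<in>K}"
  using p gen_closed unfolding tgens_def pure_def by auto
 then have "mod_span R ?F (free_gen R ` tgens A B n) \<subseteq> {x\<in>carrier ?F. ?c x\<in>K}"
  by (rule mod_span_least[OF sub])
 then have "carrier ?F \<subseteq> {x\<in>carrier ?F. ?c x\<in>K}"
  unfolding free_mod_span[OF cring, of "tgens A B n", folded tfree_def] .
 moreover obtain y where "y\<in>carrier ?F" "x = ?c y"
  using x unfolding tmod_def quotient_module.carrier_quot[OF quot] by blast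
 ultimately show ?thesis by blast
qed

lemma tmod_hom_eq:
 assumes "module R N" "f\<in>mod_hom R (tmod R A B n) N" "g\<in>mod_hom R (tmod R A B n) N"
  and "!!i a b. a\<in>grade A i==>b\<in>grade B (n - i) ==>
    f (pure R A B n (i, a, b)) = g (pure R A B n (i, a, b))"
  and x: "x\<in>carrier (tmod R A B n)"
 shows "f x = g x"
proof -
 have "x\<in>{x\<in>carrier (tmod R A B n). f x = g x}"
  by (rule tmod_induct[OF submodule_equalizer[OF tmod_module assms(1-3)] _ x])
   (use assms(4) pure_closed in auto)
 then show ?thesis by simp
qed

text \<open>The kernel of the lift is a submodule, so it is enough that it contains the generating
  relations, each of which is handled by one clause of \<open>balanced\<close>.\<close>

lemma balanced_kills:
 assumes N: "module R N" and g: "balanced R A B n N g" and x: "x\<in>rel_span n"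
 shows "free_lift R N g x = \<zero>[N]"
proof -
 interpret N: module R N by fact
 interpret F: module R "tfree R A B n" by (rule tfree_module)
 let ?F = "tfree R A B n" and ?l = "free_lift R N g"
 have gens: "g\<in>tgens A B n \<rightarrow> carrier N" using g unfolding balanced_def tgens_def by auto
 have l: "?l\<in>mod_hom R ?F N" unfolding tfree_def by (rule free_lift_hom[OF N gens])
 have lg: "?l (free_gen R (i, a, b)) = g (i, a, b)"
  if "a\<in>grade A i" "b\<in>grade B (n - i)" for i a b
  by (rule free_lift_gen[OF N gens]) (use that in \<open>auto simp: tgens_def\<close>)
 have ladd: "?l (x +[?F] y) = ?l x +[N] ?l y" if "x\<in>carrier ?F" "y\<in>carrier ?F" for x y
  using l that by (auto simp: mod_hom_def)
 have lsm: "?l (c *[?F] y) = c *[N] ?l y" if "c\<in>carrier R" "y\<in>carrier ?F" for c y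
  using l that by (auto simp: mod_hom_def)
 note ld = mod_hom_diff[OF tfree_module N l]
 have gc: "g (i, a, b)\<in>carrier N" if "a\<in>grade A i" "b\<in>grade B (n - i)" for i a b
  using g that unfolding balanced_def by blast
 have ms: "y -[N] y = \<zero>[N]" if "y\<in>carrier N" for y using that by (simp add: a_minus_def N.r_neg)
 let ?K = "{x\<in>carrier ?F. ?l x = \<zero>[N]}"
 have K: "submodule ?K R ?F" unfolding submodule_iff[OF tfree_module]
  using mod_hom_zero[OF tfree_module N l] ladd lsm by auto
 have "trels R A B n \<subseteq> ?K"
 proof
  fix x assume x: "x\<in>trels R A B n"
  then have xF: "x\<in>carrier ?F" using trels_subset by blast
  from x consider
   (1) i a a' b where "x = free_gen R (i, a +[md A i] a', b) -[?F] (free_gen R (i, a, b) +[?F] free_gen R (i, a', b))"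
    "a\<in>grade A i" "a'\<in>grade A i" "b\<in>grade B (n - i)"
  | (2) i a b b' where "x = free_gen R (i, a, b +[md B (n - i)] b') -[?F] (free_gen R (i, a, b) +[?F] free_gen R (i, a, b'))"
    "a\<in>grade A i" "b\<in>grade B (n - i)" "b'\<in>grade B (n - i)"
  | (3) i a b c where "x = free_gen R (i, c *[md A i] a, b) -[?F] (c *[?F] free_gen R (i, a, b))"
    "a\<in>grade A i" "b\<in>grade B (n - i)" "c\<in>carrier R"
  | (4) i a b c where "x = free_gen R (i, a, c *[md B (n - i)] b) -[?F] (c *[?F] free_gen R (i, a, b))"
    "a\<in>grade A i" "b\<in>grade B (n - i)" "c\<in>carrier R"
   unfolding trels_def Let_def by blast
  then have "?l x = \<zero>[N]"
  proof cases
   case 1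
   then show ?thesis using g
    by (simp add: ld ladd lg gen_closed A_closed gc balanced_def ms)
  next
   case 2
   then show ?thesis using g
    by (simp add: ld ladd lg gen_closed B_closed gc balanced_def ms)
  next
   case 3
   then show ?thesis using g
    by (simp add: ld lsm lg gen_closed A_closed gc balanced_def ms)
  next
   case 4
   then show ?thesis using g
    by (simp add: ld lsm lg gen_closed B_closed gc balanced_def ms)
  qed
  then show "x\<in>?K" using xF by blast
 qed
 then show ?thesis using mod_span_least[OF K] x by blast
qed

text \<open>\<open>tlift\<close> evaluates at a representative picked by \<open>SOME\<close>. Any
  other representative differs from it by an element of the span of the relations, where the lift
  vanishes.\<close>

lemma tlift_coset:
 assumes N: "module R N" and g: "balanced R A B n N g" and x: "x\<in>carrier (tfree R A B n)"
 shows "tlift R A B n N g (rel_span n +>\<^bsub>tfree R A B n\<^esub> x) = free_lift R N g x"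
proof -
 interpret N: module R N by fact
 let ?F = "tfree R A B n" and ?l = "free_lift R N g"
 let ?X = "rel_span n +>\<^bsub>?F\<^esub> x"
 have gens: "g\<in>tgens A B n \<rightarrow> carrier N" using g unfolding balanced_def tgens_def by auto
 have l: "?l\<in>mod_hom R ?F N" unfolding tfree_def by (rule free_lift_hom[OF N gens])
 have lc: "!!x. x\<in>carrier ?F==>?l x\<in>carrier N" using l by (auto simp: mod_hom_def)
 have XX: "?X\<in>carrier (tmod R A B n)"
  unfolding tmod_def quotient_module.carrier_quot[OF quot] using x by blast
 have "x\<in>?X" by (rule quotient_module.coset_self[OF quot x])
 then have "(SOME y. y\<in>?X)\<in>?X" by (rule someI[of "%y. y\<in>?X"])
 then obtain y where y: "(SOME y. y\<in>?X) = y" "y\<in>carrier ?F" "?X = rel_span n +>\<^bsub>?F\<^esub> y"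
  using quotient_module.coset_memD[OF quot x] by blast
 then have "x -[?F] y\<in>rel_span n" using quotient_module.coset_eq_iff[OF quot x y(2)] by blast
 then have "?l x -[N] ?l y = \<zero>[N]"
  using balanced_kills[OF N g] mod_hom_diff[OF tfree_module N l x y(2)] by metis
 then have "?l y = ?l x" using lc x y(2) by (simp add: N.diff_eq_zero_iff)
 then show ?thesis unfolding tlift_def using XX y(1) by simp
qed

lemma tlift_pure:
 assumes N: "module R N" and g: "balanced R A B n N g"
  and ab: "a\<in>grade A i" "b\<in>grade B (n - i)"
 shows "tlift R A B n N g (pure R A B n (i, a, b)) = g (i, a, b)"
proof -
 have gens: "g\<in>tgens A B n \<rightarrow> carrier N" using g unfolding balanced_def tgens_def by auto
 show ?thesis unfolding pure_def tlift_coset[OF N g gen_closed[OF ab]]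
  by (rule free_lift_gen[OF N gens]) (use ab in \<open>auto simp: tgens_def\<close>)
qed

lemma tlift_hom:
 assumes N: "module R N" and g: "balanced R A B n N g"
 shows "tlift R A B n N g\<in>mod_hom R (tmod R A B n) N"
proof -
 let ?F = "tfree R A B n" and ?l = "free_lift R N g" and ?c = "%x. rel_span n +>\<^bsub>tfree R A B n\<^esub> x"
 interpret F: module R ?F by (rule tfree_module)
 have gens: "g\<in>tgens A B n \<rightarrow> carrier N" using g unfolding balanced_def tgens_def by auto
 have l: "?l\<in>mod_hom R ?F N" unfolding tfree_def by (rule free_lift_hom[OF N gens])
 note cq = quotient_module.carrier_quot[OF quot]
 note tc = tlift_coset[OF N g]
 show ?thesis unfolding mod_hom_def
 proof (intro CollectI conjI ballI funcsetI)
  fix X assume "X\<in>carrier (tmod R A B n)"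
  then obtain x where x: "x\<in>carrier ?F" "X = ?c x" unfolding tmod_def cq by blast
  show "tlift R A B n N g X\<in>carrier N" unfolding x(2) tc[OF x(1)] using l x by (auto simp: mod_hom_def)
  { fix Y assume "Y\<in>carrier (tmod R A B n)"
   then obtain y where y: "y\<in>carrier ?F" "Y = ?c y" unfolding tmod_def cq by blast
   show "tlift R A B n N g (X +[tmod R A B n] Y) = tlift R A B n N g X +[N] tlift R A B n N g Y"
    unfolding x(2) y(2) tmod_def quotient_module.quot_add[OF quot x(1) y(1)]
     tc[OF x(1)] tc[OF y(1)] tc[OF F.a_closed[OF x(1) y(1)]]
    using l x y by (auto simp: mod_hom_def) }
  fix c assume c: "c\<in>carrier R"
  show "tlift R A B n N g (c *[tmod R A B n] X) = c *[N] tlift R A B n N g X"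
   unfolding x(2) tmod_def quotient_module.quot_smult[OF quot c x(1)]
    tc[OF x(1)] tc[OF F.smult_closed[OF c x(1)]]
   using l x c by (auto simp: mod_hom_def)
 qed
qed

lemma tlift_extensional: "tlift R A B n N g\<in>extensional (carrier (tmod R A B n))"
 unfolding tlift_def by simp

end

subsection \<open>Algebras in terms of homogeneous multiplication\<close>

lemma fcxD:
 assumes "fcx R A"
 shows "module R (md A n)" "df A n\<in>mod_hom R (md A n) (md A (n + 1))"
  "x\<in>grade A n==>df A n x\<in>grade A (n + 1)"
  "x\<in>grade A n==>df A (n + 1) (df A n x) = \<zero>[md A (n + 1 + 1)]"
  "submodule (fil A p n) R (md A n)" "fil A p n \<subseteq> fil A (p + 1) n"
  "x\<in>fil A p n==>df A n x\<in>fil A p (n + 1)"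
  "x\<in>fil A p n==>x\<in>grade A n"
proof -
 show 1: "module R (md A n)" and 2: "submodule (fil A p n) R (md A n)"
  using assms by (simp_all add: is_fcomplex_def)
 show "x\<in>fil A p n==>x\<in>grade A n" using submodule_facts(1)[OF 1 2] by (rule subsetD)
 show 3: "df A n\<in>mod_hom R (md A n) (md A (n + 1))" using assms by (simp add: is_fcomplex_def)
 then show "x\<in>grade A n==>df A n x\<in>grade A (n + 1)"
  by (auto simp: mod_hom_def)
 show "x\<in>grade A n==>df A (n + 1) (df A n x) = \<zero>[md A (n + 1 + 1)]"
  "fil A p n \<subseteq> fil A (p + 1) n"
  using assms by (simp_all add: is_fcomplex_def)
 have "df A n ` fil A p n \<subseteq> fil A p (n + 1)" using assms by (simp add: is_fcomplex_def)
 then show "x\<in>fil A p n==>df A n x\<in>fil A p (n + 1)" by auto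
qed

lemma mod_hom_comp:
 "f\<in>mod_hom R M N==>g\<in>mod_hom R N K==>(%x. g (f x))\<in>mod_hom R M K"
 unfolding mod_hom_def by (auto simp: Pi_iff)

lemma mod_homD:
 assumes "f\<in>mod_hom R M N"
 shows "x\<in>carrier M==>f x\<in>carrier N"
  "x\<in>carrier M==>y\<in>carrier M==>f (x +[M] y) = f x +[N] f y"
  "c\<in>carrier R==>x\<in>carrier M==>f (c *[M] x) = c *[N] f x"
 using assms unfolding mod_hom_def by auto

lemma mod_hom_add:
 assumes "module R M" "module R N" "f\<in>mod_hom R M N" "g\<in>mod_hom R M N"
 shows "(%x. f x +[N] g x)\<in>mod_hom R M N"
proof -
 interpret N: module R N by fact
 note f = mod_homD[OF assms(3)] and g = mod_homD[OF assms(4)]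
 show ?thesis unfolding mod_hom_def
  by (auto simp: f g N.smult_r_distr N.a_ac)
qed

lemma mod_hom_smult:
 assumes "module R M" "module R N" "f\<in>mod_hom R M N" "c\<in>carrier R"
 shows "(%x. c *[N] f x)\<in>mod_hom R M N"
proof -
 interpret N: module R N by fact
 note f = mod_homD[OF assms(3)]
 have "c *[N] (d *[N] f x) = d *[N] (c *[N] f x)" if "d\<in>carrier R" "x\<in>carrier M" for d x
  using that f assms(4) N.smult_assoc1[of c d "f x"] N.smult_assoc1[of d c "f x"] N.R.m_comm[of c d]
  by simp
 then show ?thesis unfolding mod_hom_def
  using assms(4) by (auto simp: f N.smult_r_distr)
qed

lemma koszul_sign_closed: "cring R==>koszul_sign R i\<in>carrier R"
 unfolding koszul_sign_def by (auto intro: cring.cring_simprules)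

text \<open>The complementary degree is a variable \<open>j\<close> subject to an equation, so that
  a clause also applies where the degree at hand equals \<open>n - i\<close> only after
  arithmetic.\<close>

lemma balancedD:
 assumes "balanced R A B n N g" "j = n - i"
 shows "a\<in>grade A i==>b\<in>grade B j==>g (i, a, b)\<in>carrier N"
  "a\<in>grade A i==>a'\<in>grade A i==>b\<in>grade B j ==>
   g (i, a +[md A i] a', b) = g (i, a, b) +[N] g (i, a', b)"
  "a\<in>grade A i==>b\<in>grade B j==>b'\<in>grade B j ==>
   g (i, a, b +[md B j] b') = g (i, a, b) +[N] g (i, a, b')"
  "a\<in>grade A i==>b\<in>grade B j==>c\<in>carrier R ==>
   g (i, c *[md A i] a, b) = c *[N] g (i, a, b)"
  "a\<in>grade A i==>b\<in>grade B j==>c\<in>carrier R ==>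
   g (i, a, c *[md B j] b) = c *[N] g (i, a, b)"
 using assms by (simp_all add: balanced_def)

section \<open>Maps, differential and associator of tensor products, on pure tensors\<close>

locale tensor_map_setup = D: tensor_setup R A B + T: tensor_setup R A' B'
 for R :: "'r ring" and A :: "('r, 'a) fcomplex" and B :: "('r, 'b) fcomplex"
  and A' :: "('r, 'c) fcomplex" and B' :: "('r, 'd) fcomplex" +
 fixes f g
 assumes f: "!!n. f n\<in>mod_hom R (md A n) (md A' n)"
  and g: "!!n. g n\<in>mod_hom R (md B n) (md B' n)"
begin

lemma map_balanced:
 "balanced R A B n (tmod R A' B' n) (%(i, a, b). pure R A' B' n (i, f i a, g (n - i) b))"
 unfolding balanced_def by (simp add: balancedD[OF T.balanced_pure refl] mod_homD[OF f] mod_homD[OF g])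

lemma map_hom: "tensor_map R A B A' B' f g n\<in>mod_hom R (tmod R A B n) (tmod R A' B' n)"
 unfolding tensor_map_def by (rule D.tlift_hom[OF T.tmod_module map_balanced])

lemma map_pure:
 "a\<in>grade A i==>b\<in>grade B (n - i) ==>
  tensor_map R A B A' B' f g n (pure R A B n (i, a, b)) = pure R A' B' n (i, f i a, g (n - i) b)"
 unfolding tensor_map_def by (subst D.tlift_pure[OF T.tmod_module map_balanced]) auto

end

context tensor_setup begin

lemma df_balanced:
 assumes dA: "!!n. df A n\<in>mod_hom R (md A n) (md A (n + 1))"
  and dB: "!!n. df B n\<in>mod_hom R (md B n) (md B (n + 1))"
 shows "balanced R A B n (tmod R A B (n + 1)) (%(i, a, b).
      pure R A B (n + 1) (i + 1, df A i a, b) +[tmod R A B (n + 1)]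
      koszul_sign R i *[tmod R A B (n + 1)] pure R A B (n + 1) (i, a, df B (n - i) b))"
proof -
 let ?T = "tmod R A B (n + 1)"
 interpret T: module R ?T by (rule tmod_module)
 \<comment> \<open>The two summands of the differential split the degree \<open>n + 1\<close> as
   \<open>i + 1\<close> and \<open>n - i\<close>, and as \<open>i\<close> and
   \<open>n - i + 1\<close>.\<close>
 have e1: "n + 1 - (i + 1) = n - i" for i :: int by simp
 have e2: "n + 1 - i = n - i + 1" for i :: int by simp
 note dAs = mod_homD[OF dA] and dBs = mod_homD[OF dB]
 note ks = koszul_sign_closed[OF cring]
 have P1: "pure R A B (n + 1) (i + 1, df A i a, b)\<in>carrier ?T"
  "a'\<in>grade A i==>pure R A B (n + 1) (i + 1, df A i (a +[md A i] a'), b) =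
    pure R A B (n + 1) (i + 1, df A i a, b) +[?T] pure R A B (n + 1) (i + 1, df A i a', b)"
  "b'\<in>grade B (n - i)==>pure R A B (n + 1) (i + 1, df A i a, b +[md B (n - i)] b') =
    pure R A B (n + 1) (i + 1, df A i a, b) +[?T] pure R A B (n + 1) (i + 1, df A i a, b')"
  "c\<in>carrier R==>pure R A B (n + 1) (i + 1, df A i (c *[md A i] a), b) =
    c *[?T] pure R A B (n + 1) (i + 1, df A i a, b)"
  "c\<in>carrier R==>pure R A B (n + 1) (i + 1, df A i a, c *[md B (n - i)] b) =
    c *[?T] pure R A B (n + 1) (i + 1, df A i a, b)"
  if "a\<in>grade A i" "b\<in>grade B (n - i)" for i a b a' b' c
  by (simp_all add: balancedD[OF balanced_pure e1[symmetric]] that dAs)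
 have P2: "pure R A B (n + 1) (i, a, df B (n - i) b)\<in>carrier ?T"
  "a'\<in>grade A i==>pure R A B (n + 1) (i, a +[md A i] a', df B (n - i) b) =
    pure R A B (n + 1) (i, a, df B (n - i) b) +[?T] pure R A B (n + 1) (i, a', df B (n - i) b)"
  "b'\<in>grade B (n - i)==>pure R A B (n + 1) (i, a, df B (n - i) (b +[md B (n - i)] b')) =
    pure R A B (n + 1) (i, a, df B (n - i) b) +[?T] pure R A B (n + 1) (i, a, df B (n - i) b')"
  "c\<in>carrier R==>pure R A B (n + 1) (i, c *[md A i] a, df B (n - i) b) =
    c *[?T] pure R A B (n + 1) (i, a, df B (n - i) b)"
  "c\<in>carrier R==>pure R A B (n + 1) (i, a, df B (n - i) (c *[md B (n - i)] b)) =
    c *[?T] pure R A B (n + 1) (i, a, df B (n - i) b)"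
  if "a\<in>grade A i" "b\<in>grade B (n - i)" for i a b a' b' c
  by (simp_all add: balancedD[OF balanced_pure e2[symmetric]] that dBs)
 have swap: "k *[?T] (c *[?T] x) = c *[?T] (k *[?T] x)" if "k\<in>carrier R" "c\<in>carrier R" "x\<in>carrier ?T" for k c x
  using that T.smult_assoc1[of c k x] T.smult_assoc1[of k c x] T.R.m_comm[of c k] by simp
 show ?thesis unfolding balanced_def
  by (simp add: P1 P2 ks T.smult_r_distr T.a_ac swap)
qed

lemma df_hom:
 assumes "!!n. df A n\<in>mod_hom R (md A n) (md A (n + 1))" "!!n. df B n\<in>mod_hom R (md B n) (md B (n + 1))"
 shows "df (tensor R A B) n\<in>mod_hom R (tmod R A B n) (tmod R A B (n + 1))"
 unfolding tensor_def fcomplex.simps by (rule tlift_hom[OF tmod_module df_balanced[OF assms]])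

lemma df_pure:
 assumes "!!n. df A n\<in>mod_hom R (md A n) (md A (n + 1))" "!!n. df B n\<in>mod_hom R (md B n) (md B (n + 1))"
  and ab: "a\<in>grade A i" "b\<in>grade B (n - i)"
 shows "df (tensor R A B) n (pure R A B n (i, a, b)) =
  pure R A B (n + 1) (i + 1, df A i a, b) +[tmod R A B (n + 1)]
      koszul_sign R i *[tmod R A B (n + 1)] pure R A B (n + 1) (i, a, df B (n - i) b)"
 unfolding tensor_def fcomplex.simps tlift_pure[OF tmod_module df_balanced[OF assms(1,2)] ab] by simp

end

locale associator_setup = AB: tensor_setup R A B + BC: tensor_setup R B C
 for R :: "'r ring" and A :: "('r, 'a) fcomplex" and B :: "('r, 'b) fcomplex"
  and C :: "('r, 'c) fcomplex"
begin

lemma md_tensor [simp]: "md (tensor S X Y) = tmod S X Y"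
 by (simp add: tensor_def)

sublocale AB_C: tensor_setup R "tensor R A B" C
 by (rule tensor_setup.intro) (simp_all add: AB.cring AB.tmod_module BC.modB)

sublocale A_BC: tensor_setup R A "tensor R B C"
 by (rule tensor_setup.intro) (simp_all add: AB.cring BC.tmod_module AB.modA)

abbreviation N where "N \<equiv> tmod R A (tensor R B C)"

definition inner where
 "inner n j c = (%(i, a, b). pure R A (tensor R B C) n (i, a, pure R B C (n - i) (j - i, b, c)))"

lemma inner_balanced:
 assumes "c\<in>grade C (n - j)"
 shows "balanced R A B j (N n) (inner n j c)"
proof -
 note o = balancedD[OF A_BC.balanced_pure[of n] refl, unfolded md_tensor]
 have e: "n - i - (j - i) = n - j" for i by simp
 note i = balancedD[OF BC.balanced_pure e[symmetric]]
 show ?thesis using assms unfolding balanced_def inner_def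
  by (simp add: o i e)
qed

lemma inner_add:
 assumes "a\<in>grade A i" "b\<in>grade B (j - i)"
  "c\<in>grade C (n - j)" "c'\<in>grade C (n - j)"
 shows "inner n j (c +[md C (n - j)] c') (i, a, b) = inner n j c (i, a, b) +[N n] inner n j c' (i, a, b)"
proof -
 note o = balancedD[OF A_BC.balanced_pure[of n] refl, unfolded md_tensor]
 have e: "n - i - (j - i) = n - j" for i by simp
 note i = balancedD[OF BC.balanced_pure e[symmetric]]
 have "pure R B C (n - i) (j - i, b, c +[md C (n - j)] c') =
  pure R B C (n - i) (j - i, b, c) +[tmod R B C (n - i)] pure R B C (n - i) (j - i, b, c')"
  by (simp add: i assms)
 moreover have "pure R B C (n - i) (j - i, b, c)\<in>carrier (tmod R B C (n - i))"
  "pure R B C (n - i) (j - i, b, c')\<in>carrier (tmod R B C (n - i))"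
  by (simp_all add: i assms)
 ultimately show ?thesis unfolding inner_def by (simp add: o assms)
qed

lemma inner_smult:
 assumes "a\<in>grade A i" "b\<in>grade B (j - i)"
  "c\<in>grade C (n - j)" "d\<in>carrier R"
 shows "inner n j (d *[md C (n - j)] c) (i, a, b) = d *[N n] inner n j c (i, a, b)"
proof -
 note o = balancedD[OF A_BC.balanced_pure[of n] refl, unfolded md_tensor]
 have e: "n - i - (j - i) = n - j" for i by simp
 note i = balancedD[OF BC.balanced_pure e[symmetric]]
 have "pure R B C (n - i) (j - i, b, d *[md C (n - j)] c) =
  d *[tmod R B C (n - i)] pure R B C (n - i) (j - i, b, c)"
  by (simp add: i assms)
 moreover have "pure R B C (n - i) (j - i, b, c)\<in>carrier (tmod R B C (n - i))"
  by (simp_all add: i assms)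
 ultimately show ?thesis unfolding inner_def by (simp add: o assms)
qed

definition outer where
 "outer n = (%(j, t, c). tlift R A B j (N n) (inner n j c) t)"

text \<open>Linearity in \<open>t\<close> is that of the inner lift. Linearity in \<open>c\<close>
  compares two homomorphisms in the variable \<open>t\<close>, and is therefore checked on pure
  tensors.\<close>

lemma outer_balanced: "balanced R (tensor R A B) C n (N n) (outer n)"
 unfolding balanced_def
proof (intro conjI allI ballI, unfold md_tensor)
 interpret N: module R "N n" by (rule A_BC.tmod_module)
 fix j t c assume t: "t\<in>carrier (tmod R A B j)" and c: "c\<in>grade C (n - j)"
 note h = AB.tlift_hom[OF A_BC.tmod_module inner_balanced]
 note hc = mod_homD[OF h]
 note lp = AB.tlift_pure[OF A_BC.tmod_module inner_balanced]
 show "outer n (j, t, c)\<in>carrier (N n)" using hc(1)[OF c t] by (simp add: outer_def)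
 { fix t' assume t': "t'\<in>carrier (tmod R A B j)"
  show "outer n (j, t +[tmod R A B j] t', c) = outer n (j, t, c) +[N n] outer n (j, t', c)"
   using hc(2)[OF c t t'] by (simp add: outer_def) }
 { fix c' assume c': "c'\<in>grade C (n - j)"
  have cc: "c +[md C (n - j)] c'\<in>grade C (n - j)" by (rule BC.B_closed(1)[OF c c'])
  have "tlift R A B j (N n) (inner n j (c +[md C (n - j)] c')) t =
    tlift R A B j (N n) (inner n j c) t +[N n] tlift R A B j (N n) (inner n j c') t"
   by (rule AB.tmod_hom_eq[OF A_BC.tmod_module h[OF cc] mod_hom_add[OF AB.tmod_module A_BC.tmod_module h[OF c] h[OF c']] _ t])
    (simp add: lp[OF cc] lp[OF c] lp[OF c'] inner_add c c')
  then show "outer n (j, t, c +[md C (n - j)] c') = outer n (j, t, c) +[N n] outer n (j, t, c')"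
   by (simp add: outer_def) }
 fix d assume d: "d\<in>carrier R"
 show "outer n (j, d *[tmod R A B j] t, c) = d *[N n] outer n (j, t, c)"
  using hc(3)[OF c d t] by (simp add: outer_def)
 have cc: "d *[md C (n - j)] c\<in>grade C (n - j)" by (rule BC.B_closed(2)[OF d c])
 have "tlift R A B j (N n) (inner n j (d *[md C (n - j)] c)) t =
    d *[N n] tlift R A B j (N n) (inner n j c) t"
  by (rule AB.tmod_hom_eq[OF A_BC.tmod_module h[OF cc] mod_hom_smult[OF AB.tmod_module A_BC.tmod_module h[OF c] d] _ t])
   (simp add: lp[OF cc] lp[OF c] inner_smult c d)
 then show "outer n (j, t, d *[md C (n - j)] c) = d *[N n] outer n (j, t, c)"
  by (simp add: outer_def)
qed

lemma associator_eq: "associator R A B C n = tlift R (tensor R A B) C n (N n) (outer n)"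
 unfolding associator_def outer_def inner_def Let_def md_tensor ..

lemma associator_hom: "associator R A B C n\<in>mod_hom R (tmod R (tensor R A B) C n) (N n)"
 unfolding associator_eq by (rule AB_C.tlift_hom[OF A_BC.tmod_module outer_balanced])

lemma associator_pure:
 assumes "a\<in>grade A i" "b\<in>grade B (j - i)" "c\<in>grade C (n - j)"
 shows "associator R A B C n (pure R (tensor R A B) C n (j, pure R A B j (i, a, b), c)) =
  pure R A (tensor R B C) n (i, a, pure R B C (n - i) (j - i, b, c))"
proof -
 have p: "pure R A B j (i, a, b)\<in>grade (tensor R A B) j"
  using AB.pure_closed[OF assms(1,2)] by simp
 show ?thesis unfolding associator_eq AB_C.tlift_pure[OF A_BC.tmod_module outer_balanced p assms(3)]
  unfolding outer_def prod.case AB.tlift_pure[OF A_BC.tmod_module inner_balanced[OF assms(3)] assms(1,2)]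
  by (simp add: inner_def)
qed

end

section \<open>The unit complex and the elementwise laws of an algebra\<close>

lemma self_mod_module: "cring R==>module R (self_mod R)"
proof -
 assume "cring R"
 then interpret cring R .
 show ?thesis
  by (rule moduleI[OF cring_axioms], rule abelian_groupI)
   (auto simp: self_mod_def a_ac l_distr r_distr m_ac intro: l_neg)
qed

lemma zero_mod_module: "cring R==>module R (zero_mod R)"
proof -
 assume "cring R"
 then interpret cring R .
 show ?thesis
  by (rule moduleI[OF cring_axioms], rule abelian_groupI)
   (auto simp: zero_mod_def self_mod_def)
qed

lemma R_complex_fcomplex: "cring R==>fcx R (R_complex R p n)"
proof -
 assume R: "cring R"
 then interpret cring R .
 have m: "module R (md (R_complex R p n) k)" for k
  by (simp add: R_complex_def self_mod_module[OF R] zero_mod_module[OF R])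
 have "submodule (fil (R_complex R p n) q k) R (md (R_complex R p n) k)" for q k
  unfolding submodule_iff[OF m] by (auto simp: R_complex_def self_mod_def zero_mod_def)
 moreover have "df (R_complex R p n) k\<in>mod_hom R (md (R_complex R p n) k) (md (R_complex R p n) (k + 1))" for k
  by (auto simp: mod_hom_def R_complex_def self_mod_def zero_mod_def)
 ultimately show ?thesis unfolding is_fcomplex_def using m
  by (auto simp: R_complex_def self_mod_def zero_mod_def)
qed

definition fmul :: "'r ring => ('r, 'a) fdga => int => int => 'a => 'a => 'a" where
 "fmul R M i j a b = multn M (i + j) (pure R (cx M) (cx M) (i + j) (i, a, b))"

definition fone :: "'r ring => ('r, 'a) fdga => 'a" where
 "fone R M = unt M 0 \<one>[R]"

text \<open>The classical definition of a filtered differential graded algebra by elements, with the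
  degrees of the factors as explicit arguments of the product. The lemmas up to
  \<open>make_fdga\<close> identify it with the definition as a monoid.\<close>

definition dga_laws ::
 "'r ring => ('r, 'a) fcomplex => (int => int => 'a => 'a => 'a) => 'a => bool" where
 "dga_laws R A m e \<longleftrightarrow>
  (\<forall>i j. \<forall>a\<in>grade A i. \<forall>b\<in>grade A j. m i j a b\<in>grade A (i + j)) &
  (\<forall>i j. \<forall>a\<in>grade A i. \<forall>a'\<in>grade A i. \<forall>b\<in>grade A j.
    m i j (a +[md A i] a') b = m i j a b +[md A (i + j)] m i j a' b) &
  (\<forall>i j. \<forall>a\<in>grade A i. \<forall>b\<in>grade A j. \<forall>b'\<in>grade A j.
    m i j a (b +[md A j] b') = m i j a b +[md A (i + j)] m i j a b') &
  (\<forall>i j. \<forall>a\<in>grade A i. \<forall>b\<in>grade A j. \<forall>c\<in>carrier R.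
    m i j (c *[md A i] a) b = c *[md A (i + j)] m i j a b) &
  (\<forall>i j. \<forall>a\<in>grade A i. \<forall>b\<in>grade A j. \<forall>c\<in>carrier R.
    m i j a (c *[md A j] b) = c *[md A (i + j)] m i j a b) &
  (\<forall>i j k. \<forall>a\<in>grade A i. \<forall>b\<in>grade A j. \<forall>c\<in>grade A k.
    m (i + j) k (m i j a b) c = m i (j + k) a (m j k b c)) &
  e\<in>fil A 0 0 &
  (\<forall>n. \<forall>a\<in>grade A n. m 0 n e a = a) &
  (\<forall>n. \<forall>a\<in>grade A n. m n 0 a e = a) &
  (\<forall>i j. \<forall>a\<in>grade A i. \<forall>b\<in>grade A j.
    df A (i + j) (m i j a b) = m (i + 1) j (df A i a) b +[md A (i + j + 1)]
     koszul_sign R i *[md A (i + j + 1)] m i (j + 1) a (df A j b)) &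
  (\<forall>p q i j. \<forall>a\<in>fil A p i. \<forall>b\<in>fil A q j. m i j a b\<in>fil A (p + q) (i + j))"

lemma dga_lawsD:
 assumes "dga_laws R A m e"
 shows
  "a\<in>grade A i==>b\<in>grade A j==>m i j a b\<in>grade A (i + j)"
  "a\<in>grade A i==>a'\<in>grade A i==>b\<in>grade A j ==>
    m i j (a +[md A i] a') b = m i j a b +[md A (i + j)] m i j a' b"
  "a\<in>grade A i==>b\<in>grade A j==>b'\<in>grade A j ==>
    m i j a (b +[md A j] b') = m i j a b +[md A (i + j)] m i j a b'"
  "a\<in>grade A i==>b\<in>grade A j==>c\<in>carrier R ==>
    m i j (c *[md A i] a) b = c *[md A (i + j)] m i j a b"
  "a\<in>grade A i==>b\<in>grade A j==>c\<in>carrier R ==>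
    m i j a (c *[md A j] b) = c *[md A (i + j)] m i j a b"
  "a\<in>grade A i==>b\<in>grade A j==>x\<in>grade A k ==>
    m (i + j) k (m i j a b) x = m i (j + k) a (m j k b x)"
  "e\<in>fil A 0 0"
  "a\<in>grade A n==>m 0 n e a = a"
  "a\<in>grade A n==>m n 0 a e = a"
  "a\<in>grade A i==>b\<in>grade A j ==>
    df A (i + j) (m i j a b) = m (i + 1) j (df A i a) b +[md A (i + j + 1)]
     koszul_sign R i *[md A (i + j + 1)] m i (j + 1) a (df A j b)"
  "a\<in>fil A p i==>b\<in>fil A q j==>m i j a b\<in>fil A (p + q) (i + j)"
 using assms unfolding dga_laws_def by auto

text \<open>The product \<open>m\<close> is tied to \<open>\<mu>\<close> on homogeneous elements
  only. The locale thus serves in both directions: with \<open>m\<close> extracted from a given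
  monoid, and with \<open>m\<close> given and \<open>\<mu>\<close> built from it.\<close>

locale mult_setup =
 fixes R :: "'r ring" and A :: "('r, 'a) fcomplex" and \<mu> :: "int => ('r, 'a, 'a) tens => 'a"
  and m :: "int => int => 'a => 'a => 'a"
 assumes cring: "cring R" and fc: "fcx R A"
  and mu: "!!n. \<mu> n\<in>mod_hom R (tmod R A A n) (md A n)"
  and m_eq: "!!i j a b. a\<in>grade A i==>b\<in>grade A j ==>
   m i j a b = \<mu> (i + j) (pure R A A (i + j) (i, a, b))"
begin

sublocale associator_setup R A A A
 unfolding associator_setup_def tensor_setup_def using cring fcxD(1)[OF fc] by simp

lemma fmap_id_hom: "fmap_id A n\<in>mod_hom R (md A n) (md A n)"
proof -
 interpret module R "md A n" by (rule AB.modA)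
 show ?thesis by (auto simp: fmap_id_def mod_hom_def)
qed

lemma fmap_id_apply: "x\<in>grade A n==>fmap_id A n x = x"
 by (simp add: fmap_id_def)

lemma mu_pure:
 assumes "j = n - i" "a\<in>grade A i" "b\<in>grade A j"
 shows "\<mu> n (pure R A A n (i, a, b)) = m i j a b"
 using m_eq[OF assms(2,3)] assms(1) by simp

lemma m_bilinear:
  "a\<in>grade A i==>b\<in>grade A j==>m i j a b\<in>grade A (i + j)"
  "a\<in>grade A i==>a'\<in>grade A i==>b\<in>grade A j ==>
    m i j (a +[md A i] a') b = m i j a b +[md A (i + j)] m i j a' b"
  "a\<in>grade A i==>b\<in>grade A j==>b'\<in>grade A j ==>
    m i j a (b +[md A j] b') = m i j a b +[md A (i + j)] m i j a b'"
  "a\<in>grade A i==>b\<in>grade A j==>c\<in>carrier R ==>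
    m i j (c *[md A i] a) b = c *[md A (i + j)] m i j a b"
  "a\<in>grade A i==>b\<in>grade A j==>c\<in>carrier R ==>
    m i j a (c *[md A j] b) = c *[md A (i + j)] m i j a b"
proof -
 have e: "j = i + j - i" by simp
 note bp = balancedD[OF AB.balanced_pure e]
 show "a\<in>grade A i==>b\<in>grade A j==>m i j a b\<in>grade A (i + j)"
  "a\<in>grade A i==>a'\<in>grade A i==>b\<in>grade A j ==>
    m i j (a +[md A i] a') b = m i j a b +[md A (i + j)] m i j a' b"
  "a\<in>grade A i==>b\<in>grade A j==>b'\<in>grade A j ==>
    m i j a (b +[md A j] b') = m i j a b +[md A (i + j)] m i j a b'"
  "a\<in>grade A i==>b\<in>grade A j==>c\<in>carrier R ==>
    m i j (c *[md A i] a) b = c *[md A (i + j)] m i j a b"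
  "a\<in>grade A i==>b\<in>grade A j==>c\<in>carrier R ==>
    m i j a (c *[md A j] b) = c *[md A (i + j)] m i j a b"
  by (simp_all add: m_eq bp mod_homD[OF mu] AB.A_closed)
qed

lemma m_zero:
 assumes "b\<in>grade A j"
 shows "m i j \<zero>[md A i] b = \<zero>[md A (i + j)]" "m j i b \<zero>[md A i] = \<zero>[md A (j + i)]"
proof -
 interpret I: module R "md A i" by (rule AB.modA)
 interpret IJ: module R "md A (i + j)" by (rule AB.modA)
 interpret JI: module R "md A (j + i)" by (rule AB.modA)
 have "m i j (\<zero>[R] *[md A i] \<zero>[md A i]) b = \<zero>[md A (i + j)]"
  using assms by (subst m_bilinear(4)) (auto intro!: IJ.smult_l_null m_bilinear(1))
 then show "m i j \<zero>[md A i] b = \<zero>[md A (i + j)]" by simp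
 have "m j i b (\<zero>[R] *[md A i] \<zero>[md A i]) = \<zero>[md A (j + i)]"
  using assms by (subst m_bilinear(5)) (auto intro!: JI.smult_l_null m_bilinear(1))
 then show "m j i b \<zero>[md A i] = \<zero>[md A (j + i)]" by simp
qed

sublocale mu_id: tensor_map_setup R "tensor R A A" A A A \<mu> "fmap_id A"
 by unfold_locales (simp_all add: mu fmap_id_hom)

sublocale id_mu: tensor_map_setup R A "tensor R A A" A A "fmap_id A" \<mu>
 by unfold_locales (simp_all add: mu fmap_id_hom)

text \<open>Both sides are linear, and the triple tensor product is spanned by pure tensors whose
  left factor is again pure; hence two nested uses of \<open>tmod_hom_eq\<close>.\<close>

lemma assoc_iff:
 "(\<forall>n. \<forall>x\<in>grade (tensor R (tensor R A A) A) n.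
   \<mu> n (tensor_map R (tensor R A A) A A A \<mu> (fmap_id A) n x) =
   \<mu> n (tensor_map R A (tensor R A A) A A (fmap_id A) \<mu> n (associator R A A A n x))) \<longleftrightarrow>
  (\<forall>i j k. \<forall>a\<in>grade A i. \<forall>b\<in>grade A j. \<forall>c\<in>grade A k.
    m (i + j) k (m i j a b) c = m i (j + k) a (m j k b c))" (is "?L \<longleftrightarrow> ?R")
proof -
 have l: "\<mu> n (tensor_map R (tensor R A A) A A A \<mu> (fmap_id A) n (pure R (tensor R A A) A n (j, t, c))) =
  m j (n - j) (\<mu> j t) c" if "t\<in>carrier (tmod R A A j)" "c\<in>grade A (n - j)" for n j t c
  using that mod_homD(1)[OF mu] by (simp add: mu_id.map_pure fmap_id_apply mu_pure)
 have r: "\<mu> n (tensor_map R A (tensor R A A) A A (fmap_id A) \<mu> n (associator R A A A n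
   (pure R (tensor R A A) A n (j, pure R A A j (i, a, b), c)))) = m i (n - i) a (m (j - i) (n - j) b c)"
  if "a\<in>grade A i" "b\<in>grade A (j - i)" "c\<in>grade A (n - j)" for n j i a b c
 proof -
  have e: "n - j = n - i - (j - i)" by simp
  have p: "pure R A A (n - i) (j - i, b, c)\<in>carrier (tmod R A A (n - i))"
   using that by (intro AB.pure_closed) simp_all
  show ?thesis using that p mod_homD(1)[OF mu p]
   by (simp add: associator_pure id_mu.map_pure fmap_id_apply mu_pure[OF refl] mu_pure[OF e])
 qed
 show ?thesis
 proof
  assume L: ?L
  show ?R
  proof (intro allI ballI)
   fix i j k a b c assume abc: "a\<in>grade A i" "b\<in>grade A j" "c\<in>grade A k"
   let ?t = "pure R A A (i + j) (i, a, b)"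
   have t: "?t\<in>carrier (tmod R A A (i + j))" using abc by (intro AB.pure_closed) simp_all
   have x: "pure R (tensor R A A) A (i + j + k) (i + j, ?t, c)\<in>carrier (tmod R (tensor R A A) A (i + j + k))"
    using abc t by (intro AB_C.pure_closed) simp_all
   have s: "i + j + k - i = j + k" by simp
   show "m (i + j) k (m i j a b) c = m i (j + k) a (m j k b c)"
    using L[rule_format, unfolded md_tensor, OF x] l[of ?t "i + j" c "i + j + k"] r[of a i b "i + j" c "i + j + k"] abc t
    by (simp add: mu_pure s)
  qed
 next
  assume R: ?R
  show ?L
  proof (intro allI ballI, unfold md_tensor)
   fix n x assume x: "x\<in>carrier (tmod R (tensor R A A) A n)"
   have hl: "(%x. \<mu> n (tensor_map R (tensor R A A) A A A \<mu> (fmap_id A) n x))\<in>mod_hom R (tmod R (tensor R A A) A n) (md A n)"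
    by (rule mod_hom_comp[OF mu_id.map_hom mu])
   have hr: "(%x. \<mu> n (tensor_map R A (tensor R A A) A A (fmap_id A) \<mu> n (associator R A A A n x)))
    \<in>mod_hom R (tmod R (tensor R A A) A n) (md A n)"
    by (rule mod_hom_comp[OF associator_hom mod_hom_comp[OF id_mu.map_hom mu]])
   show "\<mu> n (tensor_map R (tensor R A A) A A A \<mu> (fmap_id A) n x) =
    \<mu> n (tensor_map R A (tensor R A A) A A (fmap_id A) \<mu> n (associator R A A A n x))"
   proof (rule AB_C.tmod_hom_eq[OF AB.modA hl hr _ x], unfold md_tensor)
    fix j t c assume t: "t\<in>carrier (tmod R A A j)" and c: "c\<in>grade A (n - j)"
    have pt: "pure R (tensor R A A) A n (j, t, c)\<in>carrier (tmod R (tensor R A A) A n)" if "t\<in>carrier (tmod R A A j)" for t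
     using that c by (intro AB_C.pure_closed) simp_all
    have ph: "(%t. pure R (tensor R A A) A n (j, t, c))\<in>mod_hom R (tmod R A A j) (tmod R (tensor R A A) A n)"
     using balancedD[OF AB_C.balanced_pure refl] c unfolding mod_hom_def by auto
    show "\<mu> n (tensor_map R (tensor R A A) A A A \<mu> (fmap_id A) n (pure R (tensor R A A) A n (j, t, c))) =
     \<mu> n (tensor_map R A (tensor R A A) A A (fmap_id A) \<mu> n (associator R A A A n (pure R (tensor R A A) A n (j, t, c))))"
    proof (rule AB.tmod_hom_eq[OF AB.modA mod_hom_comp[OF ph hl] mod_hom_comp[OF ph hr] _ t])
     fix i a b assume a: "a\<in>grade A i" and b: "b\<in>grade A (j - i)"
     have "m (i + (j - i)) (n - j) (m i (j - i) a b) c = m i (j - i + (n - j)) a (m (j - i) (n - j) b c)"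
      using R a b c by blast
     then show "\<mu> n (tensor_map R (tensor R A A) A A A \<mu> (fmap_id A) n (pure R (tensor R A A) A n (j, pure R A A j (i, a, b), c))) =
       \<mu> n (tensor_map R A (tensor R A A) A A (fmap_id A) \<mu> n
        (associator R A A A n (pure R (tensor R A A) A n (j, pure R A A j (i, a, b), c))))"
      unfolding r[OF a b c] l[OF AB.pure_closed[OF a b] c] mu_pure[OF refl a b] by simp
    qed
   qed
  qed
 qed
qed

lemma leibniz_iff:
 "(\<forall>n. \<forall>x\<in>grade (tensor R A A) n. \<mu> (n + 1) (df (tensor R A A) n x) = df A n (\<mu> n x)) \<longleftrightarrow>
  (\<forall>i j. \<forall>a\<in>grade A i. \<forall>b\<in>grade A j.
    df A (i + j) (m i j a b) = m (i + 1) j (df A i a) b +[md A (i + j + 1)]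
     koszul_sign R i *[md A (i + j + 1)] m i (j + 1) a (df A j b))" (is "?L \<longleftrightarrow> ?R")
proof -
 note d = fcxD(2,3)[OF fc]
 note ks = koszul_sign_closed[OF cring]
 have p: "\<mu> (n + 1) (df (tensor R A A) n (pure R A A n (i, a, b))) =
   m (i + 1) (n - i) (df A i a) b +[md A (n + 1)]
     koszul_sign R i *[md A (n + 1)] m i (n - i + 1) a (df A (n - i) b)"
  if "a\<in>grade A i" "b\<in>grade A (n - i)" for n i a b
 proof -
  interpret T: module R "tmod R A A (n + 1)" by (rule AB.tmod_module)
  have e: "n - i = n + 1 - (i + 1)" "n - i + 1 = n + 1 - i" by simp_all
  have c: "pure R A A (n + 1) (i + 1, df A i a, b)\<in>carrier (tmod R A A (n + 1))"
   "pure R A A (n + 1) (i, a, df A (n - i) b)\<in>carrier (tmod R A A (n + 1))"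
   by (rule balancedD(1)[OF AB.balanced_pure e(1) d(2)[OF that(1)] that(2)]
    balancedD(1)[OF AB.balanced_pure e(2) that(1) d(2)[OF that(2)]])+
  show ?thesis unfolding AB.df_pure[OF d(1) d(1) that]
   using c that ks d(2) by (simp add: mod_homD[OF mu] mu_pure[OF e(1)] mu_pure[OF e(2)])
 qed
 show ?thesis
 proof
  assume L: ?L
  show ?R
  proof (intro allI ballI)
   fix i j a b assume ab: "a\<in>grade A i" "b\<in>grade A j"
   have t: "pure R A A (i + j) (i, a, b)\<in>carrier (tmod R A A (i + j))" using ab by (intro AB.pure_closed) simp_all
   show "df A (i + j) (m i j a b) = m (i + 1) j (df A i a) b +[md A (i + j + 1)]
     koszul_sign R i *[md A (i + j + 1)] m i (j + 1) a (df A j b)"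
    using L[rule_format, unfolded md_tensor, OF t] p[of a i b "i + j"] ab by (simp add: mu_pure)
  qed
 next
  assume R: ?R
  show ?L
  proof (intro allI ballI, unfold md_tensor)
   fix n x assume x: "x\<in>carrier (tmod R A A n)"
   show "\<mu> (n + 1) (df (tensor R A A) n x) = df A n (\<mu> n x)"
   proof (rule AB.tmod_hom_eq[OF AB.modA mod_hom_comp[OF AB.df_hom[OF d(1) d(1)] mu] mod_hom_comp[OF mu d(1)] _ x])
    fix i a b assume ab: "a\<in>grade A i" "b\<in>grade A (n - i)"
    have "df A (i + (n - i)) (m i (n - i) a b) = m (i + 1) (n - i) (df A i a) b +[md A (i + (n - i) + 1)]
     koszul_sign R i *[md A (i + (n - i) + 1)] m i ((n - i) + 1) a (df A (n - i) b)"
     using R ab by blast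
    then show "\<mu> (n + 1) (df (tensor R A A) n (pure R A A n (i, a, b))) = df A n (\<mu> n (pure R A A n (i, a, b)))"
     unfolding p[OF ab] mu_pure[OF refl ab] by simp
   qed
  qed
 qed
qed

text \<open>The filtration of the tensor product is a span. The preimage of \<open>fil A p n\<close>
  under \<open>\<mu>\<close> is a submodule and contains the span once it contains the generating
  pure tensors.\<close>

lemma fil_iff:
 "(\<forall>p n. \<mu> n ` fil (tensor R A A) p n \<subseteq> fil A p n) \<longleftrightarrow>
  (\<forall>p q i j. \<forall>a\<in>fil A p i. \<forall>b\<in>fil A q j. m i j a b\<in>fil A (p + q) (i + j))" (is "?L \<longleftrightarrow> ?R")
proof
 note fcar = fcxD(8)[OF fc]
 assume L: ?L
 show ?R
 proof (intro allI ballI)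
  fix p q i j a b assume ab: "a\<in>fil A p i" "b\<in>fil A q j"
  have "pure R A A (i + j) (i, a, b)\<in>{pure R A A (i + j) (m, a, b) | k m a b. a\<in>fil A k m & b\<in>fil A (p + q - k) (i + j - m)}"
   using ab by (intro CollectI exI[of _ p] exI[of _ i] exI[of _ a] exI[of _ b]) simp
  then have "pure R A A (i + j) (i, a, b)\<in>fil (tensor R A A) (p + q) (i + j)"
   unfolding tensor_def fcomplex.simps by (rule subsetD[OF mod_span_superset])
  then have "\<mu> (i + j) (pure R A A (i + j) (i, a, b))\<in>fil A (p + q) (i + j)" using L by blast
  then show "m i j a b\<in>fil A (p + q) (i + j)" using ab fcar by (simp add: mu_pure)
 qed
next
 note fcar = fcxD(8)[OF fc]
 assume R: ?R
 show ?L
 proof (intro allI)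
  fix p n
  have "fil (tensor R A A) p n \<subseteq> {x\<in>carrier (tmod R A A n). \<mu> n x\<in>fil A p n}"
   unfolding tensor_def fcomplex.simps
  proof (rule mod_span_least[OF submodule_vimage[OF AB.tmod_module AB.modA mu fcxD(5)[OF fc]]], safe)
   fix i k a b assume ab: "a\<in>fil A i k" "b\<in>fil A (p - i) (n - k)"
   then show "pure R A A n (k, a, b)\<in>carrier (tmod R A A n)" by (intro AB.pure_closed fcar)
   have "m k (n - k) a b\<in>fil A (i + (p - i)) (k + (n - k))" using R ab by blast
   then show "\<mu> n (pure R A A n (k, a, b))\<in>fil A p n" using ab fcar by (simp add: mu_pure)
  qed
  then show "\<mu> n ` fil (tensor R A A) p n \<subseteq> fil A p n" by auto
 qed
qed

end

lemma R_complex_carrier: "grade (R_complex R 0 0) i = (if i = 0 then carrier R else {\<zero>[R]})"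
 by (simp add: R_complex_def self_mod_def zero_mod_def)

locale unit_setup = mult_setup R A \<mu> m
 for R :: "'r ring" and A :: "('r, 'a) fcomplex" and \<mu> and m +
 fixes \<eta> :: "int => 'r => 'a"
 assumes eta: "!!n. \<eta> n\<in>mod_hom R (md (R_complex R 0 0) n) (md A n)"
begin

abbreviation E where "E \<equiv> R_complex R 0 0"

sublocale EA: tensor_map_setup R E A A A \<eta> "fmap_id A"
 unfolding tensor_map_setup_def tensor_map_setup_axioms_def tensor_setup_def
 using fcxD(1)[OF R_complex_fcomplex[OF cring]] eta fmap_id_hom AB.modA cring by blast

sublocale AE: tensor_map_setup R A E A A "fmap_id A" \<eta>
 unfolding tensor_map_setup_def tensor_map_setup_axioms_def tensor_setup_def
 using fcxD(1)[OF R_complex_fcomplex[OF cring]] eta fmap_id_hom AB.modA cring by blast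

lemma eta_0: "c\<in>carrier R==>\<eta> 0 c = c *[md A 0] \<eta> 0 \<one>[R]" "\<eta> 0 \<one>[R]\<in>grade A 0"
proof -
 interpret cring R by (rule cring)
 note h = mod_homD[OF eta[of 0], unfolded R_complex_carrier]
 show "\<eta> 0 \<one>[R]\<in>grade A 0" using h(1) by simp
 show "c\<in>carrier R==>\<eta> 0 c = c *[md A 0] \<eta> 0 \<one>[R]"
  using h(3)[of c "\<one>[R]"] by (simp add: R_complex_def self_mod_def)
qed

lemma eta_nz: "i \<noteq> 0==>\<eta> i \<zero>[R] = \<zero>[md A i]"
 using mod_hom_zero[OF fcxD(1)[OF R_complex_fcomplex[OF cring]] AB.modA eta[of i]]
 by (simp add: R_complex_def zero_mod_def self_mod_def)

text \<open>Away from degree 0 the unit complex vanishes and both sides are zero. In degree 0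
  linearity reduces the scalar \<open>c\<close> to the unit of the ring.\<close>

lemma unit_left_iff:
 "(\<forall>n. \<forall>x\<in>grade (tensor R E A) n.
    \<mu> n (tensor_map R E A A A \<eta> (fmap_id A) n x) = left_unitor R A n x) \<longleftrightarrow>
  (\<forall>n. \<forall>a\<in>grade A n. m 0 n (\<eta> 0 \<one>[R]) a = a)" (is "?L \<longleftrightarrow> ?R")
proof -
 interpret cring R by (rule cring)
 let ?g = "%n (i, c, a). if i = 0 then c *[md A n] a else \<zero>[md A n]"
 have b: "balanced R E A n (md A n) (?g n)" for n
 proof -
  interpret M: module R "md A n" by (rule AB.modA)
  have sw: "c *[md A n] (d *[md A n] x) = d *[md A n] (c *[md A n] x)" if "c\<in>carrier R" "d\<in>carrier R" "x\<in>grade A n" for c d x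
   using that M.smult_assoc1[of c d x] M.smult_assoc1[of d c x] m_comm[of c d] by simp
  show ?thesis unfolding balanced_def R_complex_carrier
   by (auto simp: R_complex_def self_mod_def zero_mod_def M.smult_l_distr M.smult_r_distr M.smult_assoc1 intro: sw)
 qed
 have lh: "left_unitor R A n\<in>mod_hom R (tmod R E A n) (md A n)" for n
  unfolding left_unitor_def by (rule EA.D.tlift_hom[OF AB.modA b])
 have lp: "left_unitor R A n (pure R E A n (i, c, a)) = ?g n (i, c, a)"
  if "c\<in>grade E i" "a\<in>grade A (n - i)" for n i c a
  unfolding left_unitor_def EA.D.tlift_pure[OF AB.modA b that] ..
 have p: "\<mu> n (tensor_map R E A A A \<eta> (fmap_id A) n (pure R E A n (i, c, a))) = m i (n - i) (\<eta> i c) a"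
  if "c\<in>grade E i" "a\<in>grade A (n - i)" for n i c a
  unfolding EA.map_pure[OF that] fmap_id_apply[OF that(2)]
  by (rule mu_pure[OF refl mod_homD(1)[OF eta that(1)] that(2)])
 show ?thesis
 proof
  assume L: ?L
  show ?R
  proof (intro allI ballI)
   fix n a assume a: "a\<in>grade A n"
   interpret M: module R "md A n" by (rule AB.modA)
   have c: "\<one>[R]\<in>grade E 0" "a\<in>grade A (n - 0)" using a by (simp_all add: R_complex_carrier)
   show "m 0 n (\<eta> 0 \<one>[R]) a = a"
    using L[rule_format, of "pure R E A n (0, \<one>[R], a)" n] EA.D.pure_closed[OF c] p[OF c] lp[OF c] a
    by (simp add: md_tensor)
  qed
 next
  assume R: ?R
  show ?L
  proof (intro allI ballI, unfold md_tensor)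
   fix n x assume x: "x\<in>carrier (tmod R E A n)"
   show "\<mu> n (tensor_map R E A A A \<eta> (fmap_id A) n x) = left_unitor R A n x"
   proof (rule EA.D.tmod_hom_eq[OF AB.modA mod_hom_comp[OF EA.map_hom mu] lh _ x])
    fix i c a assume ca: "c\<in>grade E i" "a\<in>grade A (n - i)"
    show "\<mu> n (tensor_map R E A A A \<eta> (fmap_id A) n (pure R E A n (i, c, a))) = left_unitor R A n (pure R E A n (i, c, a))"
     unfolding p[OF ca] lp[OF ca] using ca R m_zero(1)[OF ca(2), of i] eta_nz[of i] eta_0(1)[of c]
      m_bilinear(4)[OF eta_0(2), of a n c]
     by (auto simp: R_complex_carrier split: if_splits)
   qed
  qed
 qed
qed

lemma unit_right_iff:
 "(\<forall>n. \<forall>x\<in>grade (tensor R A E) n.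
    \<mu> n (tensor_map R A E A A (fmap_id A) \<eta> n x) = right_unitor R A n x) \<longleftrightarrow>
  (\<forall>n. \<forall>a\<in>grade A n. m n 0 a (\<eta> 0 \<one>[R]) = a)" (is "?L \<longleftrightarrow> ?R")
proof -
 interpret cring R by (rule cring)
 let ?g = "%n (i, a, c). if i = n then c *[md A n] a else \<zero>[md A n]"
 have b: "balanced R A E n (md A n) (?g n)" for n
 proof -
  interpret M: module R "md A n" by (rule AB.modA)
  have sw: "c *[md A n] (d *[md A n] x) = d *[md A n] (c *[md A n] x)" if "c\<in>carrier R" "d\<in>carrier R" "x\<in>grade A n" for c d x
   using that M.smult_assoc1[of c d x] M.smult_assoc1[of d c x] m_comm[of c d] by simp
  show ?thesis unfolding balanced_def R_complex_carrier
   by (auto simp: R_complex_def self_mod_def zero_mod_def M.smult_l_distr M.smult_r_distr M.smult_assoc1 intro: sw)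
 qed
 have lh: "right_unitor R A n\<in>mod_hom R (tmod R A E n) (md A n)" for n
  unfolding right_unitor_def by (rule AE.D.tlift_hom[OF AB.modA b])
 have lp: "right_unitor R A n (pure R A E n (i, a, c)) = ?g n (i, a, c)"
  if "a\<in>grade A i" "c\<in>grade E (n - i)" for n i c a
  unfolding right_unitor_def AE.D.tlift_pure[OF AB.modA b that] ..
 have p: "\<mu> n (tensor_map R A E A A (fmap_id A) \<eta> n (pure R A E n (i, a, c))) = m i (n - i) a (\<eta> (n - i) c)"
  if "a\<in>grade A i" "c\<in>grade E (n - i)" for n i c a
  unfolding AE.map_pure[OF that] fmap_id_apply[OF that(1)]
  by (rule mu_pure[OF refl that(1) mod_homD(1)[OF eta that(2)]])
 show ?thesis
 proof
  assume L: ?L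
  show ?R
  proof (intro allI ballI)
   fix n a assume a: "a\<in>grade A n"
   interpret M: module R "md A n" by (rule AB.modA)
   have c: "\<one>[R]\<in>grade E (n - n)" using a by (simp_all add: R_complex_carrier)
   show "m n 0 a (\<eta> 0 \<one>[R]) = a"
    using L[rule_format, of "pure R A E n (n, a, \<one>[R])" n] AE.D.pure_closed[OF a c] p[OF a c] lp[OF a c] a
    by (simp add: md_tensor)
  qed
 next
  assume R: ?R
  show ?L
  proof (intro allI ballI, unfold md_tensor)
   fix n x assume x: "x\<in>carrier (tmod R A E n)"
   show "\<mu> n (tensor_map R A E A A (fmap_id A) \<eta> n x) = right_unitor R A n x"
   proof (rule AE.D.tmod_hom_eq[OF AB.modA mod_hom_comp[OF AE.map_hom mu] lh _ x])
    fix i c a assume ca: "a\<in>grade A i" "c\<in>grade E (n - i)"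
    show "\<mu> n (tensor_map R A E A A (fmap_id A) \<eta> n (pure R A E n (i, a, c))) = right_unitor R A n (pure R A E n (i, a, c))"
     unfolding p[OF ca] lp[OF ca] using ca R m_zero(2)[OF ca(1), of "n - i"] eta_nz[of "n - i"] eta_0(1)[of c]
      m_bilinear(5)[OF ca(1) eta_0(2), of c]
     by (auto simp: R_complex_carrier split: if_splits)
   qed
  qed
 qed
qed

end

lemma fil_mono:
 assumes "fcx R A" "p \<le> q"
 shows "fil A p n \<subseteq> fil A q n"
 using assms(2)
proof (induction q rule: int_ge_induct)
 case (step i)
 then show ?case using fcxD(6)[OF assms(1), of i n] by blast
qed simp

lemma fdgaD:
 assumes "cring R" "is_fdga R M"
 shows "fcx R (cx M)" "dga_laws R (cx M) (fmul R M) (fone R M)"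
  "unit_setup R (cx M) (multn M) (fmul R M) (unt M)"
proof -
 note M = assms(2)[unfolded is_fdga_def Let_def]
 show fc: "fcx R (cx M)" using M by simp
 have mu: "!!n. multn M n\<in>mod_hom R (tmod R (cx M) (cx M) n) (md (cx M) n)"
  using M by (simp add: is_fmap_def tensor_def)
 interpret mult_setup R "cx M" "multn M" "fmul R M"
  by (rule mult_setup.intro[OF assms(1) fc mu]) (simp add: fmul_def)
 have eta: "!!n. unt M n\<in>mod_hom R (md (R_complex R 0 0) n) (md (cx M) n)"
  using M by (simp add: is_fmap_def)
 interpret u: unit_setup R "cx M" "multn M" "fmul R M" "unt M"
  by unfold_locales (rule eta)
 show "unit_setup R (cx M) (multn M) (fmul R M) (unt M)" by (rule u.unit_setup_axioms)
 have one: "\<one>[R]\<in>fil (R_complex R 0 0) 0 0"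
  using assms(1) by (simp add: R_complex_def cring.cring_simprules)
 have e: "fone R M\<in>fil (cx M) 0 0"
  using M one unfolding is_fmap_def fone_def by blast
 show "dga_laws R (cx M) (fmul R M) (fone R M)"
  unfolding dga_laws_def
  apply (intro conjI)
       apply (simp_all add: m_bilinear e)
    apply (rule assoc_iff[THEN iffD1], use M in simp)
    apply (rule u.unit_left_iff[THEN iffD1, folded fone_def], use M in simp)
   apply (rule u.unit_right_iff[THEN iffD1, folded fone_def], use M in simp)
   apply (rule leibniz_iff[THEN iffD1], use M in \<open>simp add: is_fmap_def\<close>)
  apply (rule fil_iff[THEN iffD1], use M in \<open>simp add: is_fmap_def\<close>)
  done
qed

lemma dga_one_closed:
 assumes "cring R" "fcx R A" "dga_laws R A m e"
 shows "e\<in>grade A 0" "df A 0 e = \<zero>[md A 1]"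
proof -
 note L = dga_lawsD[OF assms(3)] and F = fcxD[OF assms(2)]
 show e: "e\<in>grade A 0" by (rule F(8)[OF L(7)])
 interpret module R "md A 1" by (rule F(1))
 have d: "df A 0 e\<in>grade A 1" using F(3)[OF e] by simp
 \<comment> \<open>The Leibniz rule for \<open>e\<close> times \<open>e\<close> equals
   \<open>e\<close>: the differential of the unit is twice itself, hence zero.\<close>
 have "df A 0 e = df A 0 e +[md A 1] df A 0 e"
  using L(10)[OF e e] L(8)[OF e] L(8)[of "df A 0 e" 1] L(9)[of "df A 0 e" 1] d
  by (simp add: koszul_sign_def)
 then show "df A 0 e = \<zero>[md A 1]" using d by (metis M.add.r_cancel_one')
qed

definition make_fdga ::
 "'r ring => ('r, 'a) fcomplex => (int => int => 'a => 'a => 'a) => 'a => ('r, 'a) fdga" where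
 "make_fdga R A m e = \<lparr>cx = A,
   multn = (%n. tlift R A A n (md A n) (%(i, a, b). m i (n - i) a b)),
   unt = (%n. \<lambda>c\<in>grade (R_complex R 0 0) n.
    if n = 0 then c *[md A 0] e else \<zero>[md A n])\<rparr>"

text \<open>The converse of \<open>fdgaD\<close>. With these two and \<open>fdga_map_iff\<close>,
  algebras and their maps can be handled by elements, without tensors.\<close>

lemma make_fdga:
 assumes R: "cring R" and fc: "fcx R A" and laws: "dga_laws R A m e"
 defines "M \<equiv> make_fdga R A m e"
 shows "is_fdga R M" "cx M = A" "fone R M = e"
  "!!i j a b. a\<in>grade A i==>b\<in>grade A j==>fmul R M i j a b = m i j a b"
proof -
 note L = dga_lawsD[OF laws] and F = fcxD[OF fc]
 note e = dga_one_closed[OF R fc laws]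
 interpret R: cring R by (rule R)
 show cx: "cx M = A" by (simp add: M_def make_fdga_def)
 interpret T: tensor_setup R A A by (rule tensor_setup.intro[OF R F(1) F(1)])
 interpret A0: module R "md A 0" by (rule F(1))
 have bal: "balanced R A A n (md A n) (%(i, a, b). m i (n - i) a b)" for n
 proof -
  have s: "i + (n - i) = n" for i by simp
  have "\<forall>i. \<forall>a\<in>grade A i. \<forall>b\<in>grade A (n - i). m i (n - i) a b\<in>grade A n"
   using L(1) s by metis
  moreover have "\<forall>i. \<forall>a\<in>grade A i. \<forall>a'\<in>grade A i. \<forall>b\<in>grade A (n - i).
    m i (n - i) (a +[md A i] a') b = m i (n - i) a b +[md A n] m i (n - i) a' b"
   using L(2) s by metis
  moreover have "\<forall>i. \<forall>a\<in>grade A i. \<forall>b\<in>grade A (n - i). \<forall>b'\<in>grade A (n - i).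
    m i (n - i) a (b +[md A (n - i)] b') = m i (n - i) a b +[md A n] m i (n - i) a b'"
   using L(3) s by metis
  moreover have "\<forall>i. \<forall>a\<in>grade A i. \<forall>b\<in>grade A (n - i). \<forall>c\<in>carrier R.
    m i (n - i) (c *[md A i] a) b = c *[md A n] m i (n - i) a b"
   using L(4) s by metis
  moreover have "\<forall>i. \<forall>a\<in>grade A i. \<forall>b\<in>grade A (n - i). \<forall>c\<in>carrier R.
    m i (n - i) a (c *[md A (n - i)] b) = c *[md A n] m i (n - i) a b"
   using L(5) s by metis
  ultimately show ?thesis unfolding balanced_def prod.case by blast
 qed
 have mu: "multn M n\<in>mod_hom R (tmod R A A n) (md A n)" for n
  unfolding M_def make_fdga_def fdga.simps by (rule T.tlift_hom[OF F(1) bal])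
 have mue: "multn M n\<in>extensional (carrier (tmod R A A n))" for n
  unfolding M_def make_fdga_def fdga.simps by (rule T.tlift_extensional)
 have mp: "multn M (i + j) (pure R A A (i + j) (i, a, b)) = m i j a b"
  if ab: "a\<in>grade A i" "b\<in>grade A j" for i j a b
 proof -
  have b: "b\<in>grade A (i + j - i)" using ab by simp
  show ?thesis unfolding M_def make_fdga_def fdga.simps T.tlift_pure[OF F(1) bal ab(1) b] by simp
 qed
 show "fmul R M i j a b = m i j a b" if "a\<in>grade A i" "b\<in>grade A j" for i j a b
  unfolding fmul_def cx by (rule mp[OF that])
 interpret mult_setup R A "multn M" m
  by (rule mult_setup.intro[OF R fc mu]) (simp add: mp)
 have eta: "unt M n\<in>mod_hom R (md (R_complex R 0 0) n) (md A n)" for n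
 proof -
  interpret An: module R "md A n" by (rule F(1))
  show ?thesis using e(1)
   by (auto simp: M_def make_fdga_def mod_hom_def R_complex_carrier)
    (auto simp: R_complex_def self_mod_def zero_mod_def A0.smult_l_distr A0.smult_assoc1)
 qed
 interpret unit_setup R A "multn M" m "unt M"
  by unfold_locales (rule eta)
 show one: "fone R M = e" using e(1)
  by (simp add: fone_def M_def make_fdga_def R_complex_carrier)
 then have one': "unt M 0 \<one>[R] = e" by (simp add: fone_def)
 have fm: "is_fmap R (tensor R A A) A (multn M)"
  unfolding is_fmap_def md_tensor using mu mue leibniz_iff fil_iff L(10,11) by (simp add: md_tensor)
 have fe: "is_fmap R (R_complex R 0 0) A (unt M)" unfolding is_fmap_def
 proof (intro conjI allI ballI)
  fix n show "unt M n\<in>mod_hom R (md (R_complex R 0 0) n) (md A n) \<inter> extensional (grade (R_complex R 0 0) n)"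
   using eta by (simp add: M_def make_fdga_def)
  fix x assume x: "x\<in>grade (R_complex R 0 0) n"
  have "df A n (unt M n x) = \<zero>[md A (n + 1)]"
  proof (cases "n = 0")
   case True
   interpret A1: module R "md A 1" by (rule F(1))
   have "df A 0 (x *[md A 0] e) = x *[md A 1] df A 0 e"
    using mod_homD(3)[OF F(2)[of 0]] x True e(1) by (simp add: R_complex_carrier)
   then show ?thesis using x True e(2) by (simp add: M_def make_fdga_def R_complex_carrier)
  next
   case False
   then show ?thesis using x mod_hom_zero[OF F(1) F(1) F(2)[of n]]
    by (simp add: M_def make_fdga_def)
  qed
  moreover have "unt M (n + 1) (df (R_complex R 0 0) n x) = \<zero>[md A (n + 1)]"
   using e(1) by (simp add: M_def make_fdga_def R_complex_def self_mod_def zero_mod_def)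
  ultimately show "unt M (n + 1) (df (R_complex R 0 0) n x) = df A n (unt M n x)" by simp
 next
  fix p n
  note fs = submodule_facts[OF F(1) F(5)]
  have "e\<in>fil A p 0" if "0 \<le> p" using L(7) fil_mono[OF fc that] by blast
  then show "unt M n ` fil (R_complex R 0 0) p n \<subseteq> fil A p n"
   using fs(2,6) e(1) by (auto simp: M_def make_fdga_def R_complex_def self_mod_def zero_mod_def)
 qed
 show "is_fdga R M" unfolding is_fdga_def Let_def cx
  using fc fm fe assoc_iff L(6) unit_left_iff[unfolded one'] unit_right_iff[unfolded one'] L(8,9)
  by simp
qed

text \<open>Multiplicativity is an equality of homomorphisms on the tensor square, decided on pure
  tensors. Compatibility with the units is decided at the one of the ring, since both units are
  linear and vanish away from degree 0.\<close>

lemma fdga_map_iff: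
 assumes R: "cring R" and M: "is_fdga R M" and N: "is_fdga R N"
 shows "dgmap R M N f \<longleftrightarrow> is_fmap R (cx M) (cx N) f &
  (\<forall>i j. \<forall>a\<in>grade (cx M) i. \<forall>b\<in>grade (cx M) j.
    f (i + j) (fmul R M i j a b) = fmul R N i j (f i a) (f j b)) &
  f 0 (fone R M) = fone R N"
proof (cases "is_fmap R (cx M) (cx N) f")
 case True
 have f: "!!n. f n\<in>mod_hom R (md (cx M) n) (md (cx N) n)" using True by (simp add: is_fmap_def)
 interpret M: unit_setup R "cx M" "multn M" "fmul R M" "unt M" by (rule fdgaD[OF R M])
 interpret N: unit_setup R "cx N" "multn N" "fmul R N" "unt N" by (rule fdgaD[OF R N])
 interpret ff: tensor_map_setup R "cx M" "cx M" "cx N" "cx N" f f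
  by unfold_locales (rule f)+
 note fc = mod_homD[OF f]
 let ?T = "tensor_map R (cx M) (cx M) (cx N) (cx N) f f"
 have pl: "f n (multn M n (pure R (cx M) (cx M) n (i, a, b))) = f n (fmul R M i (n - i) a b)"
  "multn N n (?T n (pure R (cx M) (cx M) n (i, a, b))) = fmul R N i (n - i) (f i a) (f (n - i) b)"
  if "a\<in>grade (cx M) i" "b\<in>grade (cx M) (n - i)" for n i a b
  unfolding ff.map_pure[OF that]
  using that fc(1) by (simp_all add: M.mu_pure[OF refl] N.mu_pure[OF refl])
 have "(\<forall>n. \<forall>x\<in>carrier (tmod R (cx M) (cx M) n). f n (multn M n x) = multn N n (?T n x)) \<longleftrightarrow>
  (\<forall>i j. \<forall>a\<in>grade (cx M) i. \<forall>b\<in>grade (cx M) j.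
    f (i + j) (fmul R M i j a b) = fmul R N i j (f i a) (f j b))" (is "?L \<longleftrightarrow> ?R")
 proof
  assume L: ?L
  show ?R
  proof (intro allI ballI)
   fix i j a b assume ab: "a\<in>grade (cx M) i" "b\<in>grade (cx M) j"
   have b: "b\<in>grade (cx M) (i + j - i)" using ab by simp
   show "f (i + j) (fmul R M i j a b) = fmul R N i j (f i a) (f j b)"
    using L[rule_format, OF M.AB.pure_closed[OF ab(1) b]] unfolding pl[OF ab(1) b] by simp
  qed
 next
  assume R: ?R
  show ?L
  proof (intro allI ballI)
   fix n x assume x: "x\<in>carrier (tmod R (cx M) (cx M) n)"
   show "f n (multn M n x) = multn N n (?T n x)"
   proof (rule M.AB.tmod_hom_eq[OF N.AB.modA mod_hom_comp[OF M.mu f] mod_hom_comp[OF ff.map_hom N.mu] _ x])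
    fix i a b assume ab: "a\<in>grade (cx M) i" "b\<in>grade (cx M) (n - i)"
    have "f (i + (n - i)) (fmul R M i (n - i) a b) = fmul R N i (n - i) (f i a) (f (n - i) b)"
     using R ab by blast
    then show "f n (multn M n (pure R (cx M) (cx M) n (i, a, b))) = multn N n (?T n (pure R (cx M) (cx M) n (i, a, b)))"
     unfolding pl[OF ab] by simp
   qed
  qed
 qed
 moreover have "(\<forall>n. \<forall>c\<in>grade (R_complex R 0 0) n. f n (unt M n c) = unt N n c) \<longleftrightarrow>
  f 0 (fone R M) = fone R N" (is "?L \<longleftrightarrow> ?R")
 proof
  interpret R: cring R by (rule R)
  assume ?L then show ?R by (simp add: fone_def R_complex_carrier)
 next
  assume ?R
  then have "f 0 (unt M 0 c) = unt N 0 c" if "c\<in>carrier R" for c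
   using that unfolding M.eta_0(1)[OF that] N.eta_0(1)[OF that]
   by (simp add: fc(3)[OF that M.eta_0(2)] fone_def)
  moreover have "f n (unt M n \<zero>[R]) = unt N n \<zero>[R]" if "n \<noteq> 0" for n
   using mod_hom_zero[OF M.AB.modA N.AB.modA f] by (simp add: M.eta_nz[OF that] N.eta_nz[OF that])
  ultimately show ?L by (simp add: R_complex_carrier)
 qed
 ultimately show ?thesis using True unfolding is_fdga_map_def M.md_tensor by blast
qed (simp add: is_fdga_map_def)

abbreviation elts :: "('r, 'a) fdga => int => 'a set" where
 "elts M n \<equiv> grade (cx M) n"

text \<open>The data below present an algebra up to the equivalence \<open>q n x = q n y\<close> of raw elements.\<close>

locale raw_dga =
 fixes R :: "'r ring" and C :: "int => 'x set" and q :: "int => 'x => 'a"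
  and ad :: "int => 'x => 'x => 'x" and ze :: "int => 'x" and sm :: "int => 'r => 'x => 'x"
  and dd :: "int => 'x => 'x" and ml :: "int => int => 'x => 'x => 'x" and un :: 'x
  and Fl :: "int => int => 'x set"
 assumes cring: "cring R"
  and closed: "!!n x y. x\<in>C n==>y\<in>C n==>ad n x y\<in>C n"
   "!!n. ze n\<in>C n"
   "!!n c x. c\<in>carrier R==>x\<in>C n==>sm n c x\<in>C n"
   "!!n x. x\<in>C n==>dd n x\<in>C (n + 1)"
   "!!i j x y. x\<in>C i==>y\<in>C j==>ml i j x y\<in>C (i + j)"
   "un\<in>C 0"
  and cong: "!!n x x' y y'. x\<in>C n==>x'\<in>C n==>y\<in>C n==>y'\<in>C n ==>
    q n x = q n x'==>q n y = q n y'==>q n (ad n x y) = q n (ad n x' y')"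
   "!!n c x x'. c\<in>carrier R==>x\<in>C n==>x'\<in>C n==>q n x = q n x'==>q n (sm n c x) = q n (sm n c x')"
   "!!n x x'. x\<in>C n==>x'\<in>C n==>q n x = q n x'==>q (n + 1) (dd n x) = q (n + 1) (dd n x')"
   "!!i j x x' y y'. x\<in>C i==>x'\<in>C i==>y\<in>C j==>y'\<in>C j ==>
    q i x = q i x'==>q j y = q j y'==>q (i + j) (ml i j x y) = q (i + j) (ml i j x' y')"
  and group: "!!n x y z. x\<in>C n==>y\<in>C n==>z\<in>C n==>q n (ad n (ad n x y) z) = q n (ad n x (ad n y z))"
   "!!n x y. x\<in>C n==>y\<in>C n==>q n (ad n x y) = q n (ad n y x)"
   "!!n x. x\<in>C n==>q n (ad n (ze n) x) = q n x"
   "!!n x. x\<in>C n==>q n (ad n (sm n (\<ominus>[R] \<one>[R]) x) x) = q n (ze n)"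
  and modl: "!!n c d x. c\<in>carrier R==>d\<in>carrier R==>x\<in>C n ==>
    q n (sm n (c +[R] d) x) = q n (ad n (sm n c x) (sm n d x))"
   "!!n c x y. c\<in>carrier R==>x\<in>C n==>y\<in>C n==>q n (sm n c (ad n x y)) = q n (ad n (sm n c x) (sm n c y))"
   "!!n c d x. c\<in>carrier R==>d\<in>carrier R==>x\<in>C n==>q n (sm n (c \<otimes>[R] d) x) = q n (sm n c (sm n d x))"
   "!!n x. x\<in>C n==>q n (sm n \<one>[R] x) = q n x"
  and diff: "!!n x y. x\<in>C n==>y\<in>C n==>q (n + 1) (dd n (ad n x y)) = q (n + 1) (ad (n + 1) (dd n x) (dd n y))"
   "!!n c x. c\<in>carrier R==>x\<in>C n==>q (n + 1) (dd n (sm n c x)) = q (n + 1) (sm (n + 1) c (dd n x))"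
   "!!n x. x\<in>C n==>q (n + 1 + 1) (dd (n + 1) (dd n x)) = q (n + 1 + 1) (ze (n + 1 + 1))"
  and mult: "!!i j x x' y. x\<in>C i==>x'\<in>C i==>y\<in>C j ==>
    q (i + j) (ml i j (ad i x x') y) = q (i + j) (ad (i + j) (ml i j x y) (ml i j x' y))"
   "!!i j x y y'. x\<in>C i==>y\<in>C j==>y'\<in>C j ==>
    q (i + j) (ml i j x (ad j y y')) = q (i + j) (ad (i + j) (ml i j x y) (ml i j x y'))"
   "!!i j x y c. x\<in>C i==>y\<in>C j==>c\<in>carrier R ==>
    q (i + j) (ml i j (sm i c x) y) = q (i + j) (sm (i + j) c (ml i j x y))"
   "!!i j x y c. x\<in>C i==>y\<in>C j==>c\<in>carrier R ==>
    q (i + j) (ml i j x (sm j c y)) = q (i + j) (sm (i + j) c (ml i j x y))"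
   "!!i j k x y z. x\<in>C i==>y\<in>C j==>z\<in>C k ==>
    q (i + j + k) (ml (i + j) k (ml i j x y) z) = q (i + j + k) (ml i (j + k) x (ml j k y z))"
   "!!n x. x\<in>C n==>q n (ml 0 n un x) = q n x"
   "!!n x. x\<in>C n==>q n (ml n 0 x un) = q n x"
   "!!i j x y. x\<in>C i==>y\<in>C j==>q (i + j + 1) (dd (i + j) (ml i j x y)) =
    q (i + j + 1) (ad (i + j + 1) (ml (i + 1) j (dd i x) y) (sm (i + j + 1) (koszul_sign R i) (ml i (j + 1) x (dd j y))))"
  and filt: "!!p n. Fl p n \<subseteq> C n" "!!p n. ze n\<in>Fl p n"
   "!!p n x y. x\<in>Fl p n==>y\<in>Fl p n==>ad n x y\<in>Fl p n"
   "!!p n c x. c\<in>carrier R==>x\<in>Fl p n==>sm n c x\<in>Fl p n"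
   "!!p n. Fl p n \<subseteq> Fl (p + 1) n" "!!p n x. x\<in>Fl p n==>dd n x\<in>Fl p (n + 1)"
   "!!p p' i j x y. x\<in>Fl p i==>y\<in>Fl p' j==>ml i j x y\<in>Fl (p + p') (i + j)"
   "un\<in>Fl 0 0"
begin

definition s :: "int => 'a => 'x" where "s n = inv_into (C n) (q n)"

definition carrier_module :: "int => ('r, 'a) module" where
 "carrier_module n = \<lparr>carrier = q n ` C n, mult = (%_ _. q n (ze n)), one = q n (ze n), zero = q n (ze n),
   add = (%a b. q n (ad n (s n a) (s n b))), smult = (%c a. q n (sm n c (s n a)))\<rparr>"

definition complex :: "('r, 'a) fcomplex" where
 "complex = \<lparr>md = carrier_module, df = (%n a. q (n + 1) (dd n (s n a))), fil = (%p n. q n ` Fl p n)\<rparr>"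

definition product :: "int => int => 'a => 'a => 'a" where
 "product i j a b = q (i + j) (ml i j (s i a) (s j b))"

lemma s: "x\<in>C n==>s n (q n x)\<in>C n" "x\<in>C n==>q n (s n (q n x)) = q n x"
 unfolding s_def by (simp_all add: inv_into_into f_inv_into_f)

lemma ops:
 "grade complex n = q n ` C n" "\<zero>[md complex n] = q n (ze n)"
 "x\<in>C n==>y\<in>C n==>q n x +[md complex n] q n y = q n (ad n x y)"
 "c\<in>carrier R==>x\<in>C n==>c *[md complex n] q n x = q n (sm n c x)"
 "x\<in>C n==>df complex n (q n x) = q (n + 1) (dd n x)"
 "x\<in>C i==>y\<in>C j==>product i j (q i x) (q j y) = q (i + j) (ml i j x y)"
 "fil complex p n = q n ` Fl p n"
proof -
 show "x\<in>C n==>y\<in>C n==>q n x +[md complex n] q n y = q n (ad n x y)"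
  unfolding complex_def carrier_module_def fcomplex.simps ring_record_simps by (rule cong(1)) (simp_all add: s)
 show "c\<in>carrier R==>x\<in>C n==>c *[md complex n] q n x = q n (sm n c x)"
  unfolding complex_def carrier_module_def fcomplex.simps module.simps by (rule cong(2)) (simp_all add: s)
 show "x\<in>C n==>df complex n (q n x) = q (n + 1) (dd n x)"
  unfolding complex_def fcomplex.simps by (rule cong(3)) (simp_all add: s)
 show "x\<in>C i==>y\<in>C j==>product i j (q i x) (q j y) = q (i + j) (ml i j x y)"
  unfolding product_def by (rule cong(4)) (simp_all add: s)
qed (simp_all add: complex_def carrier_module_def)

lemma q_eq: "n = n'==>q n x = q n' x" by simp

lemma complex_fcomplex: "fcx R complex"
proof -
 interpret R: cring R by (rule cring)
 have mod: "module R (md complex n)" for n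
 proof (rule moduleI[OF cring])
  show "abelian_group (md complex n)"
  proof (rule abelian_groupI, unfold ops(1,2), safe)
   fix x assume x: "x\<in>C n"
   show "\<exists>y\<in>q n ` C n. y +[md complex n] q n x = q n (ze n)"
    by (rule bexI[of _ "q n (sm n (\<ominus>[R] \<one>[R]) x)"]) (simp_all add: ops closed x group(4))
   show "q n (ze n) +[md complex n] q n x = q n x" by (simp add: ops closed x group(3))
   fix y assume y: "y\<in>C n"
   show "q n x +[md complex n] q n y\<in>q n ` C n" by (simp add: ops x y closed)
   show "q n x +[md complex n] q n y = q n y +[md complex n] q n x"
    using group(2)[OF x y] by (simp add: ops x y)
   fix z assume z: "z\<in>C n"
   show "q n x +[md complex n] q n y +[md complex n] q n z = q n x +[md complex n] (q n y +[md complex n] q n z)"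
    by (simp add: ops x y z closed group(1))
  qed (simp add: closed)
 qed (auto simp: ops closed modl)
 have sub: "submodule (fil complex p n) R (md complex n)" for p n
  unfolding submodule_iff[OF mod] ops(1,2,7)
 proof (intro conjI ballI)
  show "q n ` Fl p n \<subseteq> q n ` C n" using filt(1) by (rule image_mono)
  show "q n (ze n)\<in>q n ` Fl p n" using filt(2) by (rule imageI)
  fix a assume "a\<in>q n ` Fl p n"
  then obtain x where x: "a = q n x" "x\<in>Fl p n" "x\<in>C n" using filt(1) by blast
  { fix b assume "b\<in>q n ` Fl p n"
   then obtain y where y: "b = q n y" "y\<in>Fl p n" "y\<in>C n" using filt(1) by blast
   show "a +[md complex n] b\<in>q n ` Fl p n" using x y by (simp add: ops filt) }
  fix c assume "c\<in>carrier R"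
  then show "c *[md complex n] a\<in>q n ` Fl p n" using x by (simp add: ops filt)
 qed
 show ?thesis unfolding is_fcomplex_def
 proof (intro conjI allI mod sub)
  fix n show "df complex n\<in>mod_hom R (md complex n) (md complex (n + 1))"
   unfolding mod_hom_def by (auto simp: ops closed diff)
  show "\<forall>x\<in>grade complex n. df complex (n + 1) (df complex n x) = \<zero>[md complex (n + 1 + 1)]"
  proof
   fix a assume "a\<in>grade complex n"
   then obtain x where x: "a = q n x" "x\<in>C n" by (auto simp: ops)
   show "df complex (n + 1) (df complex n a) = \<zero>[md complex (n + 1 + 1)]"
    unfolding x(1) ops(2) ops(5)[OF x(2)] ops(5)[OF closed(4)[OF x(2)]] by (rule diff(3)[OF x(2)])
  qed
  fix p show "fil complex p n \<subseteq> fil complex (p + 1) n"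
   unfolding ops using filt(5) by (rule image_mono)
  show "df complex n ` fil complex p n \<subseteq> fil complex p (n + 1)"
  proof
   fix a assume "a\<in>df complex n ` fil complex p n"
   then obtain x where x: "a = df complex n (q n x)" "x\<in>Fl p n" "x\<in>C n"
    using filt(1) unfolding ops(7) by blast
   then show "a\<in>fil complex p (n + 1)" using filt(6) by (simp add: ops)
  qed
 qed
qed

lemma product_laws: "dga_laws R complex product (q 0 un)"
 unfolding dga_laws_def
proof (intro conjI allI ballI)
 note ks = koszul_sign_closed[OF cring]
 show "q 0 un\<in>fil complex 0 0" unfolding ops using filt(8) by (rule imageI)
 fix n a assume "a\<in>grade complex n"
 then obtain x where x: "a = q n x" "x\<in>C n" by (auto simp: ops)
 show "product 0 n (q 0 un) a = a" using mult(6)[OF x(2)] ops(6)[OF closed(6) x(2)] by (simp add: x)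
 show "product n 0 a (q 0 un) = a" using mult(7)[OF x(2)] ops(6)[OF x(2) closed(6)] by (simp add: x)
next
 fix p p' i j a b assume "a\<in>fil complex p i" "b\<in>fil complex p' j"
 then obtain x y where x: "a = q i x" "x\<in>Fl p i" "x\<in>C i" and y: "b = q j y" "y\<in>Fl p' j" "y\<in>C j"
  using filt(1) unfolding ops by blast
 show "product i j a b\<in>fil complex (p + p') (i + j)"
  unfolding x y ops(6)[OF x(3) y(3)] ops(7) using filt(7)[OF x(2) y(2)] by (rule imageI)
next
 note ks = koszul_sign_closed[OF cring]
 fix i j a b assume "a\<in>grade complex i" "b\<in>grade complex j"
 then obtain x y where x: "a = q i x" "x\<in>C i" and y: "b = q j y" "y\<in>C j" by (auto simp: ops)
 show "product i j a b\<in>grade complex (i + j)" by (simp add: x y ops closed)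
 show "df complex (i + j) (product i j a b) = product (i + 1) j (df complex i a) b +[md complex (i + j + 1)]
     koszul_sign R i *[md complex (i + j + 1)] product i (j + 1) a (df complex j b)"
 proof -
  have "product (i + 1) j (df complex i a) b = q (i + j + 1) (ml (i + 1) j (dd i x) y)"
   unfolding x y ops(5)[OF x(2)] ops(6)[OF closed(4)[OF x(2)] y(2)] by (rule q_eq) simp
  moreover have "product i (j + 1) a (df complex j b) = q (i + j + 1) (ml i (j + 1) x (dd j y))"
   unfolding x y ops(5)[OF y(2)] ops(6)[OF x(2) closed(4)[OF y(2)]] by (rule q_eq) simp
  moreover have "ml (i + 1) j (dd i x) y\<in>C (i + j + 1)" "ml i (j + 1) x (dd j y)\<in>C (i + j + 1)"
   using closed(5)[OF closed(4)[OF x(2)] y(2)] closed(5)[OF x(2) closed(4)[OF y(2)]]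
   by (simp_all add: algebra_simps)
  ultimately show ?thesis
   using mult(8)[OF x(2) y(2)] x y ks by (simp add: ops closed)
 qed
 { fix a' assume "a'\<in>grade complex i"
  then obtain x' where x': "a' = q i x'" "x'\<in>C i" by (auto simp: ops)
  show "product i j (a +[md complex i] a') b = product i j a b +[md complex (i + j)] product i j a' b"
   by (simp add: x x' y ops closed mult) }
 { fix b' assume "b'\<in>grade complex j"
  then obtain y' where y': "b' = q j y'" "y'\<in>C j" by (auto simp: ops)
  show "product i j a (b +[md complex j] b') = product i j a b +[md complex (i + j)] product i j a b'"
   by (simp add: x y' y ops closed mult) }
 { fix c assume c: "c\<in>carrier R"
  show "product i j (c *[md complex i] a) b = c *[md complex (i + j)] product i j a b"
   by (simp add: x c y ops closed mult)
  show "product i j a (c *[md complex j] b) = c *[md complex (i + j)] product i j a b"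
   by (simp add: x c y ops closed mult) }
 fix k c assume "c\<in>grade complex k"
 then obtain z where z: "c = q k z" "z\<in>C k" by (auto simp: ops)
 have "q (i + (j + k)) (ml i (j + k) x (ml j k y z)) = q (i + j + k) (ml i (j + k) x (ml j k y z))"
  by (rule q_eq) simp
 then show "product (i + j) k (product i j a b) c = product i (j + k) a (product j k b c)"
  using mult(5)[OF x(2) y(2) z(2)] by (simp add: x y z ops closed)
qed

definition algebra :: "('r, 'a) fdga" where
 "algebra = make_fdga R complex product (q 0 un)"

theorem presented:
 "is_fdga R algebra" "elts algebra n = q n ` C n" "\<zero>[md (cx algebra) n] = q n (ze n)"
 "x\<in>C n==>y\<in>C n==>q n x +[md (cx algebra) n] q n y = q n (ad n x y)"
 "c\<in>carrier R==>x\<in>C n==>c *[md (cx algebra) n] q n x = q n (sm n c x)"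
 "x\<in>C n==>df (cx algebra) n (q n x) = q (n + 1) (dd n x)"
 "x\<in>C i==>y\<in>C j==>fmul R algebra i j (q i x) (q j y) = q (i + j) (ml i j x y)"
 "fone R algebra = q 0 un" "fil (cx algebra) p n = q n ` Fl p n"
 by (simp_all add: algebra_def make_fdga[OF cring complex_fcomplex product_laws] ops)

end

section \<open>Reduced products of algebras\<close>

text \<open>The laws in the shape that \<open>raw_dga\<close> asks for; in particular negatives are
  written as multiples by minus one.\<close>

lemma fdga_alg:
 assumes R: "cring R" and N: "is_fdga R N"
 shows "x\<in>elts N n==>y\<in>elts N n==>x +[md (cx N) n] y\<in>elts N n"
  "\<zero>[md (cx N) n]\<in>elts N n"
  "c\<in>carrier R==>x\<in>elts N n==>c *[md (cx N) n] x\<in>elts N n"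
  "x\<in>elts N n==>df (cx N) n x\<in>elts N (n + 1)"
  "a\<in>elts N i==>b\<in>elts N j==>fmul R N i j a b\<in>elts N (i + j)"
  "fone R N\<in>elts N 0"
  "x\<in>elts N n==>y\<in>elts N n==>z\<in>elts N n ==>
   x +[md (cx N) n] y +[md (cx N) n] z = x +[md (cx N) n] (y +[md (cx N) n] z)"
  "x\<in>elts N n==>y\<in>elts N n==>x +[md (cx N) n] y = y +[md (cx N) n] x"
  "x\<in>elts N n==>\<zero>[md (cx N) n] +[md (cx N) n] x = x"
  "x\<in>elts N n==>((\<ominus>[R] \<one>[R]) *[md (cx N) n] x) +[md (cx N) n] x = \<zero>[md (cx N) n]"
  "c\<in>carrier R==>d\<in>carrier R==>x\<in>elts N n ==>
   (c +[R] d) *[md (cx N) n] x = c *[md (cx N) n] x +[md (cx N) n] d *[md (cx N) n] x"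
  "c\<in>carrier R==>x\<in>elts N n==>y\<in>elts N n ==>
   c *[md (cx N) n] (x +[md (cx N) n] y) = c *[md (cx N) n] x +[md (cx N) n] c *[md (cx N) n] y"
  "c\<in>carrier R==>d\<in>carrier R==>x\<in>elts N n ==>
   (c \<otimes>[R] d) *[md (cx N) n] x = c *[md (cx N) n] (d *[md (cx N) n] x)"
  "x\<in>elts N n==>\<one>[R] *[md (cx N) n] x = x"
  "x\<in>elts N n==>y\<in>elts N n ==>
   df (cx N) n (x +[md (cx N) n] y) = df (cx N) n x +[md (cx N) (n + 1)] df (cx N) n y"
  "c\<in>carrier R==>x\<in>elts N n==>df (cx N) n (c *[md (cx N) n] x) = c *[md (cx N) (n + 1)] df (cx N) n x"
  "x\<in>elts N n==>df (cx N) (n + 1) (df (cx N) n x) = \<zero>[md (cx N) (n + 1 + 1)]"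
proof -
 note F = fcxD[OF fdgaD(1)[OF R N]] and L = dga_lawsD[OF fdgaD(2)[OF R N]]
 interpret module R "md (cx N) n" by (rule F(1))
 show "x\<in>elts N n==>y\<in>elts N n ==>
   df (cx N) n (x +[md (cx N) n] y) = df (cx N) n x +[md (cx N) (n + 1)] df (cx N) n y"
  "c\<in>carrier R==>x\<in>elts N n==>df (cx N) n (c *[md (cx N) n] x) = c *[md (cx N) (n + 1)] df (cx N) n x"
  by (simp_all add: mod_homD[OF F(2)])
 show "x\<in>elts N n==>df (cx N) (n + 1) (df (cx N) n x) = \<zero>[md (cx N) (n + 1 + 1)]" by (rule F(4))
 show "x\<in>elts N n==>df (cx N) n x\<in>elts N (n + 1)" by (rule F(3))
 show "a\<in>elts N i==>b\<in>elts N j==>fmul R N i j a b\<in>elts N (i + j)" by (rule L(1))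
 show "fone R N\<in>elts N 0" by (rule dga_one_closed(1)[OF R fdgaD(1,2)[OF R N]])
 show "x\<in>elts N n==>((\<ominus>[R] \<one>[R]) *[md (cx N) n] x) +[md (cx N) n] x = \<zero>[md (cx N) n]"
  by (simp add: smult_l_minus M.l_neg)
 note m = M.a_closed M.zero_closed smult_closed M.a_assoc M.l_zero smult_l_distr smult_r_distr smult_assoc1 smult_one
 show "x\<in>elts N n==>y\<in>elts N n==>x +[md (cx N) n] y = y +[md (cx N) n] x" by (rule M.a_comm)
 show "x\<in>elts N n==>y\<in>elts N n==>x +[md (cx N) n] y\<in>elts N n"
  "\<zero>[md (cx N) n]\<in>elts N n"
  "c\<in>carrier R==>x\<in>elts N n==>c *[md (cx N) n] x\<in>elts N n"
  "x\<in>elts N n==>y\<in>elts N n==>z\<in>elts N n ==>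
   x +[md (cx N) n] y +[md (cx N) n] z = x +[md (cx N) n] (y +[md (cx N) n] z)"
  "x\<in>elts N n==>\<zero>[md (cx N) n] +[md (cx N) n] x = x"
  "c\<in>carrier R==>d\<in>carrier R==>x\<in>elts N n ==>
   (c +[R] d) *[md (cx N) n] x = c *[md (cx N) n] x +[md (cx N) n] d *[md (cx N) n] x"
  "c\<in>carrier R==>x\<in>elts N n==>y\<in>elts N n ==>
   c *[md (cx N) n] (x +[md (cx N) n] y) = c *[md (cx N) n] x +[md (cx N) n] c *[md (cx N) n] y"
  "c\<in>carrier R==>d\<in>carrier R==>x\<in>elts N n ==>
   (c \<otimes>[R] d) *[md (cx N) n] x = c *[md (cx N) n] (d *[md (cx N) n] x)"
  "x\<in>elts N n==>\<one>[R] *[md (cx N) n] x = x"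
  by (simp_all add: m)
qed

lemma fil_alg:
 assumes A: "fcx R A"
 shows "\<zero>[md A n]\<in>fil A p n"
  "x\<in>fil A p n==>y\<in>fil A p n==>x +[md A n] y\<in>fil A p n"
  "x\<in>fil A p n==>y\<in>fil A p n==>x -[md A n] y\<in>fil A p n"
  "x\<in>fil A p n==>\<ominus>[md A n] x\<in>fil A p n"
  "c\<in>carrier R==>x\<in>fil A p n==>c *[md A n] x\<in>fil A p n"
proof -
 note m = submodule_facts[OF fcxD(1,5)[OF A]]
 show "\<zero>[md A n]\<in>fil A p n" by (rule m(2))
 show "x\<in>fil A p n==>y\<in>fil A p n==>x +[md A n] y\<in>fil A p n" by (rule m(4))
 show "x\<in>fil A p n==>y\<in>fil A p n==>x -[md A n] y\<in>fil A p n" by (rule m(5))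
 show "x\<in>fil A p n==>\<ominus>[md A n] x\<in>fil A p n" by (rule m(3))
 show "c\<in>carrier R==>x\<in>fil A p n==>c *[md A n] x\<in>fil A p n" by (rule m(6))
qed

text \<open>A subalgebra, given by \<open>C\<close>, of a reduced product: \<open>el n\<close> takes
  a family to its class modulo agreement on a set of the filter. For a principal filter this is a
  subalgebra of the product over the base set; for the tails of an ordinal and the eventually
  compatible families it is a direct limit.\<close>

definition presents ::
 "'r ring => 'k filter => ('k => ('r, 'a) fdga) => (int => ('k => 'a) set) =>
  ('r, 'b) fdga => (int => ('k => 'a) => 'b) => bool" where
 "presents R F M C E el \<longleftrightarrow> is_fdga R E &
  (\<forall>n. elts E n = el n ` C n) &
  (\<forall>n. \<forall>\<phi>\<in>C n. \<forall>\<psi>\<in>C n. el n \<phi> = el n \<psi> \<longleftrightarrow> (\<forall>\<^sub>F k in F. \<phi> k = \<psi> k)) &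
  (\<forall>n. \<forall>\<phi>\<in>C n. \<forall>\<^sub>F k in F. \<phi> k\<in>elts (M k) n) &
  (\<forall>n. (%k. \<zero>[md (cx (M k)) n])\<in>C n & \<zero>[md (cx E) n] = el n (%k. \<zero>[md (cx (M k)) n])) &
  (\<forall>n. \<forall>\<phi>\<in>C n. \<forall>\<psi>\<in>C n. (%k. \<phi> k +[md (cx (M k)) n] \<psi> k)\<in>C n &
   el n \<phi> +[md (cx E) n] el n \<psi> = el n (%k. \<phi> k +[md (cx (M k)) n] \<psi> k)) &
  (\<forall>n. \<forall>c\<in>carrier R. \<forall>\<phi>\<in>C n. (%k. c *[md (cx (M k)) n] \<phi> k)\<in>C n &
   c *[md (cx E) n] el n \<phi> = el n (%k. c *[md (cx (M k)) n] \<phi> k)) &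
  (\<forall>n. \<forall>\<phi>\<in>C n. (%k. df (cx (M k)) n (\<phi> k))\<in>C (n + 1) &
   df (cx E) n (el n \<phi>) = el (n + 1) (%k. df (cx (M k)) n (\<phi> k))) &
  (\<forall>i j. \<forall>\<phi>\<in>C i. \<forall>\<psi>\<in>C j. (%k. fmul R (M k) i j (\<phi> k) (\<psi> k))\<in>C (i + j) &
   fmul R E i j (el i \<phi>) (el j \<psi>) = el (i + j) (%k. fmul R (M k) i j (\<phi> k) (\<psi> k))) &
  (%k. fone R (M k))\<in>C 0 & fone R E = el 0 (%k. fone R (M k)) &
  (\<forall>p n. \<forall>\<phi>\<in>C n. el n \<phi>\<in>fil (cx E) p n \<longleftrightarrow> (\<forall>\<^sub>F k in F. \<phi> k\<in>fil (cx (M k)) p n))"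

text \<open>The full product over \<open>'k\<close> may be too large for the type \<open>'b\<close>.
  Codes are asked for only on a set \<open>D\<close> that contains the chosen families.\<close>

locale subproduct =
 fixes R :: "'r ring" and F :: "'k filter" and M :: "'k => ('r, 'a) fdga"
  and C :: "int => ('k => 'a) set" and code :: "('k => 'a) => 'b" and D
 assumes cring: "cring R" and ev: "\<forall>\<^sub>F k in F. is_fdga R (M k)"
  and ev_elts: "!!n \<phi>. \<phi>\<in>C n==>\<forall>\<^sub>F k in F. \<phi> k\<in>elts (M k) n"
  and closed: "!!n \<phi> \<psi>. \<phi>\<in>C n==>\<psi>\<in>C n==>(%k. \<phi> k +[md (cx (M k)) n] \<psi> k)\<in>C n"
   "!!n. (%k. \<zero>[md (cx (M k)) n])\<in>C n"
   "!!n c \<phi>. c\<in>carrier R==>\<phi>\<in>C n==>(%k. c *[md (cx (M k)) n] \<phi> k)\<in>C n"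
   "!!n \<phi>. \<phi>\<in>C n==>(%k. df (cx (M k)) n (\<phi> k))\<in>C (n + 1)"
   "!!i j \<phi> \<psi>. \<phi>\<in>C i==>\<psi>\<in>C j==>(%k. fmul R (M k) i j (\<phi> k) (\<psi> k))\<in>C (i + j)"
   "(%k. fone R (M k))\<in>C 0"
  and D: "!!n. C n \<subseteq> D" and code: "inj_on code D"
begin

text \<open>The predicate under \<open>SOME\<close> depends only on the class of the family, and so
  does the chosen member. Coding this member therefore codes the class.\<close>

definition rep :: "('k => 'a) => 'k => 'a" where
 "rep \<phi> = (SOME \<psi>. \<psi>\<in>D & (\<forall>\<^sub>F k in F. \<psi> k = \<phi> k))"

definition qq :: "int => ('k => 'a) => 'b" where "qq n \<phi> = code (rep \<phi>)"

lemma rep: "\<phi>\<in>D==>rep \<phi>\<in>D & (\<forall>\<^sub>F k in F. rep \<phi> k = \<phi> k)"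
 unfolding rep_def by (rule someI[of _ \<phi>]) simp

lemma qq_eq:
 assumes "\<phi>\<in>D" "\<psi>\<in>D"
 shows "qq n \<phi> = qq m \<psi> \<longleftrightarrow> (\<forall>\<^sub>F k in F. \<phi> k = \<psi> k)"
proof
 assume "qq n \<phi> = qq m \<psi>"
 then have "rep \<phi> = rep \<psi>" unfolding qq_def using rep assms code by (blast dest: inj_onD)
 then have "\<forall>\<^sub>F k in F. rep \<psi> k = \<phi> k" "\<forall>\<^sub>F k in F. rep \<psi> k = \<psi> k" using rep[OF assms(1)] rep[OF assms(2)] by simp_all
 then show "\<forall>\<^sub>F k in F. \<phi> k = \<psi> k" by eventually_elim simp
next
 assume e: "\<forall>\<^sub>F k in F. \<phi> k = \<psi> k"
 have "(\<forall>\<^sub>F k in F. \<chi> k = \<phi> k) \<longleftrightarrow> (\<forall>\<^sub>F k in F. \<chi> k = \<psi> k)" for \<chi> :: "'k => 'a"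
 proof
  assume "\<forall>\<^sub>F k in F. \<chi> k = \<phi> k" with e show "\<forall>\<^sub>F k in F. \<chi> k = \<psi> k" by eventually_elim simp
 next
  assume "\<forall>\<^sub>F k in F. \<chi> k = \<psi> k" with e show "\<forall>\<^sub>F k in F. \<chi> k = \<phi> k" by eventually_elim simp
 qed
 then show "qq n \<phi> = qq m \<psi>" unfolding qq_def rep_def by simp
qed

lemma qq_iff: "\<phi>\<in>C i==>\<psi>\<in>C j==>qq n \<phi> = qq m \<psi> \<longleftrightarrow> (\<forall>\<^sub>F k in F. \<phi> k = \<psi> k)"
 using D by (blast intro!: qq_eq)

lemma qqI: "\<forall>\<^sub>F k in F. \<phi> k = \<psi> k==>\<phi>\<in>C i==>\<psi>\<in>C j==>qq n \<phi> = qq n \<psi>"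
 by (simp add: qq_iff)

definition Fl :: "int => int => ('k => 'a) set" where
 "Fl p n = {\<phi>\<in>C n. \<forall>\<^sub>F k in F. \<phi> k\<in>fil (cx (M k)) p n}"

lemma Fl_iff: "\<phi>\<in>Fl p n \<longleftrightarrow> \<phi>\<in>C n & (\<forall>\<^sub>F k in F. \<phi> k\<in>fil (cx (M k)) p n)"
 by (simp add: Fl_def)

text \<open>Every law holds at each index where \<open>M k\<close> is an algebra and the families
  involved take values in it, and these indices form a set of the filter.\<close>

lemma raw: "raw_dga R C qq (%n \<phi> \<psi> k. \<phi> k +[md (cx (M k)) n] \<psi> k) (%n k. \<zero>[md (cx (M k)) n])
  (%n c \<phi> k. c *[md (cx (M k)) n] \<phi> k) (%n \<phi> k. df (cx (M k)) n (\<phi> k))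
  (%i j \<phi> \<psi> k. fmul R (M k) i j (\<phi> k) (\<psi> k)) (%k. fone R (M k)) Fl"
proof -
 interpret R: cring R by (rule cring)
 note A = fdga_alg[OF cring] and L = dga_lawsD[OF fdgaD(2)[OF cring]] and E = ev_elts
 note ks = koszul_sign_closed[OF cring]
 show ?thesis
 proof (rule raw_dga.intro, goal_cases)
  case 1 show ?case by (rule cring)
 next
  case (2 n x y) then show ?case by (rule closed(1))
 next
  case (3 n) show ?case by (rule closed(2))
 next
  case (4 n c x) then show ?case by (rule closed(3))
 next
  case (5 n x) then show ?case by (rule closed(4))
 next
  case (6 i j x y) then show ?case by (rule closed(5))
 next
  case 7 show ?case by (rule closed(6))
 next
  case (8 n x x' y y')
  have "\<forall>\<^sub>F k in F. x k = x' k" "\<forall>\<^sub>F k in F. y k = y' k" using 8 by (simp_all add: qq_iff)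
  then show ?case by (intro qqI[OF _ closed(1) closed(1)] 8, eventually_elim) simp
 next
  case (9 n c x x')
  have "\<forall>\<^sub>F k in F. x k = x' k" using 9 by (simp add: qq_iff)
  then show ?case by (intro qqI[OF _ closed(3) closed(3)] 9, eventually_elim) simp
 next
  case (10 n x x')
  have "\<forall>\<^sub>F k in F. x k = x' k" using 10 by (simp add: qq_iff)
  then show ?case by (intro qqI[OF _ closed(4) closed(4)] 10, eventually_elim) simp
 next
  case (11 i j x x' y y')
  have "\<forall>\<^sub>F k in F. x k = x' k" "\<forall>\<^sub>F k in F. y k = y' k" using 11 by (simp_all add: qq_iff)
  then show ?case by (intro qqI[OF _ closed(5) closed(5)] 11, eventually_elim) simp
 next
  case (12 n x y z)
  show ?case using ev E[OF 12(1)] E[OF 12(2)] E[OF 12(3)]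
   by (intro qqI[OF _ closed(1)[OF closed(1)] closed(1)[OF _ closed(1)]] 12, eventually_elim) (rule A(7))
 next
  case (13 n x y)
  show ?case using ev E[OF 13(1)] E[OF 13(2)]
   by (intro qqI[OF _ closed(1) closed(1)] 13, eventually_elim) (rule A(8))
 next
  case (14 n x)
  show ?case using ev E[OF 14(1)]
   by (intro qqI[OF _ closed(1)[OF closed(2)] 14] 14, eventually_elim) (rule A(9))
 next
  case (15 n x)
  show ?case using ev E[OF 15(1)]
   by (intro qqI[OF _ closed(1)[OF closed(3)] closed(2)] 15 R.a_inv_closed R.one_closed, eventually_elim) (rule A(10))
 next
  case (16 n c d x)
  show ?case using ev E[OF 16(3)]
   by (intro qqI[OF _ closed(3) closed(1)[OF closed(3) closed(3)]] 16 R.a_closed, eventually_elim) (rule A(11)[OF _ 16(1,2)])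
 next
  case (17 n c x y)
  show ?case using ev E[OF 17(2)] E[OF 17(3)]
   by (intro qqI[OF _ closed(3)[OF _ closed(1)] closed(1)[OF closed(3) closed(3)]] 17, eventually_elim) (rule A(12)[OF _ 17(1)])
 next
  case (18 n c d x)
  show ?case using ev E[OF 18(3)]
   by (intro qqI[OF _ closed(3) closed(3)[OF _ closed(3)]] 18 R.m_closed, eventually_elim) (rule A(13)[OF _ 18(1,2)])
 next
  case (19 n x)
  show ?case using ev E[OF 19(1)]
   by (intro qqI[OF _ closed(3)[OF R.one_closed] 19] 19, eventually_elim) (rule A(14))
 next
  case (20 n x y)
  show ?case using ev E[OF 20(1)] E[OF 20(2)]
   by (intro qqI[OF _ closed(4)[OF closed(1)] closed(1)[OF closed(4) closed(4)]] 20, eventually_elim) (rule A(15))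
 next
  case (21 n c x)
  show ?case using ev E[OF 21(2)]
   by (intro qqI[OF _ closed(4)[OF closed(3)] closed(3)[OF _ closed(4)]] 21, eventually_elim) (rule A(16)[OF _ 21(1)])
 next
  case (22 n x)
  show ?case using ev E[OF 22(1)]
   by (intro qqI[OF _ closed(4)[OF closed(4)] closed(2)] 22, eventually_elim) (rule A(17))
 next
  case (23 i j x x' y)
  show ?case using ev E[OF 23(1)] E[OF 23(2)] E[OF 23(3)]
   by (intro qqI[OF _ closed(5)[OF closed(1)] closed(1)[OF closed(5) closed(5)]] 23, eventually_elim) (rule L(2))
 next
  case (24 i j x y y')
  show ?case using ev E[OF 24(1)] E[OF 24(2)] E[OF 24(3)]
   by (intro qqI[OF _ closed(5)[OF _ closed(1)] closed(1)[OF closed(5) closed(5)]] 24, eventually_elim) (rule L(3))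
 next
  case (25 i j x y c)
  show ?case using ev E[OF 25(1)] E[OF 25(2)]
   by (intro qqI[OF _ closed(5)[OF closed(3)] closed(3)[OF _ closed(5)]] 25, eventually_elim) (rule L(4)[OF _ _ _ 25(3)])
 next
  case (26 i j x y c)
  show ?case using ev E[OF 26(1)] E[OF 26(2)]
   by (intro qqI[OF _ closed(5)[OF _ closed(3)] closed(3)[OF _ closed(5)]] 26, eventually_elim) (rule L(5)[OF _ _ _ 26(3)])
 next
  case (27 i j k x y z)
  show ?case using ev E[OF 27(1)] E[OF 27(2)] E[OF 27(3)]
   by (intro qqI[OF _ closed(5)[OF closed(5)] closed(5)[OF _ closed(5)]] 27, eventually_elim) (rule L(6))
 next
  case (28 n x)
  show ?case using ev E[OF 28(1)]
   by (intro qqI[OF _ closed(5)[OF closed(6)] 28] 28, eventually_elim) (rule L(8))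
 next
  case (29 n x)
  show ?case using ev E[OF 29(1)]
   by (intro qqI[OF _ closed(5)[OF _ closed(6)] 29] 29, eventually_elim) (rule L(9))
 next
  case (30 i j x y)
  have "(%k. fmul R (M k) (i + 1) j (df (cx (M k)) i (x k)) (y k))\<in>C (i + j + 1)"
   "(%k. fmul R (M k) i (j + 1) (x k) (df (cx (M k)) j (y k)))\<in>C (i + j + 1)"
   using closed(5)[OF closed(4)[OF 30(1)] 30(2)] closed(5)[OF 30(1) closed(4)[OF 30(2)]]
   by (simp_all add: algebra_simps)
  then have cl: "(%k. fmul R (M k) (i + 1) j (df (cx (M k)) i (x k)) (y k) +[md (cx (M k)) (i + j + 1)]
   koszul_sign R i *[md (cx (M k)) (i + j + 1)] fmul R (M k) i (j + 1) (x k) (df (cx (M k)) j (y k)))\<in>C (i + j + 1)"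
   using closed(1,3) ks by blast
  show ?case using ev E[OF 30(1)] E[OF 30(2)]
   by (intro qqI[OF _ closed(4)[OF closed(5)] cl] 30, eventually_elim) (rule L(10))
 next
  case (31 p n) show ?case by (auto simp: Fl_iff)
 next
  case (32 p n)
  have "\<forall>\<^sub>F k in F. \<zero>[md (cx (M k)) n]\<in>fil (cx (M k)) p n"
   using ev by eventually_elim (rule fil_alg[OF fdgaD(1)[OF cring]])
  then show ?case by (simp add: Fl_iff closed)
 next
  case (33 p n x y)
  then have e: "\<forall>\<^sub>F k in F. x k\<in>fil (cx (M k)) p n" "\<forall>\<^sub>F k in F. y k\<in>fil (cx (M k)) p n" by (simp_all add: Fl_iff)
  have "\<forall>\<^sub>F k in F. x k +[md (cx (M k)) n] y k\<in>fil (cx (M k)) p n"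
   using ev e by eventually_elim (rule fil_alg(2)[OF fdgaD(1)[OF cring]])
  then show ?case using 33 by (simp add: Fl_iff closed)
 next
  case (34 p n c x)
  then have e: "\<forall>\<^sub>F k in F. x k\<in>fil (cx (M k)) p n" by (simp_all add: Fl_iff)
  have "\<forall>\<^sub>F k in F. c *[md (cx (M k)) n] x k\<in>fil (cx (M k)) p n"
   using ev e by eventually_elim (rule fil_alg(5)[OF fdgaD(1)[OF cring] 34(1)])
  then show ?case using 34 by (simp add: Fl_iff closed)
 next
  case (35 p n)
  show ?case
  proof
   fix x assume "x\<in>Fl p n"
   then have x: "x\<in>C n" and e: "\<forall>\<^sub>F k in F. x k\<in>fil (cx (M k)) p n" by (simp_all add: Fl_iff)
   have "\<forall>\<^sub>F k in F. x k\<in>fil (cx (M k)) (p + 1) n"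
    using ev e by eventually_elim (rule subsetD[OF fcxD(6)[OF fdgaD(1)[OF cring]]])
   then show "x\<in>Fl (p + 1) n" using x by (simp add: Fl_iff)
  qed
 next
  case (36 p n x)
  then have e: "\<forall>\<^sub>F k in F. x k\<in>fil (cx (M k)) p n" by (simp_all add: Fl_iff)
  have "\<forall>\<^sub>F k in F. df (cx (M k)) n (x k)\<in>fil (cx (M k)) p (n + 1)"
   using ev e by eventually_elim (rule fcxD(7)[OF fdgaD(1)[OF cring]])
  then show ?case using 36 by (simp add: Fl_iff closed)
 next
  case (37 p p' i j x y)
  then have e: "\<forall>\<^sub>F k in F. x k\<in>fil (cx (M k)) p i" "\<forall>\<^sub>F k in F. y k\<in>fil (cx (M k)) p' j" by (simp_all add: Fl_iff)
  have "\<forall>\<^sub>F k in F. fmul R (M k) i j (x k) (y k)\<in>fil (cx (M k)) (p + p') (i + j)"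
   using ev e by eventually_elim (rule L(11))
  then show ?case using 37 by (simp add: Fl_iff closed)
 next
  case 38
  have "\<forall>\<^sub>F k in F. fone R (M k)\<in>fil (cx (M k)) 0 0"
   using ev by eventually_elim (rule L(7))
  then show ?case by (simp add: Fl_iff closed)
 qed
qed

theorem presented: obtains E :: "('r, 'b) fdga" and el where "presents R F M C E el"
proof -
 interpret P: raw_dga R C qq "%n \<phi> \<psi> k. \<phi> k +[md (cx (M k)) n] \<psi> k" "%n k. \<zero>[md (cx (M k)) n]"
  "%n c \<phi> k. c *[md (cx (M k)) n] \<phi> k" "%n \<phi> k. df (cx (M k)) n (\<phi> k)"
  "%i j \<phi> \<psi> k. fmul R (M k) i j (\<phi> k) (\<psi> k)" "%k. fone R (M k)" Fl
  by (rule raw)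
 note E = P.presented
 have "qq n \<phi>\<in>qq n ` Fl p n \<longleftrightarrow> (\<forall>\<^sub>F k in F. \<phi> k\<in>fil (cx (M k)) p n)" if "\<phi>\<in>C n" for \<phi> n p
 proof
  assume "qq n \<phi>\<in>qq n ` Fl p n"
  then obtain \<psi> where p: "\<psi>\<in>C n" "qq n \<phi> = qq n \<psi>" and e: "\<forall>\<^sub>F k in F. \<psi> k\<in>fil (cx (M k)) p n" by (auto simp: Fl_iff)
  have "\<forall>\<^sub>F k in F. \<phi> k = \<psi> k" using p that by (simp add: qq_iff)
  with e show "\<forall>\<^sub>F k in F. \<phi> k\<in>fil (cx (M k)) p n" by eventually_elim simp
 qed (use that in \<open>auto simp: Fl_iff\<close>)
 then have "presents R F M C P.algebra qq" unfolding presents_def E(9)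
  using E closed ev_elts by (auto simp: qq_iff)
 then show thesis by (rule that)
qed

end

lemma presentsD:
 assumes "presents R F M C E el"
 shows "is_fdga R E" "elts E n = el n ` C n"
  "\<phi>\<in>C n==>\<psi>\<in>C n==>el n \<phi> = el n \<psi> \<longleftrightarrow> (\<forall>\<^sub>F k in F. \<phi> k = \<psi> k)"
  "\<phi>\<in>C n==>\<forall>\<^sub>F k in F. \<phi> k\<in>elts (M k) n"
  "(%k. \<zero>[md (cx (M k)) n])\<in>C n" "\<zero>[md (cx E) n] = el n (%k. \<zero>[md (cx (M k)) n])"
  "\<phi>\<in>C n==>\<psi>\<in>C n==>(%k. \<phi> k +[md (cx (M k)) n] \<psi> k)\<in>C n"
  "\<phi>\<in>C n==>\<psi>\<in>C n==>el n \<phi> +[md (cx E) n] el n \<psi> = el n (%k. \<phi> k +[md (cx (M k)) n] \<psi> k)"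
  "c\<in>carrier R==>\<phi>\<in>C n==>(%k. c *[md (cx (M k)) n] \<phi> k)\<in>C n"
  "c\<in>carrier R==>\<phi>\<in>C n==>c *[md (cx E) n] el n \<phi> = el n (%k. c *[md (cx (M k)) n] \<phi> k)"
  "\<phi>\<in>C n==>(%k. df (cx (M k)) n (\<phi> k))\<in>C (n + 1)"
  "\<phi>\<in>C n==>df (cx E) n (el n \<phi>) = el (n + 1) (%k. df (cx (M k)) n (\<phi> k))"
  "\<phi>\<in>C i==>\<psi>\<in>C j==>(%k. fmul R (M k) i j (\<phi> k) (\<psi> k))\<in>C (i + j)"
  "\<phi>\<in>C i==>\<psi>\<in>C j==>fmul R E i j (el i \<phi>) (el j \<psi>) = el (i + j) (%k. fmul R (M k) i j (\<phi> k) (\<psi> k))"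
  "(%k. fone R (M k))\<in>C 0" "fone R E = el 0 (%k. fone R (M k))"
  "\<phi>\<in>C n==>el n \<phi>\<in>fil (cx E) p n \<longleftrightarrow> (\<forall>\<^sub>F k in F. \<phi> k\<in>fil (cx (M k)) p n)"
  "\<phi>\<in>C n==>el n \<phi>\<in>elts E n"
 using assms unfolding presents_def by simp_all

section \<open>Maps out of and into reduced products\<close>

lemma presents_map_out:
 fixes E N :: "('r, 'a) fdga" and h :: "int => ('k => 'b) => 'a"
 assumes R: "cring R" and P: "presents R F M C E el" and N: "is_fdga R N"
  and h: "!!n \<phi>. \<phi>\<in>C n==>h n \<phi>\<in>elts N n"
  and cong: "!!n \<phi> \<psi>. \<phi>\<in>C n==>\<psi>\<in>C n==>\<forall>\<^sub>F k in F. \<phi> k = \<psi> k==>h n \<phi> = h n \<psi>"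
  and add: "!!n \<phi> \<psi>. \<phi>\<in>C n==>\<psi>\<in>C n==>h n (%k. \<phi> k +[md (cx (M k)) n] \<psi> k) = h n \<phi> +[md (cx N) n] h n \<psi>"
  and sm: "!!n c \<phi>. c\<in>carrier R==>\<phi>\<in>C n==>h n (%k. c *[md (cx (M k)) n] \<phi> k) = c *[md (cx N) n] h n \<phi>"
  and d: "!!n \<phi>. \<phi>\<in>C n==>h (n + 1) (%k. df (cx (M k)) n (\<phi> k)) = df (cx N) n (h n \<phi>)"
  and mul: "!!i j \<phi> \<psi>. \<phi>\<in>C i==>\<psi>\<in>C j==>h (i + j) (%k. fmul R (M k) i j (\<phi> k) (\<psi> k)) = fmul R N i j (h i \<phi>) (h j \<psi>)"
  and one: "h 0 (%k. fone R (M k)) = fone R N"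
  and fl: "!!p n \<phi>. \<phi>\<in>C n==>\<forall>\<^sub>F k in F. \<phi> k\<in>fil (cx (M k)) p n==>h n \<phi>\<in>fil (cx N) p n"
 obtains f where "dgmap R E N f" "!!n \<phi>. \<phi>\<in>C n==>f n (el n \<phi>) = h n \<phi>"
proof -
 note D = presentsD[OF P]
 define f where "f n = (\<lambda>x\<in>elts E n. h n (inv_into (C n) (el n) x))" for n
 have fel: "f n (el n \<phi>) = h n \<phi>" if "\<phi>\<in>C n" for n \<phi>
 proof -
  have "el n (inv_into (C n) (el n) (el n \<phi>)) = el n \<phi>" "inv_into (C n) (el n) (el n \<phi>)\<in>C n"
   using that by (simp_all add: f_inv_into_f inv_into_into)
  then have "h n (inv_into (C n) (el n) (el n \<phi>)) = h n \<phi>" using cong D(3) that by blast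
  then show ?thesis using that by (simp add: f_def D)
 qed
 have "is_fmap R (cx E) (cx N) f" unfolding is_fmap_def
 proof (intro conjI allI ballI)
  fix n show "f n\<in>mod_hom R (md (cx E) n) (md (cx N) n) \<inter> extensional (elts E n)"
   unfolding mod_hom_def by (auto simp: D(2) D(7-10) fel h add sm) (simp add: f_def D(2))
  fix x assume "x\<in>elts E n"
  then show "f (n + 1) (df (cx E) n x) = df (cx N) n (f n x)" by (auto simp: D(2) D(11,12) fel d)
 next
  fix p n show "f n ` fil (cx E) p n \<subseteq> fil (cx N) p n"
  proof
   fix y assume "y\<in>f n ` fil (cx E) p n"
   then obtain x where x: "y = f n x" "x\<in>fil (cx E) p n" by blast
   then have "x\<in>el n ` C n" using fcxD(8)[OF fdgaD(1)[OF R D(1)]] D(2) by blast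
   then obtain \<phi> where p: "x = el n \<phi>" "\<phi>\<in>C n" by blast
   show "y\<in>fil (cx N) p n" using x fl[OF p(2)] D(17)[OF p(2)] p by (simp add: fel)
  qed
 qed
 moreover have "f (i + j) (fmul R E i j a b) = fmul R N i j (f i a) (f j b)" if "a\<in>elts E i" "b\<in>elts E j" for i j a b
  using that by (auto simp: D(2) D(13,14) fel mul)
 moreover have "f 0 (fone R E) = fone R N" by (simp add: D(15,16) fel one)
 ultimately have "dgmap R E N f" using fdga_map_iff[OF R D(1) N] by blast
 then show thesis using that fel by blast
qed

text \<open>Evaluation at \<open>k0\<close> respects classes because \<open>k0\<close> lies in every
  set of the filter. For a principal filter this covers all indices of the base set.\<close>

lemma presents_proj:
 fixes E :: "('r, 'a) fdga" and M :: "'k => ('r, 'a) fdga"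
 assumes R: "cring R" and P: "presents R F M C E el" and N: "is_fdga R (M k0)"
  and k0: "!!Q. eventually Q F==>Q k0"
 obtains f where "dgmap R E (M k0) f" "!!n \<phi>. \<phi>\<in>C n==>f n (el n \<phi>) = \<phi> k0"
 by (rule presents_map_out[OF R P N, of "%n \<phi>. \<phi> k0"]) (blast dest!: k0 presentsD(4)[OF P])+

lemma is_fmapD:
 assumes "is_fmap R A B f"
 shows "f n\<in>mod_hom R (md A n) (md B n)" "f n\<in>extensional (grade A n)"
  "x\<in>grade A n==>f (n + 1) (df A n x) = df B n (f n x)"
  "x\<in>fil A p n==>f n x\<in>fil B p n"
  "x\<in>grade A n==>f n x\<in>grade B n"
  "x\<in>grade A n==>y\<in>grade A n==>f n (x +[md A n] y) = f n x +[md B n] f n y"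
  "c\<in>carrier R==>x\<in>grade A n==>f n (c *[md A n] x) = c *[md B n] f n x"
 using assms unfolding is_fmap_def mod_hom_def by (auto simp: image_subset_iff)

text \<open>Stated for a complex as source, since the unit of the free algebra is only a map of
  complexes; \<open>presents_map_in\<close> adds multiplicativity.\<close>

lemma presents_fmap_in:
 fixes f :: "'k => int => 'a => 'b"
 assumes R: "cring R" and P: "presents R F M C E el" and A: "fcx R A"
  and f: "\<forall>\<^sub>F k in F. is_fmap R A (cx (M k)) (f k)"
  and C: "!!n x. x\<in>grade A n==>(%k. f k n x)\<in>C n"
 shows "is_fmap R A (cx E) (%n. \<lambda>x\<in>grade A n. el n (%k. f k n x))"
proof -
 note D = presentsD[OF P] and FA = fcxD[OF A]
 have eq: "el n \<phi> = el n \<psi>" if "\<forall>\<^sub>F k in F. \<phi> k = \<psi> k" "\<phi>\<in>C n" "\<psi>\<in>C n" for n \<phi> \<psi>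
  using that D(3) by blast
 show ?thesis unfolding is_fmap_def mod_hom_def
 proof (intro conjI allI ballI IntI CollectI funcsetI)
  fix n show "(\<lambda>x\<in>grade A n. el n (%k. f k n x))\<in>extensional (grade A n)" by simp
  interpret module R "md A n" by (rule FA(1))
  fix x assume x: "x\<in>grade A n"
  show "(\<lambda>x\<in>grade A n. el n (%k. f k n x)) x\<in>elts E n" using x C D(18) by simp
  { fix y assume y: "y\<in>grade A n"
   have "\<forall>\<^sub>F k in F. f k n (x +[md A n] y) = f k n x +[md (cx (M k)) n] f k n y"
    using f by eventually_elim (simp add: is_fmapD(6) x y)
   then have "el n (%k. f k n (x +[md A n] y)) = el n (%k. f k n x +[md (cx (M k)) n] f k n y)"
    by (rule eq) (simp_all add: C x y D(7))
   then show "(\<lambda>x\<in>grade A n. el n (%k. f k n x)) (x +[md A n] y) =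
    (\<lambda>x\<in>grade A n. el n (%k. f k n x)) x +[md (cx E) n] (\<lambda>x\<in>grade A n. el n (%k. f k n x)) y"
    using x y C by (simp add: D(8)) }
  { fix c assume c: "c\<in>carrier R"
   have "\<forall>\<^sub>F k in F. f k n (c *[md A n] x) = c *[md (cx (M k)) n] f k n x"
    using f by eventually_elim (simp add: is_fmapD(7) x c)
   then have "el n (%k. f k n (c *[md A n] x)) = el n (%k. c *[md (cx (M k)) n] f k n x)"
    by (rule eq) (simp_all add: C x c D(9))
   then show "(\<lambda>x\<in>grade A n. el n (%k. f k n x)) (c *[md A n] x) =
    c *[md (cx E) n] (\<lambda>x\<in>grade A n. el n (%k. f k n x)) x"
    using x c C by (simp add: D(10)) }
  have "\<forall>\<^sub>F k in F. f k (n + 1) (df A n x) = df (cx (M k)) n (f k n x)"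
   using f by eventually_elim (simp add: is_fmapD(3) x)
  then have "el (n + 1) (%k. f k (n + 1) (df A n x)) = el (n + 1) (%k. df (cx (M k)) n (f k n x))"
   by (rule eq) (simp_all add: C x FA(3) D(11))
  then show "(\<lambda>x\<in>grade A (n + 1). el (n + 1) (%k. f k (n + 1) x)) (df A n x) =
   df (cx E) n ((\<lambda>x\<in>grade A n. el n (%k. f k n x)) x)"
   using x C FA(3) by (simp add: D(12))
 next
  fix p n
  show "(\<lambda>x\<in>grade A n. el n (%k. f k n x)) ` fil A p n \<subseteq> fil (cx E) p n"
  proof (rule image_subsetI)
   fix x assume x: "x\<in>fil A p n"
   then have xc: "x\<in>grade A n" by (rule FA(8))
   have "\<forall>\<^sub>F k in F. f k n x\<in>fil (cx (M k)) p n" using f by eventually_elim (simp add: is_fmapD(4) x)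
   then show "(\<lambda>x\<in>grade A n. el n (%k. f k n x)) x\<in>fil (cx E) p n"
    using D(17)[OF C[OF xc]] xc by simp
  qed
 qed
qed

lemma presents_map_in:
 fixes f :: "'k => int => 'a => 'a"
 assumes R: "cring R" and P: "presents R F M C E el" and A: "is_fdga R X"
  and M: "\<forall>\<^sub>F k in F. is_fdga R (M k)" and f: "\<forall>\<^sub>F k in F. dgmap R X (M k) (f k)"
  and C: "!!n x. x\<in>elts X n==>(%k. f k n x)\<in>C n"
 shows "dgmap R X E (%n. \<lambda>x\<in>elts X n. el n (%k. f k n x))"
proof -
 note D = presentsD[OF P] and AX = fdga_alg[OF R A]
 have eq: "el n \<phi> = el n \<psi>" if "\<forall>\<^sub>F k in F. \<phi> k = \<psi> k" "\<phi>\<in>C n" "\<psi>\<in>C n" for n \<phi> \<psi>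
  using that D(3) by blast
 have "\<forall>\<^sub>F k in F. is_fmap R (cx X) (cx (M k)) (f k)" using f by eventually_elim (simp add: is_fdga_map_def)
 note fm = presents_fmap_in[OF R P fdgaD(1)[OF R A] this C]
 show ?thesis unfolding fdga_map_iff[OF R A D(1)]
 proof (intro conjI allI ballI fm)
  have "\<forall>\<^sub>F k in F. f k 0 (fone R X) = fone R (M k)" using f M
   by eventually_elim (simp add: fdga_map_iff[OF R A])
  then have "el 0 (%k. f k 0 (fone R X)) = el 0 (%k. fone R (M k))"
   by (rule eq) (simp_all add: C AX(6) D(15))
  then show "(\<lambda>x\<in>elts X 0. el 0 (%k. f k 0 x)) (fone R X) = fone R E"
   using AX(6) by (simp add: D(16))
  fix i j a b assume a: "a\<in>elts X i" and b: "b\<in>elts X j"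
  have "\<forall>\<^sub>F k in F. f k (i + j) (fmul R X i j a b) = fmul R (M k) i j (f k i a) (f k j b)" using f M
   by eventually_elim (simp add: fdga_map_iff[OF R A] a b)
  then have "el (i + j) (%k. f k (i + j) (fmul R X i j a b)) = el (i + j) (%k. fmul R (M k) i j (f k i a) (f k j b))"
   by (rule eq) (simp_all add: C a b AX(5) D(13))
  then show "(\<lambda>x\<in>elts X (i + j). el (i + j) (%k. f k (i + j) x)) (fmul R X i j a b) =
   fmul R E i j ((\<lambda>x\<in>elts X i. el i (%k. f k i x)) a) ((\<lambda>x\<in>elts X j. el j (%k. f k j x)) b)"
   using a b C AX(5) by (simp add: D(14))
 qed
qed

section \<open>The categories of filtered complexes and algebras\<close>

lemma fmap_eqI:
 assumes "is_fmap R A B f" "is_fmap R A B g" "!!n x. x\<in>grade A n==>f n x = g n x"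
 shows "f = g"
proof
 fix n show "f n = g n"
  by (rule extensionalityI[OF is_fmapD(2)[OF assms(1)] is_fmapD(2)[OF assms(2)] assms(3)])
qed

lemma map_fmap: "dgmap R X Y f==>is_fmap R (cx X) (cx Y) f"
 by (simp add: is_fdga_map_def)

lemmas fdga_mapD = is_fmapD[OF map_fmap]

lemma fdga_map_mult:
 assumes "cring R" "is_fdga R X" "is_fdga R Y" "dgmap R X Y f"
 shows "a\<in>elts X i==>b\<in>elts X j==>f (i + j) (fmul R X i j a b) = fmul R Y i j (f i a) (f j b)"
  "f 0 (fone R X) = fone R Y"
 using assms(4) unfolding fdga_map_iff[OF assms(1-3)] by auto

lemmas fdga_map_eqI = fmap_eqI[OF map_fmap map_fmap]

lemma fmap_ident:
 assumes "fcx R A" shows "is_fmap R A A (fmap_id A)"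
proof -
 note F = fcxD[OF assms]
 have "x +[md A n] y\<in>grade A n" "c *[md A n] x\<in>grade A n"
  if "x\<in>grade A n" "y\<in>grade A n" "c\<in>carrier R" for n x y c
 proof -
  interpret module R "md A n" by (rule F(1))
  show "x +[md A n] y\<in>grade A n" "c *[md A n] x\<in>grade A n" using that by simp_all
 qed
 moreover have "fcx R A==>\<one>[R]\<in>carrier R"
  using module.axioms(1)[OF F(1)] by (simp add: cring.cring_simprules)
 ultimately show ?thesis unfolding is_fmap_def mod_hom_def fmap_id_def
  using F(3,8) assms by auto
qed

lemma fmap_comp:
 assumes "is_fmap R A B f" "is_fmap R B C g" "fcx R A"
 shows "is_fmap R A C (%n. compose (grade A n) (g n) (f n))"
proof -
 note F = fcxD[OF assms(3)] and f = is_fmapD[OF assms(1)] and g = is_fmapD[OF assms(2)]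
 have "x +[md A n] y\<in>grade A n" if "x\<in>grade A n" "y\<in>grade A n" for n x y
 proof -
  interpret module R "md A n" by (rule F(1))
  show ?thesis using that by simp
 qed
 moreover have "c *[md A n] x\<in>grade A n" if "x\<in>grade A n" "c\<in>carrier R" for n x c
 proof -
  interpret module R "md A n" by (rule F(1))
  show ?thesis using that by simp
 qed
 ultimately show ?thesis unfolding is_fmap_def mod_hom_def
  by (auto simp: compose_def f g F intro: f(4) g(4) F(8))
qed

lemma fdga_map_ident:
 assumes "cring R" "is_fdga R X" shows "dgmap R X X (fmap_id (cx X))"
 unfolding fdga_map_iff[OF assms(1) assms(2) assms(2)]
 using fmap_ident[OF fdgaD(1)[OF assms]] fdga_alg(5,6)[OF assms] by (simp add: fmap_id_def)

lemma fdga_map_comp: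
 assumes "cring R" "is_fdga R X" "is_fdga R Y" "is_fdga R Z" "dgmap R X Y f" "dgmap R Y Z g"
 shows "dgmap R X Z (%n. compose (elts X n) (g n) (f n))"
 unfolding fdga_map_iff[OF assms(1,2,4)]
 using fmap_comp[OF map_fmap[OF assms(5)] map_fmap[OF assms(6)] fdgaD(1)[OF assms(1,2)]]
  fdga_alg(5,6)[OF assms(1,2)] fdga_map_mult[OF assms(1-3,5)] fdga_map_mult[OF assms(1,3,4,6)]
  fdga_mapD(5)[OF assms(5)]
 by (simp add: compose_def)

lemma fC_simps:
 "objs (fC R) = {A. fcx R A}" "src (fC R) = asrc" "tgt (fC R) = atgt"
 "ident (fC R) = (%A. Arrow A A (fmap_id A))"
 "cmpC R = (%g f. Arrow (asrc f) (atgt g) (%n. compose (grade (asrc f) n) (afun g n) (afun f n)))"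
 by (simp_all add: fC_def fmap_id_def[abs_def])

lemma fDGA_simps:
 "objs (fDGA R) = {A. is_fdga R A}" "src (fDGA R) = asrc" "tgt (fDGA R) = atgt"
 "ident (fDGA R) = (%A. Arrow A A (fmap_id (cx A)))"
 "cmpD R = (%g f. Arrow (asrc f) (atgt g) (%n. compose (elts (asrc f) n) (afun g n) (afun f n)))"
 by (simp_all add: fDGA_def)

lemma arr_fC: "f\<in>arrs (fC R) \<longleftrightarrow> fcx R (asrc f) & fcx R (atgt f) & is_fmap R (asrc f) (atgt f) (afun f)"
 by (cases f) (auto simp: fC_def)

lemma arr_fDGA: "f\<in>arrs (fDGA R) \<longleftrightarrow> is_fdga R (asrc f) & is_fdga R (atgt f) & dgmap R (asrc f) (atgt f) (afun f)"
 by (cases f) (auto simp: fDGA_def)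

lemma hom_fC: "f\<in>homC R A B \<longleftrightarrow> fcx R A & fcx R B &
  asrc f = A & atgt f = B & is_fmap R A B (afun f)"
 by (auto simp: hom_set_def arr_fC fC_simps)

lemma hom_fDGA: "f\<in>homD R A B \<longleftrightarrow> is_fdga R A & is_fdga R B &
  asrc f = A & atgt f = B & dgmap R A B (afun f)"
 by (auto simp: hom_set_def arr_fDGA fDGA_simps)

lemma hom_fC_eqI:
 assumes "f\<in>homC R A B" "g\<in>homC R A B"
  "!!n x. x\<in>grade A n==>afun f n x = afun g n x"
 shows "f = g"
 using assms fmap_eqI[of R A B "afun f" "afun g"] by (cases f; cases g) (auto simp: hom_fC)

lemma hom_fDGA_eqI:
 assumes "f\<in>homD R A B" "g\<in>homD R A B"
  "!!n x. x\<in>elts A n==>afun f n x = afun g n x"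
 shows "f = g"
 using assms fdga_map_eqI[of R A B "afun f" "afun g"] by (cases f; cases g) (auto simp: hom_fDGA)

lemma category_fC: "is_category (fC R)"
 unfolding is_category_def
proof (intro conjI ballI impI)
 fix f assume f: "f\<in>arrs (fC R)"
 then show "src (fC R) f\<in>objs (fC R)" "tgt (fC R) f\<in>objs (fC R)" by (simp_all add: arr_fC fC_simps)
 have h: "f\<in>homC R (asrc f) (atgt f)" using f by (simp add: hom_fC arr_fC)
 have fm: "is_fmap R (asrc f) (atgt f) (afun f)" "fcx R (asrc f)" "fcx R (atgt f)" using f by (simp_all add: arr_fC)
 show "cmpC R f (ident (fC R) (src (fC R) f)) = f"
  by (rule hom_fC_eqI[OF _ h]) (use fmap_comp[OF fmap_ident[OF fm(2)] fm(1,2)] fm in \<open>auto simp: fC_simps hom_fC compose_def fmap_id_def\<close>)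
 show "cmpC R (ident (fC R) (tgt (fC R) f)) f = f"
  by (rule hom_fC_eqI[OF _ h]) (use fmap_comp[OF fm(1) fmap_ident[OF fm(3)] fm(2)] fm is_fmapD(5)[OF fm(1)] in \<open>auto simp: fC_simps hom_fC compose_def fmap_id_def\<close>)
 fix g assume g: "g\<in>arrs (fC R)" and gf: "src (fC R) g = tgt (fC R) f"
 have gm: "is_fmap R (atgt f) (atgt g) (afun g)" "fcx R (atgt g)" using g gf by (simp_all add: arr_fC fC_simps)
 show "cmpC R g f\<in>homC R (src (fC R) f) (tgt (fC R) g)"
  using fmap_comp[OF fm(1) gm(1) fm(2)] fm gm by (simp add: fC_simps hom_fC)
 fix k assume k: "k\<in>arrs (fC R)" and kg: "src (fC R) k = tgt (fC R) g"
 show "cmpC R k (cmpC R g f) = cmpC R (cmpC R k g) f"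
  using is_fmapD(5)[OF fm(1)] gf by (simp add: fC_simps compose_def fun_eq_iff restrict_def)
next
 fix A assume "A\<in>objs (fC R)"
 then show "ident (fC R) A\<in>homC R A A" by (simp add: fC_simps hom_fC fmap_ident)
qed

lemma category_fDGA: assumes R: "cring R" shows "is_category (fDGA R)"
 unfolding is_category_def
proof (intro conjI ballI impI)
 fix f assume f: "f\<in>arrs (fDGA R)"
 then show "src (fDGA R) f\<in>objs (fDGA R)" "tgt (fDGA R) f\<in>objs (fDGA R)" by (simp_all add: arr_fDGA fDGA_simps)
 have h: "f\<in>homD R (asrc f) (atgt f)" using f by (simp add: hom_fDGA arr_fDGA)
 have fm: "dgmap R (asrc f) (atgt f) (afun f)" "is_fdga R (asrc f)" "is_fdga R (atgt f)" using f by (simp_all add: arr_fDGA)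
 show "cmpD R f (ident (fDGA R) (src (fDGA R) f)) = f"
  by (rule hom_fDGA_eqI[OF _ h]) (use fdga_map_comp[OF R fm(2) fm(2) fm(3) fdga_map_ident[OF R fm(2)] fm(1)] fm in \<open>auto simp: fDGA_simps hom_fDGA compose_def fmap_id_def\<close>)
 show "cmpD R (ident (fDGA R) (tgt (fDGA R) f)) f = f"
  by (rule hom_fDGA_eqI[OF _ h]) (use fdga_map_comp[OF R fm(2) fm(3) fm(3) fm(1) fdga_map_ident[OF R fm(3)]] fm fdga_mapD(5)[OF fm(1)] in \<open>auto simp: fDGA_simps hom_fDGA compose_def fmap_id_def\<close>)
 fix g assume g: "g\<in>arrs (fDGA R)" and gf: "src (fDGA R) g = tgt (fDGA R) f"
 have gm: "dgmap R (atgt f) (atgt g) (afun g)" "is_fdga R (atgt g)" using g gf by (simp_all add: arr_fDGA fDGA_simps)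
 show "cmpD R g f\<in>homD R (src (fDGA R) f) (tgt (fDGA R) g)"
  using fdga_map_comp[OF R fm(2) fm(3) gm(2) fm(1) gm(1)] fm gm by (simp add: fDGA_simps hom_fDGA)
 fix k assume k: "k\<in>arrs (fDGA R)" and kg: "src (fDGA R) k = tgt (fDGA R) g"
 show "cmpD R k (cmpD R g f) = cmpD R (cmpD R k g) f"
  using fdga_mapD(5)[OF fm(1)] gf by (simp add: fDGA_simps compose_def fun_eq_iff restrict_def)
next
 fix A assume "A\<in>objs (fDGA R)"
 then show "ident (fDGA R) A\<in>homD R A A" by (simp add: fDGA_simps hom_fDGA fdga_map_ident[OF R])
qed

lemma forget_functor: assumes R: "cring R" shows "is_functor (fDGA R) (fC R) cx forget"
 unfolding is_functor_def
 by (auto simp: fDGA_simps fC_simps arr_fDGA hom_fC forget_def fdgaD[OF R] map_fmap)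

lemma categoryD:
 assumes "is_category C"
 shows "f\<in>hom_set C X Y==>g\<in>hom_set C Y Z==>cmp C g f\<in>hom_set C X Z"
  "X\<in>objs C==>ident C X\<in>hom_set C X X"
  "f\<in>hom_set C X Y==>cmp C f (ident C X) = f"
  "f\<in>hom_set C X Y==>cmp C (ident C Y) f = f"
  "f\<in>hom_set C X Y==>g\<in>hom_set C Y Z==>h\<in>hom_set C Z W ==>
   cmp C h (cmp C g f) = cmp C (cmp C h g) f"
  "f\<in>hom_set C X Y==>X\<in>objs C & Y\<in>objs C"
  "f\<in>arrs C==>f\<in>hom_set C (src C f) (tgt C f)"
 using assms unfolding is_category_def hom_set_def by auto

lemma cmp_apply:
 "x\<in>elts (asrc f) n==>afun (cmpD R g f) n x = afun g n (afun f n x)"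
 "y\<in>grade (asrc f') n==>afun (cmpC R g' f') n y = afun g' n (afun f' n y)"
 by (simp_all add: fDGA_simps fC_simps compose_def)

subsection \<open>Limits\<close>

text \<open>The limit is the algebra of compatible families. It exists within \<open>'u\<close>
  because \<open>code\<close> embeds all families of elements indexed by \<open>'i\<close>; the
  filter is principal, so classes are families restricted to the objects of
  \<open>J\<close>.\<close>

lemma fDGA_limits:
 fixes R :: "'u ring" and J :: "('i, 'j) category" and Fo :: "'i => ('u, 'u) fdga"
 assumes inj: "inj (code :: ('i => 'u) => 'u)" and R: "cring R"
  and J: "is_category J" and F: "is_functor J (fDGA R) Fo Fm"
 shows "\<exists>X \<pi>. is_limit J (fDGA R) Fo Fm X \<pi>"
proof -
 have Fo: "is_fdga R (Fo j)" if "j\<in>objs J" for j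
  using F that unfolding is_functor_def by (simp add: fDGA_simps)
 have Fm: "dgmap R (Fo (src J u)) (Fo (tgt J u)) (afun (Fm u))"
   "asrc (Fm u) = Fo (src J u)" "atgt (Fm u) = Fo (tgt J u)" "src J u\<in>objs J" "tgt J u\<in>objs J" if "u\<in>arrs J" for u
  using F J that unfolding is_functor_def is_category_def by (simp_all add: hom_fDGA)
 define C where "C n = {\<phi>. (\<forall>j\<in>objs J. \<phi> j\<in>elts (Fo j) n) &
  (\<forall>u\<in>arrs J. afun (Fm u) n (\<phi> (src J u)) = \<phi> (tgt J u))}" for n
 have Fmz: "afun (Fm u) n \<zero>[md (cx (Fo (src J u))) n] = \<zero>[md (cx (Fo (tgt J u))) n]" if "u\<in>arrs J" for u n
  by (rule mod_hom_zero[OF fcxD(1)[OF fdgaD(1)[OF R Fo[OF Fm(4)[OF that]]]]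
   fcxD(1)[OF fdgaD(1)[OF R Fo[OF Fm(5)[OF that]]]] fdga_mapD(1)[OF Fm(1)[OF that]]])
 note alg = fdga_alg[OF R Fo]
 interpret subproduct R "principal (objs J)" Fo C code UNIV
 proof (rule subproduct.intro, goal_cases)
  case 1 show ?case by (rule R)
 next
  case 2 show ?case by (simp add: eventually_principal Fo)
 next
  case 3 then show ?case by (simp add: eventually_principal C_def)
 next
  case 4 then show ?case by (simp add: C_def alg fdga_mapD(6)[OF Fm(1)] Fm(4,5))
 next
  case 5 then show ?case by (simp add: C_def alg Fmz)
 next
  case 6 then show ?case by (simp add: C_def alg fdga_mapD(7)[OF Fm(1)] Fm(4,5))
 next
  case 7 then show ?case by (simp add: C_def alg fdga_mapD(3)[OF Fm(1)] Fm(4,5))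
 next
  case 8 then show ?case by (simp add: C_def alg fdga_map_mult(1)[OF R Fo Fo Fm(1)] Fm(4,5))
 next
  case 9 then show ?case by (simp add: C_def alg fdga_map_mult(2)[OF R Fo Fo Fm(1)] Fm(4,5))
 qed (use inj in auto)
 obtain E :: "('u, 'u) fdga" and el where P: "presents R (principal (objs J)) Fo C E el" by (rule presented)
 note D = presentsD[OF P, unfolded eventually_principal]
 have "\<exists>f. dgmap R E (Fo j) f & (\<forall>n. \<forall>\<phi>\<in>C n. f n (el n \<phi>) = \<phi> j)" if "j\<in>objs J" for j
  by (rule presents_proj[OF R P Fo[OF that]]) (use that in \<open>auto simp: eventually_principal\<close>)
 then obtain pr where pr: "!!j. j\<in>objs J==>dgmap R E (Fo j) (pr j)"
  "!!j n \<phi>. j\<in>objs J==>\<phi>\<in>C n==>pr j n (el n \<phi>) = \<phi> j" by metis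
 let ?pi = "%j. Arrow E (Fo j) (pr j)"
 have "is_limit J (fDGA R) Fo Fm E ?pi" unfolding is_limit_def
 proof (intro conjI allI impI)
  show "is_cone J (fDGA R) Fo Fm E ?pi" unfolding is_cone_def
  proof (intro conjI ballI)
   show "E\<in>objs (fDGA R)" by (simp add: fDGA_simps D)
   show pih: "?pi j\<in>homD R E (Fo j)" if "j\<in>objs J" for j using that by (simp add: hom_fDGA D Fo pr)
   fix u assume u: "u\<in>arrs J"
   have Fu: "Fm u\<in>homD R (Fo (src J u)) (Fo (tgt J u))" using Fm[OF u] Fo by (simp add: hom_fDGA)
   show "cmpD R (Fm u) (?pi (src J u)) = ?pi (tgt J u)"
   proof (rule hom_fDGA_eqI[OF categoryD(1)[OF category_fDGA[OF R] pih Fu] pih])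
    fix n x assume "x\<in>elts E n"
    then obtain \<phi> where p: "x = el n \<phi>" "\<phi>\<in>C n" by (auto simp: D(2))
    show "afun (cmpD R (Fm u) (?pi (src J u))) n x = afun (?pi (tgt J u)) n x"
     using p Fm[OF u] u by (simp add: cmp_apply pr D) (simp add: C_def)
   qed (use Fm[OF u] in auto)
  qed
  fix Y \<psi> assume cone: "is_cone J (fDGA R) Fo Fm Y \<psi>"
  then have Y: "is_fdga R Y" and ps: "!!j. j\<in>objs J==>\<psi> j\<in>homD R Y (Fo j)"
   "!!u. u\<in>arrs J==>cmpD R (Fm u) (\<psi> (src J u)) = \<psi> (tgt J u)"
   by (simp_all add: is_cone_def fDGA_simps)
  have psm: "dgmap R Y (Fo j) (afun (\<psi> j))" "asrc (\<psi> j) = Y" if "j\<in>objs J" for j using ps(1)[OF that] by (simp_all add: hom_fDGA)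
  have inC: "(%j. afun (\<psi> j) n x)\<in>C n" if "x\<in>elts Y n" for n x
   unfolding C_def
  proof (intro CollectI conjI ballI)
   show "afun (\<psi> j) n x\<in>elts (Fo j) n" if "j\<in>objs J" for j
    using fdga_mapD(5)[OF psm(1)[OF that]] \<open>x\<in>elts Y n\<close> by blast
   fix u assume u: "u\<in>arrs J"
   have "afun (cmpD R (Fm u) (\<psi> (src J u))) n x = afun (Fm u) n (afun (\<psi> (src J u)) n x)"
    by (rule cmp_apply) (use that psm(2) Fm(4)[OF u] in simp)
   then show "afun (Fm u) n (afun (\<psi> (src J u)) n x) = afun (\<psi> (tgt J u)) n x"
    unfolding ps(2)[OF u] by simp
  qed
  define h where "h = (%n. \<lambda>x\<in>elts Y n. el n (%j. afun (\<psi> j) n x))"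
  have h: "dgmap R Y E h" unfolding h_def
   by (rule presents_map_in[OF R P Y]) (simp_all add: eventually_principal Fo psm inC)
  show "\<exists>!h. h\<in>homD R Y E & (\<forall>j\<in>objs J. cmpD R (?pi j) h = \<psi> j)"
  proof (rule ex1I[of _ "Arrow Y E h"], intro conjI ballI)
   show hh: "Arrow Y E h\<in>homD R Y E" by (simp add: hom_fDGA Y D h)
   fix j assume j: "j\<in>objs J"
   have pih: "?pi j\<in>homD R E (Fo j)" using j by (simp add: hom_fDGA D Fo pr)
   show "cmpD R (?pi j) (Arrow Y E h) = \<psi> j"
    by (rule hom_fDGA_eqI[OF categoryD(1)[OF category_fDGA[OF R] hh pih] ps(1)[OF j]])
     (simp add: cmp_apply h_def pr j inC)
  next
   fix g assume g: "g\<in>homD R Y E & (\<forall>j\<in>objs J. cmpD R (?pi j) g = \<psi> j)"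
   then have g1: "dgmap R Y E (afun g)" "asrc g = Y" by (simp_all add: hom_fDGA)
   show "g = Arrow Y E h"
   proof (rule hom_fDGA_eqI)
    show "g\<in>homD R Y E" using g by simp
    show "Arrow Y E h\<in>homD R Y E" by (simp add: hom_fDGA Y D h)
    fix n x assume x: "x\<in>elts Y n"
    then have "afun g n x\<in>elts E n" using fdga_mapD(5)[OF g1(1)] by blast
    then obtain \<phi> where p: "afun g n x = el n \<phi>" "\<phi>\<in>C n" by (auto simp: D(2))
    have "\<forall>j\<in>objs J. \<phi> j = afun (\<psi> j) n x"
    proof
     fix j assume j: "j\<in>objs J"
     have "afun (cmpD R (?pi j) g) n x = \<phi> j" using x g1 p j by (simp add: cmp_apply pr)
     then show "\<phi> j = afun (\<psi> j) n x" using g j by simp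
    qed
    then show "afun g n x = afun (Arrow Y E h) n x" using x p D(3)[OF p(2) inC[OF x]] by (simp add: h_def)
   qed
  qed
 qed
 then show ?thesis by blast
qed

text \<open>A subproduct indexed by \<open>bool\<close>, for which \<open>pair_code\<close> supplies
  the codes. The conclusions list what later arguments use of a pullback: its elements are pairs,
  and the two projections together detect equality and filtration.\<close>

lemma fdga_pullback:
 fixes R :: "'u ring" and A B E :: "('u, 'u) fdga"
 assumes inf: "infinite (UNIV :: 'u set)" and R: "cring R"
  and A: "is_fdga R A" and B: "is_fdga R B" and E: "is_fdga R E"
  and p: "dgmap R A B p" and v: "dgmap R E B v"
 obtains P \<pi>1 \<pi>2 where "is_fdga R P" "dgmap R P A \<pi>1" "dgmap R P E \<pi>2"
  "!!n x. x\<in>elts P n==>p n (\<pi>1 n x) = v n (\<pi>2 n x)"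
  "!!n a e. a\<in>elts A n==>e\<in>elts E n==>p n a = v n e==>\<exists>x\<in>elts P n. \<pi>1 n x = a & \<pi>2 n x = e"
  "!!n x y. x\<in>elts P n==>y\<in>elts P n==>\<pi>1 n x = \<pi>1 n y==>\<pi>2 n x = \<pi>2 n y==>x = y"
  "!!s n x. x\<in>elts P n==>\<pi>1 n x\<in>fil (cx A) s n==>\<pi>2 n x\<in>fil (cx E) s n==>x\<in>fil (cx P) s n"
  "!!X u w. is_fdga R X==>dgmap R X A u==>dgmap R X E w ==>
   (!!n x. x\<in>elts X n==>p n (u n x) = v n (w n x)) ==>
   \<exists>h. dgmap R X P h & (\<forall>n. \<forall>x\<in>elts X n. \<pi>1 n (h n x) = u n x & \<pi>2 n (h n x) = w n x)"
proof -
 define M where "M k = (if k then A else E)" for k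
 have M: "is_fdga R (M k)" for k by (simp add: M_def A E)
 define C where "C n = {\<phi>. \<phi> True\<in>elts A n & \<phi> False\<in>elts E n & p n (\<phi> True) = v n (\<phi> False)}" for n
 define code :: "(bool => 'u) => 'u" where "code \<phi> = pair_code (\<phi> True, \<phi> False)" for \<phi>
 have "inj code"
 proof (rule injI)
  fix x y assume "code x = code y"
  then have "(x True, x False) = (y True, y False)" unfolding code_def using inj_pair_code[OF inf] by (rule injD[rotated])
  then show "x = y" by (auto simp: fun_eq_iff all_bool_eq)
 qed
 have z: "p n \<zero>[md (cx A) n] = v n \<zero>[md (cx E) n]" for n
  using mod_hom_zero[OF fcxD(1)[OF fdgaD(1)[OF R A]] fcxD(1)[OF fdgaD(1)[OF R B]] fdga_mapD(1)[OF p, of n]]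
   mod_hom_zero[OF fcxD(1)[OF fdgaD(1)[OF R E]] fcxD(1)[OF fdgaD(1)[OF R B]] fdga_mapD(1)[OF v, of n]] by simp
 note algA = fdga_alg[OF R A] and algE = fdga_alg[OF R E] and pm = fdga_mapD[OF p] and vm = fdga_mapD[OF v]
  and pmm = fdga_map_mult[OF R A B p] and vmm = fdga_map_mult[OF R E B v]
 interpret subproduct R "principal UNIV" M C code UNIV
 proof (rule subproduct.intro, goal_cases)
  case 1 show ?case by (rule R)
 next
  case 2 show ?case by (simp add: M eventually_principal)
 next
  case (3 n \<phi>) then show ?case by (auto simp: M_def C_def eventually_principal)
 next
  case 4 then show ?case by (simp add: C_def M_def algA algE pm(6) vm(6))
 next
  case 5 then show ?case by (simp add: C_def M_def algA algE z)
 next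
  case 6 then show ?case by (simp add: C_def M_def algA algE pm(7) vm(7))
 next
  case 7 then show ?case by (simp add: C_def M_def algA algE pm(3) vm(3))
 next
  case 8 then show ?case by (simp add: C_def M_def algA algE pmm vmm)
 next
  case 9 then show ?case by (simp add: C_def M_def algA algE pmm vmm)
 qed (use \<open>inj code\<close> in auto)
 obtain P :: "('u, 'u) fdga" and el where P: "presents R (principal UNIV) M C P el" by (rule presented)
 note D = presentsD[OF P, unfolded eventually_principal ball_UNIV]
 obtain \<pi>1 where p1: "dgmap R P A \<pi>1" "!!n \<phi>. \<phi>\<in>C n==>\<pi>1 n (el n \<phi>) = \<phi> True"
  using presents_proj[OF R P M, of True] by (auto simp: M_def eventually_principal)
 obtain \<pi>2 where p2: "dgmap R P E \<pi>2" "!!n \<phi>. \<phi>\<in>C n==>\<pi>2 n (el n \<phi>) = \<phi> False"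
  using presents_proj[OF R P M, of False] by (auto simp: M_def eventually_principal)
 have ob: "\<exists>\<phi>\<in>C n. x = el n \<phi>" if "x\<in>elts P n" for n x using that by (auto simp: D(2))
 show thesis
 proof (rule that[OF D(1) p1(1) p2(1)])
  fix n x assume "x\<in>elts P n"
  with ob obtain \<phi> where "\<phi>\<in>C n" "x = el n \<phi>" by blast
  then show "p n (\<pi>1 n x) = v n (\<pi>2 n x)" by (simp add: p1 p2) (simp add: C_def)
 next
  fix n a e assume a: "a\<in>elts A n" "e\<in>elts E n" "p n a = v n e"
  let ?f = "%k. if k then a else e"
  have "?f\<in>C n" using a by (simp add: C_def)
  then show "\<exists>x\<in>elts P n. \<pi>1 n x = a & \<pi>2 n x = e" by (intro bexI[of _ "el n ?f"]) (simp_all add: p1 p2 D(18))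
 next
  fix n x y assume xy: "x\<in>elts P n" "y\<in>elts P n" "\<pi>1 n x = \<pi>1 n y" "\<pi>2 n x = \<pi>2 n y"
  obtain \<phi> \<psi> where f: "\<phi>\<in>C n" "x = el n \<phi>" "\<psi>\<in>C n" "y = el n \<psi>" using ob xy by meson
  then have "\<phi> True = \<psi> True" "\<phi> False = \<psi> False" using xy by (simp_all add: p1 p2)
  then show "x = y" using f D(3)[OF f(1,3)] by (simp add: all_bool_eq)
 next
  fix s n x assume x: "x\<in>elts P n" "\<pi>1 n x\<in>fil (cx A) s n" "\<pi>2 n x\<in>fil (cx E) s n"
  obtain \<phi> where f: "\<phi>\<in>C n" "x = el n \<phi>" using ob x by blast
  then show "x\<in>fil (cx P) s n" using x D(17)[OF f(1)] by (simp add: p1 p2 all_bool_eq M_def)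
 next
  fix X u w assume X: "is_fdga R X" and u: "dgmap R X A u" and w: "dgmap R X E w"
   and e: "!!n x. x\<in>elts X n==>p n (u n x) = v n (w n x)"
  have inC: "(%k. (if k then u else w) n x)\<in>C n" if "x\<in>elts X n" for n x
   using that e fdga_mapD(5)[OF u] fdga_mapD(5)[OF w] by (simp add: C_def)
  have "dgmap R X P (%n. \<lambda>x\<in>elts X n. el n (%k. (if k then u else w) n x))"
   by (rule presents_map_in[OF R P X]) (use u w inC M in \<open>auto simp: M_def eventually_principal\<close>)
  then show "\<exists>h. dgmap R X P h & (\<forall>n. \<forall>x\<in>elts X n. \<pi>1 n (h n x) = u n x & \<pi>2 n (h n x) = w n x)"
   by (intro exI[of _ "%n. \<lambda>x\<in>elts X n. el n (%k. (if k then u else w) n x)"] conjI)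
    (simp_all add: p1 p2 inC)
 qed
qed

section \<open>Initial algebras\<close>

subsection \<open>Terms and their size\<close>

lemma pair_code_eq:
 "infinite (UNIV :: 'u set)==>pair_code (a, b) = (pair_code (c, d) :: 'u) \<longleftrightarrow> a = c & b = d"
 using inj_eq[OF inj_pair_code, of "(a, b)" "(c, d)"] by simp

lemma inj_int_into: assumes "infinite (UNIV :: 'u set)" shows "\<exists>f :: int => 'u. inj f"
proof -
 obtain f :: "nat => 'u" where f: "inj f" using infinite_countable_subset[OF assms] by auto
 have "inj (%i :: int. pair_code (f (nat i), f (nat (- i))) :: 'u)"
 proof (rule injI)
  fix i j :: int assume "pair_code (f (nat i), f (nat (- i))) = (pair_code (f (nat j), f (nat (- j))) :: 'u)"
  then have "nat i = nat j" "nat (- i) = nat (- j)"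
   by (simp_all only: pair_code_eq[OF assms] inj_eq[OF f])
  then show "i = j" by arith
 qed
 then show ?thesis by blast
qed

lemma inj_prod_into:
 assumes "infinite (UNIV :: 'u set)" "\<exists>f :: 'a => 'u. inj f" "\<exists>f :: 'b => 'u. inj f"
 shows "\<exists>f :: 'a \<times> 'b => 'u. inj f"
proof -
 obtain f :: "'a => 'u" and g :: "'b => 'u" where fg: "inj f" "inj g" using assms by blast
 have "inj (%(a, b). pair_code (f a, g b) :: 'u)"
  by (rule injI) (auto simp: pair_code_eq[OF assms(1)] inj_eq[OF fg(1)] inj_eq[OF fg(2)])
 then show ?thesis by blast
qed

lemma inj_sum_into:
 assumes "infinite (UNIV :: 'u set)" "\<exists>f :: 'a => 'u. inj f" "\<exists>f :: 'b => 'u. inj f"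
 shows "\<exists>f :: 'a + 'b => 'u. inj f"
proof -
 obtain f :: "'a => 'u" and g :: "'b => 'u" where fg: "inj f" "inj g" using assms by blast
 obtain t :: "int => 'u" where t: "inj t" using inj_int_into[OF assms(1)] by blast
 have "inj (%s. (case s of Inl a => pair_code (t 0, f a) | Inr b => pair_code (t 1, g b)) :: 'u)"
  by (rule injI) (auto simp: pair_code_eq[OF assms(1)] inj_eq[OF fg(1)] inj_eq[OF fg(2)] inj_eq[OF t] split: sum.splits)
 then show ?thesis by blast
qed

lemma inj_nat_into: assumes "infinite (UNIV :: 'u set)" shows "\<exists>f :: nat => 'u. inj f"
 using infinite_countable_subset[OF assms] by auto

text \<open>Terms over labelled constants, unary and binary operations. If the labels embed into
  \<open>'u\<close>, so do the terms, and this bounds the size of anything generated by few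
  elements.\<close>

datatype ('l0, 'l1, 'l2) tm = T0 'l0 | T1 'l1 "('l0, 'l1, 'l2) tm" | T2 'l2 "('l0, 'l1, 'l2) tm" "('l0, 'l1, 'l2) tm"

primrec code_tm :: "(int => 'u) => ('l0 => 'u) => ('l1 => 'u) => ('l2 => 'u) => ('l0, 'l1, 'l2) tm => 'u" where
 "code_tm t f0 f1 f2 (T0 l) = pair_code (t 0, f0 l)"
| "code_tm t f0 f1 f2 (T1 l x) = pair_code (t 1, pair_code (f1 l, code_tm t f0 f1 f2 x))"
| "code_tm t f0 f1 f2 (T2 l x y) = pair_code (t 2, pair_code (f2 l, pair_code (code_tm t f0 f1 f2 x, code_tm t f0 f1 f2 y)))"

lemma inj_code_tm:
 fixes f0 :: "'l0 => 'u"
 assumes inf: "infinite (UNIV :: 'u set)" and "inj t" "inj f0" "inj f1" "inj f2"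
 shows "inj (code_tm t f0 f1 f2)"
proof -
 note pc = pair_code_eq[OF inf]
 note e = inj_eq[OF assms(2)] inj_eq[OF assms(3)] inj_eq[OF assms(4)] inj_eq[OF assms(5)]
 have "code_tm t f0 f1 f2 x = code_tm t f0 f1 f2 y==>x = y" for x y
 proof (induction x arbitrary: y)
  case (T0 l) then show ?case by (cases y) (auto simp: pc e)
 next
  case (T1 l x) then show ?case by (cases y) (auto simp: pc e)
 next
  case (T2 l x1 x2) then show ?case by (cases y) (auto simp: pc e)
 qed
 then show ?thesis by (rule injI)
qed

text \<open>The closure of \<open>base\<close> under the pointwise operations and under one further
  operation. The latter is a relation \<open>step\<close>, since it may be partial: solutions to
  lifting problems exist for admissible data only.\<close>

inductive generated ::
 "'r ring => ('k => ('r, 'a) fdga) => (int => ('k => 'a) => bool) =>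
  (int => ('k => 'a) => int => ('k => 'a) => bool) => int => ('k => 'a) => bool"
 for R :: "'r ring" and M :: "'k => ('r, 'a) fdga" and base step where
 base: "base n \<phi>==>generated R M base step n \<phi>"
| step: "generated R M base step n \<phi>==>step n \<phi> m \<psi>==>generated R M base step m \<psi>"
| zero: "generated R M base step n (%k. \<zero>[md (cx (M k)) n])"
| add: "generated R M base step n \<phi>==>generated R M base step n \<psi> ==>
  generated R M base step n (%k. \<phi> k +[md (cx (M k)) n] \<psi> k)"
| smult: "c\<in>carrier R==>generated R M base step n \<phi> ==>
  generated R M base step n (%k. c *[md (cx (M k)) n] \<phi> k)"
| df: "generated R M base step n \<phi>==>generated R M base step (n + 1) (%k. df (cx (M k)) n (\<phi> k))"
| mult: "generated R M base step i \<phi>==>generated R M base step j \<psi> ==>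
  generated R M base step (i + j) (%k. fmul R (M k) i j (\<phi> k) (\<psi> k))"
| one: "generated R M base step 0 (%k. fone R (M k))"

primrec eval_tm ::
 "'r ring => ('k => ('r, 'a) fdga) => ('x => 'k => 'a) => ('y => ('k => 'a) => 'k => 'a) =>
  ('x + int + int, 'y + int \<times> 'r + int, int + int \<times> int) tm => 'k => 'a" where
 "eval_tm R M B S (T0 l) = (case l of Inl x => B x
   | Inr (Inl n) => (%k. \<zero>[md (cx (M k)) n]) | Inr (Inr n) => (%k. fone R (M k)))"
| "eval_tm R M B S (T1 l t) = (case l of Inl y => S y (eval_tm R M B S t)
   | Inr (Inl (n, c)) => (%k. c *[md (cx (M k)) n] eval_tm R M B S t k)
   | Inr (Inr n) => (%k. df (cx (M k)) n (eval_tm R M B S t k)))"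
| "eval_tm R M B S (T2 l t u) = (case l of
    Inl n => (%k. eval_tm R M B S t k +[md (cx (M k)) n] eval_tm R M B S u k)
   | Inr (i, j) => (%k. fmul R (M k) i j (eval_tm R M B S t k) (eval_tm R M B S u k)))"

text \<open>Every generated family is the value of a term. The size of the set of generated families
  is thus bounded independently of the size of the index type \<open>'k\<close>.\<close>

lemma generated_eval:
 assumes B: "!!n \<phi>. base n \<phi>==>\<phi>\<in>range B" and S: "!!n \<phi> m \<psi>. step n \<phi> m \<psi>==>\<exists>y. \<psi> = S y \<phi>"
  and g: "generated R M base step n \<phi>"
 shows "\<phi>\<in>range (eval_tm R M B S)"
 using g
proof induction
 case (base n \<phi>)
 then obtain x where "\<phi> = B x" using B by blast
 then show ?case by (intro image_eqI[of _ _ "T0 (Inl x)"]) simp_all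
next
 case (step n \<phi> m \<psi>)
 then obtain y t where "\<psi> = S y \<phi>" "\<phi> = eval_tm R M B S t" using S by blast
 then show ?case by (intro image_eqI[of _ _ "T1 (Inl y) t"]) simp_all
next
 case (zero n)
 show ?case by (intro image_eqI[of _ _ "T0 (Inr (Inl n))"]) simp_all
next
 case (add n \<phi> \<psi>)
 then obtain t u where "\<phi> = eval_tm R M B S t" "\<psi> = eval_tm R M B S u" by blast
 then show ?case by (intro image_eqI[of _ _ "T2 (Inl n) t u"]) simp_all
next
 case (smult c n \<phi>)
 then obtain t where "\<phi> = eval_tm R M B S t" by blast
 then show ?case by (intro image_eqI[of _ _ "T1 (Inr (Inl (n, c))) t"]) simp_all
next
 case (df n \<phi>)
 then obtain t where "\<phi> = eval_tm R M B S t" by blast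
 then show ?case by (intro image_eqI[of _ _ "T1 (Inr (Inr n)) t"]) simp_all
next
 case (mult i \<phi> j \<psi>)
 then obtain t u where "\<phi> = eval_tm R M B S t" "\<psi> = eval_tm R M B S u" by blast
 then show ?case by (intro image_eqI[of _ _ "T2 (Inr (i, j)) t u"]) simp_all
next
 case one
 show ?case by (intro image_eqI[of _ _ "T0 (Inr (Inr 0))"]) simp_all
qed

text \<open>The subalgebra generated by few elements of the product of all algebras with a given
  structure is again small, and hence an initial such algebra.\<close>

lemma generated_algebra:
 fixes R :: "'u ring" and M :: "'k => ('u, 'u) fdga" and B :: "'x => 'k => 'u" and S :: "'y => ('k => 'u) => 'k => 'u"
 assumes inf: "infinite (UNIV :: 'u set)" and R: "cring R" and M: "!!k. k\<in>I==>is_fdga R (M k)"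
  and bt: "!!n \<phi> k. base n \<phi>==>k\<in>I==>\<phi> k\<in>elts (M k) n"
  and st: "!!n \<phi> m \<psi> k. generated R M base step n \<phi>==>step n \<phi> m \<psi>==>(!!k. k\<in>I==>\<phi> k\<in>elts (M k) n)==>k\<in>I==>\<psi> k\<in>elts (M k) m"
  and B: "!!n \<phi>. base n \<phi>==>\<phi>\<in>range B" and S: "!!n \<phi> m \<psi>. step n \<phi> m \<psi>==>\<exists>y. \<psi> = S y \<phi>"
  and x: "\<exists>f :: 'x => 'u. inj f" and y: "\<exists>f :: 'y => 'u. inj f"
 obtains E :: "('u, 'u) fdga" and el where "presents R (principal I) M (%n. {\<phi>. generated R M base step n \<phi>}) E el"
proof -
 note i = inj_int_into[OF inf] and s = inj_sum_into[OF inf] and p = inj_prod_into[OF inf]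
 have u: "\<exists>f :: 'u => 'u. inj f" using inj_on_id by blast
 obtain t :: "int => 'u" where t: "inj t" using i by blast
 obtain f0 :: "'x + int + int => 'u" where f0: "inj f0" using s[OF x s[OF i i]] by blast
 obtain f1 :: "'y + int \<times> 'u + int => 'u" where f1: "inj f1" using s[OF y s[OF p[OF i u] i]] by blast
 obtain f2 :: "int + int \<times> int => 'u" where f2: "inj f2" using s[OF i p[OF i i]] by blast
 \<comment> \<open>A family is coded by some term that evaluates to it; families with the same code
   then have the same value.\<close>
 define code where "code \<phi> = code_tm t f0 f1 f2 (SOME a. eval_tm R M B S a = \<phi>)" for \<phi>
 have code: "inj_on code (range (eval_tm R M B S))"
 proof (rule inj_onI)
  fix \<phi> \<psi> assume r: "\<phi>\<in>range (eval_tm R M B S)" "\<psi>\<in>range (eval_tm R M B S)" and e: "code \<phi> = code \<psi>"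
  have "(SOME a. eval_tm R M B S a = \<phi>) = (SOME a. eval_tm R M B S a = \<psi>)"
   using e unfolding code_def by (rule injD[OF inj_code_tm[OF inf t f0 f1 f2]])
  moreover have "eval_tm R M B S (SOME a. eval_tm R M B S a = \<phi>) = \<phi>" "eval_tm R M B S (SOME a. eval_tm R M B S a = \<psi>) = \<psi>"
   using r by (auto intro: someI)
  ultimately show "\<phi> = \<psi>" by metis
 qed
 have ty: "\<phi> k\<in>elts (M k) n" if "generated R M base step n \<phi>" "k\<in>I" for n \<phi> k
  using that
 proof (induction arbitrary: k)
  case (base n \<phi>) then show ?case by (rule bt)
 next
  case (step n \<phi> m \<psi>) show ?case by (rule st[OF step(1,2,3,4)])
 qed (simp_all add: fdga_alg[OF R M])
 interpret subproduct R "principal I" M "%n. {\<phi>. generated R M base step n \<phi>}" code "range (eval_tm R M B S)"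
 proof (rule subproduct.intro, goal_cases)
  case (10 n) show ?case by (intro subsetI, rule generated_eval) (auto intro: B S)
 qed (auto simp: eventually_principal M R code intro: ty generated.intros)
 show thesis by (rule presented) (rule that)
qed

text \<open>The uniqueness half of initiality. Maps preserve the algebra operations anyway, so only
  \<open>base\<close> and \<open>step\<close> remain to be compared.\<close>

lemma generated_agree:
 fixes E N :: "('u, 'u) fdga"
 assumes R: "cring R" and P: "presents R F M (%n. {\<phi>. generated R M base step n \<phi>}) E el"
  and N: "is_fdga R N" and f: "dgmap R E N f" and g: "dgmap R E N g"
  and b: "!!n \<phi>. base n \<phi>==>f n (el n \<phi>) = g n (el n \<phi>)"
  and s: "!!n \<phi> m \<psi>. generated R M base step n \<phi>==>step n \<phi> m \<psi> ==>
   f n (el n \<phi>) = g n (el n \<phi>)==>f m (el m \<psi>) = g m (el m \<psi>)"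
 shows "f = g"
proof (rule fdga_map_eqI[OF f g])
 note D = presentsD[OF P, unfolded mem_Collect_eq]
 have *: "f n (el n \<phi>) = g n (el n \<phi>)" if "generated R M base step n \<phi>" for n \<phi>
  using that
 proof induction
  case (base n \<phi>) then show ?case by (rule b)
 next
  case (step n \<phi> m \<psi>) show ?case by (rule s[OF step.hyps step.IH])
 next
  case (zero n)
  show ?case unfolding D(6)[symmetric]
   using mod_hom_zero[OF fcxD(1)[OF fdgaD(1)[OF R D(1)]] fcxD(1)[OF fdgaD(1)[OF R N]] fdga_mapD(1)[OF f]]
    mod_hom_zero[OF fcxD(1)[OF fdgaD(1)[OF R D(1)]] fcxD(1)[OF fdgaD(1)[OF R N]] fdga_mapD(1)[OF g]] by simp
 next
  case (add n \<phi> \<psi>)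
  then show ?case by (simp add: D(8)[symmetric] D(18) fdga_mapD(6)[OF f] fdga_mapD(6)[OF g])
 next
  case (smult c n \<phi>)
  then show ?case by (simp add: D(10)[symmetric] D(18) fdga_mapD(7)[OF f] fdga_mapD(7)[OF g])
 next
  case (df n \<phi>)
  then show ?case by (simp add: D(12)[symmetric] D(18) fdga_mapD(3)[OF f] fdga_mapD(3)[OF g])
 next
  case (mult i \<phi> j \<psi>)
  then show ?case by (simp add: D(14)[symmetric] D(18) fdga_map_mult[OF R D(1) N f] fdga_map_mult[OF R D(1) N g])
 next
  case one
  show ?case by (simp add: D(16)[symmetric] fdga_map_mult[OF R D(1) N f] fdga_map_mult[OF R D(1) N g])
 qed
 fix n x assume "x\<in>elts E n"
 then obtain \<phi> where "x = el n \<phi>" "generated R M base step n \<phi>" by (auto simp: D(2))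
 then show "f n x = g n x" using * by simp
qed

subsection \<open>Colimits\<close>

text \<open>The product is indexed by all cocones under the diagram. A generator, labelled by
  \<open>(j, n, x)\<close>, has at each cocone the image of \<open>x\<close> under its leg at
  \<open>j\<close>. The projection to a cocone is the comparison map, and it is unique as it is
  prescribed on generators.\<close>

lemma fDGA_colimits:
 fixes R :: "'u ring" and J :: "('i, 'j) category" and Fo :: "'i => ('u, 'u) fdga"
 assumes inf: "infinite (UNIV :: 'u set)" and ii: "\<exists>f :: 'i => 'u. inj f" and R: "cring R"
  and J: "is_category J" and F: "is_functor J (fDGA R) Fo Fm"
 shows "\<exists>X \<iota>. is_colimit J (fDGA R) Fo Fm X \<iota>"
proof -
 have Fo: "is_fdga R (Fo j)" if "j\<in>objs J" for j
  using F that unfolding is_functor_def by (simp add: fDGA_simps)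
 have Fm: "Fm u\<in>homD R (Fo (src J u)) (Fo (tgt J u))" "src J u\<in>objs J" "tgt J u\<in>objs J" if "u\<in>arrs J" for u
  using F J that unfolding is_functor_def is_category_def by simp_all
 define I where "I = {(Y, \<psi>). is_cocone J (fDGA R) Fo Fm Y \<psi>}"
 define B where "B = (%(j, n, x) (Y :: ('u, 'u) fdga, \<psi> :: 'i => (('u, 'u) fdga, int => 'u => 'u) arrow). afun (\<psi> j) n x)"
 define base where "base n \<phi> \<longleftrightarrow> (\<exists>j\<in>objs J. \<exists>x\<in>elts (Fo j) n. \<phi> = B (j, n, x))" for n \<phi>
 have I: "is_fdga R Y" "!!j. j\<in>objs J==>\<psi> j\<in>homD R (Fo j) Y"
  "!!u. u\<in>arrs J==>cmpD R (\<psi> (tgt J u)) (Fm u) = \<psi> (src J u)" if "(Y, \<psi>)\<in>I" for Y \<psi>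
  using that by (simp_all add: I_def is_cocone_def fDGA_simps)
 have Im: "dgmap R (Fo j) Y (afun (\<psi> j))" "asrc (\<psi> j) = Fo j" if "(Y, \<psi>)\<in>I" "j\<in>objs J" for Y \<psi> j
  using I(2)[OF that] by (simp_all add: hom_fDGA)
 let ?g = "generated R fst base (%_ _ _ _. False)"
 have cod: "\<exists>f :: 'i \<times> int \<times> 'u => 'u. inj f"
  by (intro inj_prod_into[OF inf] ii inj_int_into[OF inf]) (use inj_on_id in blast)
 obtain E :: "('u, 'u) fdga" and el where P: "presents R (principal I) fst (%n. {\<phi>. ?g n \<phi>}) E el"
 proof (rule generated_algebra[where I = I and M = fst and base = base and step = "%_ _ _ _. False" and B = B and S = "%_ _ _. undefined", OF inf R _ _ _ _ _ cod cod])
  fix k assume "k\<in>I" then show "is_fdga R (fst k)" using I(1) by (cases k) auto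
 next
  fix n \<phi> k assume b: "base n \<phi>" "k\<in>I"
  then show "\<phi> k\<in>elts (fst k) n" using fdga_mapD(5)[OF Im(1)] by (cases k) (auto simp: base_def B_def)
 qed (auto simp: base_def)
 note D = presentsD[OF P, unfolded eventually_principal mem_Collect_eq]
 define io where "io j n = (\<lambda>x\<in>elts (Fo j) n. el n (B (j, n, x)))" for j n
 have gen: "?g n (B (j, n, x))" if "j\<in>objs J" "x\<in>elts (Fo j) n" for j n x
  by (rule generated.base) (use that in \<open>auto simp: base_def\<close>)
 have io: "dgmap R (Fo j) E (io j)" if j: "j\<in>objs J" for j
 proof -
  have B2: "B (j, n, x) = (%k. afun (snd k j) n x)" for n x by (auto simp: B_def)
  show ?thesis unfolding io_def[abs_def] B2
   by (rule presents_map_in[OF R P Fo[OF j]])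
    (use Im(1)[OF _ j] I(1) gen[OF j] in \<open>auto simp: eventually_principal B2\<close>)
 qed
 let ?io = "%j. Arrow (Fo j) E (io j)"
 have ioh: "?io j\<in>homD R (Fo j) E" if "j\<in>objs J" for j using that by (simp add: hom_fDGA D Fo io)
 have "is_colimit J (fDGA R) Fo Fm E ?io" unfolding is_colimit_def
 proof (intro conjI allI impI)
  show "is_cocone J (fDGA R) Fo Fm E ?io" unfolding is_cocone_def
  proof (intro conjI ballI)
   show "E\<in>objs (fDGA R)" by (simp add: fDGA_simps D)
   show "?io j\<in>homD R (Fo j) E" if "j\<in>objs J" for j using that by (rule ioh)
   fix u assume u: "u\<in>arrs J"
   show "cmpD R (?io (tgt J u)) (Fm u) = ?io (src J u)"
   proof (rule hom_fDGA_eqI[OF categoryD(1)[OF category_fDGA[OF R] Fm(1)[OF u] ioh[OF Fm(3)[OF u]]] ioh[OF Fm(2)[OF u]]])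
    fix n x assume x: "x\<in>elts (Fo (src J u)) n"
    have fu: "asrc (Fm u) = Fo (src J u)" "afun (Fm u) n x\<in>elts (Fo (tgt J u)) n"
     using Fm(1)[OF u] x fdga_mapD(5)[of R "Fo (src J u)" "Fo (tgt J u)" "afun (Fm u)"] by (simp_all add: hom_fDGA)
    have "\<forall>k\<in>I. B (tgt J u, n, afun (Fm u) n x) k = B (src J u, n, x) k"
    proof
     fix k assume k: "k\<in>I"
     obtain Y \<psi> where k': "k = (Y, \<psi>)" by (cases k)
     have "afun (cmpD R (\<psi> (tgt J u)) (Fm u)) n x = afun (\<psi> (src J u)) n x" using I(3) k k' u by simp
     then show "B (tgt J u, n, afun (Fm u) n x) k = B (src J u, n, x) k"
      using x fu by (simp add: k' B_def cmp_apply)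
    qed
    then have "el n (B (tgt J u, n, afun (Fm u) n x)) = el n (B (src J u, n, x))"
     using D(3)[OF gen[OF Fm(3)[OF u] fu(2)] gen[OF Fm(2)[OF u] x]] by blast
    then show "afun (cmpD R (?io (tgt J u)) (Fm u)) n x = afun (?io (src J u)) n x"
     using x fu by (simp add: cmp_apply io_def)
   qed
  qed
  fix Y \<psi> assume "is_cocone J (fDGA R) Fo Fm Y \<psi>"
  then have k: "(Y, \<psi>)\<in>I" by (simp add: I_def)
  obtain h where h: "dgmap R E Y h" "!!n \<phi>. ?g n \<phi>==>h n (el n \<phi>) = \<phi> (Y, \<psi>)"
   using presents_proj[OF R P, of "(Y, \<psi>)"] k I(1)[OF k] by (auto simp: eventually_principal)
  have hh: "Arrow E Y h\<in>homD R E Y" by (simp add: hom_fDGA I(1)[OF k] D h)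
  show "\<exists>!h. h\<in>homD R E Y & (\<forall>j\<in>objs J. cmpD R h (?io j) = \<psi> j)"
  proof (rule ex1I[of _ "Arrow E Y h"], intro conjI ballI hh)
   fix j assume j: "j\<in>objs J"
   show "cmpD R (Arrow E Y h) (?io j) = \<psi> j"
    by (rule hom_fDGA_eqI[OF categoryD(1)[OF category_fDGA[OF R] ioh[OF j] hh] I(2)[OF k j]])
     (simp add: cmp_apply io_def h(2)[OF gen[OF j]], simp add: B_def)
  next
   fix g assume g: "g\<in>homD R E Y & (\<forall>j\<in>objs J. cmpD R g (?io j) = \<psi> j)"
   then have gm: "dgmap R E Y (afun g)" by (simp add: hom_fDGA)
   have "afun g = h"
   proof (rule generated_agree[OF R P I(1)[OF k] gm h(1)])
    fix n \<phi> assume "base n \<phi>"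
    then obtain j x where j: "j\<in>objs J" and x: "x\<in>elts (Fo j) n" and p: "\<phi> = B (j, n, x)" by (auto simp: base_def)
    have "afun (cmpD R g (?io j)) n x = afun (\<psi> j) n x" using g j by simp
    then show "afun g n (el n \<phi>) = h n (el n \<phi>)"
     using x h(2)[OF gen[OF j x]] by (simp add: p cmp_apply io_def) (simp add: B_def)
   qed simp
   then show "g = Arrow E Y h" using g by (cases g) (simp add: hom_fDGA)
  qed
 qed
 then show ?thesis by blast
qed

subsection \<open>Free algebras\<close>

text \<open>The method of \<open>fDGA_colimits\<close>, with the product indexed by all maps of
  complexes from \<open>A\<close> to an algebra and with the elements of \<open>A\<close> as
  generators.\<close>

lemma free_algebra:
 fixes R :: "'u ring" and A :: "('u, 'u) fcomplex"
 assumes inf: "infinite (UNIV :: 'u set)" and R: "cring R" and A: "fcx R A"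
 shows "\<exists>T \<eta>. \<eta>\<in>homC R A (cx T) & T\<in>objs (fDGA R) &
  (\<forall>Y\<in>objs (fDGA R). \<forall>f\<in>homC R A (cx Y). \<exists>!g. g\<in>homD R T Y & cmpC R (forget g) \<eta> = f)"
proof -
 define I where "I = {(Y :: ('u, 'u) fdga, f). is_fdga R Y & is_fmap R A (cx Y) f}"
 define B where "B = (%(n, x) (Y :: ('u, 'u) fdga, f :: int => 'u => 'u). f n x)"
 define base where "base n \<phi> \<longleftrightarrow> (\<exists>x\<in>grade A n. \<phi> = B (n, x))" for n \<phi>
 have I: "is_fdga R Y" "is_fmap R A (cx Y) f" if "(Y, f)\<in>I" for Y f using that by (simp_all add: I_def)
 let ?g = "generated R fst base (%_ _ _ _. False)"
 have cod: "\<exists>f :: int \<times> 'u => 'u. inj f"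
  by (intro inj_prod_into[OF inf] inj_int_into[OF inf]) (use inj_on_id in blast)
 obtain E :: "('u, 'u) fdga" and el where P: "presents R (principal I) fst (%n. {\<phi>. ?g n \<phi>}) E el"
 proof (rule generated_algebra[where I = I and M = fst and base = base and step = "%_ _ _ _. False" and B = B and S = "%_ _ _. undefined", OF inf R _ _ _ _ _ cod cod])
  fix k assume "k\<in>I" then show "is_fdga R (fst k)" using I(1) by (cases k) auto
 next
  fix n \<phi> k assume b: "base n \<phi>" "k\<in>I"
  then show "\<phi> k\<in>elts (fst k) n" using is_fmapD(5)[OF I(2)] by (cases k) (auto simp: base_def B_def)
 qed (auto simp: base_def)
 note D = presentsD[OF P, unfolded eventually_principal mem_Collect_eq]
 define \<eta> where "\<eta> n = (\<lambda>x\<in>grade A n. el n (B (n, x)))" for n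
 have gen: "?g n (B (n, x))" if "x\<in>grade A n" for n x
  by (rule generated.base) (use that in \<open>auto simp: base_def\<close>)
 have B2: "B (n, x) = (%k. snd k n x)" for n x by (auto simp: B_def)
 have eta: "is_fmap R A (cx E) \<eta>"
  unfolding \<eta>_def[abs_def] B2
  by (rule presents_fmap_in[OF R P A]) (use I gen in \<open>auto simp: eventually_principal B2\<close>)
 have eh: "Arrow A (cx E) \<eta>\<in>homC R A (cx E)" using eta A fdgaD(1)[OF R D(1)] by (simp add: hom_fC)
 show ?thesis
 proof (intro exI[of _ E] exI[of _ "Arrow A (cx E) \<eta>"] conjI ballI eh)
  show "E\<in>objs (fDGA R)" by (simp add: fDGA_simps D)
  fix Y f assume Y: "Y\<in>objs (fDGA R)" and f: "f\<in>homC R A (cx Y)"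
  have k: "(Y, afun f)\<in>I" using Y f by (simp add: I_def fDGA_simps hom_fC)
  obtain h where h: "dgmap R E Y h" "!!n \<phi>. ?g n \<phi>==>h n (el n \<phi>) = \<phi> (Y, afun f)"
   using presents_proj[OF R P, of "(Y, afun f)"] k I(1)[OF k] by (auto simp: eventually_principal)
  have hh: "Arrow E Y h\<in>homD R E Y" by (simp add: hom_fDGA I(1)[OF k] D h)
  have fh: "forget g\<in>homC R (cx E) (cx Y)" if "g\<in>homD R E Y" for g
   using that by (simp add: hom_fC hom_fDGA forget_def fdgaD[OF R] map_fmap)
  have app: "afun (cmpC R (forget g) (Arrow A (cx E) \<eta>)) n x = afun g n (el n (B (n, x)))" if "x\<in>grade A n" for g n x
   using that by (simp add: cmp_apply \<eta>_def forget_def)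
  show "\<exists>!g. g\<in>homD R E Y & cmpC R (forget g) (Arrow A (cx E) \<eta>) = f"
  proof (rule ex1I[of _ "Arrow E Y h"], intro conjI hh)
   show "cmpC R (forget (Arrow E Y h)) (Arrow A (cx E) \<eta>) = f"
    by (rule hom_fC_eqI[OF categoryD(1)[OF category_fC eh fh[OF hh]] f])
     (simp add: app h(2)[OF gen], simp add: B_def)
  next
   fix g assume g: "g\<in>homD R E Y & cmpC R (forget g) (Arrow A (cx E) \<eta>) = f"
   then have gm: "dgmap R E Y (afun g)" by (simp add: hom_fDGA)
   have "afun g = h"
   proof (rule generated_agree[OF R P I(1)[OF k] gm h(1)])
    fix n \<phi> assume "base n \<phi>"
    then obtain x where x: "x\<in>grade A n" and p: "\<phi> = B (n, x)" by (auto simp: base_def)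
    show "afun g n (el n \<phi>) = h n (el n \<phi>)"
     using app[OF x, of g] h(2)[OF gen[OF x]] g by (simp add: p) (simp add: B_def)
   qed simp
   then show "g = Arrow E Y h" using g by (cases g) (simp add: hom_fDGA)
  qed
 qed
qed

text \<open>Universal arrows assemble into a left adjoint. The functor laws come from
  \<open>un\<close>, the uniqueness of transposes.\<close>

lemma left_adjoint_exists:
 assumes C: "is_category C" and D: "is_category D" and G: "is_functor D C Go Gm"
  and u: "!!X. X\<in>objs C==>\<exists>T \<eta>. \<eta>\<in>hom_set C X (Go T) & T\<in>objs D &
   (\<forall>Y\<in>objs D. \<forall>f\<in>hom_set C X (Go Y). \<exists>!g. g\<in>hom_set D T Y & cmp C (Gm g) \<eta> = f)"
 shows "\<exists>To Tm. left_adjoint C D To Tm Go Gm"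
proof -
 note cC = categoryD[OF C] and cD = categoryD[OF D]
 have Gh: "Gm g\<in>hom_set C (Go X) (Go Y)" if "g\<in>hom_set D X Y" for g X Y
  using G that unfolding is_functor_def hom_set_def by auto
 have Gc: "Gm (cmp D g f) = cmp C (Gm g) (Gm f)" if "f\<in>hom_set D X Y" "g\<in>hom_set D Y Z" for f g X Y Z
  using G that unfolding is_functor_def hom_set_def by auto
 have Gi: "Gm (ident D X) = ident C (Go X)" if "X\<in>objs D" for X
  using G that unfolding is_functor_def by auto
 obtain To \<eta> where T: "!!X. X\<in>objs C==>\<eta> X\<in>hom_set C X (Go (To X))" "!!X. X\<in>objs C==>To X\<in>objs D"
  "!!X Y f. X\<in>objs C==>Y\<in>objs D==>f\<in>hom_set C X (Go Y)==>\<exists>!g. g\<in>hom_set D (To X) Y & cmp C (Gm g) (\<eta> X) = f"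
  using u by metis
 define Tm where "Tm f = (THE g. g\<in>hom_set D (To (src C f)) (To (tgt C f)) & cmp C (Gm g) (\<eta> (src C f)) = cmp C (\<eta> (tgt C f)) f)" for f
 have Tm: "Tm f\<in>hom_set D (To X) (To Y)" "cmp C (Gm (Tm f)) (\<eta> X) = cmp C (\<eta> Y) f" if f: "f\<in>hom_set C X Y" for f X Y
 proof -
  have X: "X\<in>objs C" "Y\<in>objs C" using cC(6)[OF f] by auto
  have e: "src C f = X" "tgt C f = Y" using f by (simp_all add: hom_set_def)
  have "cmp C (\<eta> Y) f\<in>hom_set C X (Go (To Y))" by (rule cC(1)[OF f T(1)[OF X(2)]])
  from theI'[OF T(3)[OF X(1) T(2)[OF X(2)] this]]
  show "Tm f\<in>hom_set D (To X) (To Y)" "cmp C (Gm (Tm f)) (\<eta> X) = cmp C (\<eta> Y) f"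
   unfolding Tm_def e by auto
 qed
 have un: "g = g'" if "X\<in>objs C" "g\<in>hom_set D (To X) Y" "g'\<in>hom_set D (To X) Y" "cmp C (Gm g) (\<eta> X) = cmp C (Gm g') (\<eta> X)" for X Y g g'
 proof -
  have "cmp C (Gm g') (\<eta> X)\<in>hom_set C X (Go Y)" by (rule cC(1)[OF T(1)[OF that(1)] Gh[OF that(3)]])
  from T(3)[OF that(1) _ this] cD(6)[OF that(2)] that show ?thesis by blast
 qed
 have func: "is_functor C D To Tm" unfolding is_functor_def
 proof (intro conjI ballI impI)
  fix X assume X: "X\<in>objs C"
  show "To X\<in>objs D" by (rule T(2)[OF X])
  note i = cC(2)[OF X] and iD = cD(2)[OF T(2)[OF X]]
  show "Tm (ident C X) = ident D (To X)"
   by (rule un[OF X Tm(1)[OF i] iD]) (simp add: Tm(2)[OF i] Gi[OF T(2)[OF X]] cC(3)[OF T(1)[OF X]] cC(4)[OF T(1)[OF X]])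
 next
  fix f assume "f\<in>arrs C" note f = cC(7)[OF this]
  show "Tm f\<in>hom_set D (To (src C f)) (To (tgt C f))" by (rule Tm(1)[OF f])
  fix g assume "g\<in>arrs C" and gf: "src C g = tgt C f"
  note g = cC(7)[OF this(1), unfolded gf]
  note X = cC(6)[OF f] cC(6)[OF g]
  have "cmp C (Gm (cmp D (Tm g) (Tm f))) (\<eta> (src C f)) = cmp C (Gm (Tm g)) (cmp C (Gm (Tm f)) (\<eta> (src C f)))"
   unfolding Gc[OF Tm(1)[OF f] Tm(1)[OF g]]
   by (rule cC(5)[symmetric, OF T(1) Gh[OF Tm(1)[OF f]] Gh[OF Tm(1)[OF g]]]) (use X in simp)
  also have "\<dots> = cmp C (cmp C (Gm (Tm g)) (\<eta> (tgt C f))) f"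
   unfolding Tm(2)[OF f] by (rule cC(5)[OF f T(1) Gh[OF Tm(1)[OF g]]]) (use X in simp)
  also have "\<dots> = cmp C (\<eta> (tgt C g)) (cmp C g f)"
   unfolding Tm(2)[OF g] by (rule cC(5)[symmetric, OF f g T(1)]) (use X in simp)
  finally show "Tm (cmp C g f) = cmp D (Tm g) (Tm f)"
   using X Tm[OF cC(1)[OF f g]] by (intro un[OF _ Tm(1)[OF cC(1)[OF f g]] cD(1)[OF Tm(1)[OF f] Tm(1)[OF g]]]) simp_all
 qed
 have "left_adjoint C D To Tm Go Gm" unfolding left_adjoint_def
 proof (intro conjI func G exI[of _ \<eta>] ballI)
  fix f assume "f\<in>arrs C" note f = cC(7)[OF this]
  show "cmp C (\<eta> (tgt C f)) f = cmp C (Gm (Tm f)) (\<eta> (src C f))" by (rule Tm(2)[OF f, symmetric])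
 qed (use T in auto)
 then show ?thesis by blast
qed

lemma free_algebra_functor:
 fixes R :: "'u ring"
 assumes "infinite (UNIV :: 'u set)" "cring R"
 shows "\<exists>To Tm. is_free_algebra_functor R To Tm"
 unfolding is_free_algebra_functor_def
 by (rule left_adjoint_exists[OF category_fC category_fDGA[OF assms(2)] forget_functor[OF assms(2)]])
  (rule free_algebra[OF assms], simp add: fC_simps)

section \<open>Cycles and lifting data\<close>

lemma cycles_iff: "x\<in>cycles A k p n \<longleftrightarrow> x\<in>fil A p n & df A n x\<in>fil A (p - int k) (n + 1)"
 by (simp add: cycles_def)

lemma cycles_elts: "fcx R A==>x\<in>cycles A k p n==>x\<in>grade A n"
 by (auto simp: cycles_iff intro: fcxD(8))

lemma fmap_cycles:
 assumes "is_fmap R A B f" "fcx R A" "x\<in>cycles A k p n"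
 shows "f n x\<in>cycles B k p n"
 using assms is_fmapD(4)[OF assms(1)] is_fmapD(3)[OF assms(1) cycles_elts[OF assms(2,3)]]
 by (metis cycles_iff)

lemma fcomplex_diff_closed:
 assumes "fcx R A" "x\<in>grade A n" "y\<in>grade A n"
 shows "x -[md A n] y\<in>grade A n"
proof -
 interpret module R "md A n" by (rule fcxD(1)[OF assms(1)])
 show ?thesis using assms by simp
qed

lemma df_pred: "fcx R A==>x\<in>grade A (n - 1)==>df A (n - 1) x\<in>grade A n"
 using fcxD(3)[of R A x "n - 1"] by simp

lemma fmap_df_pred:
 "is_fmap R A B f==>x\<in>grade A (n - 1)==>f n (df A (n - 1) x) = df B (n - 1) (f (n - 1) x)"
 using is_fmapD(3)[of R A B f x "n - 1"] by simp

lemma fmap_diff: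
 assumes "is_fmap R A B f" "fcx R A" "fcx R B" "x\<in>grade A n" "y\<in>grade A n"
 shows "f n (x -[md A n] y) = f n x -[md B n] f n y"
 by (rule mod_hom_diff[OF fcxD(1)[OF assms(2)] fcxD(1)[OF assms(3)] is_fmapD(1)[OF assms(1)] assms(4,5)])

text \<open>A square from \<open>\<phi>\<^sub>r\<^sub>+\<^sub>1\<close> at \<open>(q, n)\<close> to \<open>p\<close> amounts to a pair \<open>(a, y)\<close> as in \<open>admissible\<close>, the
  second component in the filtered degree \<open>q - 1\<close> being \<open>p a - d y\<close>; a lift in it is a solution \<open>x\<close>.\<close>

definition admissible ::
 "nat => ('r, 'a) fcomplex => ('r, 'b) fcomplex => (int => 'a => 'b) => int => int => 'a => 'b => bool" where
 "admissible r A B p q n a y \<longleftrightarrow> a\<in>cycles A (r + 1) q n & y\<in>cycles B r (q + int r) (n - 1) &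
   p n a -[md B n] df B (n - 1) y\<in>fil B (q - 1) n"

definition solves ::
 "nat => ('r, 'a) fcomplex => (int => 'a => 'b) => int => int => 'a => 'b => 'a => bool" where
 "solves r A p q n a y x \<longleftrightarrow> x\<in>cycles A r (q + int r) (n - 1) & p (n - 1) x = y &
   a -[md A n] df A (n - 1) x\<in>fil A (q - 1) n"

definition solvable :: "nat => ('r, 'a) fcomplex => ('r, 'b) fcomplex => (int => 'a => 'b) => bool" where
 "solvable r A B p \<longleftrightarrow> (\<forall>q n a y. admissible r A B p q n a y \<longrightarrow> (\<exists>x. solves r A p q n a y x))"

definition cycle_onto :: "nat set => ('r, 'a) fcomplex => ('r, 'b) fcomplex => (int => 'a => 'b) => bool" where
 "cycle_onto S A B p \<longleftrightarrow> (\<forall>s\<in>S. \<forall>q n. \<forall>y\<in>cycles B s q n. \<exists>x\<in>cycles A s q n. p n x = y)"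

text \<open>The flag \<open>b\<close> treats both factorizations at once: with \<open>b\<close>
  false only lifts of cycles are chosen, with \<open>b\<close> true also fillers for the squares
  from \<open>phi\<close>.\<close>

definition structured ::
 "nat => nat set => bool => ('r, 'a) fcomplex => ('r, 'b) fcomplex => (int => 'a => 'b) =>
  (nat => int => int => 'b => 'a) => (int => int => 'a => 'b => 'a) => bool" where
 "structured r S b A B p e \<sigma> \<longleftrightarrow>
   (\<forall>s\<in>S. \<forall>q n. \<forall>y\<in>cycles B s q n. e s q n y\<in>cycles A s q n & p n (e s q n y) = y) &
   (b \<longrightarrow> (\<forall>q n a y. admissible r A B p q n a y \<longrightarrow> solves r A p q n a y (\<sigma> q n a y)))"

lemma structured_exists_iff:
 "(\<exists>e \<sigma>. structured r S b A B p e \<sigma>) \<longleftrightarrow> cycle_onto S A B p & (b \<longrightarrow> solvable r A B p)"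
proof
 assume "cycle_onto S A B p & (b \<longrightarrow> solvable r A B p)"
 then have 1: "cycle_onto S A B p" and 2: "b \<longrightarrow> solvable r A B p" by auto
 have "structured r S b A B p (%s q n y. SOME x. x\<in>cycles A s q n & p n x = y) (%q n a y. SOME x. solves r A p q n a y x)"
  unfolding structured_def
 proof (intro conjI ballI allI impI)
  fix s q n y assume "s\<in>S" "y\<in>cycles B s q n"
  then have "\<exists>x. x\<in>cycles A s q n & p n x = y" using 1 unfolding cycle_onto_def by blast
  from someI_ex[OF this] show "(SOME x. x\<in>cycles A s q n & p n x = y)\<in>cycles A s q n"
   "p n (SOME x. x\<in>cycles A s q n & p n x = y) = y" by auto
 next
  fix q n a y assume "b" "admissible r A B p q n a y"
  then have "\<exists>x. solves r A p q n a y x" using 2 unfolding solvable_def by blast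
  from someI_ex[OF this] show "solves r A p q n a y (SOME x. solves r A p q n a y x)" .
 qed
 then show "\<exists>e \<sigma>. structured r S b A B p e \<sigma>" by blast
next
 assume "\<exists>e \<sigma>. structured r S b A B p e \<sigma>"
 then obtain e \<sigma> where st: "structured r S b A B p e \<sigma>" by blast
 show "cycle_onto S A B p & (b \<longrightarrow> solvable r A B p)"
  unfolding cycle_onto_def solvable_def
 proof (intro conjI ballI allI impI)
  show "\<exists>x\<in>cycles A s q n. p n x = y" if "s\<in>S" "y\<in>cycles B s q n" for s q n y
   using st that unfolding structured_def by (intro bexI[of _ "e s q n y"]) simp_all
  show "\<exists>x. solves r A p q n a y x" if b "admissible r A B p q n a y" for q n a y
   using st that unfolding structured_def by (intro exI[of _ "\<sigma> q n a y"]) simp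
 qed
qed

lemma admissible_elts:
 assumes "admissible r A B p q n a y"
 shows "fcx R A==>a\<in>grade A n" "fcx R B==>y\<in>grade B (n - 1)"
 using assms unfolding admissible_def by (auto intro: cycles_elts)

text \<open>A commuting square transports lifting problems: \<open>\<beta>\<close> takes the
  difference \<open>p a - d y\<close> to the corresponding difference and preserves its
  filtration.\<close>

lemma admissible_square:
 assumes fc: "fcx R A" "fcx R B" "fcx R A'" "fcx R B'"
  and m: "is_fmap R A A' \<alpha>" "is_fmap R B B' \<beta>" "is_fmap R A B p"
  and c: "!!n x. x\<in>grade A n==>p' n (\<alpha> n x) = \<beta> n (p n x)"
  and a: "admissible r A B p q n a y"
 shows "admissible r A' B' p' q n (\<alpha> n a) (\<beta> (n - 1) y)"
proof -
 from a have a': "a\<in>cycles A (r + 1) q n" "y\<in>cycles B r (q + int r) (n - 1)"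
  "p n a -[md B n] df B (n - 1) y\<in>fil B (q - 1) n" by (simp_all add: admissible_def)
 note e = cycles_elts[OF fc(1) a'(1)] cycles_elts[OF fc(2) a'(2)]
 have "\<beta> n (p n a -[md B n] df B (n - 1) y) = p' n (\<alpha> n a) -[md B' n] df B' (n - 1) (\<beta> (n - 1) y)"
  using e by (simp add: fmap_diff[OF m(2) fc(2,4)] is_fmapD(5)[OF m(3)] df_pred[OF fc(2)] fmap_df_pred[OF m(2)] c)
 then show ?thesis unfolding admissible_def
  using fmap_cycles[OF m(1) fc(1) a'(1)] fmap_cycles[OF m(2) fc(2) a'(2)] is_fmapD(4)[OF m(2) a'(3)] by simp
qed

text \<open>Because elements of \<open>P\<close> are pairs and filtration is detected by the two
  projections, a lift or solution in \<open>A\<close> and one in \<open>E\<close> with the same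
  image in \<open>B\<close> combine to one in \<open>P\<close>.\<close>

locale pullback_square =
 fixes R :: "'u ring" and P A E B :: "('u, 'u) fdga" and \<pi>1 \<pi>2 p v
 assumes cring: "cring R" and obj: "is_fdga R P" "is_fdga R A" "is_fdga R E" "is_fdga R B"
  and map: "dgmap R P A \<pi>1" "dgmap R P E \<pi>2" "dgmap R A B p" "dgmap R E B v"
  and commutes: "!!n x. x\<in>elts P n==>p n (\<pi>1 n x) = v n (\<pi>2 n x)"
  and pair: "!!n a e. a\<in>elts A n==>e\<in>elts E n==>p n a = v n e==>\<exists>x\<in>elts P n. \<pi>1 n x = a & \<pi>2 n x = e"
  and joint_inj: "!!n x y. x\<in>elts P n==>y\<in>elts P n==>\<pi>1 n x = \<pi>1 n y==>\<pi>2 n x = \<pi>2 n y==>x = y"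
  and joint_fil: "!!s n x. x\<in>elts P n==>\<pi>1 n x\<in>fil (cx A) s n==>\<pi>2 n x\<in>fil (cx E) s n==>x\<in>fil (cx P) s n"
  and induced: "!!X u w. is_fdga R X==>dgmap R X A u==>dgmap R X E w ==>
   (!!n x. x\<in>elts X n==>p n (u n x) = v n (w n x)) ==>
   \<exists>h. dgmap R X P h & (\<forall>n. \<forall>x\<in>elts X n. \<pi>1 n (h n x) = u n x & \<pi>2 n (h n x) = w n x)"
begin

lemmas fc = fdgaD(1)[OF cring obj(1)] fdgaD(1)[OF cring obj(2)] fdgaD(1)[OF cring obj(3)] fdgaD(1)[OF cring obj(4)]
lemmas fm = map[THEN map_fmap]

lemma cyc:
 assumes "x\<in>elts P n" "\<pi>1 n x\<in>cycles (cx A) k s n" "\<pi>2 n x\<in>cycles (cx E) k s n"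
 shows "x\<in>cycles (cx P) k s n"
 using assms joint_fil[OF assms(1), of s] joint_fil[OF fcxD(3)[OF fc(1) assms(1)], of "s - int k"]
  is_fmapD(3)[OF fm(1) assms(1)] is_fmapD(3)[OF fm(2) assms(1)]
 by (simp add: cycles_iff)

lemma pair_cyc:
 assumes "a\<in>cycles (cx A) k s n" "e\<in>cycles (cx E) k s n" "p n a = v n e"
 shows "\<exists>x\<in>cycles (cx P) k s n. \<pi>1 n x = a & \<pi>2 n x = e"
 using pair[OF cycles_elts[OF fc(2) assms(1)] cycles_elts[OF fc(3) assms(2)] assms(3)] assms(1,2) cyc by metis

lemma diff_fil:
 assumes "a\<in>elts P n" "x\<in>elts P (n - 1)"
  "\<pi>1 n a -[md (cx A) n] df (cx A) (n - 1) (\<pi>1 (n - 1) x)\<in>fil (cx A) q n"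
  "\<pi>2 n a -[md (cx E) n] df (cx E) (n - 1) (\<pi>2 (n - 1) x)\<in>fil (cx E) q n"
 shows "a -[md (cx P) n] df (cx P) (n - 1) x\<in>fil (cx P) q n"
 using assms by (intro joint_fil)
  (simp_all add: fcomplex_diff_closed[OF fc(1)] df_pred[OF fc(1)] fmap_diff[OF fm(1) fc(1,2)]
   fmap_diff[OF fm(2) fc(1,3)] fmap_df_pred[OF fm(1)] fmap_df_pred[OF fm(2)])

end

lemma pullback_exists:
 fixes R :: "'u ring"
 assumes inf: "infinite (UNIV :: 'u set)" and R: "cring R"
  and o: "is_fdga R A" "is_fdga R B" "is_fdga R E"
  and m: "dgmap R A B p" "dgmap R E B v"
 shows "\<exists>P \<pi>1 \<pi>2. pullback_square R P A E B \<pi>1 \<pi>2 p v"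
 by (rule fdga_pullback[OF inf R o m], intro exI, rule pullback_square.intro) (assumption | rule R o m | blast)+

section \<open>Factorizations\<close>

record 'u factored =
 obj :: "('u, 'u) fdga"
 inc :: "int => 'u => 'u"
 prj :: "int => 'u => 'u"
 lft :: "nat => int => int => 'u => 'u"
 sol :: "int => int => 'u => 'u => 'u"

locale fdga_arrow =
 fixes R :: "'u ring" and r :: nat and S :: "nat set" and b :: bool
  and X Y :: "('u, 'u) fdga" and f :: "int => 'u => 'u"
 assumes inf: "infinite (UNIV :: 'u set)" and cring: "cring R"
  and X: "is_fdga R X" and Y: "is_fdga R Y" and f: "dgmap R X Y f"
begin

definition factoreds :: "'u factored set" where
 "factoreds = {k. is_fdga R (obj k) & dgmap R X (obj k) (inc k) & dgmap R (obj k) Y (prj k) &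
   (\<forall>n. \<forall>x\<in>elts X n. prj k n (inc k n x) = f n x) &
   structured r S b (cx (obj k)) (cx Y) (prj k) (lft k) (sol k)}"

lemma factoredsD:
 assumes "k\<in>factoreds"
 shows "is_fdga R (obj k)" "dgmap R X (obj k) (inc k)" "dgmap R (obj k) Y (prj k)"
  "x\<in>elts X n==>prj k n (inc k n x) = f n x"
  "s\<in>S==>y\<in>cycles (cx Y) s q n==>lft k s q n y\<in>cycles (cx (obj k)) s q n"
  "s\<in>S==>y\<in>cycles (cx Y) s q n==>prj k n (lft k s q n y) = y"
  "b==>admissible r (cx (obj k)) (cx Y) (prj k) q n a y==>solves r (cx (obj k)) (prj k) q n a y (sol k q n a y)"
 using assms unfolding factoreds_def structured_def by auto

lemmas fcY = fdgaD(1)[OF cring Y] and fcX = fdgaD(1)[OF cring X]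

text \<open>The factorization through the identity of \<open>Y\<close>. Its component of the product
  is the second factor \<open>Fq\<close>, and it makes the family of factorizations
  nonempty.\<close>

definition terminal :: "'u factored" where
 "terminal = \<lparr>obj = Y, inc = f, prj = fmap_id (cx Y), lft = (%s q n y. y), sol = (%q n a y. y)\<rparr>"

lemma terminal: "terminal\<in>factoreds"
proof -
 have e: "x\<in>cycles (cx Y) k q n==>x\<in>elts Y n" for x k q n by (rule cycles_elts[OF fcY])
 show ?thesis unfolding factoreds_def terminal_def structured_def
  using Y f fdga_map_ident[OF cring Y] fdga_mapD(5)[OF f] e
  by (auto simp: fmap_id_def admissible_def solves_def)
qed

definition base :: "int => ('u factored => 'u) => bool" where
 "base n \<phi> \<longleftrightarrow> (\<exists>x\<in>elts X n. \<phi> = (%k. inc k n x)) \<or>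
   (\<exists>s\<in>S. \<exists>q. \<exists>y\<in>cycles (cx Y) s q n. \<phi> = (%k. lft k s q n y))"

text \<open>The solution operation may be applied to a family only if the data are admissible at
  every index. The same \<open>y\<close> serves all indices, because every factorization ends in
  \<open>Y\<close>.\<close>

definition step :: "int => ('u factored => 'u) => int => ('u factored => 'u) => bool" where
 "step n \<phi> m \<psi> \<longleftrightarrow> b & m = n - 1 & (\<exists>q y. (\<forall>k\<in>factoreds. admissible r (cx (obj k)) (cx Y) (prj k) q n (\<phi> k) y) &
   \<psi> = (%k. sol k q n (\<phi> k) y))"

abbreviation gen where "gen \<equiv> generated R obj base step"

lemma gen_step: "gen n \<phi>==>step n \<phi> m \<psi>==>gen m \<psi>"
 by (rule generated.step)

lemma stepI:
 "b==>\<forall>k\<in>factoreds. admissible r (cx (obj k)) (cx Y) (prj k) q n (\<phi> k) y ==>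
  step n \<phi> (n - 1) (%k. sol k q n (\<phi> k) y)"
 unfolding step_def by blast

lemma obj_fc: "k\<in>factoreds==>fcx R (cx (obj k))"
 using fdgaD(1)[OF cring factoredsD(1)] .

definition free_on :: "('u, 'u) fdga => (int => ('u factored => 'u) => 'u) => bool" where
 "free_on E el \<longleftrightarrow> presents R (principal factoreds) obj (%n. {\<phi>. gen n \<phi>}) E el"

lemma free_exists: "\<exists>E el. free_on E el"
proof -
 \<comment> \<open>The labels of generators and steps consist of numbers and elements of
   \<open>'u\<close>; they do not mention factorizations, and this is why they can be coded.\<close>
 define B where "B z = (case z of Inl (n, x) => (%k :: 'u factored. inc k n x) | Inr (s, q, n, y) => (%k. lft k s q n y))"
  for z :: "int \<times> 'u + nat \<times> int \<times> int \<times> 'u"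
 define T where "T z \<phi> = (case z of (q, n, y) => (%k :: 'u factored. sol k q n (\<phi> k) y))"
  for z :: "int \<times> int \<times> 'u" and \<phi> :: "'u factored => 'u"
 note i = inj_int_into[OF inf] and s = inj_sum_into[OF inf] and p = inj_prod_into[OF inf] and na = inj_nat_into[OF inf]
 have u: "\<exists>f :: 'u => 'u. inj f" using inj_on_id by blast
 have c0: "\<exists>f :: int \<times> 'u + nat \<times> int \<times> int \<times> 'u => 'u. inj f" by (intro i s p na u)
 have c1: "\<exists>f :: int \<times> int \<times> 'u => 'u. inj f" by (intro i p u)
 obtain E :: "('u, 'u) fdga" and el where "presents R (principal factoreds) obj (%n. {\<phi>. gen n \<phi>}) E el"
 proof (rule generated_algebra[where I = factoreds and M = obj and base = base and step = step and B = B and S = T, OF inf cring _ _ _ _ _ c0 c1])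
  show "is_fdga R (obj k)" if "k\<in>factoreds" for k by (rule factoredsD(1)[OF that])
  show "\<phi> k\<in>elts (obj k) n" if "base n \<phi>" "k\<in>factoreds" for n \<phi> k
   using that fdga_mapD(5)[OF factoredsD(2)] cycles_elts[OF obj_fc factoredsD(5)] unfolding base_def by blast
  show "\<psi> k\<in>elts (obj k) m" if "step n \<phi> m \<psi>" "k\<in>factoreds" for n \<phi> m \<psi> k
  proof -
   from that(1) obtain q y where q: "b" "m = n - 1" "\<forall>k\<in>factoreds. admissible r (cx (obj k)) (cx Y) (prj k) q n (\<phi> k) y"
    "\<psi> = (%k. sol k q n (\<phi> k) y)" unfolding step_def by blast
   have "solves r (cx (obj k)) (prj k) q n (\<phi> k) y (sol k q n (\<phi> k) y)"
    using factoredsD(7)[OF that(2) q(1)] q(3) that(2) by blast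
   then show ?thesis unfolding q(2,4) solves_def by (auto intro: cycles_elts[OF obj_fc[OF that(2)]])
  qed
  show "\<phi>\<in>range B" if "base n \<phi>" for n \<phi>
   using that unfolding base_def
  proof (elim disjE bexE exE)
   fix x assume "\<phi> = (%k. inc k n x)"
   then show ?thesis by (intro image_eqI[of _ _ "Inl (n, x)"]) (simp_all add: B_def)
  next
   fix s q y assume "\<phi> = (%k. lft k s q n y)"
   then show ?thesis by (intro image_eqI[of _ _ "Inr (s, q, n, y)"]) (simp_all add: B_def)
  qed
  show "\<exists>z. \<psi> = T z \<phi>" if st: "step n \<phi> m \<psi>" for n \<phi> m \<psi>
  proof -
   from st obtain q y where "\<psi> = (%k. sol k q n (\<phi> k) y)" unfolding step_def by blast
   then have "\<psi> = T (q, n, y) \<phi>" by (simp add: T_def)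
   then show ?thesis by blast
  qed
 qed
 then show ?thesis unfolding free_on_def by blast
qed

text \<open>Chosen once, so that the factorization becomes a function of the arrow and of the
  parameters; functoriality requires this.\<close>

definition "free_pair = (SOME z. free_on (fst z) (snd z))"
definition "FE = fst free_pair"
definition "el = snd free_pair"

lemma pres: "presents R (principal factoreds) obj (%n. {\<phi>. gen n \<phi>}) FE el"
proof -
 have "\<exists>z. free_on (fst z) (snd z)" using free_exists by auto
 from someI_ex[OF this] show ?thesis unfolding FE_def el_def free_pair_def free_on_def .
qed

lemmas PD = presentsD[OF pres, unfolded eventually_principal mem_Collect_eq]

lemmas fcE = fdgaD(1)[OF cring PD(1)]

definition pr :: "'u factored => int => 'u => 'u" where
 "pr k = (SOME h. dgmap R FE (obj k) h & (\<forall>n \<phi>. gen n \<phi> \<longrightarrow> h n (el n \<phi>) = \<phi> k))"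

lemma pr:
 assumes "k\<in>factoreds"
 shows "dgmap R FE (obj k) (pr k)" "gen n \<phi>==>pr k n (el n \<phi>) = \<phi> k"
proof -
 have "\<exists>h. dgmap R FE (obj k) h & (\<forall>n \<phi>. gen n \<phi> \<longrightarrow> h n (el n \<phi>) = \<phi> k)"
  by (rule presents_proj[OF cring pres, of k]) (use assms factoredsD(1) in \<open>auto simp: eventually_principal\<close>)
 from someI_ex[OF this] show "dgmap R FE (obj k) (pr k)" "gen n \<phi>==>pr k n (el n \<phi>) = \<phi> k"
  unfolding pr_def by auto
qed

lemmas pr_fmap = pr(1)[THEN map_fmap]

text \<open>The filtration of the product is componentwise, so the projections detect it together.
  Everything about \<open>FE\<close> that is phrased by filtrations can then be tested in the
  factors.\<close>

lemma joint_fil: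
 assumes "z\<in>elts FE n" "!!k. k\<in>factoreds==>pr k n z\<in>fil (cx (obj k)) p n"
 shows "z\<in>fil (cx FE) p n"
proof -
 obtain \<phi> where p: "gen n \<phi>" "z = el n \<phi>" using assms(1) by (auto simp: PD(2))
 then show ?thesis using assms(2) pr(2) PD(17)[OF p(1)] by simp
qed

lemma joint_cycles:
 assumes "z\<in>elts FE n" "!!k. k\<in>factoreds==>pr k n z\<in>cycles (cx (obj k)) s p n"
 shows "z\<in>cycles (cx FE) s p n"
proof -
 have "z\<in>fil (cx FE) p n" by (rule joint_fil[OF assms(1)]) (use assms(2) in \<open>simp add: cycles_iff\<close>)
 moreover have "df (cx FE) n z\<in>fil (cx FE) (p - int s) (n + 1)"
 proof (rule joint_fil[OF fcxD(3)[OF fcE assms(1)]])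
  fix k assume k: "k\<in>factoreds"
  show "pr k (n + 1) (df (cx FE) n z)\<in>fil (cx (obj k)) (p - int s) (n + 1)"
   using assms(2)[OF k] is_fmapD(3)[OF pr_fmap[OF k] assms(1)] by (simp add: cycles_iff)
 qed
 ultimately show ?thesis by (simp add: cycles_iff)
qed

definition Fi :: "int => 'u => 'u" where "Fi n = (\<lambda>x\<in>elts X n. el n (%k. inc k n x))"
definition Fq :: "int => 'u => 'u" where "Fq = pr terminal"
definition Fe :: "nat => int => int => 'u => 'u" where "Fe s q n y = el n (%k. lft k s q n y)"
text \<open>The solution operation acts componentwise: \<open>a\<close> is decoded to a family, and
  at each index the operation of that factorization is applied to its member.\<close>

definition Fs :: "int => int => 'u => 'u => 'u" where
 "Fs q n a y = el (n - 1) (%k. sol k q n (inv_into {\<phi>. gen n \<phi>} (el n) a k) y)"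

lemma gen_inc: "x\<in>elts X n==>gen n (%k. inc k n x)"
 by (rule generated.base) (auto simp: base_def)

lemma gen_lft: "s\<in>S==>y\<in>cycles (cx Y) s q n==>gen n (%k. lft k s q n y)"
 by (rule generated.base) (auto simp: base_def)

lemma FE: "is_fdga R FE" by (rule PD(1))

lemma Fi: "dgmap R X FE Fi"
 unfolding Fi_def[abs_def]
 by (rule presents_map_in[OF cring pres X])
  (simp_all add: eventually_principal factoredsD gen_inc)

lemma Fq: "dgmap R FE Y Fq"
 using pr(1)[OF terminal] unfolding Fq_def by (simp add: terminal_def)

lemma pr_inc: "k\<in>factoreds==>x\<in>elts X n==>pr k n (Fi n x) = inc k n x"
 by (simp add: Fi_def pr(2)[OF _ gen_inc])

lemma pr_lft: "k\<in>factoreds==>s\<in>S==>y\<in>cycles (cx Y) s q n==>pr k n (Fe s q n y) = lft k s q n y"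
 by (simp add: Fe_def pr(2)[OF _ gen_lft])

text \<open>All composites from \<open>FE\<close> through a factor to \<open>Y\<close> agree, for on
  the generators \<open>inc\<close>, \<open>lft\<close> and on solutions they give
  \<open>f n x\<close>, \<open>y\<close> and \<open>y\<close>, whatever the index is. Hence
  \<open>Fq\<close>, though read off at \<open>terminal\<close>, is the common projection to
  \<open>Y\<close>.\<close>

lemma prj_pr_step:
 assumes k: "k\<in>factoreds" and k': "k'\<in>factoreds"
 shows "(%n. compose (elts FE n) (prj k n) (pr k n)) = (%n. compose (elts FE n) (prj k' n) (pr k' n))"
proof (rule generated_agree[OF cring pres Y fdga_map_comp[OF cring FE factoredsD(1)[OF k] Y pr(1)[OF k] factoredsD(3)[OF k]]
  fdga_map_comp[OF cring FE factoredsD(1)[OF k'] Y pr(1)[OF k'] factoredsD(3)[OF k']]])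
 fix n \<phi> assume b: "base n \<phi>"
 have g: "gen n \<phi>" by (rule generated.base) (rule b)
 have "prj k n (\<phi> k) = prj k' n (\<phi> k')"
  using b unfolding base_def using factoredsD(4,6)[OF k] factoredsD(4,6)[OF k'] by auto
 then show "compose (elts FE n) (prj k n) (pr k n) (el n \<phi>) = compose (elts FE n) (prj k' n) (pr k' n) (el n \<phi>)"
  using restrict_apply'[OF PD(18)[OF g], of "%z. prj k n (pr k n z)"] restrict_apply'[OF PD(18)[OF g], of "%z. prj k' n (pr k' n z)"]
  unfolding compose_def pr(2)[OF k g] pr(2)[OF k' g] by (simp only:)
next
 fix n \<phi> m \<psi> assume g: "gen n \<phi>" and st: "step n \<phi> m \<psi>"
 have g': "gen m \<psi>" by (rule gen_step[OF g st])
 from st obtain q y where q: "b" "m = n - 1" "\<forall>k\<in>factoreds. admissible r (cx (obj k)) (cx Y) (prj k) q n (\<phi> k) y"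
  "\<psi> = (%k. sol k q n (\<phi> k) y)" unfolding step_def by blast
 have "prj k m (\<psi> k) = y" if "k\<in>factoreds" for k
  using factoredsD(7)[OF that q(1) q(3)[rule_format, OF that]] unfolding solves_def q(2,4) by simp
 note y = this[OF k] this[OF k']
 show "compose (elts FE m) (prj k m) (pr k m) (el m \<psi>) = compose (elts FE m) (prj k' m) (pr k' m) (el m \<psi>)"
  using restrict_apply'[OF PD(18)[OF g'], of "%z. prj k m (pr k m z)"] restrict_apply'[OF PD(18)[OF g'], of "%z. prj k' m (pr k' m z)"]
  unfolding compose_def pr(2)[OF k g'] pr(2)[OF k' g'] y by (simp only:)
qed

lemma prj_pr: "k\<in>factoreds==>z\<in>elts FE n==>prj k n (pr k n z) = Fq n z"
proof -
 assume k: "k\<in>factoreds" and z: "z\<in>elts FE n"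
 have "compose (elts FE n) (prj k n) (pr k n) z = compose (elts FE n) (prj terminal n) (pr terminal n) z"
  using prj_pr_step[OF k terminal] by metis
 moreover have "prj terminal = fmap_id (cx Y)" by (simp add: terminal_def)
 ultimately show ?thesis using z fdga_mapD(5)[OF Fq z] by (simp add: compose_def Fq_def[symmetric] fmap_id_def)
qed

lemma Fq_Fi: "x\<in>elts X n==>Fq n (Fi n x) = f n x"
 unfolding Fq_def by (simp add: pr_inc terminal) (simp add: terminal_def)

lemma pr_admissible:
 assumes "k\<in>factoreds" "admissible r (cx FE) (cx Y) Fq q n a y"
 shows "admissible r (cx (obj k)) (cx Y) (prj k) q n (pr k n a) y"
proof -
 have y: "y\<in>elts Y (n - 1)" using assms(2) cycles_elts[OF fcY] unfolding admissible_def by blast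
 have "admissible r (cx (obj k)) (cx Y) (prj k) q n (pr k n a) (fmap_id (cx Y) (n - 1) y)"
  by (rule admissible_square[OF fcE fcY obj_fc[OF assms(1)] fcY pr_fmap[OF assms(1)] fmap_ident[OF fcY] map_fmap[OF Fq] _ assms(2)])
   (use assms(1) fdga_mapD(5)[OF Fq] in \<open>simp add: prj_pr fmap_id_def\<close>)
 then show ?thesis using y by (simp add: fmap_id_def)
qed

lemma sol_gen:
 assumes bb: b and a: "admissible r (cx FE) (cx Y) Fq q n a y"
 shows "gen (n - 1) (%k. sol k q n (inv_into {\<phi>. gen n \<phi>} (el n) a k) y)"
  "k\<in>factoreds==>pr k (n - 1) (Fs q n a y) = sol k q n (pr k n a) y"
proof -
 have "a\<in>elts FE n" using admissible_elts(1)[OF a fcE] .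
 then have a': "a\<in>el n ` {\<phi>. gen n \<phi>}" by (simp add: PD(2))
 let ?p = "inv_into {\<phi>. gen n \<phi>} (el n) a"
 have p: "gen n ?p" "el n ?p = a" using inv_into_into[OF a'] f_inv_into_f[OF a'] by simp_all
 have pk: "pr k n a = ?p k" if "k\<in>factoreds" for k using pr(2)[OF that p(1)] p(2) by simp
 have ad: "\<forall>k\<in>factoreds. admissible r (cx (obj k)) (cx Y) (prj k) q n (?p k) y"
 proof
  fix k assume k: "k\<in>factoreds"
  show "admissible r (cx (obj k)) (cx Y) (prj k) q n (?p k) y"
   using pr_admissible[OF k a] pk[OF k] by simp
 qed
 have "step n ?p (n - 1) (%k. sol k q n (?p k) y)"
  by (rule stepI[OF bb ad])
 then show g: "gen (n - 1) (%k. sol k q n (?p k) y)" by (rule gen_step[OF p(1)])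
 show "pr k (n - 1) (Fs q n a y) = sol k q n (pr k n a) y" if "k\<in>factoreds"
  unfolding Fs_def pr(2)[OF that g] using pk that by simp
qed

text \<open>The operations of \<open>FE\<close> are componentwise, and cycles and filtrations are
  tested in the components, so \<open>FE\<close> inherits the structure from the factors.\<close>

lemma structured_free: "structured r S b (cx FE) (cx Y) Fq Fe Fs"
 unfolding structured_def
proof (intro conjI ballI allI impI)
 fix s q n y assume s: "s\<in>S" "y\<in>cycles (cx Y) s q n"
 have z: "Fe s q n y\<in>elts FE n" unfolding Fe_def by (rule PD(18)[OF gen_lft[OF s]])
 show "Fe s q n y\<in>cycles (cx FE) s q n"
  by (rule joint_cycles[OF z]) (simp add: pr_lft s factoredsD(5))
 show "Fq n (Fe s q n y) = y" unfolding Fq_def by (simp add: pr_lft s terminal) (simp add: terminal_def)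
next
 fix q n a y assume b: b and a: "admissible r (cx FE) (cx Y) Fq q n a y"
 note g = sol_gen[OF b a]
 have ae: "a\<in>elts FE n" using admissible_elts(1)[OF a fcE] .
 have x: "Fs q n a y\<in>elts FE (n - 1)" unfolding Fs_def by (rule PD(18)[OF g(1)])
 have s: "solves r (cx (obj k)) (prj k) q n (pr k n a) y (sol k q n (pr k n a) y)" if "k\<in>factoreds" for k
  by (rule factoredsD(7)[OF that b pr_admissible[OF that a]])
 show "solves r (cx FE) Fq q n a y (Fs q n a y)" unfolding solves_def
 proof (intro conjI)
  show "Fs q n a y\<in>cycles (cx FE) r (q + int r) (n - 1)"
   by (rule joint_cycles[OF x]) (use s g(2) in \<open>simp add: solves_def\<close>)
  show "Fq (n - 1) (Fs q n a y) = y"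
   using s[OF terminal] prj_pr[OF terminal x] g(2)[OF terminal] by (simp add: solves_def)
  show "a -[md (cx FE) n] df (cx FE) (n - 1) (Fs q n a y)\<in>fil (cx FE) (q - 1) n"
  proof (rule joint_fil)
   show "a -[md (cx FE) n] df (cx FE) (n - 1) (Fs q n a y)\<in>elts FE n"
    by (intro fcomplex_diff_closed[OF fcE] ae df_pred[OF fcE] x)
   fix k assume k: "k\<in>factoreds"
   show "pr k n (a -[md (cx FE) n] df (cx FE) (n - 1) (Fs q n a y))\<in>fil (cx (obj k)) (q - 1) n"
    using s[OF k] ae x k by (simp add: solves_def fmap_diff[OF pr_fmap[OF k] fcE obj_fc[OF k]]
     df_pred[OF fcE] fmap_df_pred[OF pr_fmap[OF k]] g(2))
  qed
 qed
qed

text \<open>The homomorphisms for the structure of chosen lifts, lying over a map \<open>w\<close>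
  of the bases. Initiality of \<open>FE\<close> refers to these maps.\<close>

definition compatible where
 "compatible A p e \<sigma> h w \<longleftrightarrow>
   (\<forall>s\<in>S. \<forall>q n. \<forall>y\<in>cycles (cx Y) s q n. h n (Fe s q n y) = e s q n (w n y)) &
   (b \<longrightarrow> (\<forall>q n a y. admissible r (cx FE) (cx Y) Fq q n a y \<longrightarrow>
    h (n - 1) (Fs q n a y) = \<sigma> q n (h n a) (w (n - 1) y)))"

text \<open>The competing factorization is itself an index of the product, and the required map is
  the projection to its component.\<close>

lemma initial_exists:
 assumes "is_fdga R A" "dgmap R X A g" "dgmap R A Y p" "!!n x. x\<in>elts X n==>p n (g n x) = f n x"
  "structured r S b (cx A) (cx Y) p e \<sigma>"
 shows "\<exists>h. dgmap R FE A h & (\<forall>n. \<forall>x\<in>elts X n. h n (Fi n x) = g n x) &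
  (\<forall>n. \<forall>z\<in>elts FE n. p n (h n z) = Fq n z) & compatible A p e \<sigma> h (%_ y. y)"
proof -
 let ?k = "\<lparr>obj = A, inc = g, prj = p, lft = e, sol = \<sigma>\<rparr>"
 have k: "?k\<in>factoreds" using assms by (simp add: factoreds_def)
 show ?thesis
  using pr(1)[OF k] pr_inc[OF k] pr_lft[OF k] prj_pr[OF k] sol_gen(2)[OF _ _ k]
  by (intro exI[of _ "pr ?k"]) (simp add: compatible_def)
qed

text \<open>Generators that come from cycles are values of \<open>Fe\<close>, and every
  \<open>step\<close> is a value of \<open>Fs\<close>. On these compatibility prescribes the maps,
  and on the image of \<open>X\<close> they agree by assumption.\<close>

lemma initial_unique:
 assumes A: "is_fdga R A" and h: "dgmap R FE A h" "dgmap R FE A h'"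
  and i: "!!n x. x\<in>elts X n==>h n (Fi n x) = h' n (Fi n x)"
  and c: "compatible A p e \<sigma> h w" "compatible A p e \<sigma> h' w"
 shows "h = h'"
proof (rule generated_agree[OF cring pres A h])
 fix n \<phi> assume "base n \<phi>"
 then show "h n (el n \<phi>) = h' n (el n \<phi>)" unfolding base_def
 proof (elim disjE bexE exE)
  fix x assume "x\<in>elts X n" "\<phi> = (%k. inc k n x)"
  then show ?thesis using i[of x n] by (simp add: Fi_def)
 next
  fix s q y assume "s\<in>S" "y\<in>cycles (cx Y) s q n" "\<phi> = (%k. lft k s q n y)"
  then show ?thesis using c unfolding compatible_def by (simp add: Fe_def)
 qed
next
 fix n \<phi> m \<psi> assume g: "gen n \<phi>" and st: "step n \<phi> m \<psi>" and eq: "h n (el n \<phi>) = h' n (el n \<phi>)"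
 from st obtain q y where q: "b" "m = n - 1" "\<forall>k\<in>factoreds. admissible r (cx (obj k)) (cx Y) (prj k) q n (\<phi> k) y"
  "\<psi> = (%k. sol k q n (\<phi> k) y)" unfolding step_def by blast
 note e = PD(18)[OF g]
 \<comment> \<open>The premise of a step concerns the components. Admissibility in \<open>FE\<close>
   is reassembled from it: the cycle condition from all components, the condition over
   \<open>Y\<close> from the terminal one.\<close>
 have cy: "el n \<phi>\<in>cycles (cx FE) (r + 1) q n"
  by (rule joint_cycles[OF e]) (use q(3) pr(2)[OF _ g] in \<open>simp add: admissible_def\<close>)
 have a: "admissible r (cx FE) (cx Y) Fq q n (el n \<phi>) y"
  using cy q(3)[rule_format, OF terminal] prj_pr[OF terminal e] pr(2)[OF terminal g]
  by (simp add: admissible_def)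
 \<comment> \<open>\<open>Fs\<close> decodes \<open>el n \<phi>\<close> to a family that may differ
   from \<open>\<phi>\<close> outside \<open>factoreds\<close>; passing to classes removes the
   difference.\<close>
 have "el m \<psi> = Fs q n (el n \<phi>) y"
 proof -
  have "el n \<phi>\<in>el n ` {\<phi>. gen n \<phi>}" using g by blast
  from inv_into_into[OF this] f_inv_into_f[OF this]
  have i: "gen n (inv_into {\<phi>. gen n \<phi>} (el n) (el n \<phi>))" "el n (inv_into {\<phi>. gen n \<phi>} (el n) (el n \<phi>)) = el n \<phi>" by simp_all
  have "\<forall>k\<in>factoreds. inv_into {\<phi>. gen n \<phi>} (el n) (el n \<phi>) k = \<phi> k" using PD(3)[OF i(1) g] i(2) by blast
  moreover have "gen (n - 1) \<psi>" using gen_step[OF g st] unfolding q(2) .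
  ultimately show ?thesis unfolding Fs_def q(2)
   using PD(3)[OF _ sol_gen(1)[OF q(1) a], of \<psi>] by (simp add: q(4))
 qed
 then show "h m (el m \<psi>) = h' m (el m \<psi>)"
  using c a q(1) eq unfolding compatible_def q(2) by simp
qed

text \<open>Initiality with respect to another base. The pullback of \<open>p\<close> along
  \<open>w\<close> is a structured factorization of \<open>f\<close>: its lifts have the component
  prescribed by \<open>e\<close> or \<open>\<sigma>\<close> in \<open>A\<close> and the component
  \<open>y\<close> in \<open>Y\<close>. The resulting maps make the factorization
  functorial.\<close>

lemma extension:
 assumes A: "is_fdga R A" and B: "is_fdga R B" and p: "dgmap R A B p" and u: "dgmap R X A u"
  and w: "dgmap R Y B w" and c: "!!n x. x\<in>elts X n==>p n (u n x) = w n (f n x)"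
  and st: "structured r S b (cx A) (cx B) p e \<sigma>"
 shows "\<exists>h. dgmap R FE A h & (\<forall>n. \<forall>x\<in>elts X n. h n (Fi n x) = u n x) &
  (\<forall>n. \<forall>z\<in>elts FE n. p n (h n z) = w n (Fq n z)) & compatible A p e \<sigma> h w"
proof -
 obtain P \<pi>1 \<pi>2 where "pullback_square R P A Y B \<pi>1 \<pi>2 p w"
  using pullback_exists[OF inf cring A B Y p w] by blast
 then interpret Q: pullback_square R P A Y B \<pi>1 \<pi>2 p w .
 obtain g where g: "dgmap R X P g" "!!n x. x\<in>elts X n==>\<pi>1 n (g n x) = u n x & \<pi>2 n (g n x) = f n x"
  using Q.induced[OF X u f c] by blast
 define eP where "eP s q n y = (SOME x. x\<in>cycles (cx P) s q n & \<pi>1 n x = e s q n (w n y) & \<pi>2 n x = y)" for s q n y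
 define sP where "sP q n a y = (SOME x. x\<in>cycles (cx P) r (q + int r) (n - 1) &
  \<pi>1 (n - 1) x = \<sigma> q n (\<pi>1 n a) (w (n - 1) y) & \<pi>2 (n - 1) x = y)" for q n a y
 have eP: "eP s q n y\<in>cycles (cx P) s q n & \<pi>1 n (eP s q n y) = e s q n (w n y) & \<pi>2 n (eP s q n y) = y"
  if "s\<in>S" "y\<in>cycles (cx Y) s q n" for s q n y
 proof -
  have "w n y\<in>cycles (cx B) s q n" by (rule fmap_cycles[OF Q.fm(4) fcY that(2)])
  then have "e s q n (w n y)\<in>cycles (cx A) s q n" "p n (e s q n (w n y)) = w n y"
   using st that(1) unfolding structured_def by auto
  from Q.pair_cyc[OF this(1) that(2) this(2)] show ?thesis unfolding eP_def by - (rule someI_ex, blast)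
 qed
 have sP: "sP q n a y\<in>cycles (cx P) r (q + int r) (n - 1) & \<pi>1 (n - 1) (sP q n a y) = \<sigma> q n (\<pi>1 n a) (w (n - 1) y)
   & \<pi>2 (n - 1) (sP q n a y) = y & solves r (cx P) \<pi>2 q n a y (sP q n a y)"
  if b and a: "admissible r (cx P) (cx Y) \<pi>2 q n a y" for q n a y
 proof -
  have "admissible r (cx A) (cx B) p q n (\<pi>1 n a) (w (n - 1) y)"
   by (rule admissible_square[OF Q.fc(1,3,2,4) Q.fm(1,4,2) Q.commutes a])
  then have s: "solves r (cx A) p q n (\<pi>1 n a) (w (n - 1) y) (\<sigma> q n (\<pi>1 n a) (w (n - 1) y))"
   using st \<open>b\<close> unfolding structured_def by blast
  have y: "y\<in>cycles (cx Y) r (q + int r) (n - 1)" "a\<in>elts P n" "\<pi>2 n a -[md (cx Y) n] df (cx Y) (n - 1) y\<in>fil (cx Y) (q - 1) n"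
   using a cycles_elts[OF Q.fc(1)] unfolding admissible_def by auto
  have "\<exists>x. x\<in>cycles (cx P) r (q + int r) (n - 1) & \<pi>1 (n - 1) x = \<sigma> q n (\<pi>1 n a) (w (n - 1) y) & \<pi>2 (n - 1) x = y"
   using Q.pair_cyc[OF _ y(1)] s unfolding solves_def by blast
  from someI_ex[OF this, folded sP_def]
  have 1: "sP q n a y\<in>cycles (cx P) r (q + int r) (n - 1)" "\<pi>1 (n - 1) (sP q n a y) = \<sigma> q n (\<pi>1 n a) (w (n - 1) y)"
   "\<pi>2 (n - 1) (sP q n a y) = y" by auto
  moreover have "a -[md (cx P) n] df (cx P) (n - 1) (sP q n a y)\<in>fil (cx P) (q - 1) n"
   by (rule Q.diff_fil[OF y(2) cycles_elts[OF Q.fc(1) 1(1)]]) (use 1 s y in \<open>simp_all add: solves_def\<close>)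
  ultimately show ?thesis by (simp add: solves_def)
 qed
 have "structured r S b (cx P) (cx Y) \<pi>2 eP sP" unfolding structured_def using eP sP by blast
 from initial_exists[OF Q.obj(1) g(1) Q.map(2) _ this]
 obtain h where h: "dgmap R FE P h" "!!n x. x\<in>elts X n==>h n (Fi n x) = g n x"
  "!!n z. z\<in>elts FE n==>\<pi>2 n (h n z) = Fq n z" "compatible P \<pi>2 eP sP h (%_ y. y)"
  using g by auto
 let ?h = "%n. compose (elts FE n) (\<pi>1 n) (h n)"
 note he = fdga_mapD(5)[OF h(1)] and Fie = fdga_mapD(5)[OF Fi]
 have cc: "compatible A p e \<sigma> ?h w" unfolding compatible_def
 proof (intro conjI ballI allI impI)
  fix s q n y assume y: "s\<in>S" "y\<in>cycles (cx Y) s q n"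
  have "Fe s q n y\<in>elts FE n" unfolding Fe_def by (rule PD(18)[OF gen_lft[OF y]])
  then show "?h n (Fe s q n y) = e s q n (w n y)"
   using h(4) y eP[OF y] unfolding compatible_def by (simp add: compose_def)
 next
  fix q n a y assume b and a: "admissible r (cx FE) (cx Y) Fq q n a y"
  have x: "Fs q n a y\<in>elts FE (n - 1)" unfolding Fs_def by (rule PD(18)[OF sol_gen(1)[OF \<open>b\<close> a]])
  have ae: "a\<in>elts FE n" "y\<in>elts Y (n - 1)" using admissible_elts[OF a] fcE fcY by auto
  have "admissible r (cx P) (cx Y) \<pi>2 q n (h n a) (fmap_id (cx Y) (n - 1) y)"
   by (rule admissible_square[OF fcE fcY Q.fc(1) fcY map_fmap[OF h(1)] fmap_ident[OF fcY] map_fmap[OF Fq] _ a])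
    (use h(3) fdga_mapD(5)[OF Fq] in \<open>simp add: fmap_id_def\<close>)
  then have "admissible r (cx P) (cx Y) \<pi>2 q n (h n a) y" using ae by (simp add: fmap_id_def)
  from sP[OF \<open>b\<close> this] show "?h (n - 1) (Fs q n a y) = \<sigma> q n (?h n a) (w (n - 1) y)"
   using h(4) \<open>b\<close> a x ae unfolding compatible_def by (simp add: compose_def)
 qed
 have "dgmap R FE A ?h" by (rule fdga_map_comp[OF cring FE Q.obj(1) A h(1) Q.map(1)])
 moreover have "?h n (Fi n x) = u n x" if "x\<in>elts X n" for n x
  using that g(2)[OF that] h(2)[OF that] Fie[OF that] by (simp add: compose_def)
 moreover have "p n (?h n z) = w n (Fq n z)" if "z\<in>elts FE n" for n z
  using that h(3)[OF that] Q.commutes[OF he[OF that]] by (simp add: compose_def)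
 ultimately show ?thesis using cc by blast
qed

text \<open>Here \<open>p\<close> has lifts, but no chosen ones. Its pullback along
  \<open>v\<close>, followed by \<open>Fq\<close>, is a factorization of \<open>f\<close>. Lifts are
  chosen on it over those of \<open>FE\<close>, so that the projection to \<open>FE\<close>
  preserves the structure. The initial map into the pullback is then a section of this projection,
  and its component in \<open>A\<close> is the filler.\<close>

lemma inclusion_lifts:
 assumes A: "is_fdga R A" and B: "is_fdga R B" and p: "dgmap R A B p" and u: "dgmap R X A u"
  and v: "dgmap R FE B v" and c: "!!n x. x\<in>elts X n==>p n (u n x) = v n (Fi n x)"
  and st: "cycle_onto S (cx A) (cx B) p" "b==>solvable r (cx A) (cx B) p"
 shows "\<exists>h. dgmap R FE A h & (\<forall>n. \<forall>x\<in>elts X n. h n (Fi n x) = u n x) &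
  (\<forall>n. \<forall>z\<in>elts FE n. p n (h n z) = v n z)"
proof -
 obtain P \<pi>1 \<pi>2 where "pullback_square R P A FE B \<pi>1 \<pi>2 p v"
  using pullback_exists[OF inf cring A B FE p v] by blast
 then interpret Q: pullback_square R P A FE B \<pi>1 \<pi>2 p v .
 obtain g where g: "dgmap R X P g" "!!n x. x\<in>elts X n==>\<pi>1 n (g n x) = u n x & \<pi>2 n (g n x) = Fi n x"
  using Q.induced[OF X u Fi c] by blast
 let ?q = "%n. compose (elts P n) (Fq n) (\<pi>2 n)"
 have q: "dgmap R P Y ?q" by (rule fdga_map_comp[OF cring Q.obj(1) FE Y Q.map(2) Fq])
 note stF = structured_free[unfolded structured_def]
 \<comment> \<open>The second components are required to be the canonical lifts and solutions of
   \<open>FE\<close>, not just elements over \<open>y\<close>; the compatibility of the projection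
   \<open>\<pi>2\<close> depends on this.\<close>
 define eP where "eP s q n y = (SOME x. x\<in>cycles (cx P) s q n & \<pi>2 n x = Fe s q n y)" for s q n y
 define sP where "sP q n a y = (SOME x. x\<in>cycles (cx P) r (q + int r) (n - 1) & \<pi>2 (n - 1) x = Fs q n (\<pi>2 n a) y &
   a -[md (cx P) n] df (cx P) (n - 1) x\<in>fil (cx P) (q - 1) n)" for q n a y
 have eP: "eP s q n y\<in>cycles (cx P) s q n & \<pi>2 n (eP s q n y) = Fe s q n y & ?q n (eP s q n y) = y"
  if y: "s\<in>S" "y\<in>cycles (cx Y) s q n" for s q n y
 proof -
  have F: "Fe s q n y\<in>cycles (cx FE) s q n" "Fq n (Fe s q n y) = y" using stF y by auto
  have "v n (Fe s q n y)\<in>cycles (cx B) s q n" by (rule fmap_cycles[OF Q.fm(4) fcE F(1)])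
  then obtain x1 where "x1\<in>cycles (cx A) s q n" "p n x1 = v n (Fe s q n y)" using st(1) y(1) unfolding cycle_onto_def by blast
  from Q.pair_cyc[OF this(1) F(1) this(2)] have "\<exists>x. x\<in>cycles (cx P) s q n & \<pi>2 n x = Fe s q n y" by blast
  from someI_ex[OF this, folded eP_def] show ?thesis using F cycles_elts[OF Q.fc(1)] by (auto simp: compose_def)
 qed
 have sP: "\<pi>2 (n - 1) (sP q n a y) = Fs q n (\<pi>2 n a) y & solves r (cx P) ?q q n a y (sP q n a y)"
  if b and a: "admissible r (cx P) (cx Y) ?q q n a y" for q n a y
 proof -
  have ae: "a\<in>elts P n" "y\<in>elts Y (n - 1)" using admissible_elts[OF a] Q.fc(1) fcY by auto
  have "admissible r (cx FE) (cx Y) Fq q n (\<pi>2 n a) (fmap_id (cx Y) (n - 1) y)"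
   by (rule admissible_square[OF Q.fc(1) fcY fcE fcY Q.fm(2) fmap_ident[OF fcY] map_fmap[OF q] _ a])
    (use fdga_mapD(5)[OF q] in \<open>auto simp: fmap_id_def compose_def\<close>)
  then have "admissible r (cx FE) (cx Y) Fq q n (\<pi>2 n a) y" using ae by (simp add: fmap_id_def)
  then have F: "solves r (cx FE) Fq q n (\<pi>2 n a) y (Fs q n (\<pi>2 n a) y)" using stF \<open>b\<close> by blast
  let ?x = "Fs q n (\<pi>2 n a) y"
  have x: "?x\<in>cycles (cx FE) r (q + int r) (n - 1)" "Fq (n - 1) ?x = y"
   "\<pi>2 n a -[md (cx FE) n] df (cx FE) (n - 1) ?x\<in>fil (cx FE) (q - 1) n" using F by (simp_all add: solves_def)
  have p2a: "\<pi>2 n a\<in>elts FE n" "?x\<in>elts FE (n - 1)" using fdga_mapD(5)[OF Q.map(2) ae(1)] cycles_elts[OF fcE x(1)] by auto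
  \<comment> \<open>The solution \<open>?x\<close> in \<open>FE\<close> is pushed to
    \<open>B\<close> and becomes the element to be lifted. The bound on the difference in
    \<open>B\<close> is the image under \<open>v\<close> of the bound that \<open>?x\<close>
    satisfies in \<open>FE\<close>.\<close>
  have "admissible r (cx A) (cx B) p q n (\<pi>1 n a) (v (n - 1) ?x)" unfolding admissible_def
  proof (intro conjI)
   have "a\<in>cycles (cx P) (r + 1) q n" using a by (simp add: admissible_def)
   then show "\<pi>1 n a\<in>cycles (cx A) (r + 1) q n" by (rule fmap_cycles[OF Q.fm(1) Q.fc(1)])
   show "v (n - 1) ?x\<in>cycles (cx B) r (q + int r) (n - 1)" by (rule fmap_cycles[OF Q.fm(4) fcE x(1)])
   have "v n (\<pi>2 n a -[md (cx FE) n] df (cx FE) (n - 1) ?x) = p n (\<pi>1 n a) -[md (cx B) n] df (cx B) (n - 1) (v (n - 1) ?x)"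
    using p2a ae Q.commutes[OF ae(1)] by (simp add: fmap_diff[OF Q.fm(4) fcE Q.fc(4)] df_pred[OF fcE] fmap_df_pred[OF Q.fm(4)])
   then show "p n (\<pi>1 n a) -[md (cx B) n] df (cx B) (n - 1) (v (n - 1) ?x)\<in>fil (cx B) (q - 1) n"
    using is_fmapD(4)[OF Q.fm(4) x(3)] by simp
  qed
  then obtain x1 where "solves r (cx A) p q n (\<pi>1 n a) (v (n - 1) ?x) x1" using st(2)[OF \<open>b\<close>] unfolding solvable_def by blast
  then have x1: "x1\<in>cycles (cx A) r (q + int r) (n - 1)" "p (n - 1) x1 = v (n - 1) ?x"
   "\<pi>1 n a -[md (cx A) n] df (cx A) (n - 1) x1\<in>fil (cx A) (q - 1) n" by (simp_all add: solves_def)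
  from Q.pair_cyc[OF x1(1) x(1) x1(2)] obtain z where z: "z\<in>cycles (cx P) r (q + int r) (n - 1)" "\<pi>1 (n - 1) z = x1" "\<pi>2 (n - 1) z = ?x" by blast
  have "a -[md (cx P) n] df (cx P) (n - 1) z\<in>fil (cx P) (q - 1) n"
   by (rule Q.diff_fil[OF ae(1) cycles_elts[OF Q.fc(1) z(1)]]) (simp_all add: z x1 x)
  then have "\<exists>x. x\<in>cycles (cx P) r (q + int r) (n - 1) & \<pi>2 (n - 1) x = ?x & a -[md (cx P) n] df (cx P) (n - 1) x\<in>fil (cx P) (q - 1) n"
   using z by blast
  from someI_ex[OF this, folded sP_def] show ?thesis using x(2) cycles_elts[OF Q.fc(1)]
   unfolding solves_def by (auto simp: compose_def)
 qed
 have stP: "structured r S b (cx P) (cx Y) ?q eP sP" unfolding structured_def using eP sP by blast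
 have "?q n (g n x) = f n x" if "x\<in>elts X n" for n x
  using that g(2)[OF that] fdga_mapD(5)[OF g(1) that] by (simp add: compose_def Fq_Fi)
 from initial_exists[OF Q.obj(1) g(1) q this stP]
 obtain h where h: "dgmap R FE P h" "!!n x. x\<in>elts X n==>h n (Fi n x) = g n x"
  "!!n z. z\<in>elts FE n==>?q n (h n z) = Fq n z" "compatible P ?q eP sP h (%_ y. y)" by auto
 note he = fdga_mapD(5)[OF h(1)] and Fie = fdga_mapD(5)[OF Fi]
 let ?k = "%n. compose (elts FE n) (\<pi>2 n) (h n)"
 have k: "dgmap R FE FE ?k" by (rule fdga_map_comp[OF cring FE Q.obj(1) FE h(1) Q.map(2)])
 \<comment> \<open>Both maps are endomorphisms of the initial structured factorization, so
   uniqueness applies.\<close>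
 have "?k = fmap_id (cx FE)"
 proof (rule initial_unique[OF FE k fdga_map_ident[OF cring FE], where p = Fq and e = Fe and \<sigma> = Fs and w = "%_ y. y"])
  fix n x assume x: "x\<in>elts X n"
  then show "?k n (Fi n x) = fmap_id (cx FE) n (Fi n x)"
   using g(2)[OF x] h(2)[OF x] Fie[OF x] by (simp add: compose_def fmap_id_def)
 next
  show "compatible FE Fq Fe Fs (fmap_id (cx FE)) (%_ y. y)" unfolding compatible_def
  proof (intro conjI ballI allI impI)
   fix s q n y assume y: "s\<in>S" "y\<in>cycles (cx Y) s q n"
   have "Fe s q n y\<in>elts FE n" unfolding Fe_def by (rule PD(18)[OF gen_lft[OF y]])
   then show "fmap_id (cx FE) n (Fe s q n y) = Fe s q n y" by (simp add: fmap_id_def)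
  next
   fix q n a y assume b and a: "admissible r (cx FE) (cx Y) Fq q n a y"
   have x: "Fs q n a y\<in>elts FE (n - 1)" unfolding Fs_def by (rule PD(18)[OF sol_gen(1)[OF \<open>b\<close> a]])
   have "a\<in>elts FE n" using admissible_elts(1)[OF a fcE] .
   then show "fmap_id (cx FE) (n - 1) (Fs q n a y) = Fs q n (fmap_id (cx FE) n a) y" using x by (simp add: fmap_id_def)
  qed
  show "compatible FE Fq Fe Fs ?k (%_ y. y)" unfolding compatible_def
  proof (intro conjI ballI allI impI)
   fix s q n y assume y: "s\<in>S" "y\<in>cycles (cx Y) s q n"
   have "Fe s q n y\<in>elts FE n" unfolding Fe_def by (rule PD(18)[OF gen_lft[OF y]])
   then show "?k n (Fe s q n y) = Fe s q n y" using h(4) y eP[OF y] unfolding compatible_def by (simp add: compose_def)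
  next
   fix q n a y assume b and a: "admissible r (cx FE) (cx Y) Fq q n a y"
   have x: "Fs q n a y\<in>elts FE (n - 1)" unfolding Fs_def by (rule PD(18)[OF sol_gen(1)[OF \<open>b\<close> a]])
   have ae: "a\<in>elts FE n" "y\<in>elts Y (n - 1)" using admissible_elts[OF a] fcE fcY by auto
   have "admissible r (cx P) (cx Y) ?q q n (h n a) (fmap_id (cx Y) (n - 1) y)"
    by (rule admissible_square[OF fcE fcY Q.fc(1) fcY map_fmap[OF h(1)] fmap_ident[OF fcY] map_fmap[OF Fq] _ a])
     (use h(3) fdga_mapD(5)[OF Fq] in \<open>simp add: fmap_id_def\<close>)
   then have "admissible r (cx P) (cx Y) ?q q n (h n a) y" using ae by (simp add: fmap_id_def)
   from sP[OF \<open>b\<close> this] show "?k (n - 1) (Fs q n a y) = Fs q n (?k n a) y"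
    using h(4) \<open>b\<close> a x ae unfolding compatible_def by (simp add: compose_def)
  qed
 qed
 then have id: "\<pi>2 n (h n z) = z" if "z\<in>elts FE n" for n z
  using that by (simp add: fun_eq_iff compose_def fmap_id_def) (metis restrict_apply')
 let ?h = "%n. compose (elts FE n) (\<pi>1 n) (h n)"
 have "dgmap R FE A ?h" by (rule fdga_map_comp[OF cring FE Q.obj(1) A h(1) Q.map(1)])
 moreover have "?h n (Fi n x) = u n x" if "x\<in>elts X n" for n x
  using that g(2)[OF that] h(2)[OF that] Fie[OF that] by (simp add: compose_def)
 moreover have "p n (?h n z) = v n z" if "z\<in>elts FE n" for n z
  using that id[OF that] Q.commutes[OF he[OF that]] by (simp add: compose_def)
 ultimately show ?thesis by blast
qed

end

text \<open>Cancellation rules for sums in AC normal form, where an element and its negative can end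
  up with one summand between them.\<close>

lemma (in abelian_group) cancel_gap:
 assumes "x\<in>carrier G" "y\<in>carrier G"
 shows "z\<in>carrier G==>x \<oplus> (y \<oplus> (\<ominus> x \<oplus> z)) = y \<oplus> z" "x \<oplus> (y \<oplus> \<ominus> x) = y"
  "z\<in>carrier G==>\<ominus> x \<oplus> (y \<oplus> (x \<oplus> z)) = y \<oplus> z" "\<ominus> x \<oplus> (y \<oplus> x) = y"
proof -
 note c = assms a_inv_closed[OF assms(1)]
 have p: "x \<oplus> (y \<oplus> (\<ominus> x \<oplus> z)) = y \<oplus> z" "\<ominus> x \<oplus> (y \<oplus> (x \<oplus> z)) = y \<oplus> z" if "z\<in>carrier G" for z
  using that c a_lcomm[of y "\<ominus> x" z] a_lcomm[of y x z] by (simp_all add: r_neg1 r_neg2)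
 show "z\<in>carrier G==>x \<oplus> (y \<oplus> (\<ominus> x \<oplus> z)) = y \<oplus> z" by (rule p(1))
 show "z\<in>carrier G==>\<ominus> x \<oplus> (y \<oplus> (x \<oplus> z)) = y \<oplus> z" by (rule p(2))
 show "x \<oplus> (y \<oplus> \<ominus> x) = y" "\<ominus> x \<oplus> (y \<oplus> x) = y" using p[OF zero_closed] c by simp_all
qed

section \<open>Weak equivalences\<close>

lemma cycles_submodule:
 assumes A: "fcx R A"
 shows "submodule (cycles A k p n) R (md A n)"
proof -
 note F = fcxD[OF A]
 have "cycles A k p n = fil A p n \<inter> {x\<in>grade A n. df A n x\<in>fil A (p - int k) (n + 1)}"
  using F(8) by (auto simp: cycles_iff)
 moreover have "submodule (fil A p n \<inter> {x\<in>grade A n. df A n x\<in>fil A (p - int k) (n + 1)}) R (md A n)"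
  using F(5)[of p n] submodule_vimage[OF F(1) F(1) F(2) F(5)[of "p - int k" "n + 1"]]
  unfolding submodule_iff[OF F(1)] by auto
 ultimately show ?thesis by simp
qed

lemma boundaries_iff:
 "x\<in>boundaries A (r + 1) p n \<longleftrightarrow>
  (\<exists>u\<in>cycles A r (p + int r) (n - 1). \<exists>v\<in>cycles A r (p - 1) n. x = df A (n - 1) u +[md A n] v)"
 by (auto simp: boundaries_def set_add_def')

lemma df_df_pred:
 "fcx R A==>x\<in>grade A (n - 1)==>df A n (df A (n - 1) x) = \<zero>[md A (n + 1)]"
 using fcxD(4)[of R A x "n - 1"] by simp

lemma df_zero: "fcx R A==>df A n \<zero>[md A n] = \<zero>[md A (n + 1)]"
 by (rule mod_hom_zero[OF fcxD(1) fcxD(1) fcxD(2)])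

lemma fmap_zero: "fcx R A==>fcx R B==>is_fmap R A B f==>f n \<zero>[md A n] = \<zero>[md B n]"
 by (rule mod_hom_zero[OF fcxD(1) fcxD(1) is_fmapD(1)])

lemma fil_subset: "fcx R A==>p \<le> q==>x\<in>fil A p n==>x\<in>fil A q n"
 using fil_mono by blast

text \<open>The differential of an exact element is zero and lies in every filtration, so the order
  \<open>k\<close> is arbitrary. Its own filtration \<open>p\<close> is the bound
  \<open>p + r - r\<close> from the cycle condition on \<open>u\<close>.\<close>

lemma df_cycle:
 assumes A: "fcx R A" and u: "u\<in>cycles A r (p + int r) (n - 1)"
 shows "df A (n - 1) u\<in>cycles A k p n"
proof -
 have "df A (n - 1) u\<in>fil A p n" using u by (simp add: cycles_iff)
 moreover have "df A n (df A (n - 1) u) = \<zero>[md A (n + 1)]" by (rule df_df_pred[OF A cycles_elts[OF A u]])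
 ultimately show ?thesis using fil_alg(1)[OF A] by (simp add: cycles_iff)
qed

lemma cycle_lower:
 assumes A: "fcx R A" and v: "v\<in>cycles A r (p - 1) n"
 shows "v\<in>cycles A (r + 1) p n"
proof -
 \<comment> \<open>Lowering the filtration by one and raising the order by one leave the bound on
   the differential unchanged.\<close>
 have e: "p - int (r + 1) = p - 1 - int r" by simp
 show ?thesis unfolding cycles_iff e using v fil_subset[OF A, of "p - 1" p v n] by (simp add: cycles_iff)
qed

lemma boundaries_submodule:
 assumes A: "fcx R A"
 shows "submodule (boundaries A (r + 1) p n) R (md A n)"
proof -
 note F = fcxD[OF A]
 interpret M: module R "md A n" by (rule F(1))
 interpret M1: module R "md A (n - 1)" by (rule F(1))
 note Z1 = submodule_facts[OF F(1) cycles_submodule[OF A, of r "p + int r" "n - 1"]]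
 note Z2 = submodule_facts[OF F(1) cycles_submodule[OF A, of r "p - 1" n]]
 have dh: "df A (n - 1)\<in>mod_hom R (md A (n - 1)) (md A n)" using F(2)[of "n - 1"] by simp
 note d = mod_homD[OF dh]
 show ?thesis unfolding submodule_iff[OF F(1)]
 proof (intro conjI ballI subsetI)
  fix x assume "x\<in>boundaries A (r + 1) p n"
  then obtain u v where u: "u\<in>cycles A r (p + int r) (n - 1)" and v: "v\<in>cycles A r (p - 1) n"
   and x: "x = df A (n - 1) u +[md A n] v" unfolding boundaries_iff by blast
  have c: "u\<in>grade A (n - 1)" "v\<in>grade A n" using u v by (auto intro: cycles_elts[OF A])
  show "x\<in>grade A n" using c d(1) x by simp
  { fix x' assume "x'\<in>boundaries A (r + 1) p n"
   then obtain u' v' where u': "u'\<in>cycles A r (p + int r) (n - 1)" and v': "v'\<in>cycles A r (p - 1) n"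
    and x': "x' = df A (n - 1) u' +[md A n] v'" unfolding boundaries_iff by blast
   have c': "u'\<in>grade A (n - 1)" "v'\<in>grade A n" using u' v' by (auto intro: cycles_elts[OF A])
   have "x +[md A n] x' = df A (n - 1) (u +[md A (n - 1)] u') +[md A n] (v +[md A n] v')"
    using c c' d(1) by (simp add: x x' d(2) M.a_ac)
   then show "x +[md A n] x'\<in>boundaries A (r + 1) p n"
    unfolding boundaries_iff using Z1(4)[OF u u'] Z2(4)[OF v v'] by blast }
  fix k assume k: "k\<in>carrier R"
  have "k *[md A n] x = df A (n - 1) (k *[md A (n - 1)] u) +[md A n] (k *[md A n] v)"
   using c k d(1) by (simp add: x d(3) M.smult_r_distr)
  then show "k *[md A n] x\<in>boundaries A (r + 1) p n"
   unfolding boundaries_iff using Z1(6)[OF k u] Z2(6)[OF k v] by blast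
 next
  have "\<zero>[md A n] = df A (n - 1) \<zero>[md A (n - 1)] +[md A n] \<zero>[md A n]"
   using df_zero[OF A, of "n - 1"] by simp
  then show "\<zero>[md A n]\<in>boundaries A (r + 1) p n" unfolding boundaries_iff using Z1(2) Z2(2) by blast
 qed
qed

lemma fmap_boundaries:
 assumes A: "fcx R A" and f: "is_fmap R A B f" and x: "x\<in>boundaries A (r + 1) p n"
 shows "f n x\<in>boundaries B (r + 1) p n"
proof -
 from x obtain u v where u: "u\<in>cycles A r (p + int r) (n - 1)" and v: "v\<in>cycles A r (p - 1) n"
  and e: "x = df A (n - 1) u +[md A n] v" unfolding boundaries_iff by blast
 note c = cycles_elts[OF A u] cycles_elts[OF A v]
 have "f n x = df B (n - 1) (f (n - 1) u) +[md B n] f n v"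
  unfolding e using c by (simp add: is_fmapD(6)[OF f] df_pred[OF A] fmap_df_pred[OF f])
 then show ?thesis unfolding boundaries_iff using fmap_cycles[OF f A u] fmap_cycles[OF f A v] by blast
qed

text \<open>Trivial kernel and surjectivity on the page \<open>r + 1\<close>, expressed by cycles
  and boundaries instead of cosets; \<open>page_map_bij\<close> is the link.\<close>

definition page_iso :: "nat => ('r, 'a) fcomplex => ('r, 'b) fcomplex => (int => 'a => 'b) => bool" where
 "page_iso r A B f \<longleftrightarrow> (\<forall>p n.
   (\<forall>x\<in>cycles A (r + 1) p n. f n x\<in>boundaries B (r + 1) p n \<longrightarrow> x\<in>boundaries A (r + 1) p n) &
   (\<forall>y\<in>cycles B (r + 1) p n. \<exists>x\<in>cycles A (r + 1) p n. y -[md B n] f n x\<in>boundaries B (r + 1) p n))"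

text \<open>Cosets of cycles are regarded as elements of the quotient of all of
  \<open>md A n\<close> by the boundaries, so that \<open>quotient_module\<close> applies to the
  ambient module.\<close>

lemma page_eq:
 "page A k p n = (quot_mod (md A n) (boundaries A k p n))
   \<lparr>carrier := {boundaries A k p n +>\<^bsub>md A n\<^esub> x | x. x\<in>cycles A k p n}\<rparr>"
 by (auto simp: page_def quot_mod_def A_RCOSETS_def' a_r_coset_def' set_add_def')

lemma page_map_bij:
 assumes R: "cring R" and A: "fcx R A" and B: "fcx R B" and f: "is_fmap R A B f"
 shows "page_map B f (r + 1) p n\<in>mod_iso R (page A (r + 1) p n) (page B (r + 1) p n) \<longleftrightarrow>
  (\<forall>x\<in>cycles A (r + 1) p n. f n x\<in>boundaries B (r + 1) p n \<longrightarrow> x\<in>boundaries A (r + 1) p n) &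
  (\<forall>y\<in>cycles B (r + 1) p n. \<exists>x\<in>cycles A (r + 1) p n. y -[md B n] f n x\<in>boundaries B (r + 1) p n)"
  (is "?L \<longleftrightarrow> ?inj & ?surj")
proof -
 let ?BA = "boundaries A (r + 1) p n" and ?BB = "boundaries B (r + 1) p n"
 let ?ZA = "cycles A (r + 1) p n" and ?ZB = "cycles B (r + 1) p n"
 interpret QA: quotient_module R "md A n" ?BA
  by (rule quotient_module.intro[OF fcxD(1)[OF A] boundaries_submodule[OF A]])
 interpret QB: quotient_module R "md B n" ?BB
  by (rule quotient_module.intro[OF fcxD(1)[OF B] boundaries_submodule[OF B]])
 note ZA = submodule_facts[OF fcxD(1)[OF A] cycles_submodule[OF A, of "r + 1" p n]]
 note ZB = submodule_facts[OF fcxD(1)[OF B] cycles_submodule[OF B, of "r + 1" p n]]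
 note BBs = submodule_facts[OF fcxD(1)[OF B] boundaries_submodule[OF B, of r p n]]
 note eA = cycles_elts[OF A, of _ "r + 1" p n] and eB = cycles_elts[OF B, of _ "r + 1" p n]
 note fm = is_fmapD[OF f]
 let ?cA = "%x. ?BA +>\<^bsub>md A n\<^esub> x" and ?cB = "%x. ?BB +>\<^bsub>md B n\<^esub> x"
 \<comment> \<open>\<open>page_map\<close> adds the boundaries of \<open>B\<close> to the image of a
   whole coset. As boundaries go to boundaries, the result is the single coset of
   \<open>f n x\<close>.\<close>
 have pm: "page_map B f (r + 1) p n (?cA x) = ?cB (f n x)" if x: "x\<in>?ZA" for x
 proof -
  have fx: "f n x\<in>grade B n" by (rule fm(5)[OF eA[OF x]])
  have "f n ` ?cA x \<subseteq> ?cB (f n x)"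
  proof
   fix w assume "w\<in>f n ` ?cA x"
   then obtain z where z: "z\<in>?BA" "w = f n (z +[md A n] x)" by (auto simp: a_r_coset_def')
   have "w = f n z +[md B n] f n x" unfolding z by (rule fm(6)[OF subsetD[OF QA.N.a_subset z(1)] eA[OF x]])
   then show "w\<in>?cB (f n x)" using fmap_boundaries[OF A f z(1)] by (auto simp: a_r_coset_def')
  qed
  moreover have "f n x\<in>f n ` ?cA x" using QA.coset_self[OF eA[OF x]] by (rule imageI)
  ultimately have "?BB <+>\<^bsub>md B n\<^esub> (f n ` ?cA x) = ?cB (f n x)"
  proof (intro equalityI subsetI)
   fix w assume "w\<in>?BB <+>\<^bsub>md B n\<^esub> (f n ` ?cA x)" and sub: "f n ` ?cA x \<subseteq> ?cB (f n x)"
   then obtain z z' where z: "z\<in>?BB" "z'\<in>?cB (f n x)" "w = z +[md B n] z'" by (auto simp: set_add_def')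
   then obtain t where t: "t\<in>?BB" "z' = t +[md B n] f n x" by (auto simp: a_r_coset_def')
   have tc: "z\<in>grade B n" "t\<in>grade B n" using z t QB.N.a_subset by auto
   have "w = (z +[md B n] t) +[md B n] f n x" unfolding z t by (rule QB.M.a_assoc[OF tc fx, symmetric])
   then show "w\<in>?cB (f n x)" using BBs(4)[OF z(1) t(1)] by (auto simp: a_r_coset_def')
  next
   fix w assume "w\<in>?cB (f n x)" and s: "f n x\<in>f n ` ?cA x"
   then show "w\<in>?BB <+>\<^bsub>md B n\<^esub> (f n ` ?cA x)" unfolding set_add_def' a_r_coset_def' by blast
  qed
  then show ?thesis by (simp only: page_map_def)
 qed
 have carA: "carrier (page A (r + 1) p n) = ?cA ` ?ZA" and carB: "carrier (page B (r + 1) p n) = ?cB ` ?ZB"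
  unfolding page_eq by auto
 have opsA: "X +[page A (r + 1) p n] X' = X +[quot_mod (md A n) ?BA] X'" "c *[page A (r + 1) p n] X = c *[quot_mod (md A n) ?BA] X" for X X' c
  unfolding page_eq by simp_all
 have opsB: "X +[page B (r + 1) p n] X' = X +[quot_mod (md B n) ?BB] X'" "c *[page B (r + 1) p n] X = c *[quot_mod (md B n) ?BB] X" for X X' c
  unfolding page_eq by simp_all
 note fZ = fmap_cycles[OF f A, of _ "r + 1" p n]
 have hom: "page_map B f (r + 1) p n\<in>mod_hom R (page A (r + 1) p n) (page B (r + 1) p n)"
  unfolding mod_hom_def carA carB opsA opsB
 proof (intro CollectI conjI ballI funcsetI)
  fix X assume "X\<in>?cA ` ?ZA"
  then obtain x where x: "X = ?cA x" "x\<in>?ZA" by blast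
  show "page_map B f (r + 1) p n X\<in>?cB ` ?ZB" unfolding x(1) pm[OF x(2)] by (rule imageI[OF fZ[OF x(2)]])
  { fix X' assume "X'\<in>?cA ` ?ZA"
   then obtain x' where x': "X' = ?cA x'" "x'\<in>?ZA" by blast
   note c = eA[OF x(2)] eA[OF x'(2)]
   show "page_map B f (r + 1) p n (X +[quot_mod (md A n) ?BA] X') =
    page_map B f (r + 1) p n X +[quot_mod (md B n) ?BB] page_map B f (r + 1) p n X'"
    unfolding x(1) x'(1) QA.quot_add[OF c] pm[OF x(2)] pm[OF x'(2)] pm[OF ZA(4)[OF x(2) x'(2)]]
     QB.quot_add[OF fm(5)[OF c(1)] fm(5)[OF c(2)]] fm(6)[OF c] .. }
  fix k assume k: "k\<in>carrier R"
  show "page_map B f (r + 1) p n (k *[quot_mod (md A n) ?BA] X) = k *[quot_mod (md B n) ?BB] page_map B f (r + 1) p n X"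
   unfolding x(1) QA.quot_smult[OF k eA[OF x(2)]] pm[OF x(2)] pm[OF ZA(6)[OF k x(2)]]
    QB.quot_smult[OF k fm(5)[OF eA[OF x(2)]]] fm(7)[OF k eA[OF x(2)]] ..
 qed
 have "inj_on (page_map B f (r + 1) p n) (?cA ` ?ZA) \<longleftrightarrow> ?inj"
 proof
  assume inj: "inj_on (page_map B f (r + 1) p n) (?cA ` ?ZA)"
  show ?inj
  proof (intro ballI impI)
   fix x assume x: "x\<in>?ZA" and b: "f n x\<in>?BB"
   have "?cB (f n x) = ?cB \<zero>[md B n]"
    using QB.coset_eq_iff[OF fm(5)[OF eA[OF x]] QB.M.zero_closed] BBs(5)[OF b BBs(2)] by blast
   then have "?cB (f n x) = ?cB (f n \<zero>[md A n])" unfolding fmap_zero[OF A B f] .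
   then have "page_map B f (r + 1) p n (?cA x) = page_map B f (r + 1) p n (?cA \<zero>[md A n])"
    unfolding pm[OF x] pm[OF ZA(2)] .
   from inj_onD[OF inj this imageI[OF x] imageI[OF ZA(2)]]
   have "x -[md A n] \<zero>[md A n]\<in>?BA" using QA.coset_eq_iff[OF eA[OF x] QA.M.zero_closed] by blast
   moreover have "\<ominus>[md A n] \<zero>[md A n] = \<zero>[md A n]"
    using QA.M.r_neg1[OF QA.M.zero_closed QA.M.zero_closed] by (simp add: QA.M.r_neg)
   ultimately show "x\<in>?BA" using eA[OF x] by (simp add: a_minus_def)
  qed
 next
  assume i: ?inj
  show "inj_on (page_map B f (r + 1) p n) (?cA ` ?ZA)"
  proof (rule inj_onI)
   fix X X' assume "X\<in>?cA ` ?ZA" "X'\<in>?cA ` ?ZA" and e: "page_map B f (r + 1) p n X = page_map B f (r + 1) p n X'"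
   then obtain x x' where x: "X = ?cA x" "x\<in>?ZA" and x': "X' = ?cA x'" "x'\<in>?ZA" by blast
   note c = eA[OF x(2)] eA[OF x'(2)]
   have "?cB (f n x) = ?cB (f n x')" using e unfolding x(1) x'(1) pm[OF x(2)] pm[OF x'(2)] .
   then have "f n x -[md B n] f n x'\<in>?BB" using QB.coset_eq_iff[OF fm(5)[OF c(1)] fm(5)[OF c(2)]] by blast
   then have "f n (x -[md A n] x')\<in>?BB" unfolding fmap_diff[OF f A B c] .
   then have "x -[md A n] x'\<in>?BA" using i ZA(5)[OF x(2) x'(2)] by blast
   then show "X = X'" unfolding x(1) x'(1) using QA.coset_eq_iff[OF c] by blast
  qed
 qed
 moreover have "page_map B f (r + 1) p n ` (?cA ` ?ZA) = ?cB ` ?ZB \<longleftrightarrow> ?surj"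
 proof
  assume s: "page_map B f (r + 1) p n ` (?cA ` ?ZA) = ?cB ` ?ZB"
  show ?surj
  proof
   fix y assume y: "y\<in>?ZB"
   then have "?cB y\<in>page_map B f (r + 1) p n ` (?cA ` ?ZA)" unfolding s by (rule imageI)
   then obtain x where x: "x\<in>?ZA" "?cB y = ?cB (f n x)" using pm by auto
   then have "y -[md B n] f n x\<in>?BB" using QB.coset_eq_iff[OF eB[OF y] fm(5)[OF eA[OF x(1)]]] by blast
   with x(1) show "\<exists>x\<in>?ZA. y -[md B n] f n x\<in>?BB" by blast
  qed
 next
  assume s: ?surj
  show "page_map B f (r + 1) p n ` (?cA ` ?ZA) = ?cB ` ?ZB"
  proof (intro equalityI subsetI)
   fix W assume "W\<in>page_map B f (r + 1) p n ` (?cA ` ?ZA)"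
   then obtain x where x: "x\<in>?ZA" "W = page_map B f (r + 1) p n (?cA x)" by blast
   show "W\<in>?cB ` ?ZB" unfolding x(2) pm[OF x(1)] by (rule imageI[OF fZ[OF x(1)]])
  next
   fix W assume "W\<in>?cB ` ?ZB"
   then obtain y where y: "W = ?cB y" "y\<in>?ZB" by blast
   then obtain x where x: "x\<in>?ZA" "y -[md B n] f n x\<in>?BB" using s by blast
   have "W = page_map B f (r + 1) p n (?cA x)" unfolding y(1) pm[OF x(1)]
    using QB.coset_eq_iff[OF eB[OF y(2)] fm(5)[OF eA[OF x(1)]]] x(2) by blast
   then show "W\<in>page_map B f (r + 1) p n ` (?cA ` ?ZA)" using x(1) by blast
  qed
 qed
 ultimately show ?thesis using hom unfolding mod_iso_def bij_betw_def carA carB by simp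
qed

lemma quasi_iso_iff:
 assumes "cring R"
 shows "f\<in>quasi_iso R r \<longleftrightarrow> f\<in>arrs (fC R) & page_iso r (asrc f) (atgt f) (afun f)"
 unfolding quasi_iso_def page_iso_def
 by (auto simp only: mem_Collect_eq arr_fC page_map_bij[OF assms])

lemma fdga_weq_iff:
 assumes "cring R"
 shows "f\<in>fdga_weq R r \<longleftrightarrow> f\<in>arrs (fDGA R) & page_iso r (cx (asrc f)) (cx (atgt f)) (afun f)"
 using fdgaD(1)[OF assms] map_fmap
 by (auto simp: fdga_weq_def quasi_iso_iff[OF assms] forget_def arr_fC arr_fDGA)

lemma cycle_surjective_iff:
 "f\<in>cycle_surjective R S \<longleftrightarrow> f\<in>arrs (fC R) & cycle_onto S (asrc f) (atgt f) (afun f)"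
proof (cases "f\<in>arrs (fC R)")
 case True
 then have m: "is_fmap R (asrc f) (atgt f) (afun f)" "fcx R (asrc f)" by (simp_all add: arr_fC)
 have "afun f n ` cycles (asrc f) s p n = cycles (atgt f) s p n \<longleftrightarrow>
  (\<forall>y\<in>cycles (atgt f) s p n. \<exists>x\<in>cycles (asrc f) s p n. afun f n x = y)" for s p n
 proof -
  have "afun f n ` cycles (asrc f) s p n \<subseteq> cycles (atgt f) s p n" using fmap_cycles[OF m] by (rule image_subsetI)
  then have "afun f n ` cycles (asrc f) s p n = cycles (atgt f) s p n \<longleftrightarrow>
   (\<forall>y\<in>cycles (atgt f) s p n. y\<in>afun f n ` cycles (asrc f) s p n)" by blast
  then show ?thesis by (simp add: image_iff eq_commute)
 qed
 then show ?thesis using True by (simp add: cycle_surjective_def cycle_onto_def)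
qed (simp add: cycle_surjective_def)

lemma fdga_fib_iff:
 assumes "cring R"
 shows "f\<in>fdga_fib R S \<longleftrightarrow> f\<in>arrs (fDGA R) & cycle_onto S (cx (asrc f)) (cx (atgt f)) (afun f)"
 using fdgaD(1)[OF assms] map_fmap
 by (auto simp: fdga_fib_def cycle_surjective_iff forget_def arr_fC arr_fDGA)

lemma diff_cancel:
 assumes "module R M" "a\<in>carrier M" "b\<in>carrier M"
 shows "b +[M] (a -[M] b) = a" "(b +[M] a) -[M] b = a" "\<zero>[M] -[M] (\<zero>[M] -[M] a) = a"
proof -
 interpret module R M by fact
 show "b +[M] (a -[M] b) = a" "(b +[M] a) -[M] b = a" "\<zero>[M] -[M] (\<zero>[M] -[M] a) = a"
  using assms(2,3) by (simp_all add: a_minus_def M.a_ac M.r_neg M.r_neg1 M.r_neg2 M.minus_add)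
qed

lemma diff_self: "module R M==>a\<in>carrier M==>a -[M] a = \<zero>[M]"
 by (simp add: abelian_group.diff_eq_zero_iff module_def)

text \<open>For cycle surjective maps, the lifting property against \<open>\<phi>\<^sub>r\<^sub>+\<^sub>1\<close> says that the map is
  an isomorphism on the page \<open>r + 1\<close>.\<close>

lemma page_iso_iff_solvable:
 assumes A: "fcx R A" and B: "fcx R B" and f: "is_fmap R A B f"
  and S: "cycle_onto S A B f" "r\<in>S"
 shows "page_iso r A B f \<longleftrightarrow> solvable r A B f"
proof
 assume sol: "solvable r A B f"
 show "page_iso r A B f" unfolding page_iso_def
 proof (intro allI conjI ballI impI)
  fix p n x assume x: "x\<in>cycles A (r + 1) p n" and b: "f n x\<in>boundaries B (r + 1) p n"
  from b obtain u v where u: "u\<in>cycles B r (p + int r) (n - 1)" and v: "v\<in>cycles B r (p - 1) n"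
   and e: "f n x = df B (n - 1) u +[md B n] v" unfolding boundaries_iff by blast
  note uc = df_pred[OF B cycles_elts[OF B u]] and vc = cycles_elts[OF B v]
  \<comment> \<open>Writing \<open>f n x\<close> as a boundary amounts to an admissible pair
    \<open>(x, u)\<close>, with \<open>v\<close> as the remaining difference.\<close>
  have "f n x -[md B n] df B (n - 1) u = v" unfolding e by (rule diff_cancel(2)[OF fcxD(1)[OF B] vc uc])
  then have "admissible r A B f p n x u" using x u v by (simp add: admissible_def cycles_iff)
  then obtain w where "solves r A f p n x u w" using sol unfolding solvable_def by blast
  then have w: "w\<in>cycles A r (p + int r) (n - 1)" "x -[md A n] df A (n - 1) w\<in>fil A (p - 1) n" by (simp_all add: solves_def)
  let ?v = "x -[md A n] df A (n - 1) w"
  note xc = cycles_elts[OF A x] and wc = df_pred[OF A cycles_elts[OF A w(1)]]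
  note Z = submodule_facts[OF fcxD(1)[OF A] cycles_submodule[OF A, of "r + 1" p n]]
  have "?v\<in>cycles A (r + 1) p n" by (rule Z(5)[OF x df_cycle[OF A w(1)]])
  then have "df A n ?v\<in>fil A (p - 1 - int r) (n + 1)" by (simp add: cycles_iff algebra_simps)
  then have "?v\<in>cycles A r (p - 1) n" using w(2) by (simp add: cycles_iff)
  then show "x\<in>boundaries A (r + 1) p n" unfolding boundaries_iff
   using w(1) diff_cancel(1)[OF fcxD(1)[OF A] xc wc] by metis
 next
  fix p n y assume y: "y\<in>cycles B (r + 1) p n"
  note yc = cycles_elts[OF B y]
  note ZA = submodule_facts[OF fcxD(1)[OF A] cycles_submodule[OF A]]
  have dy: "df B n y\<in>fil B (p - int r - 1) (n + 1)" "y\<in>fil B p n" using y by (simp_all add: cycles_iff algebra_simps)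
  have "df B n y\<in>fil B (p - int r) (n + 1)" by (rule fil_subset[OF B _ dy(1)]) simp
  then have "y\<in>cycles B r (p - int r + int r) (n + 1 - 1)" using dy by (simp add: cycles_iff)
  moreover have "f (n + 1) \<zero>[md A (n + 1)] -[md B (n + 1)] df B (n + 1 - 1) y\<in>fil B (p - int r - 1) (n + 1)"
   unfolding fmap_zero[OF A B f] using fil_alg(3)[OF B fil_alg(1)[OF B] dy(1)] by simp
  \<comment> \<open>For surjectivity the square is taken one degree higher, at filtration
    \<open>p - r\<close> and with \<open>a\<close> zero. Its solution lies over \<open>y\<close>,
    and the vanishing of \<open>a\<close> forces its differential into filtration
    \<open>p - r - 1\<close>, as an \<open>r + 1\<close>-cycle needs.\<close>
  ultimately have "admissible r A B f (p - int r) (n + 1) \<zero>[md A (n + 1)] y"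
   unfolding admissible_def using ZA(2) by blast
  then obtain x where "solves r A f (p - int r) (n + 1) \<zero>[md A (n + 1)] y x" using sol unfolding solvable_def by blast
  then have x: "x\<in>cycles A r p n" "f n x = y" "\<zero>[md A (n + 1)] -[md A (n + 1)] df A n x\<in>fil A (p - int r - 1) (n + 1)"
   by (simp_all add: solves_def)
  have xc: "df A n x\<in>grade A (n + 1)" by (rule fcxD(3)[OF A cycles_elts[OF A x(1)]])
  have "df A n x\<in>fil A (p - int r - 1) (n + 1)"
   using fil_alg(3)[OF A fil_alg(1)[OF A] x(3)] diff_cancel(3)[OF fcxD(1)[OF A] xc xc] by simp
  then have "x\<in>cycles A (r + 1) p n" using x(1) by (simp add: cycles_iff algebra_simps)
  moreover have "y -[md B n] f n x\<in>boundaries B (r + 1) p n"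
   unfolding x(2) diff_self[OF fcxD(1)[OF B] yc]
   by (rule submodule_facts(2)[OF fcxD(1)[OF B] boundaries_submodule[OF B]])
  ultimately show "\<exists>x\<in>cycles A (r + 1) p n. y -[md B n] f n x\<in>boundaries B (r + 1) p n" by blast
 qed
next
 assume iso: "page_iso r A B f"
 note ZA = submodule_facts[OF fcxD(1)[OF A] cycles_submodule[OF A]]
 note ZB = submodule_facts[OF fcxD(1)[OF B] cycles_submodule[OF B]]
 have onto: "\<exists>x\<in>cycles A r q m. f m x = y" if "y\<in>cycles B r q m" for q m y
  using S that unfolding cycle_onto_def by blast
 \<comment> \<open>Surjectivity on the page improves to surjectivity on \<open>r + 1\<close>-cycles:
   the boundary by which a preimage fails is made of \<open>r\<close>-cycles \<open>u\<close> and
   \<open>v\<close>, and these lift because \<open>r\<close> belongs to \<open>S\<close>.\<close>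
 have lift: "\<exists>x\<in>cycles A (r + 1) p n. f n x = y" if y: "y\<in>cycles B (r + 1) p n" for p n y
 proof -
  obtain x where x: "x\<in>cycles A (r + 1) p n" "y -[md B n] f n x\<in>boundaries B (r + 1) p n"
   using iso y unfolding page_iso_def by blast
  then obtain u v where u: "u\<in>cycles B r (p + int r) (n - 1)" and v: "v\<in>cycles B r (p - 1) n"
   and e: "y -[md B n] f n x = df B (n - 1) u +[md B n] v" unfolding boundaries_iff by blast
  obtain u' v' where u': "u'\<in>cycles A r (p + int r) (n - 1)" "f (n - 1) u' = u"
   and v': "v'\<in>cycles A r (p - 1) n" "f n v' = v" using onto[OF u] onto[OF v] by blast
  let ?w = "df A (n - 1) u' +[md A n] v'"
  have w: "?w\<in>cycles A (r + 1) p n" by (rule ZA(4)[OF df_cycle[OF A u'(1)] cycle_lower[OF A v'(1)]])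
  note c = cycles_elts[OF A x(1)] cycles_elts[OF A u'(1)] cycles_elts[OF A v'(1)] cycles_elts[OF A w]
  have fw: "f n ?w = y -[md B n] f n x" unfolding e using c
   by (simp add: is_fmapD(6)[OF f] df_pred[OF A] fmap_df_pred[OF f] u' v')
  have "f n (x +[md A n] ?w) = y" unfolding is_fmapD(6)[OF f c(1,4)] fw
   by (rule diff_cancel(1)[OF fcxD(1)[OF B] cycles_elts[OF B y] is_fmapD(5)[OF f c(1)]])
  then show ?thesis using ZA(4)[OF x(1) w] by blast
 qed
 show "solvable r A B f" unfolding solvable_def
 proof (intro allI impI)
  fix q n a y assume ad: "admissible r A B f q n a y"
  then have a: "a\<in>cycles A (r + 1) q n" and y: "y\<in>cycles B r (q + int r) (n - 1)"
   and l: "f n a -[md B n] df B (n - 1) y\<in>fil B (q - 1) n" by (simp_all add: admissible_def)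
  note ac = cycles_elts[OF A a] and yc = cycles_elts[OF B y]
  note fa = fmap_cycles[OF f A a] and fac = is_fmapD(5)[OF f ac]
  let ?v = "f n a -[md B n] df B (n - 1) y"
  have "?v\<in>cycles B (r + 1) q n" by (rule ZB(5)[OF fa df_cycle[OF B y]])
  \<comment> \<open>An \<open>r + 1\<close>-cycle at \<open>q\<close> that lies in filtration
    \<open>q - 1\<close> is an \<open>r\<close>-cycle there: both conditions bound the differential
    by \<open>q - r - 1\<close>.\<close>
  then have v: "?v\<in>cycles B r (q - 1) n" using l by (simp add: cycles_iff algebra_simps)
  have "f n a = df B (n - 1) y +[md B n] ?v"
   by (rule diff_cancel(1)[OF fcxD(1)[OF B] fac df_pred[OF B yc], symmetric])
  then have "f n a\<in>boundaries B (r + 1) q n" unfolding boundaries_iff using y v by blast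
  then have "a\<in>boundaries A (r + 1) q n" using iso a unfolding page_iso_def by blast
  then obtain u w where u: "u\<in>cycles A r (q + int r) (n - 1)" and w: "w\<in>cycles A r (q - 1) n"
   and e: "a = df A (n - 1) u +[md A n] w" unfolding boundaries_iff by blast
  note uc = cycles_elts[OF A u] and wc = cycles_elts[OF A w] and fuc = is_fmapD(5)[OF f cycles_elts[OF A u]]
  \<comment> \<open>The element \<open>u\<close> has the right difference \<open>a - d u\<close> but
    need not lie over \<open>y\<close>. The error \<open>?z\<close> turns out to be an
    \<open>r + 1\<close>-cycle at \<open>q + r\<close>. A lift \<open>x\<close> of it has
    differential in filtration \<open>q - 1\<close>, so adding \<open>x\<close> corrects the image
    without spoiling the difference.\<close>
  let ?z = "y -[md B (n - 1)] f (n - 1) u"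
  have z: "?z\<in>cycles B r (q + int r) (n - 1)" by (rule ZB(5)[OF y fmap_cycles[OF f A u]])
  interpret Bn: module R "md B n" by (rule fcxD(1)[OF B])
  have dh: "df B (n - 1)\<in>mod_hom R (md B (n - 1)) (md B n)" using fcxD(2)[OF B, of "n - 1"] by simp
  have fw: "f n w\<in>fil B (q - 1) n" "f n w\<in>grade B n" using fmap_cycles[OF f A w] is_fmapD(5)[OF f wc] by (simp_all add: cycles_iff)
  have "df B (n - 1) ?z = f n w -[md B n] ?v"
  proof -
   have 1: "df B (n - 1) ?z = df B (n - 1) y -[md B n] df B (n - 1) (f (n - 1) u)"
    by (rule mod_hom_diff[OF fcxD(1)[OF B] fcxD(1)[OF B] dh yc fuc])
   have 2: "f n a = df B (n - 1) (f (n - 1) u) +[md B n] f n w"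
    unfolding e by (simp add: is_fmapD(6)[OF f df_pred[OF A uc] wc] fmap_df_pred[OF f uc])
   show ?thesis unfolding 1 2 using fw df_pred[OF B yc] df_pred[OF B fuc]
    by (simp add: a_minus_def Bn.minus_add Bn.a_ac Bn.r_neg Bn.r_neg1 Bn.r_neg2 Bn.cancel_gap)
  qed
  then have "df B (n - 1) ?z\<in>fil B (q - 1) n" using fil_alg(3)[OF B fw(1) l] by simp
  then have "?z\<in>cycles B (r + 1) (q + int r) (n - 1)" using z by (simp add: cycles_iff)
  then obtain x where x: "x\<in>cycles A (r + 1) (q + int r) (n - 1)" "f (n - 1) x = ?z" using lift by blast
  have "df A (n - 1) x\<in>fil A (q - 1) n" "x\<in>fil A (q + int r) (n - 1)" using x(1) by (simp_all add: cycles_iff)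
  then have dx: "df A (n - 1) x\<in>fil A (q - 1) n" and xr: "x\<in>cycles A r (q + int r) (n - 1)"
   using fil_subset[OF A _ \<open>df A (n - 1) x\<in>fil A (q - 1) n\<close>, of q] by (simp_all add: cycles_iff)
  note xc = cycles_elts[OF A xr]
  have "u +[md A (n - 1)] x\<in>cycles A r (q + int r) (n - 1)" by (rule ZA(4)[OF u xr])
  moreover have "f (n - 1) (u +[md A (n - 1)] x) = y"
   unfolding is_fmapD(6)[OF f uc xc] x(2) by (rule diff_cancel(1)[OF fcxD(1)[OF B] yc fuc])
  moreover have "a -[md A n] df A (n - 1) (u +[md A (n - 1)] x)\<in>fil A (q - 1) n"
  proof -
   interpret An: module R "md A n" by (rule fcxD(1)[OF A])
   have dhA: "df A (n - 1)\<in>mod_hom R (md A (n - 1)) (md A n)" using fcxD(2)[OF A, of "n - 1"] by simp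
   have "a -[md A n] df A (n - 1) (u +[md A (n - 1)] x) = w -[md A n] df A (n - 1) x"
    unfolding e mod_homD(2)[OF dhA uc xc] using wc df_pred[OF A uc] df_pred[OF A xc]
    by (simp add: a_minus_def An.minus_add An.a_ac An.r_neg An.r_neg1 An.r_neg2 An.cancel_gap)
   then show ?thesis using fil_alg(3)[OF A _ dx, of w] w by (simp add: cycles_iff)
  qed
  ultimately have "solves r A f q n a y (u +[md A (n - 1)] x)" by (simp add: solves_def)
  then show "\<exists>x. solves r A f q n a y x" by blast
 qed
qed

section \<open>The mapping path algebra\<close>

lemma koszul_sign_simps:
 assumes "cring R"
 shows "koszul_sign R (i + 1) = \<ominus>[R] koszul_sign R i" "koszul_sign R (i - 1) = \<ominus>[R] koszul_sign R i"
  "koszul_sign R i \<otimes>[R] koszul_sign R i = \<one>[R]" "koszul_sign R (i + j) = koszul_sign R i \<otimes>[R] koszul_sign R j"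
  "koszul_sign R i = \<one>[R] \<or> koszul_sign R i = \<ominus>[R] \<one>[R]"
proof -
 interpret cring R by fact
 have "\<ominus>[R] \<one>[R] \<otimes>[R] \<ominus>[R] \<one>[R] = \<one>[R]" by (simp add: l_minus r_minus)
 then show "koszul_sign R (i + 1) = \<ominus>[R] koszul_sign R i" "koszul_sign R (i - 1) = \<ominus>[R] koszul_sign R i"
  "koszul_sign R i \<otimes>[R] koszul_sign R i = \<one>[R]" "koszul_sign R (i + j) = koszul_sign R i \<otimes>[R] koszul_sign R j"
  "koszul_sign R i = \<one>[R] \<or> koszul_sign R i = \<ominus>[R] \<one>[R]"
  by (auto simp: koszul_sign_def)
qed

context module begin

lemma smult_sign:
 assumes "x\<in>carrier M" shows "(\<ominus>[R] \<one>[R]) *[M] x = \<ominus>[M] x"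
 using assms by (simp add: smult_l_minus)

text \<open>The Leibniz rule in the path entry of the mapping path algebra, with the products that
  occur abstracted to \<open>P1\<close>, ..., \<open>P7\<close> and a sign \<open>s\<close>.
  \<open>P7\<close>, the product of the left end of one path with the right end of the other, occurs
  twice on the right and cancels.\<close>

lemma leibniz_sum:
 assumes P: "P1\<in>carrier M" "P2\<in>carrier M" "P3\<in>carrier M" "P4\<in>carrier M" "P5\<in>carrier M"
  "P6\<in>carrier M" "P7\<in>carrier M" and s: "s = \<one>[R] \<or> s = \<ominus>[R] \<one>[R]"
 shows "P1 -[M] (P2 +[M] (s *[M] (P3 +[M] s *[M] P4) +[M] (P5 +[M] (\<ominus>[R] s) *[M] P6))) =
  ((\<ominus>[R] s) *[M] P3 +[M] (P1 -[M] (P7 +[M] P5))) +[M]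
  s *[M] (s *[M] (P7 -[M] (P2 +[M] P4)) +[M] P6)"
proof -
 have mid: "(a +[M] \<ominus>[M] P7) +[M] (P7 +[M] c) = a +[M] c" if "a\<in>carrier M" "c\<in>carrier M" for a c
  using that P by (simp add: M.a_assoc M.r_neg1)
 let ?a = "(\<ominus>[R] s) *[M] P3 +[M] (P1 +[M] \<ominus>[M] P5)" and ?c = "\<ominus>[M] P2 +[M] \<ominus>[M] P4 +[M] s *[M] P6"
 have sc: "s\<in>carrier R" using s by auto
 have "((\<ominus>[R] s) *[M] P3 +[M] (P1 -[M] (P7 +[M] P5))) +[M]
  s *[M] (s *[M] (P7 -[M] (P2 +[M] P4)) +[M] P6) = (?a +[M] \<ominus>[M] P7) +[M] (P7 +[M] ?c)"
  using s P by (elim disjE) (simp_all add: a_minus_def smult_sign M.minus_add M.a_ac)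
 also have "\<dots> = ?a +[M] ?c" by (rule mid) (use P sc in auto)
 also have "\<dots> = P1 -[M] (P2 +[M] (s *[M] (P3 +[M] s *[M] P4) +[M] (P5 +[M] (\<ominus>[R] s) *[M] P6)))"
  using s P by (elim disjE) (simp_all add: a_minus_def smult_sign M.minus_add M.a_ac)
 finally show ?thesis ..
qed

end

text \<open>The laws are restated with the degree of a product given by an equation, so that they
  apply to splittings such as \<open>i + k - 1 = i + (k - 1)\<close>.\<close>

locale fdga_mul =
 fixes R :: "'u ring" and Y :: "('u, 'u) fdga"
 assumes cring: "cring R" and Y: "is_fdga R Y"
begin

lemmas alg = fdga_alg[OF cring Y]
lemmas fcY = fdgaD(1)[OF cring Y]
lemmas laws = dga_lawsD[OF fdgaD(2)[OF cring Y]]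

lemma mul_closed: "N = i + k==>a\<in>elts Y i==>b\<in>elts Y k==>fmul R Y i k a b\<in>elts Y N"
 using alg(5) by simp

lemma mul_homs:
 assumes "N = i + k"
 shows "b\<in>elts Y k==>(%a. fmul R Y i k a b)\<in>mod_hom R (md (cx Y) i) (md (cx Y) N)"
  "a\<in>elts Y i==>(%b. fmul R Y i k a b)\<in>mod_hom R (md (cx Y) k) (md (cx Y) N)"
 using laws(1-5) unfolding assms mod_hom_def by simp_all

lemma mul_lin:
 assumes N: "N = i + k"
 shows "a\<in>elts Y i==>a'\<in>elts Y i==>b\<in>elts Y k ==>
   fmul R Y i k (a +[md (cx Y) i] a') b = fmul R Y i k a b +[md (cx Y) N] fmul R Y i k a' b"
  "a\<in>elts Y i==>b\<in>elts Y k==>b'\<in>elts Y k ==>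
   fmul R Y i k a (b +[md (cx Y) k] b') = fmul R Y i k a b +[md (cx Y) N] fmul R Y i k a b'"
  "a\<in>elts Y i==>a'\<in>elts Y i==>b\<in>elts Y k ==>
   fmul R Y i k (a -[md (cx Y) i] a') b = fmul R Y i k a b -[md (cx Y) N] fmul R Y i k a' b"
  "a\<in>elts Y i==>b\<in>elts Y k==>b'\<in>elts Y k ==>
   fmul R Y i k a (b -[md (cx Y) k] b') = fmul R Y i k a b -[md (cx Y) N] fmul R Y i k a b'"
  "c\<in>carrier R==>a\<in>elts Y i==>b\<in>elts Y k ==>
   fmul R Y i k (c *[md (cx Y) i] a) b = c *[md (cx Y) N] fmul R Y i k a b"
  "c\<in>carrier R==>a\<in>elts Y i==>b\<in>elts Y k ==>
   fmul R Y i k a (c *[md (cx Y) k] b) = c *[md (cx Y) N] fmul R Y i k a b"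
 using mod_hom_diff[OF fcxD(1)[OF fcY] fcxD(1)[OF fcY] mul_homs(1)[OF N]]
  mod_hom_diff[OF fcxD(1)[OF fcY] fcxD(1)[OF fcY] mul_homs(2)[OF N]]
  mod_homD(2,3)[OF mul_homs(1)[OF N]] mod_homD(2,3)[OF mul_homs(2)[OF N]]
 by simp_all

lemma mul_assoc:
 "ij = i + j==>jk = j + k==>a\<in>elts Y i==>b\<in>elts Y j==>c\<in>elts Y k ==>
  fmul R Y ij k (fmul R Y i j a b) c = fmul R Y i jk a (fmul R Y j k b c)"
 using laws(6) by simp

lemma leibniz:
 "N = i + k==>i' = i + 1==>k' = k + 1==>N' = N + 1==>a\<in>elts Y i==>b\<in>elts Y k ==>
  df (cx Y) N (fmul R Y i k a b) = fmul R Y i' k (df (cx Y) i a) b +[md (cx Y) N']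
   koszul_sign R i *[md (cx Y) N'] fmul R Y i k' a (df (cx Y) k b)"
 using laws(10) by simp

lemma mod: "module R (md (cx Y) n)"
 by (rule fcxD(1)[OF fcY])

lemma df_pred_lin:
 "x\<in>elts Y (n - 1)==>y\<in>elts Y (n - 1) ==>
  df (cx Y) (n - 1) (x +[md (cx Y) (n - 1)] y) = df (cx Y) (n - 1) x +[md (cx Y) n] df (cx Y) (n - 1) y"
 "c\<in>carrier R==>x\<in>elts Y (n - 1) ==>
  df (cx Y) (n - 1) (c *[md (cx Y) (n - 1)] x) = c *[md (cx Y) n] df (cx Y) (n - 1) x"
 using alg(15)[of x "n - 1" y] alg(16)[of c x "n - 1"] by simp_all

end

text \<open>For \<open>j : X \<rightarrow> Y\<close> the elements of degree \<open>n\<close> are the triples \<open>(a, y, z)\<close> with \<open>a \<in> X\<^sup>n\<close>,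
  \<open>y \<in> Y\<^sup>n\<^sup>-\<^sup>1\<close>, \<open>z \<in> Y\<^sup>n\<close>, to be thought of as the upper triangular matrices with diagonal
  \<open>j a, z\<close> and entry \<open>y\<close>; \<open>y\<close> is a path from \<open>j a\<close> to \<open>z\<close>. The filtration of \<open>y\<close> is shifted by \<open>r\<close>.\<close>

locale mapping_path = Y: fdga_mul R Y + X: fdga_mul R X
 for R :: "'u ring" and X Y :: "('u, 'u) fdga" +
 fixes r :: nat and j
 assumes inf: "infinite (UNIV :: 'u set)" and j: "dgmap R X Y j"
begin

lemmas jm = fdga_mapD[OF j]
lemmas jmul = fdga_map_mult[OF Y.cring X.Y Y.Y j]

abbreviation mX where "mX \<equiv> md (cx X)"
abbreviation mY where "mY \<equiv> md (cx Y)"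

definition C :: "int => ('u \<times> 'u \<times> 'u) set" where "C n = elts X n \<times> elts Y (n - 1) \<times> elts Y n"
definition q :: "int => 'u \<times> 'u \<times> 'u => 'u" where "q n = (%(a, y, z). pair_code (a, pair_code (y, z)))"
definition pad :: "int => 'u \<times> 'u \<times> 'u => 'u \<times> 'u \<times> 'u => 'u \<times> 'u \<times> 'u" where
 "pad n = (%(a, y, z) (a', y', z'). (a +[mX n] a', y +[mY (n - 1)] y', z +[mY n] z'))"
definition pze :: "int => 'u \<times> 'u \<times> 'u" where "pze n = (\<zero>[mX n], \<zero>[mY (n - 1)], \<zero>[mY n])"
definition psm :: "int => 'u => 'u \<times> 'u \<times> 'u => 'u \<times> 'u \<times> 'u" where
 "psm n c = (%(a, y, z). (c *[mX n] a, c *[mY (n - 1)] y, c *[mY n] z))"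
text \<open>The path entry measures how far \<open>y\<close> is from being a path: it vanishes when
  \<open>d y\<close> is \<open>z - j a\<close>.\<close>

definition pdd :: "int => 'u \<times> 'u \<times> 'u => 'u \<times> 'u \<times> 'u" where
 "pdd n = (%(a, y, z). (df (cx X) n a, z -[mY n] (j n a +[mY n] df (cx Y) (n - 1) y), df (cx Y) n z))"
text \<open>Multiplication of triangular matrices. The Koszul sign accounts for the shift of the
  path entry by one degree when \<open>a\<close> is moved past it.\<close>

definition pml :: "int => int => 'u \<times> 'u \<times> 'u => 'u \<times> 'u \<times> 'u => 'u \<times> 'u \<times> 'u" where
 "pml i k = (%(a, y, z) (a', y', z'). (fmul R X i k a a',
   koszul_sign R i *[mY (i + k - 1)] fmul R Y i (k - 1) (j i a) y' +[mY (i + k - 1)] fmul R Y (i - 1) k y z',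
   fmul R Y i k z z'))"
definition pun :: "'u \<times> 'u \<times> 'u" where "pun = (fone R X, \<zero>[mY (- 1)], fone R Y)"
text \<open>The shift is balanced between two demands. It is large enough for
  \<open>right_onto\<close>, where \<open>z\<close> moves into the path entry while the filtration
  drops by up to \<open>r\<close>, and small enough for \<open>homotopic\<close>, where a drop by
  \<open>r + 1\<close> has to leave the path entry below filtration \<open>p\<close>.\<close>

definition PF :: "int => int => ('u \<times> 'u \<times> 'u) set" where
 "PF p n = fil (cx X) p n \<times> fil (cx Y) (p + int r) (n - 1) \<times> fil (cx Y) p n"

lemma inj_q: "q n u = q m v \<longleftrightarrow> u = v"
 by (cases u; cases v) (simp add: q_def pair_code_eq[OF inf])

lemmas ks = koszul_sign_closed[OF Y.cring]
lemmas kss = koszul_sign_simps[OF Y.cring]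

lemma mul_y:
 assumes "a\<in>elts Y i" "b\<in>elts Y (k - 1)" "y\<in>elts Y (i - 1)" "z\<in>elts Y k"
 shows "fmul R Y i (k - 1) a b\<in>elts Y (i + k - 1)" "fmul R Y (i - 1) k y z\<in>elts Y (i + k - 1)"
 using assms Y.mul_closed[of "i + k - 1" i "k - 1"] Y.mul_closed[of "i + k - 1" "i - 1" k] by simp_all

lemma raw: "raw_dga R C q pad pze psm pdd pml pun PF"
proof -
 interpret R: cring R by (rule Y.cring)
 note cl = X.alg(1-6) Y.alg(1-6) jm(5) df_pred[OF Y.fcY] fcomplex_diff_closed[OF Y.fcY] mul_y
 show ?thesis
 proof (rule raw_dga.intro, goal_cases)
  case 1 show ?case by (rule Y.cring)
 next
  case (2 n x y) then show ?case by (auto simp: C_def pad_def cl)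
 next
  case (3 n) show ?case by (auto simp: C_def pze_def cl)
 next
  case (4 n c x) then show ?case by (auto simp: C_def psm_def cl)
 next
  case (5 n x) then show ?case by (auto simp: C_def pdd_def cl)
 next
  case (6 i k x y) then show ?case by (auto simp: C_def pml_def cl ks)
 next
  case 7 show ?case by (auto simp: C_def pun_def cl)
 next
  case 8 then show ?case by (simp add: inj_q)
 next
  case 9 then show ?case by (simp add: inj_q)
 next
  case 10 then show ?case by (simp add: inj_q)
 next
  case 11 then show ?case by (simp add: inj_q)
 next
  case 12 then show ?case by (auto simp: inj_q C_def pad_def X.alg(7) Y.alg(7))
 next
  case 13 then show ?case by (auto simp: inj_q C_def pad_def X.alg(8) Y.alg(8))
 next
  case 14 then show ?case by (auto simp: inj_q C_def pad_def pze_def X.alg(9) Y.alg(9))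
 next
  case 15 then show ?case by (auto simp: inj_q C_def pad_def pze_def psm_def X.alg(10) Y.alg(10))
 next
  case 16 then show ?case by (auto simp: inj_q C_def pad_def psm_def X.alg(11) Y.alg(11))
 next
  case 17 then show ?case by (auto simp: inj_q C_def pad_def psm_def X.alg(12) Y.alg(12))
 next
  case 18 then show ?case by (auto simp: inj_q C_def pad_def psm_def X.alg(13) Y.alg(13))
 next
  case 19 then show ?case by (auto simp: inj_q C_def pad_def psm_def X.alg(14) Y.alg(14))
 next
  case (20 n u v)
  interpret M: module R "mY n" by (rule Y.mod)
  from 20 obtain a y z a' y' z' where u: "u = (a, y, z)" "v = (a', y', z')" and
   c: "a\<in>elts X n" "y\<in>elts Y (n - 1)" "z\<in>elts Y n" "a'\<in>elts X n" "y'\<in>elts Y (n - 1)" "z'\<in>elts Y n"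
   by (auto simp: C_def)
  have "z +[mY n] z' -[mY n] (j n (a +[mX n] a') +[mY n] df (cx Y) (n - 1) (y +[mY (n - 1)] y')) =
   (z -[mY n] (j n a +[mY n] df (cx Y) (n - 1) y)) +[mY n] (z' -[mY n] (j n a' +[mY n] df (cx Y) (n - 1) y'))"
   using c by (simp add: jm(6) Y.df_pred_lin cl a_minus_def M.minus_add M.a_ac)
  then show ?case using c by (simp add: u inj_q pdd_def pad_def X.alg(15) Y.alg(15))
 next
  case (21 n k u)
  interpret M: module R "mY n" by (rule Y.mod)
  from 21 obtain a y z where u: "u = (a, y, z)" and
   c: "a\<in>elts X n" "y\<in>elts Y (n - 1)" "z\<in>elts Y n" "k\<in>carrier R"
   by (auto simp: C_def)
  have "k *[mY n] z -[mY n] (j n (k *[mX n] a) +[mY n] df (cx Y) (n - 1) (k *[mY (n - 1)] y)) =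
   k *[mY n] (z -[mY n] (j n a +[mY n] df (cx Y) (n - 1) y))"
   using c by (simp add: jm(7) Y.df_pred_lin cl a_minus_def M.smult_r_distr M.smult_r_minus)
  then show ?case using c by (simp add: u inj_q pdd_def psm_def X.alg(16) Y.alg(16))
 next
  case (22 n u)
  interpret M: module R "mY (n + 1)" by (rule Y.mod)
  interpret M0: module R "mY n" by (rule Y.mod)
  from 22 obtain a y z where u: "u = (a, y, z)" and
   c: "a\<in>elts X n" "y\<in>elts Y (n - 1)" "z\<in>elts Y n" by (auto simp: C_def)
  \<comment> \<open>Since \<open>d d y\<close> vanishes, the path entry has differential
    \<open>d z - j (d a)\<close>, and this is what cancels in the path entry of the second
    differential.\<close>
  have "df (cx Y) n (z -[mY n] (j n a +[mY n] df (cx Y) (n - 1) y)) = df (cx Y) n z -[mY (n + 1)] df (cx Y) n (j n a)"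
   using c by (simp add: mod_hom_diff[OF Y.mod Y.mod fcxD(2)[OF Y.fcY]] cl Y.alg(15) df_df_pred[OF Y.fcY])
  then have "df (cx Y) n z -[mY (n + 1)] (j (n + 1) (df (cx X) n a) +[mY (n + 1)]
    df (cx Y) n (z -[mY n] (j n a +[mY n] df (cx Y) (n - 1) y))) = \<zero>[mY (n + 1)]"
   using c by (simp add: jm(3) cl diff_cancel(1)[OF Y.mod] diff_self[OF Y.mod])
  moreover have "df (cx X) (n + 1) (df (cx X) n a) = \<zero>[mX (n + 1 + 1)]" "df (cx Y) (n + 1) (df (cx Y) n z) = \<zero>[mY (n + 1 + 1)]"
   using c X.alg(17) Y.alg(17) by blast+
  ultimately show ?case by (simp add: u inj_q pdd_def pze_def add.commute[of 1 n])
 next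
  case (23 i k u u' v)
  interpret M: module R "mY (i + k - 1)" by (rule Y.mod)
  have d: "i + k - 1 = i + (k - 1)" "i + k - 1 = i - 1 + k" by simp_all
  from 23 show ?case
   by (auto simp: C_def inj_q pml_def pad_def X.mul_lin[OF refl] Y.mul_lin[OF refl[of "i + k"]] jm(6) Y.mul_lin(1)[OF d(1)] Y.mul_lin(1)[OF d(2)]
     cl ks M.smult_r_distr M.a_ac)
 next
  case (24 i k u v v')
  interpret M: module R "mY (i + k - 1)" by (rule Y.mod)
  have d: "i + k - 1 = i + (k - 1)" "i + k - 1 = i - 1 + k" by simp_all
  from 24 show ?case
   by (auto simp: C_def inj_q pml_def pad_def X.mul_lin[OF refl] Y.mul_lin[OF refl[of "i + k"]] Y.mul_lin(2)[OF d(1)] Y.mul_lin(2)[OF d(2)]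
     cl ks M.smult_r_distr M.a_ac)
 next
  case (25 i k u v c)
  interpret M: module R "mY (i + k - 1)" by (rule Y.mod)
  have d: "i + k - 1 = i + (k - 1)" "i + k - 1 = i - 1 + k" by simp_all
  have sw: "s *[mY (i + k - 1)] (c *[mY (i + k - 1)] x) = c *[mY (i + k - 1)] (s *[mY (i + k - 1)] x)"
   if "s\<in>carrier R" "x\<in>elts Y (i + k - 1)" for s x
   using that 25(3) M.smult_assoc1[of s c x] M.smult_assoc1[of c s x] R.m_comm[of s c] by simp
  from 25 show ?case
   by (auto simp: C_def inj_q pml_def psm_def X.mul_lin[OF refl] Y.mul_lin[OF refl[of "i + k"]] jm(7) Y.mul_lin(5)[OF d(1)] Y.mul_lin(5)[OF d(2)]
     cl ks M.smult_r_distr sw)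
 next
  case (26 i k u v c)
  interpret M: module R "mY (i + k - 1)" by (rule Y.mod)
  have d: "i + k - 1 = i + (k - 1)" "i + k - 1 = i - 1 + k" by simp_all
  have sw: "s *[mY (i + k - 1)] (c *[mY (i + k - 1)] x) = c *[mY (i + k - 1)] (s *[mY (i + k - 1)] x)"
   if "s\<in>carrier R" "x\<in>elts Y (i + k - 1)" for s x
   using that 26(3) M.smult_assoc1[of s c x] M.smult_assoc1[of c s x] R.m_comm[of s c] by simp
  from 26 show ?case
   by (auto simp: C_def inj_q pml_def psm_def X.mul_lin[OF refl] Y.mul_lin[OF refl[of "i + k"]] Y.mul_lin(6)[OF d(1)] Y.mul_lin(6)[OF d(2)]
     cl ks M.smult_r_distr sw)
 next
  case (27 i k l u v w)
  let ?N = "i + k + l - 1"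
  interpret M: module R "mY ?N" by (rule Y.mod)
  from 27 obtain a y z a' y' z' a'' y'' z'' where u: "u = (a, y, z)" "v = (a', y', z')" "w = (a'', y'', z'')" and
   c: "a\<in>elts X i" "y\<in>elts Y (i - 1)" "z\<in>elts Y i" "a'\<in>elts X k" "y'\<in>elts Y (k - 1)" "z'\<in>elts Y k"
   "a''\<in>elts X l" "y''\<in>elts Y (l - 1)" "z''\<in>elts Y l"
   by (auto simp: C_def)
  note jc = jm(5)[OF c(1)] jm(5)[OF c(4)] jm(5)[OF c(7)]
  have d: "?N = (i + k) + (l - 1)" "?N = (i + k - 1) + l" "?N = i + (k + l - 1)" "?N = (i - 1) + (k + l)" by simp_all
  have m1: "fmul R Y (i + k) (l - 1) (j (i + k) (fmul R X i k a a')) y'' = fmul R Y i (k + l - 1) (j i a) (fmul R Y k (l - 1) (j k a') y'')"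
   unfolding jmul(1)[OF c(1,4)] by (rule Y.mul_assoc[OF refl _ jc(1,2) c(8)]) simp
  have P: "fmul R Y i (k + l - 1) (j i a) (fmul R Y k (l - 1) (j k a') y'')\<in>elts Y ?N"
   "fmul R Y i (k + l - 1) (j i a) (fmul R Y (k - 1) l y' z'')\<in>elts Y ?N"
   "fmul R Y (i - 1) (k + l) y (fmul R Y k l z' z'')\<in>elts Y ?N"
   by (rule Y.mul_closed[OF d(3)] Y.mul_closed[OF d(4)]; use c jc mul_y[OF jc(2) c(8) c(5) c(9)] Y.alg(5) in simp)+
  \<comment> \<open>The path entry of associativity. Both sides expand into the same three products,
    and the signs match as the Koszul sign is multiplicative in the degree. The outer entries are
    associativity in \<open>X\<close> and \<open>Y\<close>.\<close>
  have "koszul_sign R (i + k) *[mY ?N] fmul R Y (i + k) (l - 1) (j (i + k) (fmul R X i k a a')) y'' +[mY ?N]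
    fmul R Y (i + k - 1) l (koszul_sign R i *[mY (i + k - 1)] fmul R Y i (k - 1) (j i a) y' +[mY (i + k - 1)] fmul R Y (i - 1) k y z') z'' =
   koszul_sign R i *[mY ?N] fmul R Y i (k + l - 1) (j i a)
    (koszul_sign R k *[mY (k + l - 1)] fmul R Y k (l - 1) (j k a') y'' +[mY (k + l - 1)] fmul R Y (k - 1) l y' z'') +[mY ?N]
    fmul R Y (i - 1) (k + l) y (fmul R Y k l z' z'')" (is "?L = ?Rh")
  proof -
   have t1: "fmul R Y (i + k - 1) l (koszul_sign R i *[mY (i + k - 1)] fmul R Y i (k - 1) (j i a) y' +[mY (i + k - 1)] fmul R Y (i - 1) k y z') z''
    = koszul_sign R i *[mY ?N] fmul R Y i (k + l - 1) (j i a) (fmul R Y (k - 1) l y' z'') +[mY ?N] fmul R Y (i - 1) (k + l) y (fmul R Y k l z' z'')"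
   proof -
    note mc = mul_y[OF jc(1) c(5) c(2) c(6)]
    have a1: "fmul R Y (i + k - 1) l (fmul R Y i (k - 1) (j i a) y') z'' = fmul R Y i (k + l - 1) (j i a) (fmul R Y (k - 1) l y' z'')"
     by (rule Y.mul_assoc[OF _ _ jc(1) c(5,9)]) simp_all
    have a2: "fmul R Y (i + k - 1) l (fmul R Y (i - 1) k y z') z'' = fmul R Y (i - 1) (k + l) y (fmul R Y k l z' z'')"
     by (rule Y.mul_assoc[OF _ _ c(2,6,9)]) simp_all
    show ?thesis using mc c(9) ks[of i] Y.alg(3)
     by (simp add: Y.mul_lin(1)[OF d(2)] Y.mul_lin(5)[OF d(2)] a1 a2)
   qed
   have t2: "fmul R Y i (k + l - 1) (j i a)
    (koszul_sign R k *[mY (k + l - 1)] fmul R Y k (l - 1) (j k a') y'' +[mY (k + l - 1)] fmul R Y (k - 1) l y' z'') =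
    koszul_sign R k *[mY ?N] fmul R Y i (k + l - 1) (j i a) (fmul R Y k (l - 1) (j k a') y'') +[mY ?N]
    fmul R Y i (k + l - 1) (j i a) (fmul R Y (k - 1) l y' z'')"
    using mul_y[OF jc(2) c(8) c(5) c(9)] jc(1) ks[of k] Y.alg(3)
    by (simp add: Y.mul_lin(2)[OF d(3)] Y.mul_lin(6)[OF d(3)])
   show ?thesis unfolding t1 t2 m1 kss(4) using P ks
    by (simp add: M.smult_r_distr M.smult_assoc1 M.a_assoc)
  qed
  moreover have "fmul R X (i + k) l (fmul R X i k a a') a'' = fmul R X i (k + l) a (fmul R X k l a' a'')"
   "fmul R Y (i + k) l (fmul R Y i k z z') z'' = fmul R Y i (k + l) z (fmul R Y k l z' z'')"
   using c X.laws(6) Y.laws(6) by blast+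
  moreover have "i + (k + l) - 1 = ?N" by simp
  ultimately show ?case by (simp only: u inj_q pml_def prod.case)
 next
  case (28 n u)
  interpret M: module R "mY (n - 1)" by (rule Y.mod)
  have o: "j 0 (fone R X) = fone R Y" by (rule jmul(2))
  have z: "fmul R Y (- 1) n \<zero>[mY (- 1)] z = \<zero>[mY (n - 1)]" if "z\<in>elts Y n" for z
   by (rule mod_hom_zero[OF Y.mod Y.mod Y.mul_homs(1)[OF _ that]]) simp
  from 28 show ?case using ks[of 0]
   by (auto simp: C_def inj_q pml_def pun_def X.laws(8) Y.laws(8) o z) (simp add: koszul_sign_def)
 next
  case (29 n u)
  interpret M: module R "mY (n - 1)" by (rule Y.mod)
  have z: "fmul R Y n (- 1) a \<zero>[mY (- 1)] = \<zero>[mY (n - 1)]" if "a\<in>elts Y n" for a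
   by (rule mod_hom_zero[OF Y.mod Y.mod Y.mul_homs(2)[OF _ that]]) simp
  from 29 show ?case using ks[of n] jm(5)
   by (auto simp: C_def inj_q pml_def pun_def X.laws(9) Y.laws(9) z)
 next
  case (30 i k u v)
  let ?N = "i + k"
  interpret M: module R "mY ?N" by (rule Y.mod)
  from 30 obtain a y z a' y' z' where u: "u = (a, y, z)" "v = (a', y', z')" and
   c: "a\<in>elts X i" "y\<in>elts Y (i - 1)" "z\<in>elts Y i" "a'\<in>elts X k" "y'\<in>elts Y (k - 1)" "z'\<in>elts Y k"
   by (auto simp: C_def)
  note jc = jm(5)[OF c(1)] jm(5)[OF c(4)]
  note dc = df_pred[OF Y.fcY c(2)] df_pred[OF Y.fcY c(5)] Y.alg(4)[OF c(6)] Y.alg(4)[OF jc(1)]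
  let ?P1 = "fmul R Y i k z z'" and ?P2 = "fmul R Y i k (j i a) (j k a')" and ?P3 = "fmul R Y (i + 1) (k - 1) (df (cx Y) i (j i a)) y'"
   and ?P4 = "fmul R Y i k (j i a) (df (cx Y) (k - 1) y')" and ?P5 = "fmul R Y i k (df (cx Y) (i - 1) y) z'"
   and ?P6 = "fmul R Y (i - 1) (k + 1) y (df (cx Y) k z')" and ?P7 = "fmul R Y i k (j i a) z'"
  let ?s = "koszul_sign R i"
  have P: "?P1\<in>elts Y ?N" "?P2\<in>elts Y ?N" "?P3\<in>elts Y ?N" "?P4\<in>elts Y ?N" "?P5\<in>elts Y ?N" "?P6\<in>elts Y ?N" "?P7\<in>elts Y ?N"
   using c jc dc by (simp_all add: Y.mul_closed)
  have L1: "df (cx Y) (i + k - 1) (fmul R Y i (k - 1) (j i a) y') = ?P3 +[mY ?N] ?s *[mY ?N] ?P4"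
   by (rule Y.leibniz[OF _ _ _ _ jc(1) c(5)]) simp_all
  have L2: "df (cx Y) (i + k - 1) (fmul R Y (i - 1) k y z') = ?P5 +[mY ?N] (\<ominus>[R] ?s) *[mY ?N] ?P6"
   unfolding kss(2)[symmetric] by (rule Y.leibniz[OF _ _ _ _ c(2,6)]) simp_all
  note mc = mul_y[OF jc(1) c(5) c(2) c(6)]
  \<comment> \<open>The path entry of the Leibniz rule: \<open>L1\<close> and \<open>L2\<close>
    expand the differential of a product, after which \<open>leibniz_sum\<close> rearranges the
    terms.\<close>
  have "fmul R Y i k z z' -[mY ?N] (j ?N (fmul R X i k a a') +[mY ?N]
    df (cx Y) (?N - 1) (?s *[mY (?N - 1)] fmul R Y i (k - 1) (j i a) y' +[mY (?N - 1)] fmul R Y (i - 1) k y z')) =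
   ?P1 -[mY ?N] (?P2 +[mY ?N] (?s *[mY ?N] (?P3 +[mY ?N] ?s *[mY ?N] ?P4) +[mY ?N] (?P5 +[mY ?N] (\<ominus>[R] ?s) *[mY ?N] ?P6)))"
   using mc ks Y.alg(3) by (simp add: jmul(1)[OF c(1,4)] Y.df_pred_lin L1 L2)
  also have "\<dots> = ((\<ominus>[R] ?s) *[mY ?N] ?P3 +[mY ?N] (?P1 -[mY ?N] (?P7 +[mY ?N] ?P5))) +[mY ?N]
   ?s *[mY ?N] (?s *[mY ?N] (?P7 -[mY ?N] (?P2 +[mY ?N] ?P4)) +[mY ?N] ?P6)"
   by (rule M.leibniz_sum[OF P kss(5)])
  also have "\<dots> = (koszul_sign R (i + 1) *[mY ?N] fmul R Y (i + 1) (k - 1) (j (i + 1) (df (cx X) i a)) y' +[mY ?N]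
    fmul R Y i k (z -[mY i] (j i a +[mY i] df (cx Y) (i - 1) y)) z') +[mY ?N]
   ?s *[mY ?N] (?s *[mY ?N] fmul R Y i k (j i a) (z' -[mY k] (j k a' +[mY k] df (cx Y) (k - 1) y')) +[mY ?N] ?P6)"
   using c jc dc by (simp add: jm(3) kss(1) Y.mul_lin[OF refl[of "i + k"]] Y.alg(1))
  finally have "fmul R Y i k z z' -[mY ?N] (j ?N (fmul R X i k a a') +[mY ?N]
    df (cx Y) (?N - 1) (?s *[mY (?N - 1)] fmul R Y i (k - 1) (j i a) y' +[mY (?N - 1)] fmul R Y (i - 1) k y z')) = \<dots>" .
  moreover note X.laws(10)[OF c(1,4)] Y.laws(10)[OF c(3,6)]
  moreover have "i + 1 - 1 = i" "k + 1 - 1 = k" "i + 1 + k - 1 = ?N" "i + (k + 1) - 1 = ?N" "i + k + 1 - 1 = ?N" by simp_all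
  ultimately show ?case by (simp only: u inj_q pml_def pdd_def pad_def psm_def prod.case)
 next
  case (31 p n) show ?case
   using fcxD(8)[OF X.fcY] fcxD(8)[OF Y.fcY] by (auto simp: PF_def C_def)
 next
  case (32 p n) show ?case by (simp add: PF_def pze_def fil_alg(1)[OF X.fcY] fil_alg(1)[OF Y.fcY])
 next
  case (33 p n x y) then show ?case by (auto simp: PF_def pad_def fil_alg(2)[OF X.fcY] fil_alg(2)[OF Y.fcY])
 next
  case (34 p n c x) then show ?case by (auto simp: PF_def psm_def fil_alg(5)[OF X.fcY] fil_alg(5)[OF Y.fcY])
 next
  case (35 p n) show ?case
   using fil_subset[OF X.fcY, of p "p + 1"] fil_subset[OF Y.fcY, of p "p + 1"] fil_subset[OF Y.fcY, of "p + int r" "p + 1 + int r"]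
   by (auto simp: PF_def)
 next
  case (36 p n x)
  then obtain a y z where u: "x = (a, y, z)" and
   c: "a\<in>fil (cx X) p n" "y\<in>fil (cx Y) (p + int r) (n - 1)" "z\<in>fil (cx Y) p n" by (auto simp: PF_def)
  have "df (cx Y) (n - 1) y\<in>fil (cx Y) (p + int r) n" using fcxD(7)[OF Y.fcY c(2)] by simp
  \<comment> \<open>The path entry of the differential has to lie in filtration
    \<open>p + r\<close>. Both ends of the path lie in filtration \<open>p\<close>, which is
    contained in it.\<close>
  moreover have "z\<in>fil (cx Y) (p + int r) n" by (rule fil_subset[OF Y.fcY _ c(3)]) simp
  moreover have "j n a\<in>fil (cx Y) (p + int r) n" by (rule fil_subset[OF Y.fcY _ jm(4)[OF c(1)]]) simp
  ultimately show ?case using c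
   by (simp add: u PF_def pdd_def fil_alg(2,3)[OF Y.fcY] fcxD(7)[OF X.fcY] fcxD(7)[OF Y.fcY])
 next
  case (37 p p' i k x y)
  then obtain a b z a' b' z' where u: "x = (a, b, z)" "y = (a', b', z')" and
   c: "a\<in>fil (cx X) p i" "b\<in>fil (cx Y) (p + int r) (i - 1)" "z\<in>fil (cx Y) p i"
    "a'\<in>fil (cx X) p' k" "b'\<in>fil (cx Y) (p' + int r) (k - 1)" "z'\<in>fil (cx Y) p' k" by (auto simp: PF_def)
  have "fmul R Y i (k - 1) (j i a) b'\<in>fil (cx Y) (p + (p' + int r)) (i + (k - 1))" by (rule Y.laws(11)[OF jm(4)[OF c(1)] c(5)])
  then have 1: "fmul R Y i (k - 1) (j i a) b'\<in>fil (cx Y) (p + p' + int r) (i + k - 1)" by (simp add: algebra_simps)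
  have "fmul R Y (i - 1) k b z'\<in>fil (cx Y) (p + int r + p') (i - 1 + k)" by (rule Y.laws(11)[OF c(2,6)])
  then have 2: "fmul R Y (i - 1) k b z'\<in>fil (cx Y) (p + p' + int r) (i + k - 1)" by (simp add: algebra_simps)
  show ?case using 1 2 c ks
   by (simp add: u PF_def pml_def fil_alg(2,5)[OF Y.fcY] X.laws(11) Y.laws(11))
 next
  case 38 show ?case by (simp add: PF_def pun_def fil_alg(1)[OF Y.fcY] X.laws(7) Y.laws(7))
 qed
qed

sublocale P: raw_dga R C q pad pze psm pdd pml pun PF
 by (rule raw)

abbreviation N where "N \<equiv> P.algebra"

definition left :: "int => 'u => 'u" where "left n = (\<lambda>x\<in>elts N n. fst (inv_into (C n) (q n) x))"
definition right :: "int => 'u => 'u" where "right n = (\<lambda>x\<in>elts N n. snd (snd (inv_into (C n) (q n) x)))"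
definition const :: "int => 'u => 'u" where "const n = (\<lambda>a\<in>elts X n. q n (a, \<zero>[mY (n - 1)], j n a))"

lemma inv_q: "u\<in>C n==>inv_into (C n) (q n) (q n u) = u"
 by (rule inv_into_f_f) (auto simp: inj_on_def inj_q)

lemma left_right: "(a, y, z)\<in>C n==>left n (q n (a, y, z)) = a" "(a, y, z)\<in>C n==>right n (q n (a, y, z)) = z"
 by (simp_all add: left_def right_def P.presented(2) inv_q)

lemma q_fil: "u\<in>C n==>q n u\<in>fil (cx N) p n \<longleftrightarrow> u\<in>PF p n"
 by (auto simp: P.presented inj_q)

lemma elts_cases:
 assumes "x\<in>elts N n"
 obtains a y z where "x = q n (a, y, z)" "(a, y, z)\<in>C n"
 using assms by (auto simp: P.presented)

lemma left_map: "dgmap R N X left"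
 unfolding fdga_map_iff[OF Y.cring P.presented(1) X.Y] is_fmap_def mod_hom_def
proof (intro conjI allI ballI IntI CollectI funcsetI)
 fix n show "left n\<in>extensional (elts N n)" by (simp add: left_def)
 show "left 0 (fone R N) = fone R X"
  unfolding P.presented(8) using P.closed(6) left_right[of "fone R X" "\<zero>[mY (- 1)]" "fone R Y" 0] by (simp only: pun_def)
 fix p show "left n ` fil (cx N) p n \<subseteq> fil (cx X) p n"
 proof (rule image_subsetI)
  fix x assume "x\<in>fil (cx N) p n"
  then obtain u where u: "u\<in>PF p n" "x = q n u" by (auto simp: P.presented(9))
  with P.filt(1) have "u\<in>C n" by blast
  with u show "left n x\<in>fil (cx X) p n" by (cases u) (simp add: left_right PF_def)
 qed
next
 fix n x assume "x\<in>elts N n"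
 then obtain a y z where x: "x = q n (a, y, z)" "(a, y, z)\<in>C n" by (rule elts_cases)
 show "left n x\<in>elts X n" using x by (simp add: left_right) (simp add: C_def)
 show "left (n + 1) (df (cx N) n x) = df (cx X) n (left n x)"
  using x P.closed(4)[OF x(2)] by (simp add: P.presented(6) left_right pdd_def)
 { fix c assume c: "c\<in>carrier R"
  show "left n (c *[md (cx N) n] x) = c *[mX n] left n x"
   using x P.closed(3)[OF c x(2)] c by (simp add: P.presented(5) left_right psm_def) }
 fix x' assume "x'\<in>elts N n"
 then obtain a' y' z' where x': "x' = q n (a', y', z')" "(a', y', z')\<in>C n" by (rule elts_cases)
 show "left n (x +[md (cx N) n] x') = left n x +[mX n] left n x'"
  using x x' P.closed(1)[OF x(2) x'(2)] by (simp add: P.presented(4) left_right pad_def)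
next
 fix i k x x' assume "x\<in>elts N i" "x'\<in>elts N k"
 then obtain a y z a' y' z' where x: "x = q i (a, y, z)" "(a, y, z)\<in>C i" and x': "x' = q k (a', y', z')" "(a', y', z')\<in>C k"
  by (meson elts_cases)
 show "left (i + k) (fmul R N i k x x') = fmul R X i k (left i x) (left k x')"
  using x x' P.closed(5)[OF x(2) x'(2)] by (simp add: P.presented(7) left_right pml_def)
qed

lemma right_map: "dgmap R N Y right"
 unfolding fdga_map_iff[OF Y.cring P.presented(1) Y.Y] is_fmap_def mod_hom_def
proof (intro conjI allI ballI IntI CollectI funcsetI)
 fix n show "right n\<in>extensional (elts N n)" by (simp add: right_def)
 show "right 0 (fone R N) = fone R Y"
  unfolding P.presented(8) using P.closed(6) left_right[of "fone R X" "\<zero>[mY (- 1)]" "fone R Y" 0] by (simp only: pun_def)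
 fix p show "right n ` fil (cx N) p n \<subseteq> fil (cx Y) p n"
 proof (rule image_subsetI)
  fix x assume "x\<in>fil (cx N) p n"
  then obtain u where u: "u\<in>PF p n" "x = q n u" by (auto simp: P.presented(9))
  with P.filt(1) have "u\<in>C n" by blast
  with u show "right n x\<in>fil (cx Y) p n" by (cases u) (simp add: left_right PF_def)
 qed
next
 fix n x assume "x\<in>elts N n"
 then obtain a y z where x: "x = q n (a, y, z)" "(a, y, z)\<in>C n" by (rule elts_cases)
 show "right n x\<in>elts Y n" using x by (simp add: left_right) (simp add: C_def)
 show "right (n + 1) (df (cx N) n x) = df (cx Y) n (right n x)"
  using x P.closed(4)[OF x(2)] by (simp add: P.presented(6) left_right pdd_def)
 { fix c assume c: "c\<in>carrier R"
  show "right n (c *[md (cx N) n] x) = c *[mY n] right n x"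
   using x P.closed(3)[OF c x(2)] c by (simp add: P.presented(5) left_right psm_def) }
 fix x' assume "x'\<in>elts N n"
 then obtain a' y' z' where x': "x' = q n (a', y', z')" "(a', y', z')\<in>C n" by (rule elts_cases)
 show "right n (x +[md (cx N) n] x') = right n x +[mY n] right n x'"
  using x x' P.closed(1)[OF x(2) x'(2)] by (simp add: P.presented(4) left_right pad_def)
next
 fix i k x x' assume "x\<in>elts N i" "x'\<in>elts N k"
 then obtain a y z a' y' z' where x: "x = q i (a, y, z)" "(a, y, z)\<in>C i" and x': "x' = q k (a', y', z')" "(a', y', z')\<in>C k"
  by (meson elts_cases)
 show "right (i + k) (fmul R N i k x x') = fmul R Y i k (right i x) (right k x')"
  using x x' P.closed(5)[OF x(2) x'(2)] by (simp add: P.presented(7) left_right pml_def)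
qed

lemma const_C: "a\<in>elts X n==>(a, \<zero>[mY (n - 1)], j n a)\<in>C n"
 by (simp add: C_def Y.alg(2) jm(5))

lemma const_map: "dgmap R X N const"
 unfolding fdga_map_iff[OF Y.cring X.Y P.presented(1)] is_fmap_def mod_hom_def
proof (intro conjI allI ballI IntI CollectI funcsetI)
 fix n show "const n\<in>extensional (elts X n)" by (simp add: const_def)
 show "const 0 (fone R X) = fone R N"
  unfolding P.presented(8) by (simp add: const_def X.alg(6) pun_def jmul(2))
 fix p show "const n ` fil (cx X) p n \<subseteq> fil (cx N) p n"
 proof (rule image_subsetI)
  fix a assume a: "a\<in>fil (cx X) p n"
  note ac = fcxD(8)[OF X.fcY a]
  show "const n a\<in>fil (cx N) p n"
   using a q_fil[OF const_C[OF ac]] by (simp add: const_def ac PF_def fil_alg(1)[OF Y.fcY] jm(4))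
 qed
next
 fix n a assume a: "a\<in>elts X n"
 interpret Mn: module R "mY n" by (rule Y.mod)
 interpret Mp: module R "mY (n - 1)" by (rule Y.mod)
 show "const n a\<in>elts N n" using a const_C by (simp add: const_def P.presented(2))
 have "df (cx Y) (n - 1) \<zero>[mY (n - 1)] = \<zero>[mY n]" using df_zero[OF Y.fcY, of "n - 1"] by simp
 then show "const (n + 1) (df (cx X) n a) = df (cx N) n (const n a)"
  using a jm(5)[OF a] by (simp add: const_def X.alg(4) P.presented(6)[OF const_C] pdd_def jm(3) diff_self[OF Y.mod])
 { fix c assume c: "c\<in>carrier R"
  show "const n (c *[mX n] a) = c *[md (cx N) n] const n a"
   using a c by (simp add: const_def X.alg(3) P.presented(5)[OF _ const_C] psm_def jm(7)) }
 fix a' assume a': "a'\<in>elts X n"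
 show "const n (a +[mX n] a') = const n a +[md (cx N) n] const n a'"
  using a a' by (simp add: const_def X.alg(1) P.presented(4)[OF const_C const_C] pad_def jm(6))
next
 fix i k a a' assume a: "a\<in>elts X i" "a'\<in>elts X k"
 interpret M: module R "mY (i + k - 1)" by (rule Y.mod)
 have "fmul R Y i (k - 1) (j i a) \<zero>[mY (k - 1)] = \<zero>[mY (i + k - 1)]"
  by (rule mod_hom_zero[OF Y.mod Y.mod Y.mul_homs(2)[OF _ jm(5)[OF a(1)]]]) simp
 moreover have "fmul R Y (i - 1) k \<zero>[mY (i - 1)] (j k a') = \<zero>[mY (i + k - 1)]"
  by (rule mod_hom_zero[OF Y.mod Y.mod Y.mul_homs(1)[OF _ jm(5)[OF a(2)]]]) simp
 ultimately show "const (i + k) (fmul R X i k a a') = fmul R N i k (const i a) (const k a')"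
  using a ks[of i] by (simp add: const_def X.alg(5) P.presented(7)[OF const_C const_C] pml_def jmul(1))
qed

lemma left_const: "a\<in>elts X n==>left n (const n a) = a"
 and right_const: "a\<in>elts X n==>right n (const n a) = j n a"
 by (simp_all add: const_def left_right const_C)

text \<open>The triple with path and left end zero lifts \<open>z\<close>. Its differential has
  \<open>z\<close> as path entry, where filtration \<open>p - s + r\<close> is required; this
  contains filtration \<open>p\<close> since \<open>s \<le> r\<close>.\<close>

lemma right_onto:
 assumes "S \<subseteq> {0..r}" shows "cycle_onto S (cx N) (cx Y) right"
 unfolding cycle_onto_def
proof (intro ballI allI)
 fix s p n z assume s: "s\<in>S" and z: "z\<in>cycles (cx Y) s p n"
 note zc = cycles_elts[OF Y.fcY z]
 let ?u = "(\<zero>[mX n], \<zero>[mY (n - 1)], z)"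
 interpret Mn: module R "mY n" by (rule Y.mod)
 have u: "?u\<in>C n" using zc by (simp add: C_def X.alg(2) Y.alg(2))
 have "df (cx Y) (n - 1) \<zero>[mY (n - 1)] = \<zero>[mY n]" using df_zero[OF Y.fcY, of "n - 1"] by simp
 moreover have "z -[mY n] \<zero>[mY n] = z"
  using diff_cancel(1)[OF Y.mod zc Y.alg(2)] zc by (simp add: a_minus_def)
 ultimately have d: "pdd n ?u = (\<zero>[mX (n + 1)], z, df (cx Y) n z)"
  by (simp add: pdd_def df_zero[OF X.fcY] fmap_zero[OF X.fcY Y.fcY map_fmap[OF j]])
 have "s \<le> r" using s assms by auto
 then have "z\<in>fil (cx Y) (p - int s + int r) n" using z by (rule_tac fil_subset[OF Y.fcY, of p]) (simp_all add: cycles_iff)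
 then have "q n ?u\<in>cycles (cx N) s p n"
  using z q_fil[OF P.closed(4)[OF u], of "p - int s"]
  by (simp add: cycles_iff q_fil[OF u] P.presented(6)[OF u] d PF_def fil_alg(1)[OF X.fcY] fil_alg(1)[OF Y.fcY])
 then show "\<exists>x\<in>cycles (cx N) s p n. right n x = z" using left_right(2)[OF u] by blast
qed

text \<open>The ends of a path differ by \<open>d y\<close> and the path entry \<open>?w\<close> of
  the differential. For an \<open>r + 1\<close>-cycle these are the two summands of a boundary on
  the page \<open>r + 1\<close>.\<close>

lemma homotopic:
 assumes b: "b\<in>cycles (cx N) (r + 1) p n"
 shows "right n b -[mY n] j n (left n b)\<in>boundaries (cx Y) (r + 1) p n"
proof -
 have "b\<in>elts N n" by (rule cycles_elts[OF fdgaD(1)[OF Y.cring P.presented(1)] b])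
 then obtain a y z where x: "b = q n (a, y, z)" "(a, y, z)\<in>C n" by (rule elts_cases)
 then have c: "a\<in>elts X n" "y\<in>elts Y (n - 1)" "z\<in>elts Y n" by (simp_all add: C_def)
 interpret Mn: module R "mY n" by (rule Y.mod)
 note jc = jm(5)[OF c(1)] and dy = df_pred[OF Y.fcY c(2)]
 let ?w = "z -[mY n] (j n a +[mY n] df (cx Y) (n - 1) y)"
 have 1: "a\<in>fil (cx X) p n" "y\<in>fil (cx Y) (p + int r) (n - 1)" "z\<in>fil (cx Y) p n"
  using b q_fil[OF x(2)] by (simp_all add: cycles_iff x(1) PF_def)
 \<comment> \<open>The path entry of the differential lies in filtration
   \<open>p - (r + 1) + r\<close>, which is \<open>p - 1\<close>, as needed for the second summand
   of a boundary.\<close>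
 have e: "p - int (r + 1) = p - 1 - int r" "p - 1 - int r + int r = p - 1" by simp_all
 have "pdd n (a, y, z)\<in>PF (p - 1 - int r) (n + 1)"
  unfolding e(1)[symmetric] using b q_fil[OF P.closed(4)[OF x(2)]] by (simp add: cycles_iff x(1) P.presented(6)[OF x(2)])
 then have 2: "df (cx X) n a\<in>fil (cx X) (p - 1 - int r) (n + 1)" "?w\<in>fil (cx Y) (p - 1) n" "df (cx Y) n z\<in>fil (cx Y) (p - 1 - int r) (n + 1)"
  unfolding pdd_def PF_def e(2) prod.case mem_Times_iff fst_conv snd_conv add_diff_cancel_right' by blast+
 have wc: "?w\<in>elts Y n" by (rule fcxD(8)[OF Y.fcY 2(2)])
 have dw: "df (cx Y) n ?w = df (cx Y) n z -[mY (n + 1)] j (n + 1) (df (cx X) n a)"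
 proof -
  interpret M1: module R "mY (n + 1)" by (rule Y.mod)
  show ?thesis using c jc dy
   by (simp add: mod_hom_diff[OF Y.mod Y.mod fcxD(2)[OF Y.fcY]] Y.alg(15,4) df_df_pred[OF Y.fcY] jm(3))
 qed
 have w: "?w\<in>cycles (cx Y) r (p - 1) n"
  unfolding cycles_iff dw using 2 fil_alg(3)[OF Y.fcY 2(3) jm(4)[OF 2(1)]] by simp
 have e: "z -[mY n] j n a = df (cx Y) (n - 1) y +[mY n] ?w"
  using c jc dy by (simp add: a_minus_def Mn.minus_add Mn.a_ac Mn.r_neg1 Mn.r_neg2 Mn.cancel_gap)
 \<comment> \<open>Solving for \<open>d y\<close> shows that it lies in filtration \<open>p\<close>.
   Hence \<open>y\<close>, which has filtration \<open>p + r\<close>, is an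
   \<open>r\<close>-cycle.\<close>
 have "df (cx Y) (n - 1) y = (z -[mY n] j n a) -[mY n] ?w"
  unfolding e using diff_cancel(2)[OF Y.mod dy wc] Mn.a_comm[OF dy wc] by simp
 moreover have "(z -[mY n] j n a) -[mY n] ?w\<in>fil (cx Y) p n"
  by (rule fil_alg(3)[OF Y.fcY fil_alg(3)[OF Y.fcY 1(3) jm(4)[OF 1(1)]] fil_subset[OF Y.fcY _ 2(2)]]) simp
 ultimately have "y\<in>cycles (cx Y) r (p + int r) (n - 1)" using 1(2) by (simp add: cycles_iff)
 then have "z -[mY n] j n a\<in>boundaries (cx Y) (r + 1) p n" unfolding boundaries_iff e using w by blast
 then show ?thesis by (simp add: x(1) left_right[OF x(2)])
qed

end

section \<open>Lifting properties\<close>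

lemma has_liftingD:
 assumes "has_lifting C i p" "u\<in>hom_set C (src C i) (src C p)" "v\<in>hom_set C (tgt C i) (tgt C p)" "cmp C p u = cmp C v i"
 obtains h where "h\<in>hom_set C (tgt C i) (src C p)" "cmp C h i = u" "cmp C p h = v"
 using assms unfolding has_lifting_def by blast

definition llp :: "('o, 'm) category => 'm set => 'm set" where
 "llp C K = {i\<in>arrs C. \<forall>p\<in>K. has_lifting C i p}"

lemma hom_setD: "f\<in>hom_set C X Y==>f\<in>arrs C" "f\<in>hom_set C X Y==>src C f = X" "f\<in>hom_set C X Y==>tgt C f = Y"
 by (simp_all add: hom_set_def)

lemma llp_subcategory:
 assumes C: "is_category C" and K: "K \<subseteq> arrs C"
 shows "wide_subcategory C (llp C K)"
 unfolding wide_subcategory_def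
proof (intro conjI ballI impI)
 show "llp C K \<subseteq> arrs C" by (auto simp: llp_def)
 note D = categoryD[OF C]
 { fix X assume X: "X\<in>objs C"
  note i = D(2)[OF X]
  have "has_lifting C (ident C X) p" if p: "p\<in>K" for p
   unfolding has_lifting_def hom_setD(2,3)[OF i]
  proof (intro ballI impI)
   fix u v assume u: "u\<in>hom_set C X (src C p)" and v: "v\<in>hom_set C X (tgt C p)" and e: "cmp C p u = cmp C v (ident C X)"
   have "cmp C p u = v" using e D(3)[OF v] by simp
   then show "\<exists>h\<in>hom_set C X (src C p). cmp C h (ident C X) = u & cmp C p h = v" using u D(3)[OF u] by blast
  qed
  then show "ident C X\<in>llp C K" using hom_setD(1)[OF i] by (simp add: llp_def) }
 fix f g assume f: "f\<in>llp C K" and g: "g\<in>llp C K" and gf: "src C g = tgt C f"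
 then have fa: "f\<in>hom_set C (src C f) (tgt C f)" and ga: "g\<in>hom_set C (tgt C f) (tgt C g)"
  by (simp_all add: llp_def hom_set_def)
 note c = D(1)[OF fa ga]
 have "has_lifting C (cmp C g f) p" if p: "p\<in>K" for p
  unfolding has_lifting_def hom_setD(2,3)[OF c]
 proof (intro ballI impI)
  fix u v assume u: "u\<in>hom_set C (src C f) (src C p)" and v: "v\<in>hom_set C (tgt C g) (tgt C p)" and e: "cmp C p u = cmp C v (cmp C g f)"
  have pa: "p\<in>hom_set C (src C p) (tgt C p)" using K p by (auto simp: hom_set_def)
  have lf: "has_lifting C f p" "has_lifting C g p" using f g p by (simp_all add: llp_def)
  obtain k where k: "k\<in>hom_set C (tgt C f) (src C p)" "cmp C k f = u" "cmp C p k = cmp C v g"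
   by (rule has_liftingD[OF lf(1) u D(1)[OF ga v]]) (use e D(5)[OF fa ga v] in simp)
  obtain h where h: "h\<in>hom_set C (tgt C g) (src C p)" "cmp C h g = k" "cmp C p h = v"
   using has_liftingD[OF lf(2)] k v gf by metis
  show "\<exists>h\<in>hom_set C (tgt C g) (src C p). cmp C h (cmp C g f) = u & cmp C p h = v"
   using h k D(5)[OF fa ga h(1)] by auto
 qed
 then show "cmp C g f\<in>llp C K" using hom_setD(1)[OF c] by (simp add: llp_def)
qed

lemma llp_retract:
 assumes C: "is_category C" and K: "K \<subseteq> arrs C"
 shows "retract_closed C (llp C K)"
 unfolding retract_closed_def
proof (intro allI impI, elim conjE)
 note D = categoryD[OF C]
 fix f g assume g: "g\<in>llp C K" and fg: "is_retract C f g"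
 then obtain s t s' t' where st: "s\<in>hom_set C (src C f) (src C g)" "t\<in>hom_set C (src C g) (src C f)"
  "s'\<in>hom_set C (tgt C f) (tgt C g)" "t'\<in>hom_set C (tgt C g) (tgt C f)"
  and e: "cmp C t s = ident C (src C f)" "cmp C t' s' = ident C (tgt C f)" "cmp C g s = cmp C s' f" "cmp C f t = cmp C t' g"
  and a: "f\<in>arrs C" "g\<in>arrs C"
  unfolding is_retract_def by blast
 note fa = D(7)[OF a(1)] and ga = D(7)[OF a(2)]
 have "has_lifting C f p" if p: "p\<in>K" for p
  unfolding has_lifting_def
 proof (intro ballI impI)
  fix u v assume u: "u\<in>hom_set C (src C f) (src C p)" and v: "v\<in>hom_set C (tgt C f) (tgt C p)" and c: "cmp C p u = cmp C v f"
  have pa: "p\<in>hom_set C (src C p) (tgt C p)" using K p by (auto simp: hom_set_def)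
  have l: "has_lifting C g p" using g p by (simp add: llp_def)
  have "cmp C p (cmp C u t) = cmp C (cmp C v t') g"
   using D(5)[OF st(2) u pa] D(5)[OF st(2) fa v] D(5)[OF ga st(4) v] c e(4) by simp
  then obtain h where h: "h\<in>hom_set C (tgt C g) (src C p)" "cmp C h g = cmp C u t" "cmp C p h = cmp C v t'"
   using has_liftingD[OF l D(1)[OF st(2) u] D(1)[OF st(4) v]] by blast
  have "cmp C (cmp C h s') f = u"
   using D(5)[OF fa st(3) h(1)] D(5)[OF st(1) ga h(1)] D(5)[OF st(1,2) u] D(3)[OF u] h(2) e(1,3) by simp
  moreover have "cmp C p (cmp C h s') = v" using D(5)[OF st(3) h(1) pa] D(5)[OF st(3,4) v] D(3)[OF v] h(3) e(2) by simp
  ultimately show "\<exists>h\<in>hom_set C (tgt C f) (src C p). cmp C h f = u & cmp C p h = v"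
   using D(1)[OF st(3) h(1)] by blast
 qed
 then show "f\<in>llp C K" using a by (simp add: llp_def)
qed

text \<open>The retract argument: a filler of the square formed by \<open>j\<close> and the identity
  exhibits \<open>i\<close> as a retract of \<open>j\<close>.\<close>

lemma llp_retract_argument:
 assumes C: "is_category C" and K: "K \<subseteq> arrs C" and i: "i\<in>arrs C" and j: "j\<in>llp C K" and q: "q\<in>arrs C"
  and s: "src C j = src C i" "src C q = tgt C j" "tgt C q = tgt C i" and e: "cmp C q j = i" and l: "has_lifting C i q"
 shows "i\<in>llp C K"
proof -
 note D = categoryD[OF C]
 have ja: "j\<in>hom_set C (src C i) (tgt C j)" using j s by (simp add: hom_set_def llp_def)
 have qa: "q\<in>hom_set C (tgt C j) (tgt C i)" using q s by (simp add: hom_set_def)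
 note ia = D(7)[OF i]
 have o: "src C i\<in>objs C" "tgt C i\<in>objs C" using D(6)[OF ia] by auto
 obtain h where h: "h\<in>hom_set C (tgt C i) (tgt C j)" "cmp C h i = j" "cmp C q h = ident C (tgt C i)"
  using has_liftingD[OF l, of j "ident C (tgt C i)"] ja D(2)[OF o(2)] s e D(4)[OF ia] by auto
 have "is_retract C i j" unfolding is_retract_def
  using i j h qa D(2)[OF o(1)] D(3)[OF D(2)[OF o(1)]] D(3)[OF ja] D(3)[OF ia] e s ja
  by (intro conjI bexI[of _ "ident C (src C i)"] bexI[of _ h] bexI[of _ q]) (simp_all add: llp_def)
 then show ?thesis using llp_retract[OF C K] j unfolding retract_closed_def by blast
qed

lemma square_apply:
 assumes "cmpD R v f = cmpD R g u" "asrc u = asrc f" "x\<in>elts (asrc f) n"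
 shows "afun v n (afun f n x) = afun g n (afun u n x)"
 using assms cmp_apply(1)[of x f n R v] cmp_apply(1)[of x u n R g] by simp

text \<open>Strips arrows down to the underlying functions, so that squares and fillers become
  pointwise equations.\<close>

lemma lifting_fDGA_iff:
 assumes R: "cring R" and i: "i\<in>arrs (fDGA R)" and p: "p\<in>arrs (fDGA R)"
 shows "has_lifting (fDGA R) i p \<longleftrightarrow> (\<forall>u v. dgmap R (asrc i) (asrc p) u \<longrightarrow> dgmap R (atgt i) (atgt p) v \<longrightarrow>
  (\<forall>n. \<forall>x\<in>elts (asrc i) n. afun p n (u n x) = v n (afun i n x)) \<longrightarrow>
  (\<exists>h. dgmap R (atgt i) (asrc p) h & (\<forall>n. \<forall>x\<in>elts (asrc i) n. h n (afun i n x) = u n x) &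
   (\<forall>n. \<forall>z\<in>elts (atgt i) n. afun p n (h n z) = v n z)))" (is "?L \<longleftrightarrow> ?E")
proof
 note D = categoryD[OF category_fDGA[OF R]]
 note ia = D(7)[OF i, unfolded fDGA_simps] and pa = D(7)[OF p, unfolded fDGA_simps]
 note ob = i[unfolded arr_fDGA] p[unfolded arr_fDGA]
 { assume l: ?L
  show ?E
  proof (intro allI impI)
   fix u v assume u: "dgmap R (asrc i) (asrc p) u" and v: "dgmap R (atgt i) (atgt p) v"
    and c: "\<forall>n. \<forall>x\<in>elts (asrc i) n. afun p n (u n x) = v n (afun i n x)"
   have ua: "Arrow (asrc i) (asrc p) u\<in>homD R (asrc i) (asrc p)"
    and va: "Arrow (atgt i) (atgt p) v\<in>homD R (atgt i) (atgt p)" using u v ob by (simp_all add: hom_fDGA)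
   have "cmpD R p (Arrow (asrc i) (asrc p) u) = cmpD R (Arrow (atgt i) (atgt p) v) i"
    by (rule hom_fDGA_eqI[OF D(1)[OF ua pa] D(1)[OF ia va]]) (use c in \<open>simp add: cmp_apply\<close>)
   with l ua va obtain h where h: "h\<in>homD R (atgt i) (asrc p)"
    "cmpD R h i = Arrow (asrc i) (asrc p) u" "cmpD R p h = Arrow (atgt i) (atgt p) v"
    unfolding has_lifting_def fDGA_simps(2,3) by blast
   have "afun h n (afun i n x) = u n x" if "x\<in>elts (asrc i) n" for n x
    using cmp_apply(1)[OF that, of R h] h(2) by simp
   moreover have "afun p n (afun h n z) = v n z" if "z\<in>elts (atgt i) n" for n z
    using cmp_apply(1)[of z h n R p] that h by (simp add: hom_fDGA)
   moreover have "dgmap R (atgt i) (asrc p) (afun h)" using h(1) by (simp add: hom_fDGA)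
   ultimately show "\<exists>h. dgmap R (atgt i) (asrc p) h & (\<forall>n. \<forall>x\<in>elts (asrc i) n. h n (afun i n x) = u n x) &
    (\<forall>n. \<forall>z\<in>elts (atgt i) n. afun p n (h n z) = v n z)" by blast
  qed }
 assume e: ?E
 show ?L unfolding has_lifting_def fDGA_simps(2,3)
 proof (intro ballI impI)
  fix u v assume u: "u\<in>homD R (asrc i) (asrc p)" and v: "v\<in>homD R (atgt i) (atgt p)"
   and c: "cmpD R p u = cmpD R v i"
  note m = u[unfolded hom_fDGA] v[unfolded hom_fDGA]
  have "afun p n (afun u n x) = afun v n (afun i n x)" if "x\<in>elts (asrc i) n" for n x
   using square_apply[OF c] m that by simp
  then obtain h where h: "dgmap R (atgt i) (asrc p) h" "!!n x. x\<in>elts (asrc i) n==>h n (afun i n x) = afun u n x"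
   "!!n z. z\<in>elts (atgt i) n==>afun p n (h n z) = afun v n z"
   using e[rule_format, of "afun u" "afun v"] m by blast
  let ?h = "Arrow (atgt i) (asrc p) h"
  have ha: "?h\<in>homD R (atgt i) (asrc p)" using h(1) ob by (simp add: hom_fDGA)
  have "cmpD R ?h i = u" by (rule hom_fDGA_eqI[OF D(1)[OF ia ha] u]) (simp add: cmp_apply h)
  moreover have "cmpD R p ?h = v" by (rule hom_fDGA_eqI[OF D(1)[OF ha pa] v]) (simp add: cmp_apply h)
  ultimately show "\<exists>h\<in>homD R (atgt i) (asrc p). cmpD R h i = u & cmpD R p h = v"
   using ha by blast
 qed
qed

section \<open>Weak equivalences and fibrations\<close>

text \<open>A partial equivalence relation whose domain consists of the \<open>r + 1\<close>-cycles,
  so that \<open>homol r A p n x x\<close> serves as membership. It replaces the quotient: filtered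
  maps act on representatives and no cosets appear.\<close>

definition homol :: "nat => ('r, 'a) fcomplex => int => int => 'a => 'a => bool" where
 "homol r A p n x y \<longleftrightarrow> x\<in>cycles A (r + 1) p n & y\<in>cycles A (r + 1) p n &
   x -[md A n] y\<in>boundaries A (r + 1) p n"

lemma homol_equiv:
 assumes A: "fcx R A"
 shows "x\<in>cycles A (r + 1) p n \<longleftrightarrow> homol r A p n x x"
  "homol r A p n x y==>homol r A p n y x"
  "homol r A p n x y==>homol r A p n y z==>homol r A p n x z"
proof -
 interpret M: module R "md A n" by (rule fcxD(1)[OF A])
 note B = submodule_facts[OF fcxD(1)[OF A] boundaries_submodule[OF A, of r p n]] and c = cycles_elts[OF A]
 show "x\<in>cycles A (r + 1) p n \<longleftrightarrow> homol r A p n x x"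
  using diff_self[OF fcxD(1)[OF A] c] B(2) by (auto simp: homol_def)
 { assume xy: "homol r A p n x y"
  then have xc: "x\<in>grade A n" "y\<in>grade A n" using c by (auto simp: homol_def)
  have e: "\<ominus>[md A n] (x -[md A n] y) = y -[md A n] x"
   using xc by (simp add: a_minus_def M.minus_add M.a_comm)
  show "homol r A p n y x" using xy B(3) unfolding homol_def e[symmetric] by blast
  assume yz: "homol r A p n y z"
  then have zc: "z\<in>grade A n" using c by (auto simp: homol_def)
  have e: "x -[md A n] z = (x -[md A n] y) +[md A n] (y -[md A n] z)"
   using xc zc by (simp add: a_minus_def M.a_assoc M.r_neg1)
  show "homol r A p n x z" using xy yz B(4) unfolding homol_def e by blast }
qed

lemma homol_elts:
 assumes "fcx R A" "homol r A p n x y"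
 shows "x\<in>grade A n" "y\<in>grade A n"
 using assms(2) cycles_elts[OF assms(1)] unfolding homol_def by blast+

lemma fmap_homol:
 assumes A: "fcx R A" and B: "fcx R B" and f: "is_fmap R A B f" and h: "homol r A p n x y"
 shows "homol r B p n (f n x) (f n y)"
proof -
 from h have c: "x\<in>cycles A (r + 1) p n" "y\<in>cycles A (r + 1) p n" "x -[md A n] y\<in>boundaries A (r + 1) p n"
  by (simp_all only: homol_def)
 show ?thesis unfolding homol_def
  using fmap_cycles[OF f A c(1)] fmap_cycles[OF f A c(2)] fmap_boundaries[OF A f c(3)]
   fmap_diff[OF f A B cycles_elts[OF A c(1)] cycles_elts[OF A c(2)]] by simp
qed

text \<open>Trivial kernel becomes injectivity up to \<open>homol\<close> by passing to differences
  of cycles, and back by comparing with zero.\<close>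

lemma page_iso_homologous:
 assumes A: "fcx R A" and B: "fcx R B" and f: "is_fmap R A B f"
 shows "page_iso r A B f \<longleftrightarrow> (\<forall>p n.
  (\<forall>x x'. homol r A p n x x \<longrightarrow> homol r A p n x' x' \<longrightarrow> homol r B p n (f n x) (f n x') \<longrightarrow> homol r A p n x x') &
  (\<forall>y. homol r B p n y y \<longrightarrow> (\<exists>x. homol r A p n x x & homol r B p n y (f n x))))" (is "_ = ?Q")
proof
 note c = cycles_elts[OF A] and ZA = submodule_facts[OF fcxD(1)[OF A] cycles_submodule[OF A]]
 note eq = homol_equiv(1)[OF A, symmetric] homol_equiv(1)[OF B, symmetric]
 { assume i: "page_iso r A B f"
  show ?Q unfolding eq
  proof (intro allI conjI impI)
   fix p n x x' assume x: "x\<in>cycles A (r + 1) p n" "x'\<in>cycles A (r + 1) p n" and h: "homol r B p n (f n x) (f n x')"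
   from h have "f n (x -[md A n] x')\<in>boundaries B (r + 1) p n"
    using fmap_diff[OF f A B c[OF x(1)] c[OF x(2)]] by (simp add: homol_def)
   with i ZA(5)[OF x] x show "homol r A p n x x'" unfolding page_iso_def homol_def by blast
  next
   fix p n y assume y: "y\<in>cycles B (r + 1) p n"
   then obtain x where x: "x\<in>cycles A (r + 1) p n" "y -[md B n] f n x\<in>boundaries B (r + 1) p n"
    using i unfolding page_iso_def by blast
   then show "\<exists>x. x\<in>cycles A (r + 1) p n & homol r B p n y (f n x)"
    using y fmap_cycles[OF f A x(1)] by (auto simp only: homol_def)
  qed }
 assume q: ?Q
 show "page_iso r A B f" unfolding page_iso_def
 proof (intro allI conjI ballI impI)
  fix p n x assume x: "x\<in>cycles A (r + 1) p n" and b: "f n x\<in>boundaries B (r + 1) p n"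
  interpret A: module R "md A n" by (rule fcxD(1)[OF A])
  interpret B: module R "md B n" by (rule fcxD(1)[OF B])
  have z: "\<zero>[md A n]\<in>cycles A (r + 1) p n" by (rule ZA(2))
  have m: "u -[md A n] \<zero>[md A n] = u" if "u\<in>grade A n" for u using that by (simp add: a_minus_def)
  have m': "u -[md B n] \<zero>[md B n] = u" if "u\<in>grade B n" for u using that by (simp add: a_minus_def)
  have "homol r B p n (f n x) (f n \<zero>[md A n])"
   using b fmap_cycles[OF f A x] fmap_cycles[OF f A z] m'[OF is_fmapD(5)[OF f c[OF x]]]
   by (simp add: homol_def fmap_zero[OF A B f])
  then have "homol r A p n x \<zero>[md A n]" using q x z unfolding eq by blast
  then show "x\<in>boundaries A (r + 1) p n" by (simp add: homol_def m c[OF x])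
 next
  fix p n y assume "y\<in>cycles B (r + 1) p n"
  then obtain x where "x\<in>cycles A (r + 1) p n" "homol r B p n y (f n x)" using q unfolding eq by blast
  then show "\<exists>x\<in>cycles A (r + 1) p n. y -[md B n] f n x\<in>boundaries B (r + 1) p n"
   unfolding homol_def by blast
 qed
qed

text \<open>The argument for bijections of sets, with equality replaced by \<open>homol\<close>,
  which all three maps respect.\<close>

lemma two_of_three_weq:
 assumes R: "cring R" shows "two_of_three (fDGA R) (fdga_weq R r)"
 unfolding two_of_three_def
proof (intro ballI impI)
 fix f g assume f: "f\<in>arrs (fDGA R)" and g: "g\<in>arrs (fDGA R)" and gf0: "src (fDGA R) g = tgt (fDGA R) f"
 let ?A = "homol r (cx (asrc f))" and ?B = "homol r (cx (atgt f))" and ?C = "homol r (cx (atgt g))" and ?k = "afun (cmpD R g f)"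
 from gf0 have gf: "asrc g = atgt f" by (simp add: fDGA_simps)
 note D = categoryD[OF category_fDGA[OF R]]
 have c: "cmpD R g f\<in>homD R (asrc f) (atgt g)"
  using D(1)[of f "asrc f" "atgt f" g "atgt g"] f g gf by (simp add: hom_set_def fDGA_simps)
 note ff = f[unfolded arr_fDGA] and gg = g[unfolded arr_fDGA gf] and cc = c[unfolded hom_fDGA]
 note A = fdgaD(1)[OF R ff[THEN conjunct1]] and B = fdgaD(1)[OF R gg[THEN conjunct1]] and C = fdgaD(1)[OF R gg[THEN conjunct2, THEN conjunct1]]
 note fm = map_fmap[OF ff[THEN conjunct2, THEN conjunct2]] and gm = map_fmap[OF gg[THEN conjunct2, THEN conjunct2]]
 note hf = fmap_homol[OF A B fm] and hg = fmap_homol[OF B C gm]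
 note eA = homol_equiv[OF A] and eB = homol_equiv[OF B] and eC = homol_equiv[OF C]
 have ca: "?k n x = afun g n (afun f n x)" if "?A p n x x" for p n x
  using that cycles_elts[OF A] unfolding eA(1)[symmetric] by (intro cmp_apply) blast
 note P = page_iso_homologous[OF A B fm] page_iso_homologous[OF B C gm] page_iso_homologous[OF A C map_fmap, of "afun (cmpD R g f)"]
 have W: "f\<in>fdga_weq R r \<longleftrightarrow> page_iso r (cx (asrc f)) (cx (atgt f)) (afun f)"
  "g\<in>fdga_weq R r \<longleftrightarrow> page_iso r (cx (atgt f)) (cx (atgt g)) (afun g)"
  "cmpD R g f\<in>fdga_weq R r \<longleftrightarrow> page_iso r (cx (asrc f)) (cx (atgt g)) (?k)"
  using f g c gf by (simp_all add: fdga_weq_iff[OF R] hom_set_def fDGA_simps)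
 have cm: "dgmap R (asrc f) (atgt g) (?k)" using cc by blast
 show "(f\<in>fdga_weq R r & g\<in>fdga_weq R r \<longrightarrow> cmpD R g f\<in>fdga_weq R r) &
   (f\<in>fdga_weq R r & cmpD R g f\<in>fdga_weq R r \<longrightarrow> g\<in>fdga_weq R r) &
   (g\<in>fdga_weq R r & cmpD R g f\<in>fdga_weq R r \<longrightarrow> f\<in>fdga_weq R r)"
 proof (intro conjI impI; elim conjE)
  assume f: "f\<in>fdga_weq R r" and g: "g\<in>fdga_weq R r"
  note f = f[unfolded W P, rule_format] and g = g[unfolded W P, rule_format]
  show "cmpD R g f\<in>fdga_weq R r" unfolding W P(3)[OF cm]
  proof (intro allI conjI impI)
   fix p n x x' assume x: "?A p n x x" "?A p n x' x'"
    "?C p n (?k n x) (?k n x')"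
   show "?A p n x x'"
    by (rule f[THEN conjunct1, rule_format, OF x(1,2) g[THEN conjunct1, rule_format, OF hf[OF x(1)] hf[OF x(2)]]])
     (use x(3) ca[OF x(1)] ca[OF x(2)] in simp)
  next
   fix p n z assume "?C p n z z"
   then obtain y where y: "?B p n y y" "?C p n z (afun g n y)" using g by blast
   then obtain x where x: "?A p n x x" "?B p n y (afun f n x)" using f by blast
   from eC(3)[OF y(2) hg[OF x(2)]] x(1) show "\<exists>x. ?A p n x x & ?C p n z (?k n x)"
    using ca[OF x(1)] by (intro exI[of _ x]) simp
  qed
 next
  assume f: "f\<in>fdga_weq R r" and k: "cmpD R g f\<in>fdga_weq R r"
  note f = f[unfolded W P, rule_format] and k = k[unfolded W P(3)[OF cm], rule_format]
  show "g\<in>fdga_weq R r" unfolding W P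
  proof (intro allI conjI impI)
   fix p n y y' assume y: "?B p n y y" "?B p n y' y'"
    "?C p n (afun g n y) (afun g n y')"
   obtain x where x: "?A p n x x" "?B p n y (afun f n x)" using f y(1) by blast
   obtain x' where x': "?A p n x' x'" "?B p n y' (afun f n x')" using f y(2) by blast
   have "?C p n (afun g n (afun f n x)) (afun g n (afun f n x'))"
    by (rule eC(3)[OF eC(2)[OF hg[OF x(2)]] eC(3)[OF y(3) hg[OF x'(2)]]])
   then have "?A p n x x'" using k[THEN conjunct1, rule_format, OF x(1) x'(1)] ca[OF x(1)] ca[OF x'(1)] by simp
   from eB(3)[OF x(2) eB(3)[OF hf[OF this] eB(2)[OF x'(2)]]] show "?B p n y y'" .
  next
   fix p n z assume "?C p n z z"
   then obtain x where x: "?A p n x x" "?C p n z (?k n x)"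
    using k by blast
   then show "\<exists>y. ?B p n y y & ?C p n z (afun g n y)"
    using hf[OF x(1)] ca[OF x(1)] by (intro exI[of _ "afun f n x"]) simp
  qed
 next
  assume g: "g\<in>fdga_weq R r" and k: "cmpD R g f\<in>fdga_weq R r"
  note g = g[unfolded W P, rule_format] and k = k[unfolded W P(3)[OF cm], rule_format]
  show "f\<in>fdga_weq R r" unfolding W P
  proof (intro allI conjI impI)
   fix p n x x' assume x: "?A p n x x" "?A p n x' x'"
    "?B p n (afun f n x) (afun f n x')"
   show "?A p n x x'"
    by (rule k[THEN conjunct1, rule_format, OF x(1,2)]) (use hg[OF x(3)] ca[OF x(1)] ca[OF x(2)] in simp)
  next
   fix p n y assume y: "?B p n y y"
   then obtain x where x: "?A p n x x" "?C p n (afun g n y) (?k n x)"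
    using k[THEN conjunct2, rule_format, OF hg[OF y]] by blast
   have "?B p n y (afun f n x)"
    by (rule g[THEN conjunct1, rule_format, OF y hf[OF x(1)]]) (use x(2) ca[OF x(1)] in simp)
   then show "\<exists>x. ?A p n x x & ?B p n y (afun f n x)" using x(1) by blast
  qed
 qed
qed

lemma subcategory_weq:
 assumes R: "cring R" shows "wide_subcategory (fDGA R) (fdga_weq R r)"
 unfolding wide_subcategory_def
proof (intro conjI ballI impI)
 show "fdga_weq R r \<subseteq> arrs (fDGA R)" by (auto simp: fdga_weq_def)
 fix X assume X: "X\<in>objs (fDGA R)"
 then have X': "is_fdga R X" by (simp add: fDGA_simps)
 note fc = fdgaD(1)[OF R X']
 have "page_iso r (cx X) (cx X) (fmap_id (cx X))" unfolding page_iso_homologous[OF fc fc fmap_ident[OF fc]]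
 proof (intro allI conjI impI)
  fix p n x x' assume x: "homol r (cx X) p n x x" "homol r (cx X) p n x' x'"
   "homol r (cx X) p n (fmap_id (cx X) n x) (fmap_id (cx X) n x')"
  then show "homol r (cx X) p n x x'" using homol_elts[OF fc] by (simp add: fmap_id_def)
 next
  fix p n y assume y: "homol r (cx X) p n y y"
  then have "fmap_id (cx X) n y = y" using homol_elts[OF fc] by (simp add: fmap_id_def)
  then show "\<exists>x. homol r (cx X) p n x x & homol r (cx X) p n y (fmap_id (cx X) n x)" using y by auto
 qed
 then show "ident (fDGA R) X\<in>fdga_weq R r" using categoryD(2)[OF category_fDGA[OF R] X]
  by (simp add: fdga_weq_iff[OF R] fDGA_simps hom_set_def)
next
 fix f g assume "f\<in>fdga_weq R r" "g\<in>fdga_weq R r" "src (fDGA R) g = tgt (fDGA R) f"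
 then show "cmpD R g f\<in>fdga_weq R r"
  using two_of_three_weq[OF R, of r] unfolding two_of_three_def fdga_weq_def by blast
qed

lemma retractD:
 assumes R: "cring R" and fg: "is_retract (fDGA R) f g"
 obtains s t s' t' where "dgmap R (asrc f) (asrc g) s" "dgmap R (asrc g) (asrc f) t"
  "dgmap R (atgt f) (atgt g) s'" "dgmap R (atgt g) (atgt f) t'"
  "!!n x. x\<in>elts (asrc f) n==>t n (s n x) = x" "!!n y. y\<in>elts (atgt f) n==>t' n (s' n y) = y"
  "!!n x. x\<in>elts (asrc f) n==>afun g n (s n x) = s' n (afun f n x)"
  "!!n x. x\<in>elts (asrc g) n==>afun f n (t n x) = t' n (afun g n x)"
  "f\<in>arrs (fDGA R)" "g\<in>arrs (fDGA R)"
proof -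
 from fg obtain s t s' t' where m: "s\<in>homD R (asrc f) (asrc g)" "t\<in>homD R (asrc g) (asrc f)"
  "s'\<in>homD R (atgt f) (atgt g)" "t'\<in>homD R (atgt g) (atgt f)"
  and e: "cmpD R t s = ident (fDGA R) (asrc f)" "cmpD R t' s' = ident (fDGA R) (atgt f)"
   "cmpD R g s = cmpD R s' f" "cmpD R f t = cmpD R t' g"
  and a: "f\<in>arrs (fDGA R)" "g\<in>arrs (fDGA R)"
  unfolding is_retract_def fDGA_simps(2,3) by blast
 note mm = m[unfolded hom_fDGA]
 have i: "afun v n (afun u n x) = x" if "cmpD R v u = ident (fDGA R) X" "x\<in>elts X n" "asrc u = X" for u v X n x
  using cmp_apply(1)[of x u n R v] that(2,3) unfolding that(1) by (simp add: fDGA_simps fmap_id_def)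
 show ?thesis
 proof (rule that[of "afun s" "afun t" "afun s'" "afun t'"])
  show "afun g n (afun s n x) = afun s' n (afun f n x)" if "x\<in>elts (asrc f) n" for n x
   using square_apply[OF e(3)] mm(1) that by simp
  show "afun f n (afun t n x) = afun t' n (afun g n x)" if "x\<in>elts (asrc g) n" for n x
   using square_apply[OF e(4)] mm(2) that by simp
 qed (use mm a i[OF e(1)] i[OF e(2)] in simp_all)
qed

text \<open>A retract of a bijection is a bijection. The argument is run up to \<open>homol\<close>,
  which \<open>s\<close>, \<open>t\<close>, \<open>s'\<close>, \<open>t'\<close> respect as filtered
  maps.\<close>

lemma retract_weq:
 assumes R: "cring R" shows "retract_closed (fDGA R) (fdga_weq R r)"
 unfolding retract_closed_def
proof (intro allI impI, elim conjE)
 fix f g assume g: "g\<in>fdga_weq R r" and fg: "is_retract (fDGA R) f g"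
 obtain s t s' t' where m: "dgmap R (asrc f) (asrc g) s" "dgmap R (asrc g) (asrc f) t"
  "dgmap R (atgt f) (atgt g) s'" "dgmap R (atgt g) (atgt f) t'"
  and ts: "!!n x. x\<in>elts (asrc f) n==>t n (s n x) = x" "!!n y. y\<in>elts (atgt f) n==>t' n (s' n y) = y"
  and c: "!!n x. x\<in>elts (asrc f) n==>afun g n (s n x) = s' n (afun f n x)"
  "!!n x. x\<in>elts (asrc g) n==>afun f n (t n x) = t' n (afun g n x)"
  and a: "f\<in>arrs (fDGA R)" "g\<in>arrs (fDGA R)"
  by (rule retractD[OF R fg]) (rule that; assumption)
 note mm = m[THEN map_fmap] and af = a[unfolded arr_fDGA]
 have fc: "fcx R (cx (asrc f))" "fcx R (cx (atgt f))" "fcx R (cx (asrc g))" "fcx R (cx (atgt g))"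
  and fm: "is_fmap R (cx (asrc f)) (cx (atgt f)) (afun f)" "is_fmap R (cx (asrc g)) (cx (atgt g)) (afun g)"
  using af fdgaD(1)[OF R] map_fmap by blast+
 note g' = g[unfolded fdga_weq_iff[OF R] page_iso_homologous[OF fc(3,4) fm(2)], THEN conjunct2, rule_format]
 have "page_iso r (cx (asrc f)) (cx (atgt f)) (afun f)" unfolding page_iso_homologous[OF fc(1,2) fm(1)]
 proof (intro allI conjI impI)
  fix p n x x' assume x: "homol r (cx (asrc f)) p n x x" "homol r (cx (asrc f)) p n x' x'"
   and h: "homol r (cx (atgt f)) p n (afun f n x) (afun f n x')"
  note xc = homol_elts(1)[OF fc(1) x(1)] homol_elts(1)[OF fc(1) x(2)]
  have "homol r (cx (asrc g)) p n (s n x) (s n x')"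
   by (rule g'[THEN conjunct1, rule_format, OF fmap_homol[OF fc(1,3) mm(1) x(1)] fmap_homol[OF fc(1,3) mm(1) x(2)]])
    (use fmap_homol[OF fc(2,4) mm(3) h] c(1) xc in simp)
  from fmap_homol[OF fc(3,1) mm(2) this] show "homol r (cx (asrc f)) p n x x'" using ts(1) xc by simp
 next
  fix p n y assume y: "homol r (cx (atgt f)) p n y y"
  from g'[THEN conjunct2, rule_format, OF fmap_homol[OF fc(2,4) mm(3) y]]
  obtain x where x: "homol r (cx (asrc g)) p n x x" "homol r (cx (atgt g)) p n (s' n y) (afun g n x)" by blast
  have "homol r (cx (atgt f)) p n y (afun f n (t n x))"
   using fmap_homol[OF fc(4,2) mm(4) x(2)] ts(2)[OF homol_elts(1)[OF fc(2) y]] c(2)[OF homol_elts(1)[OF fc(3) x(1)]] by simp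
  then show "\<exists>x. homol r (cx (asrc f)) p n x x & homol r (cx (atgt f)) p n y (afun f n x)"
   using fmap_homol[OF fc(3,1) mm(2) x(1)] by blast
 qed
 then show "f\<in>fdga_weq R r" using a(1) by (simp add: fdga_weq_iff[OF R])
qed

lemma subcategory_fib:
 assumes R: "cring R" shows "wide_subcategory (fDGA R) (fdga_fib R S)"
 unfolding wide_subcategory_def
proof (intro conjI ballI impI)
 show "fdga_fib R S \<subseteq> arrs (fDGA R)" by (auto simp: fdga_fib_def)
 note D = categoryD[OF category_fDGA[OF R]]
 fix X assume X: "X\<in>objs (fDGA R)"
 then have fc: "fcx R (cx X)" by (simp add: fDGA_simps fdgaD(1)[OF R])
 have "cycle_onto S (cx X) (cx X) (fmap_id (cx X))" unfolding cycle_onto_def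
 proof (intro ballI allI)
  fix s q n y assume "y\<in>cycles (cx X) s q n"
  then show "\<exists>x\<in>cycles (cx X) s q n. fmap_id (cx X) n x = y"
   using cycles_elts[OF fc] by (intro bexI[of _ y]) (simp_all add: fmap_id_def)
 qed
 then show "ident (fDGA R) X\<in>fdga_fib R S" using D(2)[OF X] by (simp add: fdga_fib_iff[OF R] fDGA_simps hom_set_def)
next
 note D = categoryD[OF category_fDGA[OF R]]
 fix f g assume f: "f\<in>fdga_fib R S" and g: "g\<in>fdga_fib R S" and "src (fDGA R) g = tgt (fDGA R) f"
 then have gf: "asrc g = atgt f" by (simp add: fDGA_simps)
 note f' = f[unfolded fdga_fib_iff[OF R] arr_fDGA] and g' = g[unfolded fdga_fib_iff[OF R] arr_fDGA gf]
 have c: "cmpD R g f\<in>homD R (asrc f) (atgt g)"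
  using D(1)[of f "asrc f" "atgt f" g "atgt g"] f' g' gf by (simp add: hom_fDGA)
 have "cycle_onto S (cx (asrc f)) (cx (atgt g)) (afun (cmpD R g f))" unfolding cycle_onto_def
 proof (intro ballI allI)
  fix s q n z assume s: "s\<in>S" and z: "z\<in>cycles (cx (atgt g)) s q n"
  obtain y where y: "y\<in>cycles (cx (atgt f)) s q n" "afun g n y = z" using g' s z unfolding cycle_onto_def by blast
  obtain x where x: "x\<in>cycles (cx (asrc f)) s q n" "afun f n x = y" using f' s y(1) unfolding cycle_onto_def by blast
  have "x\<in>elts (asrc f) n" using cycles_elts[OF fdgaD(1)[OF R] x(1)] f' by blast
  then show "\<exists>x\<in>cycles (cx (asrc f)) s q n. afun (cmpD R g f) n x = z"
   using x y by (intro bexI[of _ x]) (simp_all add: cmp_apply)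
 qed
 then show "cmpD R g f\<in>fdga_fib R S" using c by (simp add: fdga_fib_iff[OF R] hom_fDGA arr_fDGA)
qed

lemma retract_fib:
 assumes R: "cring R" shows "retract_closed (fDGA R) (fdga_fib R S)"
 unfolding retract_closed_def
proof (intro allI impI, elim conjE)
 fix f g assume g: "g\<in>fdga_fib R S" and fg: "is_retract (fDGA R) f g"
 obtain s t s' t' where m: "dgmap R (asrc f) (asrc g) s" "dgmap R (asrc g) (asrc f) t"
  "dgmap R (atgt f) (atgt g) s'" "dgmap R (atgt g) (atgt f) t'"
  and ts: "!!n y. y\<in>elts (atgt f) n==>t' n (s' n y) = y"
  and c: "!!n x. x\<in>elts (asrc g) n==>afun f n (t n x) = t' n (afun g n x)"
  and a: "f\<in>arrs (fDGA R)" "g\<in>arrs (fDGA R)"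
  by (rule retractD[OF R fg]) (rule that; assumption)
 note mm = m[THEN map_fmap]
 have fc: "fcx R (cx (atgt f))" "fcx R (cx (asrc g))"
  using a[unfolded arr_fDGA] fdgaD(1)[OF R] by blast+
 have "cycle_onto S (cx (asrc f)) (cx (atgt f)) (afun f)" unfolding cycle_onto_def
 proof (intro ballI allI)
  fix k q n y assume k: "k\<in>S" and y: "y\<in>cycles (cx (atgt f)) k q n"
  from fmap_cycles[OF mm(3) fc(1) y] g[unfolded fdga_fib_iff[OF R] cycle_onto_def] k
  obtain x where x: "x\<in>cycles (cx (asrc g)) k q n" "afun g n x = s' n y" by blast
  then show "\<exists>x\<in>cycles (cx (asrc f)) k q n. afun f n x = y"
   using fmap_cycles[OF mm(2) fc(2) x(1)] c[OF cycles_elts[OF fc(2) x(1)]] ts[OF cycles_elts[OF fc(1) y]]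
   by (intro bexI[of _ "t n x"]) simp_all
 qed
 then show "f\<in>fdga_fib R S" using a(1) by (simp add: fdga_fib_iff[OF R])
qed

lemma llp_fib_weq:
 fixes R :: "'u ring"
 assumes inf: "infinite (UNIV :: 'u set)" and R: "cring R" and S: "S \<subseteq> {0..r}" and i: "i\<in>llp (fDGA R) (fdga_fib R S)"
 shows "i\<in>fdga_weq R r"
proof -
 have a: "i\<in>arrs (fDGA R)" using i by (simp add: llp_def)
 have X: "is_fdga R (asrc i)" and Y: "is_fdga R (atgt i)" and im: "dgmap R (asrc i) (atgt i) (afun i)"
  using a by (simp_all add: arr_fDGA)
 interpret M: mapping_path R "asrc i" "atgt i" r "afun i"
  using inf R X Y im by (simp add: mapping_path_def fdga_mul_def mapping_path_axioms_def)
 let ?p = "Arrow M.N (atgt i) M.right"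
 have p: "?p\<in>arrs (fDGA R)" using M.P.presented(1) M.right_map Y by (simp add: arr_fDGA)
 have "?p\<in>fdga_fib R S" using p M.right_onto[OF S] by (simp add: fdga_fib_iff[OF R])
 then have "has_lifting (fDGA R) i ?p" using i by (simp add: llp_def)
 \<comment> \<open>The square has constant paths on top and the identity of the target of
   \<open>i\<close> at the bottom. In its filler \<open>h\<close>, the left ends give the
   retraction, and the path joins \<open>i\<close> after this retraction to the identity.\<close>
 from this[unfolded lifting_fDGA_iff[OF R a p], rule_format, of M.const "fmap_id (cx (atgt i))"]
 obtain h where h: "dgmap R (atgt i) M.N h" "!!n x. x\<in>elts (asrc i) n==>h n (afun i n x) = M.const n x"
  "!!n z. z\<in>elts (atgt i) n==>M.right n (h n z) = z"
  using M.const_map fdga_map_ident[OF R Y] M.right_const M.jm(5) by (auto simp: fmap_id_def)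
 note hm = map_fmap[OF h(1)] and fX = fdgaD(1)[OF R X] and fY = fdgaD(1)[OF R Y] and im' = map_fmap[OF im]
 note fN = fdgaD(1)[OF R M.P.presented(1)] and lm = map_fmap[OF M.left_map]
 have retr: "M.left n (h n (afun i n x)) = x" if "x\<in>elts (asrc i) n" for n x
  using h(2)[OF that] M.left_const[OF that] by simp
 have "page_iso r (cx (asrc i)) (cx (atgt i)) (afun i)" unfolding page_iso_homologous[OF fX fY im']
 proof (intro allI conjI impI)
  fix p n x x' assume x: "homol r (cx (asrc i)) p n x x" "homol r (cx (asrc i)) p n x' x'"
   and e: "homol r (cx (atgt i)) p n (afun i n x) (afun i n x')"
  show "homol r (cx (asrc i)) p n x x'"
   using homol_elts(1)[OF fX x(1)] homol_elts(1)[OF fX x(2)] fmap_homol[OF fN fX lm fmap_homol[OF fY fN hm e]] retr by simp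
 next
  fix p n y assume y: "homol r (cx (atgt i)) p n y y"
  then have yc: "y\<in>cycles (cx (atgt i)) (r + 1) p n" by (simp add: homol_def)
  note hy = fmap_cycles[OF hm fY yc]
  note ly = fmap_cycles[OF lm fN hy]
  have "homol r (cx (atgt i)) p n y (afun i n (M.left n (h n y)))" unfolding homol_def
   using yc fmap_cycles[OF im' fX ly] M.homotopic[OF hy] h(3)[OF cycles_elts[OF fY yc]] by simp
  then show "\<exists>x. homol r (cx (asrc i)) p n x x & homol r (cx (atgt i)) p n y (afun i n x)"
   using homol_equiv(1)[OF fX] ly by blast
 qed
 then show ?thesis using a by (simp add: fdga_weq_iff[OF R])
qed

section \<open>The model structure\<close>

locale fdga_model =
 fixes R :: "'u ring" and r :: nat and S :: "nat set"
 assumes inf: "infinite (UNIV :: 'u set)" and R: "cring R" and S: "S \<subseteq> {0..r}" "r\<in>S"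
begin

abbreviation "FD \<equiv> fDGA R"
abbreviation "Fib \<equiv> fdga_fib R S"
abbreviation "W \<equiv> fdga_weq R r"

lemmas cat = category_fDGA[OF R]
lemmas catD = categoryD[OF cat]

abbreviation mid where "mid b f \<equiv> fdga_arrow.FE R r S b (asrc f) (atgt f) (afun f)"
abbreviation ilv where "ilv b f \<equiv> fdga_arrow.Fi R r S b (asrc f) (atgt f) (afun f)"
abbreviation qtv where "qtv b f \<equiv> fdga_arrow.Fq R r S b (asrc f) (atgt f) (afun f)"
abbreviation elv where "elv b f \<equiv> fdga_arrow.Fe R r S b (asrc f) (atgt f) (afun f)"
abbreviation slv where "slv b f \<equiv> fdga_arrow.Fs R r S b (asrc f) (atgt f) (afun f)"

definition "left b f = Arrow (asrc f) (mid b f) (ilv b f)"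
definition "right b f = Arrow (mid b f) (atgt f) (qtv b f)"

lemma arrow: "f\<in>arrs FD==>fdga_arrow R (asrc f) (atgt f) (afun f)"
 by (simp add: fdga_arrow_def inf R arr_fDGA)

text \<open>A relation rather than a construction. Since at most one map satisfies it, the functor
  laws reduce to the fact that identities and composites satisfy it again.\<close>

definition induced :: "bool => (('u, 'u) fdga, int => 'u => 'u) arrow => (('u, 'u) fdga, int => 'u => 'u) arrow =>
  (('u, 'u) fdga, int => 'u => 'u) arrow => (('u, 'u) fdga, int => 'u => 'u) arrow => (int => 'u => 'u) => bool" where
 "induced b f g u v h \<longleftrightarrow> dgmap R (mid b f) (mid b g) h &
  (\<forall>n. \<forall>x\<in>elts (asrc f) n. h n (ilv b f n x) = ilv b g n (afun u n x)) &
  (\<forall>n. \<forall>z\<in>elts (mid b f) n. qtv b g n (h n z) = afun v n (qtv b f n z)) &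
  fdga_arrow.compatible R r S b (asrc f) (atgt f) (afun f) (mid b g) (qtv b g) (elv b g) (slv b g) h (afun v)"

lemma factors:
 assumes f: "f\<in>arrs FD"
 shows "left b f\<in>hom_set FD (asrc f) (mid b f)" "right b f\<in>hom_set FD (mid b f) (atgt f)" "cmp FD (right b f) (left b f) = f"
proof -
 interpret f: fdga_arrow R r S b "asrc f" "atgt f" "afun f" by (rule arrow[OF f])
 show l: "left b f\<in>hom_set FD (asrc f) (mid b f)" and q: "right b f\<in>hom_set FD (mid b f) (atgt f)"
  using f.X f.Y f.FE f.Fi f.Fq by (simp_all add: hom_fDGA left_def right_def)
 show "cmp FD (right b f) (left b f) = f"
  by (rule hom_fDGA_eqI[OF catD(1)[OF l q] catD(7)[OF f, unfolded fDGA_simps]])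
   (simp add: cmp_apply left_def right_def f.Fq_Fi)
qed

text \<open>\<open>extension\<close> is applied with the factorization of \<open>g\<close> as the
  structured target and with \<open>v\<close> as the map of bases.\<close>

lemma induced_exists:
 assumes f: "f\<in>arrs FD" and g: "g\<in>arrs FD" and u: "u\<in>hom_set FD (asrc f) (asrc g)" and v: "v\<in>hom_set FD (atgt f) (atgt g)"
  and c: "cmp FD v f = cmp FD g u"
 shows "\<exists>h. induced b f g u v h"
proof -
 interpret f: fdga_arrow R r S b "asrc f" "atgt f" "afun f" by (rule arrow[OF f])
 interpret g: fdga_arrow R r S b "asrc g" "atgt g" "afun g" by (rule arrow[OF g])
 have u': "dgmap R (asrc f) (asrc g) (afun u)" "asrc u = asrc f" and v': "dgmap R (atgt f) (atgt g) (afun v)"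
  using u v by (simp_all add: hom_fDGA)
 have sq: "g.Fq n (compose (elts (asrc f) n) (g.Fi n) (afun u n) x) = afun v n (afun f n x)" if x: "x\<in>elts (asrc f) n" for n x
  using square_apply[OF c u'(2) x] g.Fq_Fi[OF fdga_mapD(5)[OF u'(1) x]] x by (simp add: compose_def)
 from f.extension[OF g.FE g.Y g.Fq fdga_map_comp[OF R f.X g.X g.FE u'(1) g.Fi] v' sq g.structured_free]
 show ?thesis unfolding induced_def by (auto simp: compose_def)
qed

lemma induced_unique:
 assumes f: "f\<in>arrs FD" and g: "g\<in>arrs FD" and h: "induced b f g u v h" "induced b f g u v h'"
 shows "h = h'"
proof -
 interpret f: fdga_arrow R r S b "asrc f" "atgt f" "afun f" by (rule arrow[OF f])
 interpret g: fdga_arrow R r S b "asrc g" "atgt g" "afun g" by (rule arrow[OF g])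
 show ?thesis by (rule f.initial_unique[OF g.FE]) (use h in \<open>auto simp: induced_def\<close>)
qed

lemma induced_ident:
 assumes f: "f\<in>arrs FD"
 shows "induced b f f (ident FD (asrc f)) (ident FD (atgt f)) (fmap_id (cx (mid b f)))"
proof -
 interpret f: fdga_arrow R r S b "asrc f" "atgt f" "afun f" by (rule arrow[OF f])
 note F = f.structured_free[unfolded structured_def]
 have "f.compatible f.FE f.Fq f.Fe f.Fs (fmap_id (cx f.FE)) (fmap_id (cx (atgt f)))"
  unfolding f.compatible_def
 proof (intro conjI ballI allI impI)
  fix s q n y assume y: "s\<in>S" "y\<in>cycles (cx (atgt f)) s q n"
  then have "f.Fe s q n y\<in>cycles (cx f.FE) s q n" using F by blast
  from cycles_elts[OF f.fcE this] cycles_elts[OF f.fcY y(2)]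
  show "fmap_id (cx f.FE) n (f.Fe s q n y) = f.Fe s q n (fmap_id (cx (atgt f)) n y)" by (simp add: fmap_id_def)
 next
  fix q n a y assume b and a: "admissible r (cx f.FE) (cx (atgt f)) f.Fq q n a y"
  with F have "solves r (cx f.FE) f.Fq q n a y (f.Fs q n a y)" by blast
  then have "f.Fs q n a y\<in>elts f.FE (n - 1)" using cycles_elts[OF f.fcE] unfolding solves_def by blast
  then show "fmap_id (cx f.FE) (n - 1) (f.Fs q n a y) = f.Fs q n (fmap_id (cx f.FE) n a) (fmap_id (cx (atgt f)) (n - 1) y)"
   using admissible_elts(1)[OF a f.fcE] admissible_elts(2)[OF a f.fcY] by (simp add: fmap_id_def)
 qed
 then show ?thesis unfolding induced_def
  using fdga_map_ident[OF R f.FE] fdga_mapD(5)[OF f.Fi] fdga_mapD(5)[OF f.Fq]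
  by (simp add: fDGA_simps fmap_id_def)
qed

lemma induced_comp:
 assumes f: "f\<in>arrs FD" and g: "g\<in>arrs FD" and k: "k\<in>arrs FD"
  and u: "u\<in>hom_set FD (asrc f) (asrc g)" and v: "v\<in>hom_set FD (atgt f) (atgt g)"
  and h: "induced b f g u v h" and h': "induced b g k u' v' h'"
 shows "induced b f k (cmp FD u' u) (cmp FD v' v) (%n. compose (elts (mid b f) n) (h' n) (h n))"
proof -
 interpret f: fdga_arrow R r S b "asrc f" "atgt f" "afun f" by (rule arrow[OF f])
 interpret g: fdga_arrow R r S b "asrc g" "atgt g" "afun g" by (rule arrow[OF g])
 interpret k: fdga_arrow R r S b "asrc k" "atgt k" "afun k" by (rule arrow[OF k])
 note F = f.structured_free[unfolded structured_def]
 have um: "dgmap R (asrc f) (asrc g) (afun u)" "asrc u = asrc f" and vm: "dgmap R (atgt f) (atgt g) (afun v)" "asrc v = atgt f"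
  using u v by (simp_all add: hom_fDGA)
 have hm: "dgmap R f.FE g.FE h" "dgmap R g.FE k.FE h'"
  and hi: "!!n x. x\<in>elts (asrc f) n==>h n (f.Fi n x) = g.Fi n (afun u n x)"
   "!!n x. x\<in>elts (asrc g) n==>h' n (g.Fi n x) = k.Fi n (afun u' n x)"
  and hq: "!!n z. z\<in>elts f.FE n==>g.Fq n (h n z) = afun v n (f.Fq n z)"
   "!!n z. z\<in>elts g.FE n==>k.Fq n (h' n z) = afun v' n (g.Fq n z)"
  and hc: "f.compatible g.FE g.Fq g.Fe g.Fs h (afun v)" "g.compatible k.FE k.Fq k.Fe k.Fs h' (afun v')"
  using h h' by (simp_all add: induced_def)
 note he = fdga_mapD(5)[OF hm(1)] and ve = fdga_mapD(5)[OF vm(1)] and ue = fdga_mapD(5)[OF um(1)]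
 have cu: "afun (cmp FD u' u) n x = afun u' n (afun u n x)" if "x\<in>elts (asrc f) n" for n x
  using that um(2) by (simp add: cmp_apply)
 have cv: "afun (cmp FD v' v) n y = afun v' n (afun v n y)" if "y\<in>elts (atgt f) n" for n y
  using that vm(2) by (simp add: cmp_apply)
 let ?h = "%n. compose (elts f.FE n) (h' n) (h n)"
 have "f.compatible k.FE k.Fq k.Fe k.Fs ?h (afun (cmp FD v' v))"
  unfolding f.compatible_def
 proof (intro conjI ballI allI impI)
  fix s q n y assume y: "s\<in>S" "y\<in>cycles (cx (atgt f)) s q n"
  then have "f.Fe s q n y\<in>cycles (cx f.FE) s q n" using F by blast
  note e = cycles_elts[OF f.fcE this]
  have "h n (f.Fe s q n y) = g.Fe s q n (afun v n y)" using hc(1) y unfolding f.compatible_def by blast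
  moreover have "h' n (g.Fe s q n (afun v n y)) = k.Fe s q n (afun v' n (afun v n y))"
   using hc(2) y(1) fmap_cycles[OF map_fmap[OF vm(1)] f.fcY y(2)] unfolding g.compatible_def by blast
  ultimately show "?h n (f.Fe s q n y) = k.Fe s q n (afun (cmp FD v' v) n y)"
   using e cv[OF cycles_elts[OF f.fcY y(2)]] by (simp add: compose_def)
 next
  fix q n a y assume b: b and a: "admissible r (cx f.FE) (cx (atgt f)) f.Fq q n a y"
  with F have "solves r (cx f.FE) f.Fq q n a y (f.Fs q n a y)" by blast
  then have e: "f.Fs q n a y\<in>elts f.FE (n - 1)" using cycles_elts[OF f.fcE] unfolding solves_def by blast
  have a': "admissible r (cx g.FE) (cx (atgt g)) g.Fq q n (h n a) (afun v (n - 1) y)"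
   by (rule admissible_square[OF f.fcE f.fcY g.fcE g.fcY map_fmap[OF hm(1)] map_fmap[OF vm(1)] map_fmap[OF f.Fq] hq(1) a])
  have "h (n - 1) (f.Fs q n a y) = g.Fs q n (h n a) (afun v (n - 1) y)" using hc(1) b a unfolding f.compatible_def by blast
  moreover have "h' (n - 1) (g.Fs q n (h n a) (afun v (n - 1) y)) = k.Fs q n (h' n (h n a)) (afun v' (n - 1) (afun v (n - 1) y))"
   using hc(2) b a' unfolding g.compatible_def by blast
  ultimately show "?h (n - 1) (f.Fs q n a y) = k.Fs q n (?h n a) (afun (cmp FD v' v) (n - 1) y)"
   using e admissible_elts(1)[OF a f.fcE] cv[OF admissible_elts(2)[OF a f.fcY]] by (simp add: compose_def)
 qed
 moreover have "?h n (f.Fi n x) = k.Fi n (afun (cmp FD u' u) n x)" if x: "x\<in>elts (asrc f) n" for n x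
  using fdga_mapD(5)[OF f.Fi x] hi(1)[OF x] hi(2)[OF ue[OF x]] cu[OF x] by (simp add: compose_def)
 moreover have "k.Fq n (?h n z) = afun (cmp FD v' v) n (f.Fq n z)" if z: "z\<in>elts f.FE n" for n z
  using z hq(1)[OF z] hq(2)[OF he[OF z]] cv[OF fdga_mapD(5)[OF f.Fq z]] by (simp add: compose_def)
 ultimately show ?thesis using fdga_map_comp[OF R f.FE g.FE k.FE hm] unfolding induced_def by blast
qed

text \<open>The middle maps have to satisfy the functor laws strictly, which fillers obtained from
  lifting alone would not guarantee. Here they are singled out by \<open>THE\<close>, as the maps
  that preserve the chosen lifts.\<close>

lemma functorial:
 assumes L: "!!f. f\<in>arrs FD==>left b f\<in>K" and P: "!!f. f\<in>arrs FD==>right b f\<in>K'"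
 shows "functorial_factorization FD K K'"
proof -
 define M where "M f g u v = Arrow (mid b f) (mid b g) (THE h. induced b f g u v h)" for f g u v
 have M: "M f g u v = Arrow (mid b f) (mid b g) h" if "f\<in>arrs FD" "g\<in>arrs FD" "induced b f g u v h" for f g u v h
  using the_equality[of "induced b f g u v" h, OF that(3)] induced_unique[OF that(1,2) _ that(3)] by (simp add: M_def)
 show ?thesis unfolding functorial_factorization_def
 proof (unfold fDGA_simps(2,3), rule exI[of _ "left b"], rule exI[of _ "right b"], rule exI[of _ M], intro conjI ballI impI)
  fix f assume f: "f\<in>arrs FD"
  show "left b f\<in>K" by (rule L[OF f])
  show "right b f\<in>K'" by (rule P[OF f])
  show "asrc (left b f) = asrc f" "asrc (right b f) = atgt (left b f)" "atgt (right b f) = atgt f"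
   by (simp_all add: left_def right_def)
  show "cmp FD (right b f) (left b f) = f" by (rule factors[OF f])
  show "M f f (ident FD (asrc f)) (ident FD (atgt f)) = ident FD (atgt (left b f))"
   unfolding M[OF f f induced_ident[OF f]] by (simp add: left_def fDGA_simps)
  fix g assume g: "g\<in>arrs FD"
  { fix u v assume u: "u\<in>hom_set FD (asrc f) (asrc g)" and v: "v\<in>hom_set FD (atgt f) (atgt g)" and c: "cmp FD v f = cmp FD g u"
   obtain h where h: "induced b f g u v h" using induced_exists[OF f g u v c] by blast
   note Mh = M[OF f g h]
   interpret f: fdga_arrow R r S b "asrc f" "atgt f" "afun f" by (rule arrow[OF f])
   interpret g: fdga_arrow R r S b "asrc g" "atgt g" "afun g" by (rule arrow[OF g])
   have Ma: "Arrow (mid b f) (mid b g) h\<in>hom_set FD (mid b f) (mid b g)"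
    using h f.FE g.FE by (simp add: induced_def hom_fDGA)
   then show "M f g u v\<in>hom_set FD (atgt (left b f)) (atgt (left b g))" by (simp add: Mh left_def)
   have ua: "asrc u = asrc f" using u by (simp add: hom_fDGA)
   show "cmp FD (M f g u v) (left b f) = cmp FD (left b g) u" unfolding Mh
    by (rule hom_fDGA_eqI[OF catD(1)[OF factors(1)[OF f] Ma] catD(1)[OF u factors(1)[OF g]]])
     (use h ua in \<open>simp add: cmp_apply left_def induced_def\<close>)
   show "cmp FD (right b g) (M f g u v) = cmp FD v (right b f)" unfolding Mh
    by (rule hom_fDGA_eqI[OF catD(1)[OF Ma factors(2)[OF g]] catD(1)[OF factors(2)[OF f] v]])
     (use h in \<open>simp add: cmp_apply right_def induced_def\<close>) }
  fix k u v u' v' assume k: "k\<in>arrs FD" and u: "u\<in>hom_set FD (asrc f) (asrc g)" "v\<in>hom_set FD (atgt f) (atgt g)"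
   and u': "u'\<in>hom_set FD (asrc g) (asrc k)" "v'\<in>hom_set FD (atgt g) (atgt k)"
   and c: "cmp FD v f = cmp FD g u & cmp FD v' g = cmp FD k u'"
  obtain h where h: "induced b f g u v h" using induced_exists[OF f g u conjunct1[OF c]] by blast
  obtain h' where h': "induced b g k u' v' h'" using induced_exists[OF g k u' conjunct2[OF c]] by blast
  show "M f k (cmp FD u' u) (cmp FD v' v) = cmp FD (M g k u' v') (M f g u v)"
   unfolding M[OF f g h] M[OF g k h'] M[OF f k induced_comp[OF f g k u h h']] by (simp add: fDGA_simps)
 qed
qed

text \<open>Trivial only for \<open>b\<close> true; for \<open>b\<close> false these are all
  fibrations.\<close>

definition "trivial_fib b p \<longleftrightarrow> p\<in>arrs FD & cycle_onto S (cx (asrc p)) (cx (atgt p)) (afun p) &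
 (b \<longrightarrow> solvable r (cx (asrc p)) (cx (atgt p)) (afun p))"

lemma trivial_fib_iff: "p\<in>Fib \<inter> W \<longleftrightarrow> trivial_fib True p" "p\<in>Fib \<longleftrightarrow> trivial_fib False p"
proof -
 show "p\<in>Fib \<longleftrightarrow> trivial_fib False p" by (simp add: trivial_fib_def fdga_fib_iff[OF R])
 have "page_iso r (cx (asrc p)) (cx (atgt p)) (afun p) \<longleftrightarrow> solvable r (cx (asrc p)) (cx (atgt p)) (afun p)"
  if a: "p\<in>arrs FD" and o: "cycle_onto S (cx (asrc p)) (cx (atgt p)) (afun p)"
  using a page_iso_iff_solvable[OF fdgaD(1)[OF R] fdgaD(1)[OF R] map_fmap o S(2)] by (simp add: arr_fDGA)
 then show "p\<in>Fib \<inter> W \<longleftrightarrow> trivial_fib True p" by (auto simp: trivial_fib_def fdga_fib_iff[OF R] fdga_weq_iff[OF R])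
qed

lemma left_llp:
 assumes f: "f\<in>arrs FD"
 shows "left b f\<in>llp FD {p. trivial_fib b p}"
proof -
 interpret f: fdga_arrow R r S b "asrc f" "atgt f" "afun f" by (rule arrow[OF f])
 have l: "left b f\<in>arrs FD" using factors(1)[OF f] by (simp add: hom_set_def)
 have "has_lifting FD (left b f) p" if "trivial_fib b p" for p
 proof -
  have p: "p\<in>arrs FD" and o: "cycle_onto S (cx (asrc p)) (cx (atgt p)) (afun p)" "b==>solvable r (cx (asrc p)) (cx (atgt p)) (afun p)"
   using that by (simp_all add: trivial_fib_def)
  show ?thesis unfolding lifting_fDGA_iff[OF R l p]
  proof (intro allI impI)
   fix u v assume u: "dgmap R (asrc (left b f)) (asrc p) u" and v: "dgmap R (atgt (left b f)) (atgt p) v"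
    and c: "\<forall>n. \<forall>x\<in>elts (asrc (left b f)) n. afun p n (u n x) = v n (afun (left b f) n x)"
   have pm: "is_fdga R (asrc p)" "is_fdga R (atgt p)" "dgmap R (asrc p) (atgt p) (afun p)" using p by (simp_all add: arr_fDGA)
   show "\<exists>h. dgmap R (atgt (left b f)) (asrc p) h &
    (\<forall>n. \<forall>x\<in>elts (asrc (left b f)) n. h n (afun (left b f) n x) = u n x) &
    (\<forall>n. \<forall>z\<in>elts (atgt (left b f)) n. afun p n (h n z) = v n z)"
    using f.inclusion_lifts[OF pm _ _ _ o, of u v] u v c by (simp add: left_def)
  qed
 qed
 then show ?thesis using l by (simp add: llp_def)
qed

lemma right_trivial:
 assumes f: "f\<in>arrs FD" shows "trivial_fib b (right b f)"
proof -
 interpret f: fdga_arrow R r S b "asrc f" "atgt f" "afun f" by (rule arrow[OF f])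
 have "cycle_onto S (cx f.FE) (cx (atgt f)) f.Fq & (b \<longrightarrow> solvable r (cx f.FE) (cx (atgt f)) f.Fq)"
  using f.structured_free structured_exists_iff by blast
 then show ?thesis using factors(2)[OF f] by (simp add: trivial_fib_def right_def hom_set_def)
qed

abbreviation "Cof \<equiv> llp FD (Fib \<inter> W)"

lemma fib_arrs: "Fib \<subseteq> arrs FD" "Fib \<inter> W \<subseteq> arrs FD"
 by (auto simp: fdga_fib_def)

lemma llp_fib: "llp FD Fib \<subseteq> Cof \<inter> W"
 using llp_fib_weq[OF inf R S(1)] by (auto simp: llp_def)

text \<open>\<open>i\<close> factors as a map with the lifting property against fibrations followed
  by a fibration. The former is a weak equivalence, hence by two of three so is the latter; thus
  \<open>i\<close> lifts against it and the retract argument applies.\<close>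

lemma trivial_cofibration:
 assumes i: "i\<in>Cof \<inter> W" shows "i\<in>llp FD Fib"
proof -
 have a: "i\<in>arrs FD" using i by (simp add: llp_def)
 have e: "{p. trivial_fib False p} = Fib" using trivial_fib_iff(2) by blast
 have j: "left False i\<in>llp FD Fib" using left_llp[OF a, of False] unfolding e .
 have q: "right False i\<in>Fib" using right_trivial[OF a] trivial_fib_iff(2) by blast
 note F = factors[OF a, of False]
 note H = F(1)[unfolded hom_set_def] F(2)[unfolded hom_set_def]
 have "left False i\<in>W" using llp_fib j by blast
 then have "right False i\<in>W"
  using two_of_three_weq[OF R, of r] H F(3) i unfolding two_of_three_def by auto
 then have "has_lifting FD i (right False i)" using i q by (simp add: llp_def)
 then show ?thesis
  by (rule llp_retract_argument[OF cat fib_arrs(1) a j, rotated 5]) (use H F(3) in \<open>simp_all add: fDGA_simps\<close>)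
qed

lemma fdga_model_category:
 assumes "bicomplete ty FD" shows "model_category ty FD W Cof Fib"
 unfolding model_category_def
proof (intro conjI ballI)
 show "is_category FD" by (rule cat)
 show "bicomplete ty FD" by fact
 show "wide_subcategory FD W" by (rule subcategory_weq[OF R])
 show "wide_subcategory FD Fib" by (rule subcategory_fib[OF R])
 show "wide_subcategory FD Cof" by (rule llp_subcategory[OF cat fib_arrs(2)])
 show "two_of_three FD W" by (rule two_of_three_weq[OF R])
 show "retract_closed FD W" by (rule retract_weq[OF R])
 show "retract_closed FD Fib" by (rule retract_fib[OF R])
 show "retract_closed FD Cof" by (rule llp_retract[OF cat fib_arrs(2)])
 show "has_lifting FD i p" if "i\<in>Cof \<inter> W" "p\<in>Fib" for i p
  using trivial_cofibration[OF that(1)] that(2) by (simp add: llp_def)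
 show "has_lifting FD i p" if "i\<in>Cof" "p\<in>Fib \<inter> W" for i p using that by (simp add: llp_def)
 have e: "{p. trivial_fib True p} = Fib \<inter> W" "{p. trivial_fib False p} = Fib" using trivial_fib_iff by blast+
 show "functorial_factorization FD Cof (Fib \<inter> W)"
  using left_llp[of _ True, unfolded e(1)] right_trivial[of _ True, unfolded trivial_fib_iff(1)[symmetric]] by (rule functorial)
 show "functorial_factorization FD (Cof \<inter> W) Fib"
  by (rule functorial[of False]) (use left_llp[of _ False] right_trivial[of _ False] llp_fib in \<open>auto simp only: e trivial_fib_iff(2)\<close>)
qed

end

lemma fDGA_bicomplete:
 fixes R :: "'u ring"
 assumes U: "universe TYPE('i) TYPE('u)" and R: "cring R"
 shows "bicomplete TYPE('i) (fDGA R)"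
proof -
 obtain code :: "('i => 'u) => 'u" where code: "inj code" using U by (auto simp: universe_def lepoll_def)
 have inf: "infinite (UNIV :: 'u set)" using U by (simp add: universe_def)
 then obtain a b :: 'u where ab: "a \<noteq> b" using finite.simps[of "UNIV :: 'u set"] by (metis UNIV_I finite.emptyI finite_insert finite_subset insertI1 singletonD subsetI)
 \<comment> \<open>Indices embed into \<open>'u\<close> as codes of indicator functions with two
   distinct values. The labels of generators in colimits need this.\<close>
 have "inj (%i. code (%k. if k = i then a else b))"
  by (rule injI) (use ab in \<open>auto dest!: injD[OF code] simp: fun_eq_iff split: if_splits\<close>)
 then have ii: "\<exists>f :: 'i => 'u. inj f" by blast
 show ?thesis unfolding bicomplete_def
  using fDGA_limits[OF code R] fDGA_colimits[OF inf ii R] by blast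
qed

section \<open>The generating morphisms\<close>

lemma ex1_eq: "\<exists>!x. P x==>P a==>P b==>a = b"
 by blast

text \<open>Transposition \<open>T\<close> is a bijection on hom sets, compatible with composition
  by \<open>i\<close> on one side (\<open>Ti\<close>) and by \<open>p\<close> on the other
  (\<open>Tp\<close>), so squares and fillers correspond.\<close>

lemma adjoint_lifting:
 assumes C: "is_category C" and D: "is_category D" and adj: "left_adjoint C D Fo Fm Go Gm"
  and i: "i\<in>arrs C" and p: "p\<in>arrs D"
 shows "has_lifting D (Fm i) p \<longleftrightarrow> has_lifting C i (Gm p)"
proof -
 note CD = categoryD[OF C] and DD = categoryD[OF D]
 from adj obtain \<eta> where F: "is_functor C D Fo Fm" and G: "is_functor D C Go Gm"
  and \<eta>: "!!X. X\<in>objs C==>\<eta> X\<in>hom_set C X (Go (Fo X))"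
  and nat: "!!f. f\<in>arrs C==>cmp C (\<eta> (tgt C f)) f = cmp C (Gm (Fm f)) (\<eta> (src C f))"
  and u: "!!X Y f. X\<in>objs C==>Y\<in>objs D==>f\<in>hom_set C X (Go Y) ==>
   \<exists>!g. g\<in>hom_set D (Fo X) Y & cmp C (Gm g) (\<eta> X) = f"
  unfolding left_adjoint_def by blast
 note ia = CD(7)[OF i] and pa = DD(7)[OF p]
 define X Y where "X = src C i" and "Y = tgt C i"
 have nat': "cmp C (\<eta> Y) i = cmp C (Gm (Fm i)) (\<eta> X)" using nat[OF i] unfolding X_def Y_def .
 define K L where "K = src D p" and "L = tgt D p"
 have ia: "i\<in>hom_set C X Y" and pa: "p\<in>hom_set D K L" using ia pa by (simp_all add: X_def Y_def K_def L_def)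
 have o: "X\<in>objs C" "Y\<in>objs C" "K\<in>objs D" "L\<in>objs D" using CD(6)[OF ia] DD(6)[OF pa] by auto
 have Gh: "Gm g\<in>hom_set C (Go A) (Go B)" if "g\<in>hom_set D A B" for g A B
  using G that unfolding is_functor_def hom_set_def by blast
 have Fi: "Fm i\<in>hom_set D (Fo X) (Fo Y)" using F ia unfolding is_functor_def hom_set_def by blast
 have Gc: "Gm (cmp D g f) = cmp C (Gm g) (Gm f)" if "f\<in>hom_set D A B" "g\<in>hom_set D B E" for f g A B E
  using G that unfolding is_functor_def hom_set_def by blast
 define T where "T A g = cmp C (Gm g) (\<eta> A)" for A g
 have T: "T A g\<in>hom_set C A (Go B)" if "g\<in>hom_set D (Fo A) B" "A\<in>objs C" for A B g
  unfolding T_def by (rule CD(1)[OF \<eta>[OF that(2)] Gh[OF that(1)]])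
 have inj: "g = g'" if "g\<in>hom_set D (Fo A) B" "g'\<in>hom_set D (Fo A) B" "A\<in>objs C" "T A g = T A g'" for A B g g'
  by (rule ex1_eq[OF u[OF that(3) conjunct2[OF DD(6)[OF that(1)]] T[OF that(1,3)]]]) (use that in \<open>simp_all add: T_def\<close>)
 have surj: "\<exists>g\<in>hom_set D (Fo A) B. T A g = f" if "f\<in>hom_set C A (Go B)" "A\<in>objs C" "B\<in>objs D" for A B f
  using u[OF that(2,3,1)] unfolding T_def by blast
 have Ti: "T X (cmp D g (Fm i)) = cmp C (T Y g) i" if g: "g\<in>hom_set D (Fo Y) B" for g B
  unfolding T_def Gc[OF Fi g] CD(5)[OF \<eta>[OF o(1)] Gh[OF Fi] Gh[OF g], symmetric] nat'[symmetric]
  by (rule CD(5)[OF ia \<eta>[OF o(2)] Gh[OF g]])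
 have Tp: "T A (cmp D p g) = cmp C (Gm p) (T A g)" if g: "g\<in>hom_set D (Fo A) K" and A: "A\<in>objs C" for A g
  unfolding T_def Gc[OF g pa] by (rule CD(5)[OF \<eta>[OF A] Gh[OF g] Gh[OF pa], symmetric])
 show ?thesis
 proof
  assume l: "has_lifting D (Fm i) p"
  show "has_lifting C i (Gm p)" unfolding has_lifting_def hom_setD(2,3)[OF ia] hom_setD(2,3)[OF Gh[OF pa]]
  proof (intro ballI impI)
   fix u v assume u: "u\<in>hom_set C X (Go K)" and v: "v\<in>hom_set C Y (Go L)" and e: "cmp C (Gm p) u = cmp C v i"
   obtain u' where u': "u'\<in>hom_set D (Fo X) K" "T X u' = u" using surj[OF u o(1,3)] by blast
   obtain v' where v': "v'\<in>hom_set D (Fo Y) L" "T Y v' = v" using surj[OF v o(2,4)] by blast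
   have "cmp D p u' = cmp D v' (Fm i)"
    by (rule inj[OF DD(1)[OF u'(1) pa] DD(1)[OF Fi v'(1)] o(1)]) (simp add: Tp[OF u'(1) o(1)] Ti[OF v'(1)] u' v' e)
   then obtain h where h: "h\<in>hom_set D (Fo Y) K" "cmp D h (Fm i) = u'" "cmp D p h = v'"
    using has_liftingD[OF l, unfolded hom_setD(2,3)[OF Fi] hom_setD(2,3)[OF pa], OF u'(1) v'(1)] by blast
   show "\<exists>h\<in>hom_set C Y (Go K). cmp C h i = u & cmp C (Gm p) h = v"
    using T[OF h(1) o(2)] Ti[OF h(1)] Tp[OF h(1) o(2)] h(2,3) u'(2) v'(2) by (intro bexI[of _ "T Y h"]) simp_all
  qed
 next
  assume l: "has_lifting C i (Gm p)"
  show "has_lifting D (Fm i) p" unfolding has_lifting_def hom_setD(2,3)[OF Fi] hom_setD(2,3)[OF pa]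
  proof (intro ballI impI)
   fix u v assume u: "u\<in>hom_set D (Fo X) K" and v: "v\<in>hom_set D (Fo Y) L" and e: "cmp D p u = cmp D v (Fm i)"
   have "cmp C (Gm p) (T X u) = cmp C (T Y v) i" using Tp[OF u o(1)] Ti[OF v] e by simp
   then obtain k where k: "k\<in>hom_set C Y (Go K)" "cmp C k i = T X u" "cmp C (Gm p) k = T Y v"
    using has_liftingD[OF l, unfolded hom_setD(2,3)[OF ia] hom_setD(2,3)[OF Gh[OF pa]], OF T[OF u o(1)] T[OF v o(2)]] by blast
   obtain h where h: "h\<in>hom_set D (Fo Y) K" "T Y h = k" using surj[OF k(1) o(2,3)] by blast
   have "cmp D h (Fm i) = u"
    by (rule inj[OF DD(1)[OF Fi h(1)] u o(1)]) (simp add: Ti[OF h(1)] h(2) k(2))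
   moreover have "cmp D p h = v"
    by (rule inj[OF DD(1)[OF h(1) pa] v o(2)]) (simp add: Tp[OF h(1) o(2)] h(2) k(3))
   ultimately show "\<exists>h\<in>hom_set D (Fo Y) K. cmp D h (Fm i) = u & cmp D p h = v" using h(1) by blast
  qed
 qed
qed

section \<open>Cycles as maps out of \<open>Z_complex\<close>\<close>

lemma Z_simps:
 "grade (Z_complex R k p n) m = (if m = n \<or> m = n + 1 then carrier R else {\<zero>[R]})"
 "\<zero>[md (Z_complex R k p n) m] = \<zero>[R]"
 "x +[md (Z_complex R k p n) m] y = x +[R] y" "c *[md (Z_complex R k p n) m] x = c \<otimes>[R] x"
 "df (Z_complex R k p n) m x = (if m = n then x else \<zero>[R])"
 "fil (Z_complex R k p n) q m = (if m = n & p \<le> q \<or> m = n + 1 & p - int k \<le> q then carrier R else {\<zero>[R]})"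
 by (simp_all add: Z_complex_def R_complex_def self_mod_def zero_mod_def)

lemma Z_fcomplex:
 assumes R: "cring R" shows "fcx R (Z_complex R k p n)"
proof -
 interpret cring R by fact
 have m: "module R (md (Z_complex R k p n) j)" for j
  by (simp add: Z_complex_def R_complex_def self_mod_module[OF R] zero_mod_module[OF R])
 have "submodule (fil (Z_complex R k p n) q j) R (md (Z_complex R k p n) j)" for q j
  unfolding submodule_iff[OF m] by (auto simp: Z_simps)
 moreover have "df (Z_complex R k p n) j\<in>mod_hom R (md (Z_complex R k p n) j) (md (Z_complex R k p n) (j + 1))" for j
  by (auto simp: mod_hom_def Z_simps)
 ultimately show ?thesis unfolding is_fcomplex_def using m by (auto simp: Z_simps)
qed

lemma zero_fcomplex:
 assumes R: "cring R" shows "fcx R (zero_complex R)"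
proof -
 interpret cring R by fact
 have m: "module R (md (zero_complex R) j)" for j by (simp add: zero_complex_def zero_mod_module[OF R])
 have "submodule (fil (zero_complex R) q j) R (md (zero_complex R) j)" for q j
  unfolding submodule_iff[OF m] by (auto simp: zero_complex_def zero_mod_def self_mod_def)
 then show ?thesis unfolding is_fcomplex_def using m by (auto simp: mod_hom_def zero_complex_def zero_mod_def self_mod_def)
qed

lemma zero_complex_hom:
 assumes R: "cring R" and A: "fcx R A"
 shows "\<exists>!f. f\<in>homC R (zero_complex R) A"
proof (rule ex1I)
 interpret cring R by fact
 let ?f = "%m. \<lambda>x\<in>{\<zero>[R]}. \<zero>[md A m]"
 have "is_fmap R (zero_complex R) A ?f" unfolding is_fmap_def mod_hom_def
 proof (intro conjI allI ballI IntI CollectI funcsetI)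
  fix m
  interpret M: module R "md A m" by (rule fcxD(1)[OF A])
  { fix x assume "x\<in>grade (zero_complex R) m"
   then have x: "x = \<zero>[R]" by (simp add: zero_complex_def zero_mod_def)
   show "?f m x\<in>grade A m" by (simp add: x)
   show "?f (m + 1) (df (zero_complex R) m x) = df A m (?f m x)" by (simp add: x zero_complex_def df_zero[OF A])
   { fix y assume "y\<in>grade (zero_complex R) m"
    then show "?f m (x +[md (zero_complex R) m] y) = ?f m x +[md A m] ?f m y"
     by (simp add: x zero_complex_def zero_mod_def self_mod_def) }
   fix c assume "c\<in>carrier R"
   then show "?f m (c *[md (zero_complex R) m] x) = c *[md A m] ?f m x"
    by (simp add: x zero_complex_def zero_mod_def self_mod_def) }
  show "?f m\<in>extensional (grade (zero_complex R) m)" by (simp add: zero_complex_def zero_mod_def)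
  fix q show "?f m ` fil (zero_complex R) q m \<subseteq> fil A q m" using fil_alg(1)[OF A] by (simp add: zero_complex_def)
 qed
 then show "Arrow (zero_complex R) A ?f\<in>homC R (zero_complex R) A"
  using A zero_fcomplex[OF R] by (simp add: hom_fC)
 fix f assume f: "f\<in>homC R (zero_complex R) A"
 then have fm: "is_fmap R (zero_complex R) A (afun f)" by (simp add: hom_fC)
 show "f = Arrow (zero_complex R) A ?f"
 proof (rule hom_fC_eqI[OF f \<open>Arrow (zero_complex R) A ?f\<in>_\<close>])
  fix m x assume "x\<in>grade (zero_complex R) m"
  then show "afun f m x = afun (Arrow (zero_complex R) A ?f) m x"
   using fmap_zero[OF zero_fcomplex[OF R] A fm, of m] by (simp add: zero_complex_def zero_mod_def self_mod_def)
 qed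
qed

text \<open>The map that corresponds to the cycle \<open>y\<close> when \<open>Z_complex\<close>
  represents cycles: the generator in degree \<open>n\<close> goes to \<open>y\<close>, and hence
  the one in degree \<open>n + 1\<close> to its differential.\<close>

definition Z_map :: "'r ring => ('r, 'a) fcomplex => int => 'a => int => 'r => 'a" where
 "Z_map R A n y m = (\<lambda>x\<in>(if m = n \<or> m = n + 1 then carrier R else {\<zero>[R]}).
   if m = n then x *[md A m] y else if m = n + 1 then x *[md A m] df A n y else \<zero>[md A m])"

lemma Z_map:
 assumes R: "cring R" and A: "fcx R A" and y: "y\<in>cycles A k p n"
 shows "is_fmap R (Z_complex R k p n) A (Z_map R A n y)" "Z_map R A n y n \<one>[R] = y"
proof -
 interpret cring R by fact
 note yc = cycles_elts[OF A y] and dy = fcxD(3)[OF A cycles_elts[OF A y]]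
 have yf: "y\<in>fil A p n" "df A n y\<in>fil A (p - int k) (n + 1)" using y by (simp_all add: cycles_iff)
 interpret N: module R "md A n" by (rule fcxD(1)[OF A])
 interpret N1: module R "md A (n + 1)" by (rule fcxD(1)[OF A])
 have z0: "Z_map R A n y j \<zero>[R] = \<zero>[md A j]" for j
  using N.smult_l_null[OF yc] N1.smult_l_null[OF dy] by (simp add: Z_map_def)
 show "Z_map R A n y n \<one>[R] = y" using yc by (simp add: Z_map_def)
 show "is_fmap R (Z_complex R k p n) A (Z_map R A n y)" unfolding is_fmap_def mod_hom_def
 proof (intro conjI allI ballI IntI CollectI funcsetI)
  fix m
  interpret M: module R "md A m" by (rule fcxD(1)[OF A])
  { fix x assume x: "x\<in>grade (Z_complex R k p n) m"
   then have xR: "x\<in>carrier R" by (simp add: Z_simps split: if_splits)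
   note xdy = N1.smult_closed[OF xR dy]
   show "Z_map R A n y m x\<in>grade A m" using x yc xdy by (auto simp: Z_map_def Z_simps)
   consider "m = n" | "m = n + 1" | "m \<noteq> n" "m \<noteq> n + 1" by blast
   then show "Z_map R A n y (m + 1) (df (Z_complex R k p n) m x) = df A m (Z_map R A n y m x)"
   proof cases
    case 1
    then show ?thesis using xR mod_homD(3)[OF fcxD(2)[OF A, of n] xR yc] by (simp add: Z_map_def Z_simps)
   next
    case 2
    interpret N2: module R "md A (n + 1 + 1)" by (rule fcxD(1)[OF A])
    have "df A (n + 1) (x *[md A (n + 1)] df A n y) = \<zero>[md A (n + 1 + 1)]"
     unfolding mod_homD(3)[OF fcxD(2)[OF A, of "n + 1"] xR dy] fcxD(4)[OF A yc] by (rule N2.smult_r_null[OF xR])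
    moreover have "Z_map R A n y (n + 1) x = x *[md A (n + 1)] df A n y" using xR by (simp add: Z_map_def)
    moreover have "df (Z_complex R k p n) (n + 1) x = \<zero>[R]" by (simp add: Z_simps)
    ultimately show ?thesis by (simp only: 2 z0)
   next
    case 3
    then have "x = \<zero>[R]" "df (Z_complex R k p n) m x = \<zero>[R]" using x by (simp_all add: Z_simps)
    then show ?thesis by (simp only: z0 df_zero[OF A])
   qed
   { fix x' assume x': "x'\<in>grade (Z_complex R k p n) m"
    show "Z_map R A n y m (x +[md (Z_complex R k p n) m] x') = Z_map R A n y m x +[md A m] Z_map R A n y m x'"
     using x x' yc dy N1.smult_l_distr by (auto simp: Z_map_def Z_simps N.smult_l_distr) }
   fix c assume c: "c\<in>carrier R"
   show "Z_map R A n y m (c *[md (Z_complex R k p n) m] x) = c *[md A m] Z_map R A n y m x"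
    using x c yc dy N1.smult_assoc1 by (auto simp: Z_map_def Z_simps N.smult_assoc1) }
  show "Z_map R A n y m\<in>extensional (grade (Z_complex R k p n) m)" by (simp add: Z_map_def Z_simps)
  fix q show "Z_map R A n y m ` fil (Z_complex R k p n) q m \<subseteq> fil A q m"
  proof (rule image_subsetI)
   fix x assume x: "x\<in>fil (Z_complex R k p n) q m"
   then have xR: "x\<in>carrier R" by (simp add: Z_simps split: if_splits)
   consider "m = n" "p \<le> q" | "m = n + 1" "p - int k \<le> q" | "x = \<zero>[R]"
    using x by (auto simp: Z_simps split: if_splits)
   then show "Z_map R A n y m x\<in>fil A q m"
   proof cases
    case 1 then show ?thesis using fil_alg(5)[OF A xR fil_subset[OF A 1(2) yf(1)]] xR by (simp add: Z_map_def)
   next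
    case 2 then show ?thesis using fil_alg(5)[OF A xR fil_subset[OF A 2(2) yf(2)]] xR by (simp add: Z_map_def)
   next
    case 3 then show ?thesis using fil_alg(1)[OF A, of m q] by (simp only: z0)
   qed
  qed
 qed
qed

text \<open>The generator in degree \<open>n\<close> is a universal cycle. Its differential is the
  generator in degree \<open>n + 1\<close>, so its image determines the map in both degrees.\<close>

lemma Z_map_unique:
 assumes R: "cring R" and A: "fcx R A" and f: "is_fmap R (Z_complex R k p n) A f"
 shows "f n \<one>[R]\<in>cycles A k p n" "f = Z_map R A n (f n \<one>[R])"
proof -
 interpret cring R by fact
 note Z = Z_fcomplex[OF R, of k p n]
 have "\<one>[R]\<in>cycles (Z_complex R k p n) k p n" by (simp add: cycles_iff Z_simps)
 from fmap_cycles[OF f Z this] show c: "f n \<one>[R]\<in>cycles A k p n" .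
 show "f = Z_map R A n (f n \<one>[R])"
 proof (rule fmap_eqI[OF f Z_map(1)[OF R A c]])
  fix m x assume x: "x\<in>grade (Z_complex R k p n) m"
  then have xR: "x\<in>carrier R" by (simp add: Z_simps split: if_splits)
  consider "m = n" | "m = n + 1" | "m \<noteq> n" "m \<noteq> n + 1" by blast
  then show "f m x = Z_map R A n (f n \<one>[R]) m x"
  proof cases
   case 1
   then show ?thesis using is_fmapD(7)[OF f xR, of "\<one>[R]" n] xR by (simp add: Z_map_def Z_simps)
  next
   case 2
   have "f (n + 1) \<one>[R] = df A n (f n \<one>[R])" using is_fmapD(3)[OF f, of "\<one>[R]" n] by (simp add: Z_simps)
   then show ?thesis using 2 is_fmapD(7)[OF f xR, of "\<one>[R]" "n + 1"] xR by (simp add: Z_map_def Z_simps)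
  next
   case 3
   then show ?thesis using x fmap_zero[OF Z A f, of m] by (simp add: Z_map_def Z_simps)
  qed
 qed
qed

text \<open>Maps out of the zero complex are unique, so a square is just a map from
  \<open>Z_complex\<close> to the target of \<open>f\<close>, which is a cycle, and a filler is a
  cycle over it.\<close>

lemma zero_to_Z_lifting:
 assumes R: "cring R" and f: "f\<in>arrs (fC R)"
 shows "zero_to_Z R s p n\<in>arrs (fC R)"
  "has_lifting (fC R) (zero_to_Z R s p n) f \<longleftrightarrow> (\<forall>y\<in>cycles (atgt f) s p n. \<exists>x\<in>cycles (asrc f) s p n. afun f n x = y)"
proof -
 interpret cring R by fact
 let ?Z = "Z_complex R s p n" and ?A = "asrc f" and ?B = "atgt f"
 note Z = Z_fcomplex[OF R, of s p n] and D = categoryD[OF category_fC[of R]]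
 have A: "fcx R ?A" and B: "fcx R ?B" and fm: "is_fmap R ?A ?B (afun f)" and fa: "f\<in>homC R ?A ?B"
  using f by (simp_all add: arr_fC hom_fC)
 \<comment> \<open>\<open>zero_to_Z\<close> is recognized as the unique arrow from the zero complex,
   which gives its morphism properties without a direct check.\<close>
 obtain g where g: "g\<in>homC R (zero_complex R) ?Z" using zero_complex_hom[OF R Z] by blast
 then have gm: "is_fmap R (zero_complex R) ?Z (afun g)" by (simp add: hom_fC)
 have e: "afun g m = (\<lambda>x\<in>{\<zero>[R]}. \<zero>[R])" for m
  using is_fmapD(2)[OF gm, of m] fmap_zero[OF zero_fcomplex[OF R] Z gm, of m]
  by (intro extensionalityI[of _ "{\<zero>[R]}"]) (simp_all add: zero_complex_def zero_mod_def self_mod_def Z_simps)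
 have "g = zero_to_Z R s p n" using g ext[of "afun g", OF e] by (cases g) (simp add: zero_to_Z_def hom_fC)
 with g have z: "zero_to_Z R s p n\<in>homC R (zero_complex R) ?Z" by simp
 then show "zero_to_Z R s p n\<in>arrs (fC R)" by (simp add: hom_set_def)
 have uq: "u = v" if "u\<in>homC R (zero_complex R) K" "v\<in>homC R (zero_complex R) K" for u v K
  using that zero_complex_hom[OF R, of K] by (auto simp: hom_fC)
 show "has_lifting (fC R) (zero_to_Z R s p n) f \<longleftrightarrow> (\<forall>y\<in>cycles ?B s p n. \<exists>x\<in>cycles ?A s p n. afun f n x = y)"
  unfolding has_lifting_def hom_setD(2,3)[OF z] hom_setD(2,3)[OF fa]
 proof (intro iffI ballI impI)
  fix y assume l: "\<forall>u\<in>homC R (zero_complex R) ?A. \<forall>v\<in>homC R ?Z ?B. cmpC R f u = cmpC R v (zero_to_Z R s p n) \<longrightarrow>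
    (\<exists>h\<in>homC R ?Z ?A. cmpC R h (zero_to_Z R s p n) = u & cmpC R f h = v)" and y: "y\<in>cycles ?B s p n"
  obtain u where u: "u\<in>homC R (zero_complex R) ?A" using zero_complex_hom[OF R A] by blast
  have v: "Arrow ?Z ?B (Z_map R ?B n y)\<in>homC R ?Z ?B" using Z_map(1)[OF R B y] Z B by (simp add: hom_fC)
  obtain h where h: "h\<in>homC R ?Z ?A" "cmpC R f h = Arrow ?Z ?B (Z_map R ?B n y)"
   using l u v uq[OF D(1)[OF u fa] D(1)[OF z v]] by blast
  have hm: "is_fmap R ?Z ?A (afun h)" "asrc h = ?Z" using h(1) by (simp_all add: hom_fC)
  have "afun f n (afun h n \<one>[R]) = y"
   using cmp_apply(2)[of "\<one>[R]" h n R f] h(2) hm(2) Z_map(2)[OF R B y] by (simp add: Z_simps)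
  then show "\<exists>x\<in>cycles ?A s p n. afun f n x = y" using Z_map_unique(1)[OF R A hm(1)] by blast
 next
  fix u v assume on: "\<forall>y\<in>cycles ?B s p n. \<exists>x\<in>cycles ?A s p n. afun f n x = y"
   and u: "u\<in>homC R (zero_complex R) ?A" and v: "v\<in>homC R ?Z ?B"
  have vm: "is_fmap R ?Z ?B (afun v)" "asrc v = ?Z" using v by (simp_all add: hom_fC)
  obtain x where x: "x\<in>cycles ?A s p n" "afun f n x = afun v n \<one>[R]" using on Z_map_unique(1)[OF R B vm(1)] by blast
  let ?h = "Arrow ?Z ?A (Z_map R ?A n x)"
  have h: "?h\<in>homC R ?Z ?A" using Z_map(1)[OF R A x(1)] Z A by (simp add: hom_fC)
  have fh: "cmpC R f ?h\<in>homC R ?Z ?B" by (rule D(1)[OF h fa])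
  then have fhm: "is_fmap R ?Z ?B (afun (cmpC R f ?h))" by (simp add: hom_fC)
  have "afun (cmpC R f ?h) n \<one>[R] = afun v n \<one>[R]"
   using cmp_apply(2)[of "\<one>[R]" ?h n R f] x(2) Z_map(2)[OF R A x(1)] by (simp add: Z_simps)
  then have "afun (cmpC R f ?h) = afun v" using Z_map_unique(2)[OF R B fhm] Z_map_unique(2)[OF R B vm(1)] by simp
  then have "cmpC R f ?h = v" using fh v by (intro hom_fC_eqI) simp_all
  then show "\<exists>h\<in>homC R ?Z ?A. cmpC R h (zero_to_Z R s p n) = u & cmpC R f h = v"
   using h uq[OF D(1)[OF z h] u] by blast
 qed
qed

section \<open>Direct sums of complexes, coded into the type of their summands\<close>

locale coded_sum =
 fixes R :: "'u ring" and A1 A2 :: "('u, 'u) fcomplex"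
 assumes inf: "infinite (UNIV :: 'u set)" and R: "cring R" and A: "fcx R A1" "fcx R A2"
begin

definition "B = copy_complex pair_code (sum_complex A1 A2)"

lemma dec: "inv_into UNIV pair_code (pair_code x) = (x :: 'u \<times> 'u)"
 by (rule inv_f_f[OF inj_pair_code[OF inf]])

lemma simps:
 "grade B m = pair_code ` (grade A1 m \<times> grade A2 m)"
 "\<zero>[md B m] = pair_code (\<zero>[md A1 m], \<zero>[md A2 m])"
 "pair_code (a, b) +[md B m] pair_code (a', b') = pair_code (a +[md A1 m] a', b +[md A2 m] b')"
 "c *[md B m] pair_code (a, b) = pair_code (c *[md A1 m] a, c *[md A2 m] b)"
 "df B m (pair_code (a, b)) = pair_code (df A1 m a, df A2 m b)"
 "fil B p m = pair_code ` (fil A1 p m \<times> fil A2 p m)"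
 by (simp_all add: B_def copy_complex_def copy_mod_def sum_complex_def sum_mod_def dec)

lemma pair_mem: "pair_code (a, b)\<in>pair_code ` (X \<times> Y) \<longleftrightarrow> a\<in>X & b\<in>(Y :: 'u set)"
 using pair_code_eq[OF inf] by fastforce

lemma fcB: "fcx R B"
proof -
 interpret cring R by (rule R)
 note D = fcxD[OF A(1)] fcxD[OF A(2)]
 have m: "module R (md B m)" for m
 proof -
  interpret M1: module R "md A1 m" by (rule D)
  interpret M2: module R "md A2 m" by (rule D)
  have "abelian_group (md B m)"
  proof (rule abelian_groupI)
   fix x assume "x\<in>grade B m"
   then obtain a b where x: "x = pair_code (a, b)" "a\<in>grade A1 m" "b\<in>grade A2 m" by (auto simp: simps)
   then show "\<exists>y\<in>grade B m. y +[md B m] x = \<zero>[md B m]"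
    by (intro bexI[of _ "pair_code (\<ominus>[md A1 m] a, \<ominus>[md A2 m] b)"]) (simp_all add: simps M1.l_neg M2.l_neg)
  qed (auto simp: simps M1.a_ac M2.a_ac)
  then show ?thesis
   by (intro moduleI R) (auto simp: simps M1.smult_closed M2.smult_closed M1.smult_l_distr M2.smult_l_distr M1.smult_r_distr M2.smult_r_distr
     M1.smult_assoc1 M2.smult_assoc1)
 qed
 have "submodule (fil B p j) R (md B j)" for p j
  unfolding submodule_iff[OF m] using fil_alg[OF A(1)] fil_alg[OF A(2)] D(8,16) by (auto simp: simps)
 moreover have "df B j\<in>mod_hom R (md B j) (md B (j + 1))" for j
  using mod_homD[OF D(2)[of j]] mod_homD[OF D(10)[of j]] by (auto simp: mod_hom_def simps)
 moreover have "df B (j + 1) (df B j x) = \<zero>[md B (j + 1 + 1)]" if "x\<in>grade B j" for j x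
 proof -
  from that obtain a b where x: "x = pair_code (a, b)" "a\<in>grade A1 j" "b\<in>grade A2 j" by (auto simp: simps)
  show ?thesis unfolding x(1) simps D(4)[OF x(2)] D(12)[OF x(3)] ..
 qed
 moreover have "fil B p j \<subseteq> fil B (p + 1) j" "df B j ` fil B p j \<subseteq> fil B p (j + 1)" for p j
  using D(6)[of p j] D(14)[of p j] D(7,15) by (auto simp: simps)
 ultimately show ?thesis unfolding is_fcomplex_def using m by blast
qed

definition incl :: "bool => int => 'u => 'u" where
 "incl t m = (if t then (\<lambda>x\<in>grade A1 m. pair_code (x, \<zero>[md A2 m])) else (\<lambda>y\<in>grade A2 m. pair_code (\<zero>[md A1 m], y)))"

lemma incl: "is_fmap R A1 B (incl True)" "is_fmap R A2 B (incl False)"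
proof -
 have z: "\<zero>[M] +[M] \<zero>[M] = \<zero>[M]" "\<zero>[M]\<in>carrier M"
  "x\<in>carrier M==>y\<in>carrier M==>x +[M] y\<in>carrier M"
  "c\<in>carrier R==>c *[M] \<zero>[M] = \<zero>[M]" "c\<in>carrier R==>x\<in>carrier M==>c *[M] x\<in>carrier M"
  if "module R M" for M :: "('u, 'u) module" and c x y
 proof -
  interpret module R M by fact
  show "\<zero>[M] +[M] \<zero>[M] = \<zero>[M]" "\<zero>[M]\<in>carrier M"
   "x\<in>carrier M==>y\<in>carrier M==>x +[M] y\<in>carrier M"
   "c\<in>carrier R==>c *[M] \<zero>[M] = \<zero>[M]" "c\<in>carrier R==>x\<in>carrier M==>c *[M] x\<in>carrier M"
   by simp_all
 qed
 note z = z[OF fcxD(1)[OF A(1)]] z[OF fcxD(1)[OF A(2)]]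
 note f = fil_alg(1)[OF A(1)] fil_alg(1)[OF A(2)] fcxD(3,8)[OF A(1)] fcxD(3,8)[OF A(2)] df_zero[OF A(1)] df_zero[OF A(2)]
  fcxD(7)[OF A(1)] fcxD(7)[OF A(2)]
 show "is_fmap R A1 B (incl True)" "is_fmap R A2 B (incl False)"
  unfolding is_fmap_def mod_hom_def by (auto simp: incl_def simps z f pair_mem)
qed

lemma split: "a\<in>grade A1 m==>b\<in>grade A2 m==>pair_code (a, b) = incl True m a +[md B m] incl False m b"
proof -
 assume ab: "a\<in>grade A1 m" "b\<in>grade A2 m"
 interpret M1: module R "md A1 m" by (rule fcxD(1)[OF A(1)])
 interpret M2: module R "md A2 m" by (rule fcxD(1)[OF A(2)])
 show ?thesis using ab by (simp add: incl_def simps)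
qed

lemma out_unique:
 assumes g: "is_fmap R B C g" "is_fmap R B C g'"
  and e: "!!m x. x\<in>grade A1 m==>g m (incl True m x) = g' m (incl True m x)"
   "!!m x. x\<in>grade A2 m==>g m (incl False m x) = g' m (incl False m x)"
 shows "g = g'"
proof (rule fmap_eqI[OF g])
 fix m z assume "z\<in>grade B m"
 then obtain a b where z: "z = pair_code (a, b)" "a\<in>grade A1 m" "b\<in>grade A2 m" by (auto simp: simps)
 note i = is_fmapD(5)[OF incl(1) z(2)] is_fmapD(5)[OF incl(2) z(3)]
 show "g m z = g' m z" unfolding z(1) split[OF z(2,3)] is_fmapD(6)[OF g(1) i] is_fmapD(6)[OF g(2) i] e(1)[OF z(2)] e(2)[OF z(3)] ..
qed

lemma out_exists:
 assumes C: "fcx R C" and f: "is_fmap R A1 C f1" "is_fmap R A2 C f2"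
 shows "\<exists>g. is_fmap R B C g & (\<forall>m. \<forall>a\<in>grade A1 m. \<forall>b\<in>grade A2 m. g m (pair_code (a, b)) = f1 m a +[md C m] f2 m b)"
proof -
 let ?g = "%m. \<lambda>z\<in>grade B m. f1 m (fst (inv_into UNIV pair_code z)) +[md C m] f2 m (snd (inv_into UNIV pair_code z))"
 have v: "?g m (pair_code (a, b)) = f1 m a +[md C m] f2 m b" if "a\<in>grade A1 m" "b\<in>grade A2 m" for m a b
  using that by (simp add: simps dec)
 have "is_fmap R B C ?g" unfolding is_fmap_def mod_hom_def
 proof (intro conjI allI ballI IntI CollectI funcsetI)
  fix m
  interpret M: module R "md C m" by (rule fcxD(1)[OF C])
  interpret M1: module R "md A1 m" by (rule fcxD(1)[OF A(1)])
  interpret M2: module R "md A2 m" by (rule fcxD(1)[OF A(2)])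
  show "?g m\<in>extensional (grade B m)" by simp
  { fix z assume "z\<in>grade B m"
   then obtain a b where z: "z = pair_code (a, b)" "a\<in>grade A1 m" "b\<in>grade A2 m" by (auto simp: simps)
   note fc = is_fmapD(5)[OF f(1) z(2)] is_fmapD(5)[OF f(2) z(3)]
   show "?g m z\<in>grade C m" unfolding z(1) v[OF z(2,3)] using fc by simp
   show "?g (m + 1) (df B m z) = df C m (?g m z)"
    unfolding z(1) simps(5) v[OF z(2,3)] v[OF fcxD(3)[OF A(1) z(2)] fcxD(3)[OF A(2) z(3)]]
    by (simp only: is_fmapD(3)[OF f(1) z(2)] is_fmapD(3)[OF f(2) z(3)] mod_homD(2)[OF fcxD(2)[OF C] fc])
   { fix z' assume "z'\<in>grade B m"
    then obtain a' b' where z': "z' = pair_code (a', b')" "a'\<in>grade A1 m" "b'\<in>grade A2 m" by (auto simp: simps)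
    note fc' = is_fmapD(5)[OF f(1) z'(2)] is_fmapD(5)[OF f(2) z'(3)]
    show "?g m (z +[md B m] z') = ?g m z +[md C m] ?g m z'"
     unfolding z(1) z'(1) simps(3) v[OF z(2,3)] v[OF z'(2,3)] v[OF M1.a_closed[OF z(2) z'(2)] M2.a_closed[OF z(3) z'(3)]]
     using fc fc' by (simp add: is_fmapD(6)[OF f(1) z(2) z'(2)] is_fmapD(6)[OF f(2) z(3) z'(3)] M.a_ac) }
   fix c assume c: "c\<in>carrier R"
   show "?g m (c *[md B m] z) = c *[md C m] ?g m z"
    unfolding z(1) simps(4) v[OF z(2,3)] v[OF M1.smult_closed[OF c z(2)] M2.smult_closed[OF c z(3)]]
    using fc by (simp add: is_fmapD(7)[OF f(1) c z(2)] is_fmapD(7)[OF f(2) c z(3)] M.smult_r_distr[OF c]) }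
  fix q show "?g m ` fil B q m \<subseteq> fil C q m"
  proof (rule image_subsetI)
   fix z assume "z\<in>fil B q m"
   then obtain a b where z: "z = pair_code (a, b)" "a\<in>fil A1 q m" "b\<in>fil A2 q m" by (auto simp: simps)
   show "?g m z\<in>fil C q m" unfolding z(1) v[OF fcxD(8)[OF A(1) z(2)] fcxD(8)[OF A(2) z(3)]]
    by (rule fil_alg(2)[OF C is_fmapD(4)[OF f(1) z(2)] is_fmapD(4)[OF f(2) z(3)]])
  qed
 qed
 then show ?thesis using v by blast
qed

end

text \<open>By representability a square is an \<open>r + 1\<close>-cycle \<open>a\<close> together
  with two \<open>r\<close>-cycles \<open>y\<close> and \<open>w\<close> in the target, and it
  commutes when \<open>f a = d y + w\<close>. So \<open>w\<close> is determined by \<open>a\<close>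
  and \<open>y\<close>, which form an admissible pair. In the same way a filler is determined by a
  solution \<open>x\<close>.\<close>

lemma phi_lifting:
 fixes R :: "'u ring"
 assumes inf: "infinite (UNIV :: 'u set)" and R: "cring R" and f: "f\<in>arrs (fC R)"
 shows "phi R (r + 1) p n\<in>arrs (fC R)"
  "has_lifting (fC R) (phi R (r + 1) p n) f \<longleftrightarrow> (\<forall>a y. admissible r (asrc f) (atgt f) (afun f) p n a y \<longrightarrow> (\<exists>x. solves r (asrc f) (afun f) p n a y x))"
proof -
 interpret cring R by fact
 let ?Z = "Z_complex R (r + 1) p n" and ?Z1 = "Z_complex R r (p + int r) (n - 1)" and ?Z2 = "Z_complex R r (p - 1) n"
 let ?A = "asrc f" and ?C = "atgt f"
 note Z = Z_fcomplex[OF R]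
 interpret B: coded_sum R ?Z1 ?Z2 using inf R Z by (simp add: coded_sum_def)
 have Beq: "B_complex R (r + 1) p n = B.B" by (simp add: B_complex_def B.B_def)
 note D = categoryD[OF category_fC[of R]]
 have A: "fcx R ?A" and C: "fcx R ?C" and fm: "is_fmap R ?A ?C (afun f)" and fa: "f\<in>homC R ?A ?C"
  using f by (simp_all add: arr_fC hom_fC)
 let ?o = "\<one>[R]" and ?z = "\<zero>[R]"
 \<comment> \<open>The generators of the two summands and the image of the generator under
   \<open>phi\<close>. In degree \<open>n\<close> the code \<open>?e1\<close> is at the same time
   the differential of \<open>?e1\<close> from degree \<open>n - 1\<close>, as the differential of
   the first summand is the identity of \<open>R\<close> there. Hence \<open>?e\<close> is the sum
   of \<open>d ?e1\<close> and \<open>?e2\<close>.\<close>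
 let ?e1 = "pair_code (?o, ?z)" and ?e2 = "pair_code (?z, ?o)" and ?e = "pair_code (?o, ?o)"
 note sm = B.simps Z_simps
 have e: "?e\<in>cycles B.B (r + 1) p n" "?e1\<in>cycles B.B r (p + int r) (n - 1)" "?e2\<in>cycles B.B r (p - 1) n"
  by (simp_all add: cycles_iff sm B.pair_mem)
 have de1: "df B.B (n - 1) ?e1 = ?e1" by (simp add: sm)
 have e1n: "?e1\<in>grade B.B n" by (simp add: sm B.pair_mem)
 have ee: "?e = ?e1 +[md B.B n] ?e2" by (simp add: sm)
 note ec = cycles_elts[OF B.fcB e(1)] cycles_elts[OF B.fcB e(2)] cycles_elts[OF B.fcB e(3)]
 have ph: "phi R (r + 1) p n = Arrow ?Z B.B (Z_map R B.B n ?e)" unfolding phi_def Beq arrow.inject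
 proof (intro conjI refl ext)
  fix m x
  show "(\<lambda>x\<in>grade ?Z m. pair_code (if m = n then (x, x) else (?z, x))) x = Z_map R B.B n ?e m x"
   by (auto simp: Z_map_def Z_simps restrict_def B.simps)
 qed
 have pa: "phi R (r + 1) p n\<in>homC R ?Z B.B" unfolding ph using Z_map(1)[OF R B.fcB e(1)] Z B.fcB by (simp add: hom_fC)
 then show "phi R (r + 1) p n\<in>arrs (fC R)" by (simp add: hom_set_def)
 have phi1: "afun (cmpC R g (phi R (r + 1) p n)) n ?o = afun g n ?e" for g
  unfolding ph using cmp_apply(2)[of ?o "Arrow ?Z B.B (Z_map R B.B n ?e)" n R g] Z_map(2)[OF R B.fcB e(1)]
  by (simp add: Z_simps)
 have Zeq: "u = v" if "u\<in>homC R ?Z K" "v\<in>homC R ?Z K" "afun u n ?o = afun v n ?o" for u v K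
 proof -
  have h: "fcx R K" "is_fmap R ?Z K (afun u)" "is_fmap R ?Z K (afun v)" using that(1,2) by (simp_all add: hom_fC)
  have "afun u = afun v" using Z_map_unique(2)[OF R h(1,2)] Z_map_unique(2)[OF R h(1,3)] that(3) by simp
  then show ?thesis by (intro hom_fC_eqI[OF that(1,2)]) simp
 qed
 have fmB: "fcx R K" "is_fmap R B.B K (afun g)" "asrc g = B.B" if "g\<in>homC R B.B K" for g K
  using that by (simp_all add: hom_fC)
 have ev: "afun g n ?e = df K (n - 1) (afun g (n - 1) ?e1) +[md K n] afun g n ?e2" if g: "g\<in>homC R B.B K" for g K
  using is_fmapD(6)[OF fmB(2)[OF g] e1n ec(3)] is_fmapD(3)[OF fmB(2)[OF g] ec(2)] by (simp add: ee de1)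
 have Beq2: "u = v" if h: "u\<in>homC R B.B K" "v\<in>homC R B.B K" "afun u (n - 1) ?e1 = afun v (n - 1) ?e1" "afun u n ?e2 = afun v n ?e2" for u v K
 proof -
  note K = fmB(1)[OF h(1)]
  have i1: "B.incl True (n - 1) ?o = ?e1" "B.incl False n ?o = ?e2" by (simp_all add: B.incl_def Z_simps)
  have m: "is_fmap R X K (%m. compose (grade X m) (afun w m) (i m))"
   if "is_fmap R X B.B i" "w\<in>homC R B.B K" "fcx R X" for w X i
   using fmap_comp[OF that(1) fmB(2)[OF that(2)] that(3)] by simp
  have c1: "(%m. compose (grade ?Z1 m) (afun u m) (B.incl True m)) = (%m. compose (grade ?Z1 m) (afun v m) (B.incl True m))"
   using Z_map_unique(2)[OF R K m[OF B.incl(1) h(1) Z]] Z_map_unique(2)[OF R K m[OF B.incl(1) h(2) Z]] h(3)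
   by (simp add: compose_def i1 Z_simps(1))
  have c2: "(%m. compose (grade ?Z2 m) (afun u m) (B.incl False m)) = (%m. compose (grade ?Z2 m) (afun v m) (B.incl False m))"
   using Z_map_unique(2)[OF R K m[OF B.incl(2) h(1) Z]] Z_map_unique(2)[OF R K m[OF B.incl(2) h(2) Z]] h(4)
   by (simp add: compose_def i1 Z_simps(1))
  have "afun u = afun v"
  proof (rule B.out_unique[OF fmB(2)[OF h(1)] fmB(2)[OF h(2)]])
   show "afun u m (B.incl True m x) = afun v m (B.incl True m x)" if "x\<in>grade ?Z1 m" for m x
    using fun_cong[OF fun_cong[OF c1, of m], of x] that by (simp add: compose_def)
   show "afun u m (B.incl False m x) = afun v m (B.incl False m x)" if "x\<in>grade ?Z2 m" for m x
    using fun_cong[OF fun_cong[OF c2, of m], of x] that by (simp add: compose_def)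
  qed
  then show ?thesis by (intro hom_fC_eqI[OF h(1,2)]) simp
 qed
 have Bex: "\<exists>g\<in>homC R B.B K. afun g (n - 1) ?e1 = y1 & afun g n ?e2 = y2"
  if K: "fcx R K" and y: "y1\<in>cycles K r (p + int r) (n - 1)" "y2\<in>cycles K r (p - 1) n" for K y1 y2
 proof -
  note z1 = Z_map[OF R K y(1)] and z2 = Z_map[OF R K y(2)]
  obtain g where g: "is_fmap R B.B K g" "!!m a b. a\<in>grade ?Z1 m==>b\<in>grade ?Z2 m ==>
    g m (pair_code (a, b)) = Z_map R K (n - 1) y1 m a +[md K m] Z_map R K n y2 m b"
   using B.out_exists[OF K z1(1) z2(1)] by blast
  interpret M: module R "md K (n - 1)" by (rule fcxD(1)[OF K])
  interpret N: module R "md K n" by (rule fcxD(1)[OF K])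
  have "Z_map R K (n - 1) y1 n ?z = \<zero>[md K n]" "Z_map R K n y2 (n - 1) ?z = \<zero>[md K (n - 1)]"
   using fmap_zero[OF Z K z1(1), of n] fmap_zero[OF Z K z2(1), of "n - 1"] by (simp_all add: Z_simps)
  then have "g (n - 1) ?e1 = y1" "g n ?e2 = y2"
   using cycles_elts[OF K y(1)] cycles_elts[OF K y(2)] z1(2) z2(2) by (simp_all add: g(2) Z_simps)
  then show ?thesis using g(1) K B.fcB by (intro bexI[of _ "Arrow B.B K g"]) (simp_all add: hom_fC)
 qed
 show "has_lifting (fC R) (phi R (r + 1) p n) f \<longleftrightarrow> (\<forall>a y. admissible r ?A ?C (afun f) p n a y \<longrightarrow> (\<exists>x. solves r ?A (afun f) p n a y x))"
  unfolding has_lifting_def hom_setD(2,3)[OF pa] hom_setD(2,3)[OF fa]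
 proof (intro iffI allI ballI impI)
  fix a y assume l: "\<forall>u\<in>homC R ?Z ?A. \<forall>v\<in>homC R B.B ?C. cmpC R f u = cmpC R v (phi R (r + 1) p n) \<longrightarrow>
    (\<exists>h\<in>homC R B.B ?A. cmpC R h (phi R (r + 1) p n) = u & cmpC R f h = v)"
   and ay: "admissible r ?A ?C (afun f) p n a y"
  then have a: "a\<in>cycles ?A (r + 1) p n" and y: "y\<in>cycles ?C r (p + int r) (n - 1)"
   and d: "afun f n a -[md ?C n] df ?C (n - 1) y\<in>fil ?C (p - 1) n" by (simp_all add: admissible_def)
  \<comment> \<open>The value on the second generator that commutativity forces. The cycle
    conditions on \<open>a\<close> and \<open>y\<close> make it an \<open>r\<close>-cycle at
    \<open>p - 1\<close>.\<close>
  let ?w = "afun f n a -[md ?C n] df ?C (n - 1) y"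
  note ac = cycles_elts[OF A a] and yc = cycles_elts[OF C y]
  note ZC = submodule_facts[OF fcxD(1)[OF C] cycles_submodule[OF C, of "r + 1" p n]]
  have "?w\<in>cycles ?C (r + 1) p n" by (rule ZC(5)[OF fmap_cycles[OF fm A a] df_cycle[OF C y]])
  then have "df ?C n ?w\<in>fil ?C (p - 1 - int r) (n + 1)" by (simp add: cycles_iff algebra_simps)
  then have w: "?w\<in>cycles ?C r (p - 1) n" using d by (simp add: cycles_iff)
  obtain v where v: "v\<in>homC R B.B ?C" "afun v (n - 1) ?e1 = y" "afun v n ?e2 = ?w" using Bex[OF C y w] by blast
  let ?u = "Arrow ?Z ?A (Z_map R ?A n a)"
  have u: "?u\<in>homC R ?Z ?A" using Z_map(1)[OF R A a] Z A by (simp add: hom_fC)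
  have "cmpC R f ?u = cmpC R v (phi R (r + 1) p n)"
  proof (rule Zeq[OF D(1)[OF u fa] D(1)[OF pa v(1)]])
   have "afun (cmpC R f ?u) n ?o = afun f n a"
    using cmp_apply(2)[of ?o ?u n R f] Z_map(2)[OF R A a] by (simp add: Z_simps)
   moreover have "df ?C (n - 1) y +[md ?C n] ?w = afun f n a"
    by (rule diff_cancel(1)[OF fcxD(1)[OF C] is_fmapD(5)[OF fm ac] df_pred[OF C yc]])
   ultimately show "afun (cmpC R f ?u) n ?o = afun (cmpC R v (phi R (r + 1) p n)) n ?o"
    unfolding phi1 ev[OF v(1)] v(2,3) by simp
  qed
  then obtain h where h: "h\<in>homC R B.B ?A" "cmpC R h (phi R (r + 1) p n) = ?u" "cmpC R f h = v"
   using l u v(1) by blast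
  note hm = fmB(2)[OF h(1)]
  let ?x = "afun h (n - 1) ?e1"
  have "a = afun h n ?e" using phi1[of h] Z_map(2)[OF R A a] unfolding h(2) by simp
  also have "\<dots> = df ?A (n - 1) ?x +[md ?A n] afun h n ?e2" by (rule ev[OF h(1)])
  finally have a': "a = df ?A (n - 1) ?x +[md ?A n] afun h n ?e2" .
  have "a -[md ?A n] df ?A (n - 1) ?x = afun h n ?e2" unfolding a'
   by (rule diff_cancel(2)[OF fcxD(1)[OF A] is_fmapD(5)[OF hm ec(3)] df_pred[OF A is_fmapD(5)[OF hm ec(2)]]])
  moreover have "afun h n ?e2\<in>fil ?A (p - 1) n" using fmap_cycles[OF hm B.fcB e(3)] by (simp add: cycles_iff)
  moreover have "afun f (n - 1) ?x = y" using cmp_apply(2)[of ?e1 h "n - 1" R f] ec(2) fmB(3)[OF h(1)] h(3) v(2) by simp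
  ultimately show "\<exists>x. solves r ?A (afun f) p n a y x"
   unfolding solves_def using fmap_cycles[OF hm B.fcB e(2)] by (intro exI[of _ ?x]) simp
 next
  fix u v assume s: "\<forall>a y. admissible r ?A ?C (afun f) p n a y \<longrightarrow> (\<exists>x. solves r ?A (afun f) p n a y x)"
   and u: "u\<in>homC R ?Z ?A" and v: "v\<in>homC R B.B ?C" and c: "cmpC R f u = cmpC R v (phi R (r + 1) p n)"
  have um: "is_fmap R ?Z ?A (afun u)" "asrc u = ?Z" using u by (simp_all add: hom_fC)
  note vm = fmB(2)[OF v]
  let ?a = "afun u n ?o" and ?y = "afun v (n - 1) ?e1"
  have a: "?a\<in>cycles ?A (r + 1) p n" by (rule Z_map_unique(1)[OF R A um(1)])
  have y: "?y\<in>cycles ?C r (p + int r) (n - 1)" by (rule fmap_cycles[OF vm B.fcB e(2)])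
  note ac = cycles_elts[OF A a] and dyc = df_pred[OF C cycles_elts[OF C y]]
  have fa': "afun f n ?a = df ?C (n - 1) ?y +[md ?C n] afun v n ?e2"
   using phi1[of v, folded c] cmp_apply(2)[of ?o u n R f] um(2) ev[OF v] by (simp add: Z_simps)
  have w: "afun f n ?a -[md ?C n] df ?C (n - 1) ?y = afun v n ?e2" unfolding fa'
   by (rule diff_cancel(2)[OF fcxD(1)[OF C] is_fmapD(5)[OF vm ec(3)] dyc])
  have "admissible r ?A ?C (afun f) p n ?a ?y" unfolding admissible_def w
   using a y fmap_cycles[OF vm B.fcB e(3)] by (simp add: cycles_iff)
  then obtain x where "solves r ?A (afun f) p n ?a ?y x" using s by blast
  then have x: "x\<in>cycles ?A r (p + int r) (n - 1)" "afun f (n - 1) x = ?y" "?a -[md ?A n] df ?A (n - 1) x\<in>fil ?A (p - 1) n"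
   by (simp_all add: solves_def)
  \<comment> \<open>Commutativity of the upper triangle forces this value on the second generator;
    that it is an \<open>r\<close>-cycle at \<open>p - 1\<close> uses the last clause of
    \<open>solves\<close>.\<close>
  let ?w = "?a -[md ?A n] df ?A (n - 1) x"
  note xc = cycles_elts[OF A x(1)]
  note ZA = submodule_facts[OF fcxD(1)[OF A] cycles_submodule[OF A, of "r + 1" p n]]
  have "?w\<in>cycles ?A (r + 1) p n" by (rule ZA(5)[OF a df_cycle[OF A x(1)]])
  then have "df ?A n ?w\<in>fil ?A (p - 1 - int r) (n + 1)" by (simp add: cycles_iff algebra_simps)
  then have wc: "?w\<in>cycles ?A r (p - 1) n" using x(3) by (simp add: cycles_iff)
  obtain h where h: "h\<in>homC R B.B ?A" "afun h (n - 1) ?e1 = x" "afun h n ?e2 = ?w" using Bex[OF A x(1) wc] by blast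
  have "cmpC R h (phi R (r + 1) p n) = u"
   by (rule Zeq[OF D(1)[OF pa h(1)] u], unfold phi1 ev[OF h(1)] h(2,3),
    rule diff_cancel(1)[OF fcxD(1)[OF A] ac df_pred[OF A xc]])
  moreover have "cmpC R f h = v"
  proof (rule Beq2[OF D(1)[OF h(1) fa] v])
   show "afun (cmpC R f h) (n - 1) ?e1 = ?y"
    using cmp_apply(2)[of ?e1 h "n - 1" R f] ec(2) fmB(3)[OF h(1)] h(2) x(2) by simp
   have "afun f n ?w = afun f n ?a -[md ?C n] df ?C (n - 1) ?y"
    unfolding fmap_diff[OF fm A C ac df_pred[OF A xc]] fmap_df_pred[OF fm xc] x(2) ..
   then show "afun (cmpC R f h) n ?e2 = afun v n ?e2"
    using cmp_apply(2)[of ?e2 h n R f] ec(3) fmB(3)[OF h(1)] h(3) w by simp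
  qed
  ultimately show "\<exists>h\<in>homC R B.B ?A. cmpC R h (phi R (r + 1) p n) = u & cmpC R f h = v" using h(1) by blast
 qed
qed

context fdga_model begin

text \<open>Lifting against \<open>Tm i\<close> is transposed to lifting against \<open>i\<close> in
  filtered complexes, where \<open>zero_to_Z_lifting\<close> and \<open>phi_lifting\<close> read it
  as a statement on cycles.\<close>

lemma generators_rlp:
 assumes T: "is_free_algebra_functor R To Tm"
 shows "Tm ` I_gen R r S \<subseteq> arrs FD" "Tm ` J_gen R S \<subseteq> arrs FD" "Fib = rlp FD (Tm ` J_gen R S)" "Fib \<inter> W = rlp FD (Tm ` I_gen R r S)"
proof -
 have adj: "left_adjoint (fC R) FD To Tm cx forget" using T by (simp add: is_free_algebra_functor_def)
 then have fT: "is_functor (fC R) FD To Tm" and fF: "is_functor FD (fC R) cx forget" by (simp_all add: left_adjoint_def)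
 have Ta: "Tm i\<in>arrs FD" if "i\<in>arrs (fC R)" for i using fT that unfolding is_functor_def hom_set_def by blast
 have idf: "Arrow A A (fmap_id A)\<in>arrs (fC R)" if "fcx R A" for A using that fmap_ident[OF that] by (simp add: arr_fC)
 have Ja: "zero_to_Z R s p n\<in>arrs (fC R)" for s p n
  by (rule zero_to_Z_lifting(1)[OF R idf[OF zero_fcomplex[OF R]]])
 have Ia: "phi R (r + 1) p n\<in>arrs (fC R)" for p n
  by (rule phi_lifting(1)[OF inf R idf[OF zero_fcomplex[OF R]]])
 show "Tm ` I_gen R r S \<subseteq> arrs FD" "Tm ` J_gen R S \<subseteq> arrs FD" using Ja Ia Ta by (auto simp: I_gen_def J_gen_def)
 have l: "has_lifting FD (Tm i) f \<longleftrightarrow> has_lifting (fC R) i (forget f)" if "i\<in>arrs (fC R)" "f\<in>arrs FD" for i f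
  by (rule adjoint_lifting[OF category_fC cat adj that])
 have fa: "forget f\<in>arrs (fC R)" if "f\<in>arrs FD" for f using fF that unfolding is_functor_def hom_set_def by blast
 have fs: "asrc (forget f) = cx (asrc f)" "atgt (forget f) = cx (atgt f)" "afun (forget f) = afun f" for f by (simp_all add: forget_def)
 have J: "(\<forall>i\<in>J_gen R S. has_lifting FD (Tm i) f) \<longleftrightarrow> cycle_onto S (cx (asrc f)) (cx (atgt f)) (afun f)" if f: "f\<in>arrs FD" for f
 proof -
  have "has_lifting FD (Tm (zero_to_Z R s p n)) f \<longleftrightarrow> (\<forall>y\<in>cycles (cx (atgt f)) s p n. \<exists>x\<in>cycles (cx (asrc f)) s p n. afun f n x = y)" for s p n
   using l[OF Ja f] zero_to_Z_lifting(2)[OF R fa[OF f]] by (simp add: fs)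
  then show ?thesis unfolding J_gen_def cycle_onto_def by blast
 qed
 have I: "(\<forall>i\<in>I_gen R r S. has_lifting FD (Tm i) f) \<longleftrightarrow> solvable r (cx (asrc f)) (cx (atgt f)) (afun f) & cycle_onto S (cx (asrc f)) (cx (atgt f)) (afun f)"
  if f: "f\<in>arrs FD" for f
 proof -
  have "has_lifting FD (Tm (phi R (r + 1) p n)) f \<longleftrightarrow>
    (\<forall>a y. admissible r (cx (asrc f)) (cx (atgt f)) (afun f) p n a y \<longrightarrow> (\<exists>x. solves r (cx (asrc f)) (afun f) p n a y x))" for p n
   using l[OF Ia f] phi_lifting(2)[OF inf R fa[OF f]] by (simp add: fs)
  then have "(\<forall>p n. has_lifting FD (Tm (phi R (r + 1) p n)) f) \<longleftrightarrow> solvable r (cx (asrc f)) (cx (atgt f)) (afun f)"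
   unfolding solvable_def by simp
  moreover have "(\<forall>i\<in>I_gen R r S. has_lifting FD (Tm i) f) \<longleftrightarrow>
    (\<forall>p n. has_lifting FD (Tm (phi R (r + 1) p n)) f) & (\<forall>i\<in>J_gen R S. has_lifting FD (Tm i) f)"
   unfolding I_gen_def by blast
  ultimately show ?thesis using J[OF f] by simp
 qed
 show "Fib = rlp FD (Tm ` J_gen R S)" unfolding rlp_def set_eq_iff trivial_fib_iff trivial_fib_def ball_simps using J by auto
 show "Fib \<inter> W = rlp FD (Tm ` I_gen R r S)" unfolding rlp_def set_eq_iff trivial_fib_iff trivial_fib_def ball_simps using I by auto
qed

end

section \<open>Smallness\<close>

text \<open>The colimit \<open>Y\<close> is known only through its universal property. Its elements
  are reached by comparison with a concrete direct limit of the \<open>Xo b\<close>.\<close>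

locale sequential_colimit =
 fixes R :: "'u ring" and code :: "('i => 'u) => 'u" and r :: "'i rel" and Xo :: "'i => ('u, 'u) fdga" and Xm Y and \<iota>
 assumes code: "inj code" and R: "cring R" and wo: "Well_order r" and ne: "Field r \<noteq> {}"
  and fn: "is_functor (poset_category r) (fDGA R) Xo Xm" and col: "is_colimit (poset_category r) (fDGA R) Xo Xm Y \<iota>"
begin

abbreviation le where "le b c \<equiv> (b, c)\<in>r"
abbreviation f where "f b c \<equiv> afun (Xm (b, c))"
abbreviation j where "j b \<equiv> afun (\<iota> b)"

lemma field: "le b c==>b\<in>Field r" "le b c==>c\<in>Field r"
 by (auto simp: Field_def)

lemma le_refl: "b\<in>Field r==>le b b"
 using wo by (auto simp: well_order_on_def linear_order_on_def partial_order_on_def preorder_on_def refl_on_def)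

lemma le_trans: "le b c==>le c d==>le b d"
 using wo unfolding well_order_on_def linear_order_on_def partial_order_on_def preorder_on_def by (blast dest: transD)

lemma le_max: "b\<in>Field r==>c\<in>Field r==>\<exists>e. le b e & le c e"
 using wo le_refl unfolding well_order_on_def linear_order_on_def total_on_def by metis

lemma Xm: "le b c==>Xm (b, c)\<in>homD R (Xo b) (Xo c)"
 "le b c==>le c d==>cmpD R (Xm (c, d)) (Xm (b, c)) = Xm (b, d)"
 using fn unfolding is_functor_def poset_category_def by fastforce+

lemma Xo: "b\<in>Field r==>is_fdga R (Xo b)"
 using fn by (simp add: is_functor_def poset_category_def fDGA_simps)

lemma f: "le b c==>dgmap R (Xo b) (Xo c) (f b c)"
 using Xm(1) by (simp add: hom_fDGA)

lemma ff: "le b c==>le c d==>x\<in>elts (Xo b) n==>f c d n (f b c n x) = f b d n x"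
 using cmp_apply(1)[of x "Xm (b, c)" n R "Xm (c, d)"] Xm by (simp add: hom_fDGA)

lemma cocone: "Y\<in>objs (fDGA R)" "b\<in>Field r==>\<iota> b\<in>homD R (Xo b) Y"
 "le b c==>cmpD R (\<iota> c) (Xm (b, c)) = \<iota> b"
 using col by (auto simp: is_colimit_def is_cocone_def poset_category_def)

lemma colimit:
 assumes "is_cocone (poset_category r) (fDGA R) Xo Xm Z \<psi>"
 shows "\<exists>!h. h\<in>homD R Y Z & (\<forall>b\<in>Field r. cmpD R h (\<iota> b) = \<psi> b)"
proof -
 have "objs (poset_category r) = Field r" by (simp add: poset_category_def)
 with col assms show ?thesis unfolding is_colimit_def by metis
qed

lemma Y: "is_fdga R Y"
 using cocone(1) by (simp add: fDGA_simps)

lemma j: "b\<in>Field r==>dgmap R (Xo b) Y (j b)"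
 using cocone(2) by (simp add: hom_fDGA)

lemma jf: "le b c==>x\<in>elts (Xo b) n==>j c n (f b c n x) = j b n x"
 using cmp_apply(1)[of x "Xm (b, c)" n R "\<iota> c"] Xm(1) cocone(3) by (simp add: hom_fDGA)

text \<open>The filter of tails of the ordinal; agreement modulo it is equality from some stage
  on.\<close>

definition F :: "'i filter" where "F = (INF b\<in>Field r. principal {c. le b c})"

lemma evF: "eventually P F \<longleftrightarrow> (\<exists>b\<in>Field r. \<forall>c. le b c \<longrightarrow> P c)"
 unfolding F_def
proof (subst eventually_INF_base[OF ne])
 fix a b assume ab: "a\<in>Field r" "b\<in>Field r"
 then obtain e where "le a e" "le b e" using le_max by blast
 then show "\<exists>x\<in>Field r. principal {c. le x c} \<le> inf (principal {c. le a c}) (principal {c. le b c})"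
  using field le_trans by (intro bexI[of _ e]) (auto simp: inf_principal)
qed (simp add: eventually_principal)

lemma tail: "b\<in>Field r==>(!!c. le b c==>P c)==>eventually P F"
 unfolding evF by blast

lemma F_ex: "eventually P F==>b\<in>Field r==>\<exists>c. le b c & P c"
 unfolding evF using le_max by blast

lemma F_field: "\<forall>\<^sub>F c in F. c\<in>Field r"
 using ne tail[of _ "%c. c\<in>Field r"] field(2) by blast

text \<open>A family which from stage \<open>b\<close> on consists of the images of
  \<open>x\<close>. Its class modulo \<open>F\<close> is the class of \<open>x\<close> in the direct
  limit.\<close>

definition thread :: "int => ('i => 'u) => 'i => 'u => bool" where
 "thread n \<phi> b x \<longleftrightarrow> b\<in>Field r & x\<in>elts (Xo b) n & (\<forall>c. le b c \<longrightarrow> \<phi> c = f b c n x)"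

definition C :: "int => ('i => 'u) set" where "C n = {\<phi>. \<exists>b x. thread n \<phi> b x}"

lemma thread_up: "thread n \<phi> b x==>le b c==>thread n \<phi> c (f b c n x)"
 unfolding thread_def using field le_trans ff fdga_mapD(5)[OF f] by auto

lemma thread_value: "thread n \<phi> b x==>\<forall>\<^sub>F c in F. \<phi> c\<in>elts (Xo c) n & j c n (\<phi> c) = j b n x"
 by (rule tail[of b]) (simp_all add: thread_def fdga_mapD(5)[OF f] jf)

lemma common:
 assumes "\<phi>\<in>C i" "\<psi>\<in>C k"
 obtains b x y where "thread i \<phi> b x" "thread k \<psi> b y"
proof -
 obtain b x b' y where t: "thread i \<phi> b x" "thread k \<psi> b' y" using assms by (auto simp: C_def)
 then obtain e where "le b e" "le b' e" using le_max unfolding thread_def by blast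
 then show ?thesis using that thread_up t by blast
qed

lemma presented: obtains E :: "('u, 'u) fdga" and el where "presents R F Xo C E el"
proof -
 interpret S: subproduct R F Xo C code UNIV
 proof (rule subproduct.intro)
  show "cring R" by (rule R)
  show "\<forall>\<^sub>F k in F. is_fdga R (Xo k)" using F_field by eventually_elim (rule Xo)
  show "\<forall>\<^sub>F k in F. \<phi> k\<in>elts (Xo k) n" if c: "\<phi>\<in>C n" for n \<phi>
  proof -
   obtain b x where "thread n \<phi> b x" using c by (auto simp: C_def)
   then show ?thesis by (rule eventually_mono[OF thread_value]) simp
  qed
  show "(%k. \<phi> k +[md (cx (Xo k)) n] \<psi> k)\<in>C n" if c: "\<phi>\<in>C n" "\<psi>\<in>C n" for n \<phi> \<psi>
  proof (rule common[OF c])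
   fix b x y assume t: "thread n \<phi> b x" "thread n \<psi> b y"
   then have "thread n (%k. \<phi> k +[md (cx (Xo k)) n] \<psi> k) b (x +[md (cx (Xo b)) n] y)"
    by (simp add: thread_def fdga_alg(1)[OF R Xo] fdga_mapD(6)[OF f])
   then show ?thesis by (auto simp: C_def)
  qed
  obtain b where b: "b\<in>Field r" using ne by blast
  have "thread n (%k. \<zero>[md (cx (Xo k)) n]) b \<zero>[md (cx (Xo b)) n]" for n
   using b fmap_zero[OF fdgaD(1)[OF R Xo] fdgaD(1)[OF R Xo] map_fmap[OF f]] field
   by (simp add: thread_def fdga_alg(2)[OF R Xo])
  then show "(%k. \<zero>[md (cx (Xo k)) n])\<in>C n" for n by (auto simp: C_def)
  have "thread 0 (%k. fone R (Xo k)) b (fone R (Xo b))"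
   using b fdga_map_mult(2)[OF R Xo Xo f] field by (simp add: thread_def fdga_alg(6)[OF R Xo])
  then show "(%k. fone R (Xo k))\<in>C 0" by (auto simp: C_def)
  show "(%k. c *[md (cx (Xo k)) n] \<phi> k)\<in>C n" if c: "c\<in>carrier R" "\<phi>\<in>C n" for n c \<phi>
  proof -
   obtain b x where "thread n \<phi> b x" using c by (auto simp: C_def)
   then have "thread n (%k. c *[md (cx (Xo k)) n] \<phi> k) b (c *[md (cx (Xo b)) n] x)"
    using c by (simp add: thread_def fdga_alg(3)[OF R Xo] fdga_mapD(7)[OF f])
   then show ?thesis by (auto simp: C_def)
  qed
  show "(%k. df (cx (Xo k)) n (\<phi> k))\<in>C (n + 1)" if c: "\<phi>\<in>C n" for n \<phi>
  proof -
   obtain b x where "thread n \<phi> b x" using c by (auto simp: C_def)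
   then have "thread (n + 1) (%k. df (cx (Xo k)) n (\<phi> k)) b (df (cx (Xo b)) n x)"
    by (simp add: thread_def fdga_alg(4)[OF R Xo] fdga_mapD(3)[OF f])
   then show ?thesis by (auto simp: C_def)
  qed
  show "(%k. fmul R (Xo k) i l (\<phi> k) (\<psi> k))\<in>C (i + l)" if c: "\<phi>\<in>C i" "\<psi>\<in>C l" for i l \<phi> \<psi>
  proof (rule common[OF c])
   fix b x y assume t: "thread i \<phi> b x" "thread l \<psi> b y"
   then have "thread (i + l) (%k. fmul R (Xo k) i l (\<phi> k) (\<psi> k)) b (fmul R (Xo b) i l x y)"
    using field by (auto simp: thread_def fdga_alg(5)[OF R Xo] fdga_map_mult(1)[OF R Xo Xo f])
   then show ?thesis by (auto simp: C_def)
  qed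
 qed (use code in simp_all)
 show thesis by (rule S.presented) (rule that)
qed

text \<open>The common image in \<open>Y\<close> of the late members of a thread.\<close>

definition val :: "int => ('i => 'u) => 'u" where "val n \<phi> = (THE y. \<forall>\<^sub>F c in F. j c n (\<phi> c) = y)"

lemma valI:
 assumes "\<forall>\<^sub>F c in F. j c n (\<phi> c) = y" shows "val n \<phi> = y"
 unfolding val_def
proof (rule the_equality)
 fix z assume "\<forall>\<^sub>F c in F. j c n (\<phi> c) = z"
 with assms have "\<forall>\<^sub>F c in F. z = y" by eventually_elim simp
 then show "z = y" using F_ex ne by blast
qed fact

lemma val: "thread n \<phi> b x==>val n \<phi> = j b n x"
 by (rule valI) (auto elim: eventually_mono[OF thread_value])

lemma val_ev: "\<phi>\<in>C n==>\<forall>\<^sub>F c in F. c\<in>Field r & \<phi> c\<in>elts (Xo c) n & j c n (\<phi> c) = val n \<phi>"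
 using eventually_conj[OF F_field thread_value] val by (auto simp: C_def)

text \<open>The comparison map from the direct limit to \<open>Y\<close>. Each law is checked at a
  late stage, where the members of the threads are mapped by an algebra map
  \<open>j c\<close>.\<close>

lemma lift_out:
 assumes P: "presents R F Xo C E el"
 obtains k where "dgmap R E Y k" "!!n \<phi>. \<phi>\<in>C n==>k n (el n \<phi>) = val n \<phi>"
proof (rule presents_map_out[OF R P Y, of val])
 note v = val_ev
 show "val n \<phi>\<in>elts Y n" if "\<phi>\<in>C n" for n \<phi>
  using F_ex[OF v[OF that]] ne fdga_mapD(5)[OF j] by (metis ex_in_conv)
 show "val n \<phi> = val n \<psi>" if "\<phi>\<in>C n" "\<psi>\<in>C n" "\<forall>\<^sub>F k in F. \<phi> k = \<psi> k" for n \<phi> \<psi>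
  by (rule valI) (use v[OF that(2)] that(3) in \<open>eventually_elim, simp\<close>)
 show "val n (%k. \<phi> k +[md (cx (Xo k)) n] \<psi> k) = val n \<phi> +[md (cx Y) n] val n \<psi>" if "\<phi>\<in>C n" "\<psi>\<in>C n" for n \<phi> \<psi>
  by (rule valI) (use v[OF that(1)] v[OF that(2)] in \<open>eventually_elim, simp add: fdga_mapD(6)[OF j]\<close>)
 show "val n (%k. c *[md (cx (Xo k)) n] \<phi> k) = c *[md (cx Y) n] val n \<phi>" if "c\<in>carrier R" "\<phi>\<in>C n" for n c \<phi>
  by (rule valI, rule eventually_mono[OF v[OF that(2)]]) (use that(1) in \<open>simp add: fdga_mapD(7)[OF j]\<close>)
 show "val (n + 1) (%k. df (cx (Xo k)) n (\<phi> k)) = df (cx Y) n (val n \<phi>)" if "\<phi>\<in>C n" for n \<phi>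
  by (rule valI) (use v[OF that] in \<open>eventually_elim, simp add: fdga_mapD(3)[OF j]\<close>)
 show "val (i + l) (%k. fmul R (Xo k) i l (\<phi> k) (\<psi> k)) = fmul R Y i l (val i \<phi>) (val l \<psi>)" if "\<phi>\<in>C i" "\<psi>\<in>C l" for i l \<phi> \<psi>
  by (rule valI) (use v[OF that(1)] v[OF that(2)] in \<open>eventually_elim, simp add: fdga_map_mult(1)[OF R Xo Y j]\<close>)
 show "val 0 (%k. fone R (Xo k)) = fone R Y"
  by (rule valI) (use F_field in \<open>eventually_elim, simp add: fdga_map_mult(2)[OF R Xo Y j]\<close>)
 show "val n \<phi>\<in>fil (cx Y) p n" if c: "\<phi>\<in>C n" "\<forall>\<^sub>F k in F. \<phi> k\<in>fil (cx (Xo k)) p n" for p n \<phi>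
 proof -
  obtain c where "c\<in>Field r" "\<phi> c\<in>fil (cx (Xo c)) p n" "j c n (\<phi> c) = val n \<phi>"
   using F_ex[OF eventually_conj[OF v[OF c(1)] c(2)]] ne by blast
  then show ?thesis using fdga_mapD(4)[OF j] by metis
 qed
qed (rule that)

text \<open>The direct limit \<open>E\<close> is a cocone, which gives \<open>h\<close> from
  \<open>Y\<close> to \<open>E\<close>. Followed by the comparison \<open>k\<close> back to
  \<open>Y\<close> it is the identity, so \<open>Y\<close> is a retract of \<open>E\<close>. This is
  enough to read off at a stage the filtration of an element and the equality of two
  elements.\<close>

lemma stages:
 shows "y\<in>fil (cx Y) p n==>\<exists>b\<in>Field r. \<exists>x\<in>fil (cx (Xo b)) p n. j b n x = y"
  "b\<in>Field r==>x\<in>elts (Xo b) n==>x'\<in>elts (Xo b) n==>j b n x = j b n x'==>\<exists>c. le b c & f b c n x = f b c n x'"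
proof -
 obtain E :: "('u, 'u) fdga" and el where P: "presents R F Xo C E el" by (rule presented)
 note PD = presentsD[OF P]
 obtain k where k: "dgmap R E Y k" "!!n \<phi>. \<phi>\<in>C n==>k n (el n \<phi>) = val n \<phi>"
  by (rule lift_out[OF P]) (rule that; assumption)
 let ?i = "%b n. \<lambda>x\<in>elts (Xo b) n. el n (%c. f b c n x)"
 have th: "thread n (%c. f b c n x) b x" if "b\<in>Field r" "x\<in>elts (Xo b) n" for b n x
  using that by (simp add: thread_def)
 have thC: "(%c. f b c n x)\<in>C n" if "b\<in>Field r" "x\<in>elts (Xo b) n" for b n x using th[OF that] by (auto simp: C_def)
 have im: "dgmap R (Xo b) E (?i b)" if b: "b\<in>Field r" for b
  by (rule presents_map_in[OF R P Xo[OF b]]) (use F_field Xo tail[OF b f] thC[OF b] in \<open>auto elim: eventually_mono\<close>)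
 let ?I = "%b. Arrow (Xo b) E (?i b)"
 have Ia: "?I b\<in>homD R (Xo b) E" if "b\<in>Field r" for b using im[OF that] Xo[OF that] PD(1) by (simp add: hom_fDGA)
 note D = categoryD[OF category_fDGA[OF R]]
 have Ic: "cmpD R (?I c) (Xm (b, c)) = ?I b" if bc: "le b c" for b c
 proof (rule hom_fDGA_eqI[OF D(1)[OF Xm(1)[OF bc] Ia[OF field(2)[OF bc]]] Ia[OF field(1)[OF bc]]])
  fix n x assume x: "x\<in>elts (Xo b) n"
  note fx = fdga_mapD(5)[OF f[OF bc] x]
  have "el n (%d. f c d n (f b c n x)) = el n (%d. f b d n x)"
   unfolding PD(3)[OF thC[OF field(2)[OF bc] fx] thC[OF field(1)[OF bc] x]]
   by (rule tail[OF field(2)[OF bc]]) (rule ff[OF bc _ x])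
  then show "afun (cmpD R (?I c) (Xm (b, c))) n x = afun (?I b) n x"
   using cmp_apply(1)[of x "Xm (b, c)" n R "?I c"] Xm(1)[OF bc] x fx by (simp add: hom_fDGA)
 qed
 have "is_cocone (poset_category r) (fDGA R) Xo Xm E ?I" unfolding is_cocone_def
 proof (intro conjI ballI)
  fix u assume "u\<in>arrs (poset_category r)"
  then have "le (fst u) (snd u)" by (simp add: poset_category_def)
  from Ic[OF this] show "cmpD R (?I (tgt (poset_category r) u)) (Xm u) = ?I (src (poset_category r) u)"
   by (simp only: poset_category_def category.simps prod.collapse)
 qed (use Ia PD(1) in \<open>simp_all add: poset_category_def fDGA_simps(1)\<close>)
 from ex1_implies_ex[OF colimit[OF this]]
 obtain h where h: "h\<in>homD R Y E" "!!b. b\<in>Field r==>cmpD R h (\<iota> b) = ?I b"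
  by blast
 have hj: "afun h n (j b n x) = el n (%c. f b c n x)" if "b\<in>Field r" "x\<in>elts (Xo b) n" for b n x
  using cmp_apply(1)[of x "\<iota> b" n R h] h(2)[OF that(1)] cocone(2)[OF that(1)] that(2) by (simp add: hom_fDGA)
 let ?K = "Arrow E Y k"
 have Ka: "?K\<in>homD R E Y" using k(1) PD(1) Y by (simp add: hom_fDGA)
 have c1: "cmpD R (cmpD R ?K h) (\<iota> b) = \<iota> b" if b: "b\<in>Field r" for b
 proof (rule hom_fDGA_eqI[OF D(1)[OF cocone(2)[OF b] D(1)[OF h(1) Ka]] cocone(2)[OF b]])
  fix n x assume x: "x\<in>elts (Xo b) n"
  have "k n (el n (%c. f b c n x)) = j b n x" unfolding k(2)[OF thC[OF b x]] by (rule val[OF th[OF b x]])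
  then show "afun (cmpD R (cmpD R ?K h) (\<iota> b)) n x = j b n x"
   unfolding D(5)[OF cocone(2)[OF b] h(1) Ka, symmetric] h(2)[OF b] using x by (simp add: cmp_apply)
 qed
 have c2: "cmpD R (ident (fDGA R) Y) (\<iota> b) = \<iota> b" if "b\<in>Field r" for b by (rule D(4)[OF cocone(2)[OF that]])
 have c3: "\<exists>!g. g\<in>homD R Y Y & (\<forall>b\<in>Field r. cmpD R g (\<iota> b) = \<iota> b)"
  by (rule colimit) (use col in \<open>simp add: is_colimit_def\<close>)
 \<comment> \<open>Both are endomorphisms of \<open>Y\<close> under the legs of the colimit cocone,
   so the universal property of \<open>Y\<close> itself identifies them.\<close>
 have id: "cmpD R ?K h = ident (fDGA R) Y"
  by (rule ex1_eq[OF c3]; intro conjI ballI; (rule D(1)[OF h(1) Ka] | rule D(2)[OF cocone(1)] | erule c1 | erule c2))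
 have kh: "k n (afun h n y) = y" if "y\<in>elts Y n" for n y
  using cmp_apply(1)[of y h n R ?K] that h(1)[unfolded hom_fDGA] unfolding id by (simp add: fDGA_simps(4) fmap_id_def)
 have hm: "dgmap R Y E (afun h)" using h(1) by (simp add: hom_fDGA)
 { assume y: "y\<in>fil (cx Y) p n"
  have yc: "y\<in>elts Y n" by (rule fcxD(8)[OF fdgaD(1)[OF R Y] y])
  obtain \<phi> where p: "\<phi>\<in>C n" "afun h n y = el n \<phi>" using fdga_mapD(5)[OF hm yc] by (auto simp: PD(2))
  have "\<forall>\<^sub>F c in F. \<phi> c\<in>fil (cx (Xo c)) p n" using fdga_mapD(4)[OF hm y] PD(17)[OF p(1)] p(2) by simp
  from F_ex[OF eventually_conj[OF val_ev[OF p(1)] this]] ne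
  obtain c where "c\<in>Field r" "\<phi> c\<in>fil (cx (Xo c)) p n" "j c n (\<phi> c) = val n \<phi>" by blast
  moreover have "val n \<phi> = y" using kh[OF yc] k(2)[OF p(1)] p(2) by simp
  ultimately show "\<exists>b\<in>Field r. \<exists>x\<in>fil (cx (Xo b)) p n. j b n x = y" by blast }
 assume b: "b\<in>Field r" and x: "x\<in>elts (Xo b) n" "x'\<in>elts (Xo b) n" and e: "j b n x = j b n x'"
 have "el n (%c. f b c n x) = el n (%c. f b c n x')" using hj[OF b x(1)] hj[OF b x(2)] e by simp
 then have "\<forall>\<^sub>F c in F. f b c n x = f b c n x'" unfolding PD(3)[OF thC[OF b x(1)] thC[OF b x(2)]] .
 from F_ex[OF this b] show "\<exists>c. le b c & f b c n x = f b c n x'" .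
qed

text \<open>The element and its differential have representatives of the right filtrations at
  possibly different stages. In a common later stage the differential of the first representative
  becomes equal to the second.\<close>

lemma cycle_stage:
 assumes y: "y\<in>cycles (cx Y) k p n"
 shows "\<exists>b\<in>Field r. \<exists>x\<in>cycles (cx (Xo b)) k p n. j b n x = y"
proof -
 have y': "y\<in>fil (cx Y) p n" "df (cx Y) n y\<in>fil (cx Y) (p - int k) (n + 1)" using y by (simp_all add: cycles_iff)
 obtain b x where x: "b\<in>Field r" "x\<in>fil (cx (Xo b)) p n" "j b n x = y" using stages(1)[OF y'(1)] by blast
 obtain c z where z: "c\<in>Field r" "z\<in>fil (cx (Xo c)) (p - int k) (n + 1)" "j c (n + 1) z = df (cx Y) n y" using stages(1)[OF y'(2)] by blast
 obtain e where e: "le b e" "le c e" using le_max[OF x(1) z(1)] by blast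
 have fc: "fcx R (cx (Xo b))" if "b\<in>Field r" for b by (rule fdgaD(1)[OF R Xo[OF that]])
 note xc = fcxD(8)[OF fc[OF x(1)] x(2)] and zc = fcxD(8)[OF fc[OF z(1)] z(2)]
 note dx = fcxD(3)[OF fc[OF x(1)] xc]
 have "j e (n + 1) (f b e (n + 1) (df (cx (Xo b)) n x)) = j e (n + 1) (f c e (n + 1) z)"
  unfolding jf[OF e(1) dx] jf[OF e(2) zc] z(3) using fdga_mapD(3)[OF j[OF x(1)] xc] x(3) by simp
 from stages(2)[OF field(2)[OF e(1)] fdga_mapD(5)[OF f[OF e(1)] dx] fdga_mapD(5)[OF f[OF e(2)] zc] this]
 obtain d where d: "le e d" "f e d (n + 1) (f b e (n + 1) (df (cx (Xo b)) n x)) = f e d (n + 1) (f c e (n + 1) z)" by blast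
 have bd: "le b d" and cd: "le c d" using e d(1) le_trans by blast+
 have "df (cx (Xo d)) n (f b d n x) = f c d (n + 1) z"
  unfolding fdga_mapD(3)[OF f[OF bd] xc, symmetric] using d(2) unfolding ff[OF e(1) d(1) dx] ff[OF e(2) d(1) zc] .
 then have "f b d n x\<in>cycles (cx (Xo d)) k p n"
  using fdga_mapD(4)[OF f[OF bd] x(2)] fdga_mapD(4)[OF f[OF cd] z(2)] by (simp add: cycles_iff)
 then show ?thesis using jf[OF bd xc] x(3) field(2)[OF bd] by blast
qed

end

context fdga_model begin

text \<open>The free algebra on \<open>Z_complex\<close> represents the functor of cycles on
  algebras. The universal cycle \<open>u\<close> is the image of the generator under the unit of the
  adjunction.\<close>

lemma free_on_cycle:
 assumes T: "is_free_algebra_functor R To Tm"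
 shows "\<exists>u\<in>cycles (cx (To (Z_complex R k p n))) k p n. \<forall>X\<in>objs FD. \<forall>y\<in>cycles (cx X) k p n.
  \<exists>!g. g\<in>hom_set FD (To (Z_complex R k p n)) X & afun g n u = y"
proof -
 interpret cring R by (rule R)
 let ?Z = "Z_complex R k p n" and ?o = "\<one>[R]"
 note Z = Z_fcomplex[OF R, of k p n]
 then have Zo: "?Z\<in>objs (fC R)" by (simp add: fC_simps)
 from T obtain \<eta> where \<eta>: "\<eta> ?Z\<in>homC R ?Z (cx (To ?Z))"
  and u: "!!X f. X\<in>objs FD==>f\<in>homC R ?Z (cx X)==>\<exists>!g. g\<in>hom_set FD (To ?Z) X & cmpC R (forget g) (\<eta> ?Z) = f"
  using Zo unfolding is_free_algebra_functor_def left_adjoint_def by blast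
 note D = categoryD[OF category_fC[of R]]
 have em: "fcx R (cx (To ?Z))" "asrc (\<eta> ?Z) = ?Z" "is_fmap R ?Z (cx (To ?Z)) (afun (\<eta> ?Z))" using \<eta> by (simp_all add: hom_fC)
 let ?u = "afun (\<eta> ?Z) n ?o"
 show ?thesis
 proof (intro bexI ballI)
  show "?u\<in>cycles (cx (To ?Z)) k p n" by (rule Z_map_unique(1)[OF R em(1,3)])
  fix X y assume X: "X\<in>objs FD" and y: "y\<in>cycles (cx X) k p n"
  have fX: "fcx R (cx X)" using X by (simp add: fDGA_simps fdgaD(1)[OF R])
  let ?f = "Arrow ?Z (cx X) (Z_map R (cx X) n y)"
  have f: "?f\<in>homC R ?Z (cx X)" using Z_map(1)[OF R fX y] Z fX by (simp add: hom_fC)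
  have "cmpC R (forget g) (\<eta> ?Z) = ?f \<longleftrightarrow> afun g n ?u = y" if g: "g\<in>hom_set FD (To ?Z) X" for g
  proof -
   have "forget g\<in>homC R (cx (To ?Z)) (cx X)"
    using g fdgaD(1)[OF R] by (auto simp: hom_fDGA hom_fC forget_def map_fmap)
   then have c: "cmpC R (forget g) (\<eta> ?Z)\<in>homC R ?Z (cx X)" by (rule D(1)[OF \<eta>])
   then have cm: "is_fmap R ?Z (cx X) (afun (cmpC R (forget g) (\<eta> ?Z)))" by (simp add: hom_fC)
   have v: "afun (cmpC R (forget g) (\<eta> ?Z)) n ?o = afun g n ?u"
    using cmp_apply(2)[of ?o "\<eta> ?Z" n R "forget g"] em(2) by (simp add: Z_simps forget_def)
   show ?thesis
   proof
    assume "cmpC R (forget g) (\<eta> ?Z) = ?f"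
    then show "afun g n ?u = y" using v Z_map(2)[OF R fX y] by simp
   next
    assume "afun g n ?u = y"
    then have "afun (cmpC R (forget g) (\<eta> ?Z)) = Z_map R (cx X) n y" using Z_map_unique(2)[OF R fX cm] v by simp
    then show "cmpC R (forget g) (\<eta> ?Z) = ?f" by (intro hom_fC_eqI[OF c f]) simp
   qed
  qed
  then show "\<exists>!g. g\<in>hom_set FD (To ?Z) X & afun g n ?u = y" using u[OF X f] by (simp cong: conj_cong)
 qed
qed

text \<open>The free algebra on the zero complex is an initial algebra, since left adjoints preserve
  initial objects.\<close>

lemma free_on_zero:
 assumes T: "is_free_algebra_functor R To Tm" and X: "X\<in>objs FD"
 shows "\<exists>!g. g\<in>hom_set FD (To (zero_complex R)) X"
proof -
 let ?Z = "zero_complex R"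
 have fX: "fcx R (cx X)" using X by (simp add: fDGA_simps fdgaD(1)[OF R])
 have Zo: "?Z\<in>objs (fC R)" by (simp add: fC_simps zero_fcomplex[OF R])
 from T obtain \<eta> where \<eta>: "\<eta> ?Z\<in>homC R ?Z (cx (To ?Z))"
  and u: "!!X f. X\<in>objs FD==>f\<in>homC R ?Z (cx X)==>\<exists>!g. g\<in>hom_set FD (To ?Z) X & cmpC R (forget g) (\<eta> ?Z) = f"
  using Zo unfolding is_free_algebra_functor_def left_adjoint_def by blast
 obtain f where f: "f\<in>homC R ?Z (cx X)" "!!g. g\<in>homC R ?Z (cx X)==>g = f"
  using zero_complex_hom[OF R fX] by blast
 have "cmpC R (forget g) (\<eta> ?Z) = f" if g: "g\<in>hom_set FD (To ?Z) X" for g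
 proof (rule f(2), rule categoryD(1)[OF category_fC \<eta>])
  show "forget g\<in>homC R (cx (To ?Z)) (cx X)"
   using g fdgaD(1)[OF R] by (auto simp: hom_fDGA hom_fC forget_def map_fmap)
 qed
 then show ?thesis using u[OF X f(1)] by (simp cong: conj_cong)
qed

text \<open>Maps out of the free algebra are cycles, so factoring through a stage is
  \<open>cycle_stage\<close>, and equality at a later stage is equality of the images of
  \<open>u\<close>. For the initial algebra both conditions hold by uniqueness.\<close>

lemma small_free:
 fixes code :: "('i => 'u) => 'u"
 assumes code: "inj code" and T: "is_free_algebra_functor R To Tm"
 shows "small_relative_to TYPE('i) FD K (To (Z_complex R k p n))" "small_relative_to TYPE('i) FD K (To (zero_complex R))"
proof -
 \<comment> \<open>The cardinal is the empty set: every limit ordinal is then filtered, and a single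
   common upper stage is all that the argument takes.\<close>
 have ka: "({} :: 'i set) \<prec> (UNIV :: 'i set)" 
  unfolding lesspoll_def
 proof (intro conjI notI)
  assume "({} :: 'i set) \<approx> UNIV"
  from eqpoll_sym[OF this] show False by simp
 qed simp
 have loc: "sequential_colimit R code r Xo Xm Y \<iota>"
  if "is_sequence r FD Xo Xm" "filtered_ordinal {} r" "is_colimit (poset_category r) FD Xo Xm Y \<iota>" for r :: "'i rel" and Xo Xm Y \<iota>
  using that code R by (simp add: sequential_colimit_def is_sequence_def filtered_ordinal_def is_limit_ordinal_def)
 obtain u where u: "u\<in>cycles (cx (To (Z_complex R k p n))) k p n"
  and uq: "!!X y. X\<in>objs FD==>y\<in>cycles (cx X) k p n==>\<exists>!g. g\<in>hom_set FD (To (Z_complex R k p n)) X & afun g n u = y"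
  using free_on_cycle[OF T, of k p n] by blast
 let ?T = "To (Z_complex R k p n)"
 have cy: "afun g n u\<in>cycles (cx X) k p n" "X\<in>objs FD" "asrc g = ?T" "u\<in>elts ?T n" if "g\<in>hom_set FD ?T X" for g X
  using that fmap_cycles[OF map_fmap fdgaD(1)[OF R] u] cycles_elts[OF fdgaD(1)[OF R] u] by (simp_all add: hom_fDGA fDGA_simps)
 have eq: "g = g'" if "g\<in>hom_set FD ?T X" "g'\<in>hom_set FD ?T X" "afun g n u = afun g' n u" for g g' X
  by (rule ex1_eq[OF uq[OF cy(2,1)[OF that(1)]]]) (use that in simp_all)
 show "small_relative_to TYPE('i) FD K ?T" unfolding small_relative_to_def
 proof (intro exI[of _ "{}"] conjI allI impI ballI ka; elim conjE)
  fix r :: "'i rel" and Xo Xm Y \<iota>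
  assume "is_sequence r FD Xo Xm" "filtered_ordinal {} r" "is_colimit (poset_category r) FD Xo Xm Y \<iota>"
  then interpret s: sequential_colimit R code r Xo Xm Y \<iota> by (rule loc)
  { fix g assume g: "g\<in>hom_set FD ?T Y"
   obtain b x where b: "b\<in>Field r" and x: "x\<in>cycles (cx (Xo b)) k p n" "afun (\<iota> b) n x = afun g n u"
    using s.cycle_stage[OF cy(1)[OF g]] by blast
   have "Xo b\<in>objs FD" using s.Xo[OF b] by (simp add: fDGA_simps)
   from uq[OF this x(1)] obtain h where h: "h\<in>hom_set FD ?T (Xo b)" "afun h n u = x" by blast
   have "g = cmp FD (\<iota> b) h"
    by (rule eq[OF g catD(1)[OF h(1) s.cocone(2)[OF b]]]) (use cy(3,4)[OF h(1)] x(2) h(2) in \<open>simp add: cmp_apply\<close>)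
   then show "\<exists>b\<in>Field r. \<exists>h\<in>hom_set FD ?T (Xo b). g = cmp FD (\<iota> b) h" using b h(1) by blast }
  fix b h h' assume b: "b\<in>Field r" and h: "h\<in>hom_set FD ?T (Xo b)" "h'\<in>hom_set FD ?T (Xo b)" and e: "cmp FD (\<iota> b) h = cmp FD (\<iota> b) h'"
  note hu = cycles_elts[OF fdgaD(1)[OF R s.Xo[OF b]] cy(1)[OF h(1)]] cycles_elts[OF fdgaD(1)[OF R s.Xo[OF b]] cy(1)[OF h(2)]]
  have ap: "afun (cmp FD q h) n u = afun q n (afun h n u)" "afun (cmp FD q h') n u = afun q n (afun h' n u)" for q
   using cy(3,4)[OF h(1)] cy(3,4)[OF h(2)] by (simp_all add: cmp_apply)
  have "afun (\<iota> b) n (afun h n u) = afun (\<iota> b) n (afun h' n u)" using ap[of "\<iota> b"] e by simp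
  from s.stages(2)[OF b hu this] obtain c where c: "(b, c)\<in>r" "afun (Xm (b, c)) n (afun h n u) = afun (Xm (b, c)) n (afun h' n u)" by blast
  have "cmp FD (Xm (b, c)) h = cmp FD (Xm (b, c)) h'"
   by (rule eq[OF catD(1)[OF h(1) s.Xm(1)[OF c(1)]] catD(1)[OF h(2) s.Xm(1)[OF c(1)]]]) (simp only: ap c(2))
  then show "\<exists>c. (b, c)\<in>r & cmp FD (Xm (b, c)) h = cmp FD (Xm (b, c)) h'" using c(1) by blast
 qed
 let ?O = "To (zero_complex R)"
 have eq0: "g = g'" if "g\<in>hom_set FD ?O X" "g'\<in>hom_set FD ?O X" for g g' X
  by (rule ex1_eq[OF free_on_zero[OF T conjunct2[OF catD(6)[OF that(1)]]] that])
 show "small_relative_to TYPE('i) FD K ?O" unfolding small_relative_to_def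
 proof (intro exI[of _ "{}"] conjI allI impI ballI ka; elim conjE)
  fix r :: "'i rel" and Xo Xm Y \<iota>
  assume "is_sequence r FD Xo Xm" "filtered_ordinal {} r" "is_colimit (poset_category r) FD Xo Xm Y \<iota>"
  then interpret s: sequential_colimit R code r Xo Xm Y \<iota> by (rule loc)
  { fix g assume g: "g\<in>hom_set FD ?O Y"
   obtain b where b: "b\<in>Field r" using s.ne by blast
   have "Xo b\<in>objs FD" using s.Xo[OF b] by (simp add: fDGA_simps)
   then obtain h where h: "h\<in>hom_set FD ?O (Xo b)" using free_on_zero[OF T] by blast
   show "\<exists>b\<in>Field r. \<exists>h\<in>hom_set FD ?O (Xo b). g = cmp FD (\<iota> b) h"
    using b h eq0[OF g catD(1)[OF h s.cocone(2)[OF b]]] by blast }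
  fix b h h' assume "b\<in>Field r" "h\<in>hom_set FD ?O (Xo b)" "h'\<in>hom_set FD ?O (Xo b)"
  then show "\<exists>c. (b, c)\<in>r & cmp FD (Xm (b, c)) h = cmp FD (Xm (b, c)) h'"
   using s.le_refl[of b] eq0[of h "Xo b" h'] by auto
 qed
qed

lemma fdga_generated_by:
 fixes code :: "('i => 'u) => 'u"
 assumes code: "inj code" and T: "is_free_algebra_functor R To Tm"
 shows "generated_by TYPE('i) FD W Fib (Tm ` I_gen R r S) (Tm ` J_gen R S)"
proof -
 note G = generators_rlp[OF T]
 have F: "is_functor (fC R) FD To Tm" using T by (simp add: is_free_algebra_functor_def left_adjoint_def)
 have idf: "Arrow A A (fmap_id A)\<in>arrs (fC R)" if "fcx R A" for A using that fmap_ident[OF that] by (simp add: arr_fC)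
 note A = zero_to_Z_lifting(1)[OF R idf[OF zero_fcomplex[OF R]]] phi_lifting(1)[OF inf R idf[OF zero_fcomplex[OF R]]]
 have s: "src FD (Tm i) = To (asrc i)" if "i\<in>arrs (fC R)" for i
  using F that by (simp add: is_functor_def hom_set_def fC_simps)
 have z: "asrc (zero_to_Z R k p n) = zero_complex R" "asrc (phi R (r + 1) p n) = Z_complex R (r + 1) p n" for k p n
  by (simp_all add: zero_to_Z_def phi_def)
 have J: "small_relative_to TYPE('i) FD K (src FD (Tm i))" if "i\<in>J_gen R S" for i K
  using that small_free(2)[OF code T] by (auto simp: J_gen_def s[OF A(1)] z)
 have I: "small_relative_to TYPE('i) FD K (src FD (Tm i))" if "i\<in>I_gen R r S" for i K
  using that J unfolding I_gen_def
 proof (elim UnE CollectE exE conjE)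
  fix p n assume "i = phi R (r + 1) p n"
  then show ?thesis using small_free(1)[OF code T] s[OF A(2)] z(2) by simp
 qed
 show ?thesis unfolding generated_by_def ball_simps
  by (intro conjI G ballI I J)
qed

end

theorem corollary6p0p8:
  fixes R :: "'u ring" and r :: nat and S :: "nat set"
  assumes "universe TYPE('i) TYPE('u)"
    and "cring R"
    and "S \<subseteq> {0..r}" and "r \<in> S"
  shows "\<exists>Cof. model_category TYPE('i) (fDGA R) (fdga_weq R r) Cof (fdga_fib R S) \<and>
    (\<exists>To Tm. is_free_algebra_functor R To Tm) \<and>
    (\<forall>To Tm. is_free_algebra_functor R To Tm \<longrightarrow>
       generated_by TYPE('i) (fDGA R) (fdga_weq R r) (fdga_fib R S)
         (Tm ` I_gen R r S) (Tm ` J_gen R S))"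
proof -
  interpret fdga_model R r S using assms by (simp add: fdga_model_def universe_def)
  obtain code :: "('i \<Rightarrow> 'u) \<Rightarrow> 'u" where code: "inj code" using assms(1) by (auto simp: universe_def lepoll_def)
  show ?thesis
    by (intro exI[of _ Cof] conjI allI impI fdga_model_category[OF fDGA_bicomplete[OF assms(1,2)]] free_algebra_functor[OF inf R]
        fdga_generated_by[OF code])
qed

end
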